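(* Let $\zeta\in\mathbb D$ with $\zeta\ne0$ and let $1>r,s>0$ satisfy $$\overline{B_r(\zeta)}\cap\overline{B_s(0)}=\emptyset\quad\text{and}\quad B_r(\zeta),B_s(0)\subset\mathbb D.$$ Then, for the normalized $\mathbb{CE}_2^{\mathrm{HS}}$-algebra structure $\rho^{\mathcal N}$ on $\mathrm{Sym}\,A^2(\mathbb D)$, for all $v_1,v_2\in M(0)$, $$\rho^{\mathcal N}_{(B_{\zeta,r},B_{0,s})}(\Psi(v_1),\Psi(v_2))=\Psi\big(Y(r^{L(0)}v_1,z)s^{L(0)}v_2\big|_{z=\zeta}\big)$$ as elements of $\mathrm{Sym}\,A^2(\mathbb D)$.
   Context: **Bergman side.** $\mathbb D$ is the open unit disk, $B_r(a)$ the open disk of radius $r$ centred at $a$, and $B_{a,r}(z)=rz+a$. $d\mu$ is Lebesgue measure on $\mathbb D^p$ divided by $\pi^p$; $A^2(\mathbb D^p)$ is the Hilbert space of holomorphic functions in $L^2(\mathbb D^p,d\mu)$; $A^2(\mathbb D)^{\hat\otimes p}\cong A^2(\mathbb D^p)$; $\hat S^p$ is the orthogonal projection onto symmetric tensors (averaging over $S_p$), with image $\mathrm{Sym}^pA^2(\mathbb D)$; $\mathrm{Sym}^0A^2(\mathbb D)=\mathbb C\mathbf 1$, $\|\mathbf 1\|=1$; $\mathrm{Sym}\,A^2(\mathbb D)=\bigoplus_{p\ge 0}\mathrm{Sym}^pA^2(\mathbb D)$ (algebraic direct sum). For injective holomorphic $\phi:\mathbb D\to\mathbb D$: $\mathcal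 J(\phi)(z)=\overline{\phi(\bar z)}$, $T_\phi f=\phi'\cdot(f\circ\phi)$, $\rho_{\mathrm{cl}}(\phi)=T^*_{\mathcal J(\phi)}$ on $A^2(\mathbb D)$, extended diagonally to tensor powers with $\rho_{\mathrm{cl}}(\phi)\mathbf 1=\mathbf 1$; $F_\phi(z,w)=\frac{\phi'(z)\phi'(w)}{(\phi(z)-\phi(w))^2}-\frac1{(z-w)^2}$. When $F_\phi\in L^2(\mathbb D\times\mathbb D)$ put $\partial_\phi(P)=\int F_\phi(\bar z,\bar w)P(z,w)\,d\mu$ for $P\in A^2(\mathbb D\times\mathbb D)$, extended by $\partial_\phi(a_1\otimes\cdots\otimes a_n)=\sum_{i<j}\partial_\phi(a_i\otimes a_j)\,a_1\otimes\cdots\hat a_i\cdots\hat a_j\cdots\otimes a_n$, and $\rho_1(\phi)=\rho_{\mathrm{cl}}(\phi)\exp(\partial_\phi)$. For injective holomorphic $\phi,\psi:\mathbb D\to\mathbb D$ with disjoint images, $G_{\phi,\psi}(z,w)=\frac{\phi'(z)\psi'(w)}{(\phi(z)-\psi(w))^2}$; when it is in $L^2(\mathbb D\times\mathbb D)$, $C_{\phi,\psi}(P)=\int G_{\phi,\psi}(\bar z,\bar w)P(z,w)\,d\mu$, and $\hat C_{\phi,\psi}$ sends $(v_1\otimes\cdots\otimes v_p)\otimes(w_1\otimes\cdots\otimes w_q)$ to $\sum_{i,j}C_{\phi,\psi}(v_i\otimes w_j)(v_1\otimes\cdots\hat v_i\cdots\otimes v_p)\otimes(w_1\otimes\cdots\hat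 w_j\cdots\otimes w_q)$ (zero if $p=0$ or $q=0$). If also $F_\phi,F_\psi\in L^2$, the binary operation is $\rho_{(\phi,\psi)}=\hat S\circ(\rho_1(\phi)\otimes\rho_1(\psi))\circ\exp(\hat C_{\phi,\psi})$ on $\mathrm{Sym}\,A^2(\mathbb D)\otimes\mathrm{Sym}\,A^2(\mathbb D)$, where $\hat S=\hat S^{p+q}$ on $\mathrm{Sym}^p\otimes\mathrm{Sym}^q$. With $\mathcal N|_{\mathrm{Sym}^pA^2(\mathbb D)}=\sqrt{p!}\,\mathrm{id}$, the normalized operation is $\rho^{\mathcal N}_{(\phi,\psi)}=\mathcal N\circ\rho_{(\phi,\psi)}\circ(\mathcal N^{-1}\otimes\mathcal N^{-1})$. The pair $(B_{\zeta,r},B_{0,s})$ of the claim satisfies all these square-integrability conditions. **Vertex algebra side.** Let $\hat{\mathfrak h}=\bigoplus_{n\in\mathbb Z}\mathbb C h\otimes t^n\oplus\mathbb Cc$ with $c$ central and $[h\otimes t^n,h\otimes t^m]=n\delta_{n+m,0}c$. $M(0)$ is the $\hat{\mathfrak h}$-module induced from the vector $\mathbf 1$ with $(h\otimes t^n)\mathbf 1=0$ for $n\ge0$, $c\mathbf 1=\mathbf 1$; $h(n)$ is the action of $h\otimes t^n$. $M(0)$ carries the unique vertex algebra structure $Y(a,z)=\sum_n a(n)z^{-n-1}$ with vacuum $\mathbf 1$ and $Y(h(-1)\mathbf 1,z)=\sum_nh(n)z^{-n-1}$. $L(0)$ is the operator with $L(0)h(-k_1)\cdots h(-k_p)\mathbf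 1=(k_1+\cdots+k_p)h(-k_1)\cdots h(-k_p)\mathbf 1$. $M_p(0)$ is the span of the vectors $h(-k_1)\cdots h(-k_p)\mathbf 1$ ($k_i\ge1$) and $M(0)^p=\bigoplus_{k=0}^pM_k(0)$. The positive-definite form $(-,-)_M$ on $M(0)$ is $(a,b)_M=(\theta(a),b)$, where $\theta$ is the antilinear map $h(-k_1)\cdots h(-k_n)\mathbf 1\mapsto(-1)^nh(-k_1)\cdots h(-k_n)\mathbf 1$ and $(-,-)$ is the unique symmetric bilinear form with $(\mathbf 1,\mathbf 1)=1$ and $(Y(a,z)b,c)=(b,Y(e^{zL(1)}(-z^{-2})^{L(0)}a,z^{-1})c)$, where $\sum_nL(n)z^{-n-2}=Y(\tfrac12h(-1)^2\mathbf 1,z)$. $\overline{M(0)^p}$ is the Hilbert completion of $M(0)^p$. For $v\in M(0)^p$, $w\in M(0)^q$ and $\zeta\in\mathbb D\setminus\{0\}$, $Y(v,z)w|_{z=\zeta}=\sum_nv(n)w\,\zeta^{-n-1}$ denotes the (norm-convergent) sum in $\overline{M(0)^{p+q}}$. **The map $\Psi$.** Put $h_j(z)=(j+1)z^j\in A^2(\mathbb D)$. $\Psi:M(0)\to\mathrm{Sym}\,A^2(\mathbb D)$ is the linear map with $\Psi(\mathbf 1)=\mathbf 1$ and, for $i_1>\cdots>i_n\ge0$, $k_1,\dots,k_n\ge1$, $p=k_1+\cdots+k_n$, $\Psi(h(-i_1-1)^{k_1}\cdots h(-i_n-1)^{k_n}\mathbf 1)=\sqrt{p!}\,\hat S^p(h_{i_1}^{\otimes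 k_1}\otimes\cdots\otimes h_{i_n}^{\otimes k_n})$. It is isometric for $(-,-)_M$ and is extended by continuity to isometric isomorphisms $\overline{M(0)^p}\to\bigoplus_{k=0}^p\mathrm{Sym}^kA^2(\mathbb D)$. *)

theory Defs
  imports
    "HOL-Analysis.Analysis"
    "HOL-Library.Function_Algebras"
    "HOL-Library.Groups_Big_Fun"
begin

(* Bergman spaces.

   Points of the p-dimensional polydisc are functions nat => complex that are extensional on
   {..<p}, so for p = 0 the polydisc is a single point of mass 1 and the 0-th Bergman space is the
   line of constants, with the constant 1 of norm 1.  Functions on the disc or polydisc are
   normalised to be 0 elsewhere; equality of HOL functions is then equality of functions on the
   domain, and the vector space operations are the pointwise ones of Function_Algebras. *)

abbreviation disc :: "complex set" where
  "disc \<equiv> ball 0 1"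

definition disc_measure :: "complex measure" where
  "disc_measure = scale_measure (ennreal (1 / pi)) (restrict_space lborel disc)"

definition bergman :: "(complex \<Rightarrow> complex) set" where
  "bergman = {a. a holomorphic_on disc \<and> integrable disc_measure (\<lambda>z. (cmod (a z))\<^sup>2)
                 \<and> (\<forall>z. z \<notin> disc \<longrightarrow> a z = 0)}"

definition bergman_inner :: "(complex \<Rightarrow> complex) \<Rightarrow> (complex \<Rightarrow> complex) \<Rightarrow> complex" where
  "bergman_inner a b = (\<integral>z. a z * cnj (b z) \<partial>disc_measure)"

type_synonym polyfun = "(nat \<Rightarrow> complex) \<Rightarrow> complex"

definition polydisc :: "nat \<Rightarrow> (nat \<Rightarrow> complex) set" where
  "polydisc p = PiE {..<p} (\<lambda>_. disc)"

definition polydisc_measure :: "nat \<Rightarrow> (nat \<Rightarrow> complex) measure" where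
  "polydisc_measure p = PiM {..<p} (\<lambda>_. disc_measure)"

definition polydisc_holomorphic :: "nat \<Rightarrow> polyfun \<Rightarrow> bool" where
  "polydisc_holomorphic p f \<longleftrightarrow> continuous_on (polydisc p) f \<and>
     (\<forall>x\<in>polydisc p. \<forall>i<p. (\<lambda>z. f (x(i := z))) holomorphic_on disc)"

definition A2 :: "nat \<Rightarrow> polyfun set" where
  "A2 p = {f. polydisc_holomorphic p f \<and> integrable (polydisc_measure p) (\<lambda>x. (cmod (f x))\<^sup>2)
              \<and> (\<forall>x. x \<notin> polydisc p \<longrightarrow> f x = 0)}"

definition A2_norm :: "nat \<Rightarrow> polyfun \<Rightarrow> real" where
  "A2_norm p f = sqrt (\<integral>x. (cmod (f x))\<^sup>2 \<partial>polydisc_measure p)"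

definition pure_tensor :: "(complex \<Rightarrow> complex) list \<Rightarrow> polyfun" where
  "pure_tensor as x =
     (if x \<in> polydisc (length as) then \<Prod>i<length as. (as ! i) (x i) else 0)"

definition tensor_prod :: "nat \<Rightarrow> nat \<Rightarrow> polyfun \<Rightarrow> polyfun \<Rightarrow> polyfun" where
  "tensor_prod p q f g x =
     (if x \<in> polydisc (p + q)
      then f (restrict x {..<p}) * g (\<lambda>i\<in>{..<q}. x (p + i)) else 0)"

definition symmetrize :: "nat \<Rightarrow> polyfun \<Rightarrow> polyfun" where
  "symmetrize p f x = (\<Sum>\<sigma> | \<sigma> permutes {..<p}. f (x \<circ> \<sigma>)) / fact p"

definition lin_comb ::
  "('i \<Rightarrow> polyfun) \<Rightarrow> (complex \<times> 'i) list \<Rightarrow> polyfun" where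
  "lin_comb P u = (\<lambda>x. \<Sum>(c, i)\<leftarrow>u. c * P i x)"

(* Extension by linearity and continuity from pure tensors: the value at f of the bounded linear
   map A2 p -> A2 m that sends pure_tensor as to Q as.  Every f in A2 p is the limit of finite
   linear combinations of pure tensors, and the value is the limit of the corresponding
   combinations of the Q as. *)
definition tensor_extend ::
  "nat \<Rightarrow> nat \<Rightarrow> ((complex \<Rightarrow> complex) list \<Rightarrow> polyfun) \<Rightarrow> polyfun \<Rightarrow> polyfun" where
  "tensor_extend p m Q f = (THE g. g \<in> A2 m \<and>
     (\<exists>u. (\<forall>n. \<forall>(c, as) \<in> set (u n). length as = p \<and> set as \<subseteq> bergman) \<and>
          (\<lambda>n. A2_norm p (f - lin_comb pure_tensor (u n))) \<longlonglongrightarrow> 0 \<and>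
          (\<lambda>n. A2_norm m (g - lin_comb Q (u n))) \<longlonglongrightarrow> 0))"

(* Direct sums.  The value of a tens at p is its component of degree p.  The value of a bitens at
   p, q lies in A2 (p + q), the completed tensor product of A2 p and A2 q, the first p variables
   belonging to the left factor. *)

type_synonym tens = "nat \<Rightarrow> polyfun"
type_synonym bitens = "nat \<Rightarrow> nat \<Rightarrow> polyfun"

definition tens_scale :: "complex \<Rightarrow> tens \<Rightarrow> tens" where
  "tens_scale c x = (\<lambda>p z. c * x p z)"

definition bitens_scale :: "complex \<Rightarrow> bitens \<Rightarrow> bitens" where
  "bitens_scale c X = (\<lambda>p q z. c * X p q z)"

definition in_degree :: "nat \<Rightarrow> polyfun \<Rightarrow> tens" where
  "in_degree p f = (\<lambda>q. if q = p then f else 0)"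

definition Sym_A2 :: "tens set" where
  "Sym_A2 = {x. (\<forall>p. x p \<in> A2 p \<and> symmetrize p (x p) = x p) \<and> finite {p. x p \<noteq> 0}}"

definition Sym_A2_upto :: "nat \<Rightarrow> tens set" where
  "Sym_A2_upto N = {x \<in> Sym_A2. \<forall>p>N. x p = 0}"

definition Sym_dist :: "nat \<Rightarrow> tens \<Rightarrow> tens \<Rightarrow> real" where
  "Sym_dist N x y = sqrt (\<Sum>p\<le>N. (A2_norm p (x p - y p))\<^sup>2)"

(* Used for locally nilpotent D only: Sum_any is the sum over the finite support. *)
definition op_exp ::
  "(complex \<Rightarrow> 'v \<Rightarrow> 'v) \<Rightarrow> ('v \<Rightarrow> 'v) \<Rightarrow> 'v \<Rightarrow> 'v::comm_monoid_add" where
  "op_exp sc D x = Sum_any (\<lambda>k::nat. sc (1 / fact k) ((D ^^ k) x))"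

(* The operations attached to conformal embeddings of the disc. *)

definition affine_map :: "complex \<Rightarrow> real \<Rightarrow> complex \<Rightarrow> complex" where
  "affine_map a r z = of_real r * z + a"

definition conj_map :: "(complex \<Rightarrow> complex) \<Rightarrow> complex \<Rightarrow> complex" where
  "conj_map \<phi> z = cnj (\<phi> (cnj z))"

definition T_op :: "(complex \<Rightarrow> complex) \<Rightarrow> (complex \<Rightarrow> complex) \<Rightarrow> complex \<Rightarrow> complex" where
  "T_op \<phi> f z = (if z \<in> disc then deriv \<phi> z * f (\<phi> z) else 0)"

definition bergman_adjoint ::
  "((complex \<Rightarrow> complex) \<Rightarrow> complex \<Rightarrow> complex) \<Rightarrow> (complex \<Rightarrow> complex) \<Rightarrow> complex \<Rightarrow> complex"
where
  "bergman_adjoint T f =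
     (THE g. g \<in> bergman \<and> (\<forall>h\<in>bergman. bergman_inner (T h) f = bergman_inner h g))"

definition rho_cl1 :: "(complex \<Rightarrow> complex) \<Rightarrow> (complex \<Rightarrow> complex) \<Rightarrow> complex \<Rightarrow> complex" where
  "rho_cl1 \<phi> = bergman_adjoint (T_op (conj_map \<phi>))"

definition rho_cl :: "(complex \<Rightarrow> complex) \<Rightarrow> tens \<Rightarrow> tens" where
  "rho_cl \<phi> x = (\<lambda>p. tensor_extend p p (\<lambda>as. pure_tensor (map (rho_cl1 \<phi>) as)) (x p))"

(* On the diagonal z = w, a null set, the value is the irrelevant 0. *)
definition F_kernel :: "(complex \<Rightarrow> complex) \<Rightarrow> complex \<Rightarrow> complex \<Rightarrow> complex" where
  "F_kernel \<phi> z w = deriv \<phi> z * deriv \<phi> w / (\<phi> z - \<phi> w)\<^sup>2 - 1 / (z - w)\<^sup>2"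

definition G_kernel ::
  "(complex \<Rightarrow> complex) \<Rightarrow> (complex \<Rightarrow> complex) \<Rightarrow> complex \<Rightarrow> complex \<Rightarrow> complex" where
  "G_kernel \<phi> \<psi> z w = deriv \<phi> z * deriv \<psi> w / (\<phi> z - \<psi> w)\<^sup>2"

definition kernel_pairing ::
  "(complex \<Rightarrow> complex \<Rightarrow> complex) \<Rightarrow> (complex \<Rightarrow> complex) \<Rightarrow> (complex \<Rightarrow> complex) \<Rightarrow> complex" where
  "kernel_pairing K a b =
     (\<integral>(z, w). K (cnj z) (cnj w) * (a z * b w) \<partial>(disc_measure \<Otimes>\<^sub>M disc_measure))"

definition self_contraction ::
  "(complex \<Rightarrow> complex) \<Rightarrow> (complex \<Rightarrow> complex) list \<Rightarrow> polyfun" where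
  "self_contraction \<phi> as = (\<lambda>x. \<Sum>(i, j) \<in> {(i, j). i < j \<and> j < length as}.
     kernel_pairing (F_kernel \<phi>) (as ! i) (as ! j) * pure_tensor (nths as (- {i, j})) x)"

definition del_op :: "(complex \<Rightarrow> complex) \<Rightarrow> tens \<Rightarrow> tens" where
  "del_op \<phi> x = (\<lambda>p. tensor_extend (p + 2) p (self_contraction \<phi>) (x (p + 2)))"

definition rho1 :: "(complex \<Rightarrow> complex) \<Rightarrow> tens \<Rightarrow> tens" where
  "rho1 \<phi> x = rho_cl \<phi> (op_exp tens_scale (del_op \<phi>) x)"

definition cross_contraction ::
  "(complex \<Rightarrow> complex) \<Rightarrow> (complex \<Rightarrow> complex) \<Rightarrow>
   (complex \<Rightarrow> complex) list \<Rightarrow> (complex \<Rightarrow> complex) list \<Rightarrow> polyfun" where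
  "cross_contraction \<phi> \<psi> vs ws = (\<lambda>x. \<Sum>i<length vs. \<Sum>j<length ws.
     kernel_pairing (G_kernel \<phi> \<psi>) (vs ! i) (ws ! j) *
     pure_tensor (nths vs (- {i}) @ nths ws (- {j})) x)"

definition C_hat :: "(complex \<Rightarrow> complex) \<Rightarrow> (complex \<Rightarrow> complex) \<Rightarrow> bitens \<Rightarrow> bitens" where
  "C_hat \<phi> \<psi> X = (\<lambda>p q. tensor_extend (Suc p + Suc q) (p + q)
     (\<lambda>as. cross_contraction \<phi> \<psi> (take (Suc p) as) (drop (Suc p) as)) (X (Suc p) (Suc q)))"

(* The summand for p, q is the component from bidegree (p, q) to bidegree (m, n). *)
definition rho1_tensor :: "(complex \<Rightarrow> complex) \<Rightarrow> (complex \<Rightarrow> complex) \<Rightarrow> bitens \<Rightarrow> bitens" where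
  "rho1_tensor \<phi> \<psi> X = (\<lambda>m n. Sum_any (\<lambda>(p, q). tensor_extend (p + q) (m + n)
     (\<lambda>as. tensor_prod m n
        (rho1 \<phi> (in_degree p (pure_tensor (take p as))) m)
        (rho1 \<psi> (in_degree q (pure_tensor (drop p as))) n)) (X p q)))"

definition S_hat :: "bitens \<Rightarrow> tens" where
  "S_hat X = (\<lambda>n. \<Sum>p\<le>n. symmetrize n (X p (n - p)))"

definition tens_tensor :: "tens \<Rightarrow> tens \<Rightarrow> bitens" where
  "tens_tensor x y = (\<lambda>p q. tensor_prod p q (x p) (y q))"

(* rho2, and hence rho2_N, is meaningful when phi and psi have disjoint images and F_kernel phi,
   F_kernel psi and G_kernel phi psi are square-integrable on disc \<times> disc. *)
definition rho2 :: "(complex \<Rightarrow> complex) \<Rightarrow> (complex \<Rightarrow> complex) \<Rightarrow> tens \<Rightarrow> tens \<Rightarrow> tens" where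
  "rho2 \<phi> \<psi> x y =
     S_hat (rho1_tensor \<phi> \<psi> (op_exp bitens_scale (C_hat \<phi> \<psi>) (tens_tensor x y)))"

definition N_op :: "tens \<Rightarrow> tens" where
  "N_op x = (\<lambda>p z. of_real (sqrt (fact p)) * x p z)"

definition N_inv :: "tens \<Rightarrow> tens" where
  "N_inv x = (\<lambda>p z. x p z / of_real (sqrt (fact p)))"

definition rho2_N :: "(complex \<Rightarrow> complex) \<Rightarrow> (complex \<Rightarrow> complex) \<Rightarrow> tens \<Rightarrow> tens \<Rightarrow> tens" where
  "rho2_N \<phi> \<psi> x y = N_op (rho2 \<phi> \<psi> (N_inv x) (N_inv y))"

(* The induced module M(0), by generators and relations: it is the module over the Heisenberg
   Lie algebra generated by a vector vac subject only to h(n) vac = 0 for n >= 0 and c vac = vac;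
   since c is central and vac generates, c acts as the identity on the whole module.  It is
   constructed as formal expressions modulo the least congruence that makes them a complex vector
   space with linear operators h(n) satisfying these relations. *)

datatype fock_term =
    TVac
  | TZero
  | TAdd fock_term fock_term
  | TScale complex fock_term
  | TH int fock_term

inductive fock_eq :: "fock_term \<Rightarrow> fock_term \<Rightarrow> bool" where
  refl: "fock_eq t t"
| sym: "fock_eq t u \<Longrightarrow> fock_eq u t"
| trans: "fock_eq t u \<Longrightarrow> fock_eq u v \<Longrightarrow> fock_eq t v"
| add_cong: "fock_eq t t' \<Longrightarrow> fock_eq u u' \<Longrightarrow> fock_eq (TAdd t u) (TAdd t' u')"
| scale_cong: "fock_eq t t' \<Longrightarrow> fock_eq (TScale c t) (TScale c t')"
| H_cong: "fock_eq t t' \<Longrightarrow> fock_eq (TH n t) (TH n t')"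
| add_assoc: "fock_eq (TAdd (TAdd t u) v) (TAdd t (TAdd u v))"
| add_comm: "fock_eq (TAdd t u) (TAdd u t)"
| add_zero: "fock_eq (TAdd TZero t) t"
| add_inv: "fock_eq (TAdd (TScale (- 1) t) t) TZero"
| scale_add_right: "fock_eq (TScale c (TAdd t u)) (TAdd (TScale c t) (TScale c u))"
| scale_add_left: "fock_eq (TScale (c + d) t) (TAdd (TScale c t) (TScale d t))"
| scale_scale: "fock_eq (TScale c (TScale d t)) (TScale (c * d) t)"
| scale_one: "fock_eq (TScale 1 t) t"
| H_add: "fock_eq (TH n (TAdd t u)) (TAdd (TH n t) (TH n u))"
| H_scale: "fock_eq (TH n (TScale c t)) (TScale c (TH n t))"
| H_commutator: "fock_eq (TH n (TH m t))
    (TAdd (TH m (TH n t)) (TScale (if n + m = 0 then of_int n else 0) t))"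
| H_vac: "n \<ge> 0 \<Longrightarrow> fock_eq (TH n TVac) TZero"

quotient_type fock = fock_term / fock_eq
  by (rule equivpI) (auto intro!: reflpI sympI transpI intro: fock_eq.refl fock_eq.sym fock_eq.trans)

instantiation fock :: ab_group_add
begin

lift_definition zero_fock :: fock is TZero .

lift_definition plus_fock :: "fock \<Rightarrow> fock \<Rightarrow> fock" is TAdd
  by (rule fock_eq.add_cong)

lift_definition uminus_fock :: "fock \<Rightarrow> fock" is "TScale (- 1)"
  by (rule fock_eq.scale_cong)

definition minus_fock :: "fock \<Rightarrow> fock \<Rightarrow> fock" where
  "minus_fock a b = a + (- b)"

instance
proof
  fix a b c :: fock
  show "a + b + c = a + (b + c)" by transfer (rule fock_eq.add_assoc)
  show "a + b = b + a" by transfer (rule fock_eq.add_comm)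
  show "0 + a = a" by transfer (rule fock_eq.add_zero)
  show "- a + a = 0" by transfer (rule fock_eq.add_inv)
  show "a - b = a + - b" by (rule minus_fock_def)
qed

end

lift_definition fock_scale :: "complex \<Rightarrow> fock \<Rightarrow> fock" is TScale
  by (rule fock_eq.scale_cong)

lift_definition vac :: fock is TVac .

lift_definition h :: "int \<Rightarrow> fock \<Rightarrow> fock" is TH
  by (rule fock_eq.H_cong)

interpretation fock: vector_space fock_scale
proof
  fix c d :: complex and a b :: fock
  show "fock_scale c (a + b) = fock_scale c a + fock_scale c b"
    by transfer (rule fock_eq.scale_add_right)
  show "fock_scale (c + d) a = fock_scale c a + fock_scale d a"
    by transfer (rule fock_eq.scale_add_left)
  show "fock_scale c (fock_scale d a) = fock_scale (c * d) a"
    by transfer (rule fock_eq.scale_scale)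
  show "fock_scale 1 a = a" by transfer (rule fock_eq.scale_one)
qed

interpretation tens: vector_space tens_scale
  by unfold_locales (auto simp: tens_scale_def fun_eq_iff algebra_simps)

lemma h_commutator:
  "h n (h m a) - h m (h n a) = fock_scale (if n + m = 0 then of_int n else 0) a"
proof -
  have "h n (h m a) = h m (h n a) + fock_scale (if n + m = 0 then of_int n else 0) a"
    by transfer (rule fock_eq.H_commutator)
  then show ?thesis by simp
qed

lemma h_vac: "n \<ge> 0 \<Longrightarrow> h n vac = 0"
  by transfer (rule fock_eq.H_vac)

lemma h_linear: "Vector_Spaces.linear fock_scale fock_scale (h n)"
proof -
  have "h n (a + b) = h n a + h n b" for a b
    by transfer (rule fock_eq.H_add)
  moreover have "h n (fock_scale c a) = fock_scale c (h n a)" for c a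
    by transfer (rule fock_eq.H_scale)
  ultimately show ?thesis
    by unfold_locales auto
qed

definition h_monomial :: "nat list \<Rightarrow> fock" where
  "h_monomial ks = foldr (\<lambda>k. h (- int k)) ks vac"

definition M_deg :: "nat \<Rightarrow> fock set" where
  "M_deg p = fock.span {h_monomial ks |ks. length ks = p \<and> (\<forall>k\<in>set ks. k \<ge> 1)}"

definition M_upto :: "nat \<Rightarrow> fock set" where
  "M_upto p = fock.span (\<Union>k\<le>p. M_deg k)"

(* Y a n b is a(n)b.  By truncation all sums in the Borcherds identity are finite. *)
locale vertex_algebra = vector_space scale
  for scale :: "complex \<Rightarrow> 'v::ab_group_add \<Rightarrow> 'v" +
  fixes one :: 'v
    and Y :: "'v \<Rightarrow> int \<Rightarrow> 'v \<Rightarrow> 'v"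
  assumes linear_left: "\<And>n b. Vector_Spaces.linear scale scale (\<lambda>a. Y a n b)"
    and linear_right: "\<And>a n. Vector_Spaces.linear scale scale (Y a n)"
    and truncation: "\<And>a b. \<exists>N. \<forall>n\<ge>N. Y a n b = 0"
    and vacuum: "\<And>n b. Y one n b = (if n = - 1 then b else 0)"
    and creation: "\<And>a. Y a (- 1) one = a" "\<And>a n. n \<ge> 0 \<Longrightarrow> Y a n one = 0"
    and borcherds: "\<And>a b c k l m.
      Sum_any (\<lambda>j::nat. scale (of_int k gchoose j) (Y (Y a (m + int j) b) (k + l - int j) c)) =
      Sum_any (\<lambda>j::nat. scale ((- 1) ^ j * (of_int m gchoose j))
        (Y a (k + m - int j) (Y b (l + int j) c)
         - scale ((- 1) powi m) (Y b (l + m - int j) (Y a (k + int j) c))))"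

definition is_M0_vertex_algebra :: "(fock \<Rightarrow> int \<Rightarrow> fock \<Rightarrow> fock) \<Rightarrow> bool" where
  "is_M0_vertex_algebra Y \<longleftrightarrow>
     vertex_algebra fock_scale vac Y \<and> (\<forall>n. Y (h (- 1) vac) n = h n)"

definition is_L0 :: "(fock \<Rightarrow> fock) \<Rightarrow> bool" where
  "is_L0 L0 \<longleftrightarrow> Vector_Spaces.linear fock_scale fock_scale L0 \<and>
     (\<forall>ks. (\<forall>k\<in>set ks. k \<ge> 1) \<longrightarrow>
        L0 (h_monomial ks) = fock_scale (of_nat (sum_list ks)) (h_monomial ks))"

definition L0_power :: "(fock \<Rightarrow> fock) \<Rightarrow> real \<Rightarrow> fock \<Rightarrow> fock" where
  "L0_power L0 r = (THE R. Vector_Spaces.linear fock_scale fock_scale R \<and>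
     (\<forall>(k::nat) a. L0 a = fock_scale (of_nat k) a \<longrightarrow> R a = fock_scale (of_real (r ^ k)) a))"

definition L1_op :: "(fock \<Rightarrow> int \<Rightarrow> fock \<Rightarrow> fock) \<Rightarrow> fock \<Rightarrow> fock" where
  "L1_op Y = Y (fock_scale (1 / 2) (h (- 1) (h (- 1) vac))) 2"

definition is_theta :: "(fock \<Rightarrow> fock) \<Rightarrow> bool" where
  "is_theta \<theta> \<longleftrightarrow> (\<forall>a b. \<theta> (a + b) = \<theta> a + \<theta> b) \<and>
     (\<forall>c a. \<theta> (fock_scale c a) = fock_scale (cnj c) (\<theta> a)) \<and>
     (\<forall>ks. (\<forall>k\<in>set ks. k \<ge> 1) \<longrightarrow>
        \<theta> (h_monomial ks) = fock_scale ((- 1) ^ length ks) (h_monomial ks))"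

(* The last clause is the coefficient of z^(-n-1) in
     (Y(a,z)b, c) = (b, Y(exp(z L(1)) (-z^(-2))^L(0) a, z^(-1)) c)
   for L(0) a = k a: there (-z^(-2))^L(0) a = (-1)^k z^(-2k) a, and the term
   (L(1)^j a)(m) / j! occurs with z^(-2k + j + m + 1). *)
definition is_invariant_form ::
  "(fock \<Rightarrow> int \<Rightarrow> fock \<Rightarrow> fock) \<Rightarrow> (fock \<Rightarrow> fock) \<Rightarrow> (fock \<Rightarrow> fock \<Rightarrow> complex) \<Rightarrow> bool" where
  "is_invariant_form Y L0 B \<longleftrightarrow>
     (\<forall>a. Vector_Spaces.linear fock_scale (*) (B a)) \<and>
     (\<forall>a b. B a b = B b a) \<and>
     B vac vac = 1 \<and>
     (\<forall>(k::nat) a b c n. L0 a = fock_scale (of_nat k) a \<longrightarrow>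
        B (Y a n b) c = (- 1) ^ k * Sum_any (\<lambda>j::nat.
          B b (Y ((L1_op Y ^^ j) a) (2 * int k - n - int j - 2) c) / fact j))"

definition M_inner ::
  "(fock \<Rightarrow> fock) \<Rightarrow> (fock \<Rightarrow> fock \<Rightarrow> complex) \<Rightarrow> fock \<Rightarrow> fock \<Rightarrow> complex" where
  "M_inner \<theta> B a b = B (\<theta> a) b"

definition M_dist :: "(fock \<Rightarrow> fock) \<Rightarrow> (fock \<Rightarrow> fock \<Rightarrow> complex) \<Rightarrow> fock \<Rightarrow> fock \<Rightarrow> real" where
  "M_dist \<theta> B a b = sqrt (Re (M_inner \<theta> B (a - b) (a - b)))"

definition is_completion ::
  "'a set \<Rightarrow> ('a \<Rightarrow> 'a \<Rightarrow> real) \<Rightarrow> 'x set \<Rightarrow> ('x \<Rightarrow> 'x \<Rightarrow> real) \<Rightarrow> ('a \<Rightarrow> 'x) \<Rightarrow> bool" where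
  "is_completion A D X d \<iota> \<longleftrightarrow>
     Metric_space X d \<and> Metric_space.mcomplete X d \<and> \<iota> ` A \<subseteq> X \<and>
     (\<forall>a\<in>A. \<forall>b\<in>A. d (\<iota> a) (\<iota> b) = D a b) \<and>
     Metric_space.mtopology X d closure_of (\<iota> ` A) = X"

definition bergman_h :: "nat \<Rightarrow> complex \<Rightarrow> complex" where
  "bergman_h j z = (if z \<in> disc then of_nat (j + 1) * z ^ j else 0)"

(* A weakly decreasing list js lists i_1 > ... > i_n with multiplicities k_1, ..., k_n. *)
definition is_Psi :: "(fock \<Rightarrow> tens) \<Rightarrow> bool" where
  "is_Psi \<Psi> \<longleftrightarrow> Vector_Spaces.linear fock_scale tens_scale \<Psi> \<and>
     \<Psi> vac = in_degree 0 (pure_tensor []) \<and>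
     (\<forall>js. sorted_wrt (\<ge>) js \<longrightarrow>
        \<Psi> (h_monomial (map Suc js)) =
          in_degree (length js) (\<lambda>x. of_real (sqrt (fact (length js))) *
            symmetrize (length js) (pure_tensor (map bergman_h js)) x))"

definition is_Psi_extension ::
  "(fock \<Rightarrow> tens) \<Rightarrow> nat \<Rightarrow> 'x set \<Rightarrow> ('x \<Rightarrow> 'x \<Rightarrow> real) \<Rightarrow> (fock \<Rightarrow> 'x) \<Rightarrow> ('x \<Rightarrow> tens) \<Rightarrow> bool"
where
  "is_Psi_extension \<Psi> N X d \<iota> \<Psi>' \<longleftrightarrow>
     continuous_map (Metric_space.mtopology X d)
       (Metric_space.mtopology (Sym_A2_upto N) (Sym_dist N)) \<Psi>' \<and>
     (\<forall>a\<in>M_upto N. \<Psi>' (\<iota> a) = \<Psi> a)"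

(* y is the sum over all integers n of a(n)b z^(-n-1), converging in the completion. *)
definition Y_sums_to ::
  "(fock \<Rightarrow> int \<Rightarrow> fock \<Rightarrow> fock) \<Rightarrow> 'x set \<Rightarrow> ('x \<Rightarrow> 'x \<Rightarrow> real) \<Rightarrow> (fock \<Rightarrow> 'x) \<Rightarrow>
   fock \<Rightarrow> fock \<Rightarrow> complex \<Rightarrow> 'x \<Rightarrow> bool" where
  "Y_sums_to Y X d \<iota> a b z y \<longleftrightarrow>
     limitin (Metric_space.mtopology X d)
       (\<lambda>I. \<iota> (\<Sum>n\<in>I. fock_scale (z powi (- n - 1)) (Y a n b))) y
       (finite_subsets_at_top UNIV)"

end

theory Submission
  imports Defs "HOL-Complex_Analysis.Complex_Analysis"
begin

text \<open>
Both sides are bilinear in the two vectors, and products of commuting creation operators are linear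
combinations of powers of single ones (\<open>polarisation\<close>). So only pairs of powers
\<open>A ^ p vac\<close>, \<open>B ^ q vac\<close> have to be compared, and for them both sides turn out to be the same finite sum over
the number \<open>k\<close> of contracted pairs.

On the Bergman side the kernel \<open>F\<close> of an affine map is 0, hence \<open>rho1\<close> is just \<open>rho_cl\<close>. The
contraction sends the pair of powers with exponents \<open>(p, q)\<close> to \<open>p * q * C(A, B)\<close> times the pair with
exponents \<open>(p - 1, q - 1)\<close>, so that its exponential can be written down (\<open>rho_raw_powers\<close>, \<open>rho_powers\<close>). The operations on
completed tensor products are specified through limits of pure tensors; that these specifications determine
the expected values follows because each value at a point, of the adjoints \<open>rho_cl1\<close> and of the
contraction alike, is a bounded functional of the tensor (\<open>tensor_extend_lin_comb\<close>). For the adjoint such a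
functional is an explicit bounded kernel, for the contraction an absolutely convergent series of
products of moments and mean values, with coefficients summable because the two discs are separated.

On the vertex algebra side the Borcherds identity expresses \<open>Y(h(- j - 1)a, z)b\<close> through \<open>Y(a, z)\<close>: a
creation part acts on the result, an annihilation part acts on \<open>b\<close> (\<open>Y_h\<close>). Summed at \<open>z = \<zeta>\<close>, the
creation part multiplies by the series that represents \<open>rho_cl1\<close> on the basis vector, and the
annihilation part contributes the Taylor coefficients of the contraction kernel (\<open>G_coeff_annihilation\<close>). Thus a
new factor in the first argument is either left alone or contracted with one of the factors of the second,
and this recursion produces the same sum (\<open>contraction_sum_Suc\<close>, \<open>Y_sum_is_powers\<close>).

Convergence is first treated pointwise, with bounds by suprema that are summable over the modes
(\<open>Y_bound\<close>). As the polydiscs have mass 1, these bounds dominate norms; since \<open>\<Psi>\<close> is an isometry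
(\<open>Psi_isometry\<close>), the partial sums are Cauchy in the completion. Point evaluations are bounded on the
Bergman spaces (\<open>A2_evaluation_bound\<close>), which identifies the limit with the pointwise sum.
\<close>

section \<open>Normalised area measure on the disc\<close>

lemma space_disc_measure [simp]: "space disc_measure = disc"
  by (simp add: disc_measure_def space_scale_measure space_restrict_space)

lemma sets_disc_measure: "sets disc_measure = sets (restrict_space borel disc)"
  by (simp add: disc_measure_def sets_restrict_space)

lemma sets_disc_measure_iff: "A \<in> sets disc_measure \<longleftrightarrow> A \<in> sets borel \<and> A \<subseteq> disc"
  by (subst sets_disc_measure) (auto simp: sets_restrict_space_iff)

lemma measurable_disc_continuous:
  fixes f :: "complex \<Rightarrow> 'a::{banach, second_countable_topology}"
  assumes "continuous_on disc f"
  shows "f \<in> borel_measurable disc_measure"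
proof -
  have "f \<in> borel_measurable (restrict_space borel disc)"
    by (rule borel_measurable_continuous_on_restrict[OF assms])
  then show ?thesis by (subst measurable_cong_sets[OF sets_disc_measure HOL.refl])
qed

lemma measurable_into_disc:
  assumes "f \<in> borel_measurable M" "\<And>x. x \<in> space M \<Longrightarrow> f x \<in> disc"
  shows "f \<in> measurable M disc_measure"
  by (subst measurable_cong_sets[OF HOL.refl sets_disc_measure])
     (use assms in \<open>auto intro!: measurable_restrict_space2\<close>)

lemma emeasure_disc_measure:
  assumes "A \<in> sets disc_measure"
  shows "emeasure disc_measure A = ennreal (1 / pi) * emeasure lborel A"
proof -
  have "emeasure (restrict_space lborel disc) A = emeasure lborel A"
    using assms by (subst emeasure_restrict_space) (auto simp: sets_disc_measure_iff)
  then show ?thesis by (simp add: disc_measure_def)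
qed

lemma emeasure_disc_ball:
  assumes "0 < r" "ball c r \<subseteq> disc"
  shows "emeasure disc_measure (ball c r) = ennreal (r\<^sup>2)"
proof -
  have "emeasure (lborel :: complex measure) (ball c r) = ennreal (pi * r\<^sup>2)"
    using assms by (subst emeasure_ball) (auto simp: unit_ball_vol_2)
  then show ?thesis
    using assms by (subst emeasure_disc_measure)
      (auto simp: sets_disc_measure_iff ennreal_mult[symmetric])
qed

lemma emeasure_disc: "emeasure disc_measure disc = 1"
  using emeasure_disc_ball[of 1 0] by simp

interpretation disc: finite_measure disc_measure
  by standard (simp add: emeasure_disc)

text \<open>Rotations preserve area. The change of variables theorem for orthogonal maps is about
  \<^typ>\<open>real ^ 2\<close>, so the statement is carried over along the obvious isometry.\<close>

definition complex_of_vec :: "real ^ 2 \<Rightarrow> complex" where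
  "complex_of_vec x = Complex (x $ 1) (x $ 2)"

definition vec_of_complex :: "complex \<Rightarrow> real ^ 2" where
  "vec_of_complex z = vector [Re z, Im z]"

lemma complex_vec_inverse [simp]:
  "complex_of_vec (vec_of_complex z) = z" "vec_of_complex (complex_of_vec x) = x"
  by (auto simp: complex_of_vec_def vec_of_complex_def vec_eq_iff forall_2)

lemma continuous_complex_of_vec: "continuous_on UNIV complex_of_vec"
  unfolding complex_of_vec_def Complex_eq by (intro continuous_intros)

lemma inner_complex_of_vec: "complex_of_vec x \<bullet> complex_of_vec y = x \<bullet> y"
  by (simp add: complex_of_vec_def inner_vec_def sum_2 inner_complex_def)

lemma linear_complex_of_vec: "linear complex_of_vec"
  by (rule linearI) (auto simp: complex_of_vec_def complex_eq_iff)

lemma linear_vec_of_complex: "linear vec_of_complex"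
  by (rule linearI) (auto simp: vec_of_complex_def vec_eq_iff forall_2)

lemma vec2_basis: "(Basis :: (real^2) set) = {axis 1 1, axis 2 1}"
  by (auto simp: Basis_vec_def UNIV_2)

lemma emeasure_vec_box:
  fixes a b :: "real ^ 2"
  assumes "a $ 1 \<le> b $ 1" "a $ 2 \<le> b $ 2"
  shows "emeasure lborel (box a b) = ennreal ((b $ 1 - a $ 1) * (b $ 2 - a $ 2))"
proof -
  have "emeasure lborel (box a b) = (\<Prod>c\<in>Basis. (b - a) \<bullet> c)"
    by (rule emeasure_lborel_box) (use assms in \<open>auto simp: vec2_basis inner_axis\<close>)
  also have "(\<Prod>c\<in>Basis. (b - a) \<bullet> c) = (b $ 1 - a $ 1) * (b $ 2 - a $ 2)"
    by (simp add: vec2_basis inner_axis axis_eq_axis)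
  finally show ?thesis .
qed

lemma distr_complex_of_vec: "distr lborel borel complex_of_vec = lborel"
proof (rule lborel_eqI[symmetric])
  fix l u :: complex
  assume le: "\<And>b. b \<in> Basis \<Longrightarrow> l \<bullet> b \<le> u \<bullet> b"
  have le': "Re l \<le> Re u" "Im l \<le> Im u"
    using le[of 1] le[of \<i>] by (auto simp: Basis_complex_def inner_complex_def)
  have *: "complex_of_vec -` box l u = box (vec_of_complex l) (vec_of_complex u)"
    by (auto simp: complex_of_vec_def vec_of_complex_def box_def vec2_basis inner_axis
        Basis_complex_def inner_complex_def)
  have m: "complex_of_vec \<in> borel_measurable borel"
    by (rule borel_measurable_continuous_onI[OF continuous_complex_of_vec])
  have "emeasure (distr lborel borel complex_of_vec) (box l u)
      = emeasure lborel (box (vec_of_complex l) (vec_of_complex u))"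
    using m by (subst emeasure_distr) (auto simp: *)
  also have "\<dots> = ennreal ((Re u - Re l) * (Im u - Im l))"
    by (subst emeasure_vec_box) (use le' in \<open>auto simp: vec_of_complex_def\<close>)
  also have "(Re u - Re l) * (Im u - Im l) = (\<Prod>b\<in>Basis. (u - l) \<bullet> b)"
    by (auto simp: Basis_complex_def inner_complex_def)
  finally show "emeasure (distr lborel borel complex_of_vec) (box l u) = (\<Prod>b\<in>Basis. (u - l) \<bullet> b)" .
qed auto

text \<open>Invariance of the measure is known for images of sets, so preimages are rewritten as images under
  the inverse \<open>g\<close>.\<close>

lemma lborel_orthogonal_vec:
  fixes f g :: "real ^ 2 \<Rightarrow> real ^ 2"
  assumes f: "orthogonal_transformation f" and g: "orthogonal_transformation g"
    and fg: "\<And>x. f (g x) = x" "\<And>x. g (f x) = x"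
  shows "distr lborel borel f = lborel"
proof (rule lborel_eqI[symmetric])
  fix l u :: "real ^ 2"
  assume le: "\<And>b. b \<in> Basis \<Longrightarrow> l \<bullet> b \<le> u \<bullet> b"
  have cf: "continuous_on UNIV f"
    using f linear_continuous_on linear_conv_bounded_linear orthogonal_transformation_linear by blast
  then have m: "f \<in> borel_measurable borel"
    by (rule borel_measurable_continuous_onI)
  have im: "f -` box l u = g ` box l u"
    using fg by (auto simp: image_iff) metis
  have lm: "g ` box l u \<in> lmeasurable" "measure lebesgue (g ` box l u) = measure lebesgue (box l u)"
    using measurable_orthogonal_image[OF g] measure_orthogonal_image[OF g] by auto
  have op: "open (f -` box l u)"
    using open_vimage[OF open_box cf] .
  then have bm: "f -` box l u \<in> sets borel" by simp
  have "emeasure (distr lborel borel f) (box l u) = emeasure lborel (f -` box l u)"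
    using m by (subst emeasure_distr) auto
  also have "\<dots> = emeasure lebesgue (g ` box l u)"
    using bm by (simp add: im)
  also have "\<dots> = emeasure lebesgue (box l u)"
    using lm by (metis emeasure_eq_measure2 lmeasurable_box)
  also have "\<dots> = emeasure lborel (box l u)"
    by simp
  also have "\<dots> = (\<Prod>b\<in>Basis. (u - l) \<bullet> b)"
    using le by (rule emeasure_lborel_box)
  finally show "emeasure (distr lborel borel f) (box l u) = (\<Prod>b\<in>Basis. (u - l) \<bullet> b)" .
qed auto

lemma lborel_rotate:
  assumes w: "cmod w = 1"
  shows "distr lborel borel ((*) w) = (lborel :: complex measure)"
proof -
  define rot where "rot = (\<lambda>w x. vec_of_complex (w * complex_of_vec x))"
  have rot: "orthogonal_transformation (rot v)" if "cmod v = 1" for v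
    unfolding orthogonal_transformation_def
  proof (intro conjI allI)
    show "linear (rot v)"
      unfolding rot_def
      by (rule linear_compose[unfolded o_def, OF linear_complex_of_vec
            linear_compose[unfolded o_def, OF _ linear_vec_of_complex]])
         (auto intro!: linearI simp: algebra_simps)
    fix x y
    have "rot v x \<bullet> rot v y = (v * complex_of_vec x) \<bullet> (v * complex_of_vec y)"
      unfolding rot_def by (metis inner_complex_of_vec complex_vec_inverse(1))
    also have "\<dots> = ((Re v)\<^sup>2 + (Im v)\<^sup>2) * (complex_of_vec x \<bullet> complex_of_vec y)"
      by (simp add: inner_complex_def power2_eq_square algebra_simps)
    also have "\<dots> = x \<bullet> y"
      using that by (simp add: cmod_def inner_complex_of_vec)
    finally show "rot v x \<bullet> rot v y = x \<bullet> y" .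
  qed
  have inv: "w * cnj w = 1" using w by (simp add: complex_norm_square[symmetric])
  have dr: "distr lborel borel (rot w) = lborel"
    by (rule lborel_orthogonal_vec[OF rot[OF w] rot[of "cnj w"]])
       (use w inv in \<open>auto simp: rot_def mult.assoc[symmetric] mult.commute\<close>)
  have mc: "complex_of_vec \<in> borel_measurable borel"
    by (rule borel_measurable_continuous_onI[OF continuous_complex_of_vec])
  have mr: "rot w \<in> borel_measurable borel"
    using rot[OF w] borel_measurable_continuous_onI linear_continuous_on
      linear_conv_bounded_linear orthogonal_transformation_linear by blast
  have "distr lborel borel ((*) w) = distr (distr lborel borel complex_of_vec) borel ((*) w)"
    by (simp add: distr_complex_of_vec)
  also have "\<dots> = distr lborel borel (\<lambda>x. w * complex_of_vec x)"
    using mc by (subst distr_distr) (auto simp: o_def)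
  also have "(\<lambda>x. w * complex_of_vec x) = complex_of_vec \<circ> rot w"
    by (auto simp: rot_def)
  also have "distr lborel borel (complex_of_vec \<circ> rot w) = distr (distr lborel borel (rot w)) borel complex_of_vec"
    using mc mr by (subst distr_distr) auto
  also have "\<dots> = lborel" by (simp add: dr distr_complex_of_vec)
  finally show ?thesis .
qed

lemma disc_measure_rotate:
  assumes w: "cmod w = 1"
  shows "distr disc_measure disc_measure ((*) w) = disc_measure"
proof (rule measure_eqI)
  fix A assume "A \<in> sets (distr disc_measure disc_measure ((*) w))"
  then have A: "A \<in> sets borel" "A \<subseteq> disc" by (auto simp: sets_disc_measure_iff)
  have m: "(*) w \<in> measurable disc_measure disc_measure"
    by (intro measurable_into_disc measurable_disc_continuous continuous_intros)
       (use w in \<open>auto simp: norm_mult\<close>)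
  have eq: "(*) w -` A \<inter> disc = (*) w -` A"
    using A(2) w by (auto simp: norm_mult)
  have m2: "(*) w -` A \<in> sets borel"
    using A(1) measurable_sets[of "(*) w" borel borel A] by simp
  have "emeasure (distr disc_measure disc_measure ((*) w)) A = emeasure disc_measure ((*) w -` A)"
    using A m by (subst emeasure_distr) (auto simp: sets_disc_measure_iff eq)
  also have "\<dots> = ennreal (1/pi) * emeasure lborel ((*) w -` A)"
    using m2 A w eq by (subst emeasure_disc_measure) (auto simp: sets_disc_measure_iff norm_mult)
  also have "emeasure lborel ((*) w -` A) = emeasure (distr lborel borel ((*) w)) A"
    using A by (subst emeasure_distr) auto
  also have "\<dots> = emeasure lborel A" by (simp add: lborel_rotate[OF w])
  also have "ennreal (1/pi) * \<dots> = emeasure disc_measure A"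
    using A by (subst emeasure_disc_measure) (auto simp: sets_disc_measure_iff)
  finally show "emeasure (distr disc_measure disc_measure ((*) w)) A = emeasure disc_measure A" .
qed simp

lemma affine_into_disc:
  assumes "0 < r" "ball c r \<subseteq> disc" "z \<in> disc"
  shows "c + of_real r * z \<in> disc"
proof -
  have "c + of_real r * z \<in> ball c r"
    using assms(1,3) by (auto simp: dist_norm norm_mult)
  with assms(2) show ?thesis by blast
qed

lemma measurable_affine_disc:
  assumes "0 < r" "ball c r \<subseteq> disc"
  shows "(\<lambda>z. c + of_real r * z) \<in> measurable disc_measure disc_measure"
  using affine_into_disc[OF assms] 
  by (intro measurable_into_disc measurable_disc_continuous continuous_intros) auto

lemma distr_disc_affine:
  assumes r: "0 < r" and sub: "ball c r \<subseteq> disc"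
  shows "distr disc_measure disc_measure (\<lambda>z. c + of_real r * z)
       = density disc_measure (\<lambda>z. ennreal (indicator (ball c r) z / r\<^sup>2))"
proof (rule measure_eqI)
  let ?T = "\<lambda>z. c + complex_of_real r * z"
  fix A assume "A \<in> sets (distr disc_measure disc_measure ?T)"
  then have A: "A \<in> sets borel" "A \<subseteq> disc" by (auto simp: sets_disc_measure_iff)
  have m: "?T \<in> measurable disc_measure disc_measure"
    by (rule measurable_affine_disc[OF r sub])
  have eq: "?T -` A \<inter> disc = ?T -` (A \<inter> ball c r)"
    using r by (auto simp: dist_norm norm_mult)
  have Tb: "?T \<in> borel_measurable borel" by measurable
  have m2: "?T -` (A \<inter> ball c r) \<in> sets borel"
    using A(1) measurable_sets[OF Tb, of "A \<inter> ball c r"] by simp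
  have sub2: "?T -` (A \<inter> ball c r) \<subseteq> disc"
    using r by (auto simp: dist_norm norm_mult)
  have [measurable]: "A \<inter> ball c r \<in> sets disc_measure" using A by (auto simp: sets_disc_measure_iff)
  have e1: "emeasure lborel (A \<inter> ball c r)
      = ennreal (r\<^sup>2) * emeasure (distr lborel borel (\<lambda>x. c + r *\<^sub>R x)) (A \<inter> ball c r)"
    using r A by (subst lborel_affine[of r c])
      (auto simp: emeasure_density nn_integral_cmult_indicator)
  have e2: "emeasure (distr lborel borel (\<lambda>x. c + r *\<^sub>R x)) (A \<inter> ball c r)
      = emeasure lborel (?T -` (A \<inter> ball c r))"
    using A Tb by (subst emeasure_distr) (auto simp: scaleR_conv_of_real)
  have [measurable]: "ball c r \<in> sets disc_measure"
    using sub by (simp add: sets_disc_measure_iff)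
  have b: "(\<lambda>z. indicat_real (ball c r) z / r\<^sup>2) \<in> borel_measurable disc_measure"
    by measurable
  have "emeasure (distr disc_measure disc_measure ?T) A = emeasure disc_measure (?T -` (A \<inter> ball c r))"
    using A m by (subst emeasure_distr) (auto simp: sets_disc_measure_iff eq)
  also have "\<dots> = ennreal (1/pi) * emeasure lborel (?T -` (A \<inter> ball c r))"
    using m2 sub2 by (subst emeasure_disc_measure) (auto simp: sets_disc_measure_iff)
  also have "\<dots> = ennreal (1/r\<^sup>2) * (ennreal (1/pi) * emeasure lborel (A \<inter> ball c r))"
    using r by (simp add: e1 e2 mult.assoc[symmetric] ennreal_mult[symmetric])
  also have "\<dots> = ennreal (1/r\<^sup>2) * emeasure disc_measure (A \<inter> ball c r)"
    by (subst emeasure_disc_measure) auto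
  also have "\<dots> = (\<integral>\<^sup>+z. ennreal (1/r\<^sup>2) * indicator (A \<inter> ball c r) z \<partial>disc_measure)"
    by (simp add: nn_integral_cmult_indicator)
  also have "\<dots> = (\<integral>\<^sup>+z. ennreal (indicator (ball c r) z / r\<^sup>2) * indicator A z \<partial>disc_measure)"
    by (intro nn_integral_cong) (auto split: split_indicator)
  also have "\<dots> = emeasure (density disc_measure (\<lambda>z. ennreal (indicator (ball c r) z / r\<^sup>2))) A"
    using A b by (subst emeasure_density) (auto simp: sets_disc_measure_iff)
  finally show "emeasure (distr disc_measure disc_measure ?T) A
     = emeasure (density disc_measure (\<lambda>z. ennreal (indicator (ball c r) z / r\<^sup>2))) A" .
qed simp

lemma integral_disc_affine:
  fixes f :: "complex \<Rightarrow> 'a::{banach, second_countable_topology}"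
  assumes r: "0 < r" and sub: "ball c r \<subseteq> disc" and f [measurable]: "f \<in> borel_measurable disc_measure"
  shows "(\<integral>z. f (c + of_real r * z) \<partial>disc_measure)
       = (\<integral>z. (indicator (ball c r) z / r\<^sup>2) *\<^sub>R f z \<partial>disc_measure)"
proof -
  have [measurable]: "ball c r \<in> sets disc_measure"
    using sub by (simp add: sets_disc_measure_iff)
  have b: "(\<lambda>z. indicat_real (ball c r) z / r\<^sup>2) \<in> borel_measurable disc_measure"
    by measurable
  have "(\<integral>z. f (c + of_real r * z) \<partial>disc_measure)
      = (\<integral>z. f z \<partial>distr disc_measure disc_measure (\<lambda>z. c + of_real r * z))"
    using measurable_affine_disc[OF r sub] by (subst integral_distr) auto
  also have "\<dots> = (\<integral>z. (indicator (ball c r) z / r\<^sup>2) *\<^sub>R f z \<partial>disc_measure)"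
    unfolding distr_disc_affine[OF r sub] using b by (subst integral_density) auto
  finally show ?thesis .
qed

lemma nn_integral_disc_affine:
  assumes r: "0 < r" and sub: "ball c r \<subseteq> disc" and f [measurable]: "f \<in> borel_measurable disc_measure"
  shows "(\<integral>\<^sup>+z. f (c + of_real r * z) \<partial>disc_measure)
       = (\<integral>\<^sup>+z. ennreal (indicator (ball c r) z / r\<^sup>2) * f z \<partial>disc_measure)"
proof -
  have [measurable]: "ball c r \<in> sets disc_measure"
    using sub by (simp add: sets_disc_measure_iff)
  have b: "(\<lambda>z. indicat_real (ball c r) z / r\<^sup>2) \<in> borel_measurable disc_measure"
    by measurable
  have "(\<integral>\<^sup>+z. f (c + of_real r * z) \<partial>disc_measure)
      = (\<integral>\<^sup>+z. f z \<partial>distr disc_measure disc_measure (\<lambda>z. c + of_real r * z))"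
    using measurable_affine_disc[OF r sub] by (subst nn_integral_distr) auto
  also have "\<dots> = (\<integral>\<^sup>+z. ennreal (indicator (ball c r) z / r\<^sup>2) * f z \<partial>disc_measure)"
    unfolding distr_disc_affine[OF r sub] using b by (subst nn_integral_density) auto
  finally show ?thesis .
qed

lemma disc_integrable_bounded:
  fixes f :: "complex \<Rightarrow> 'a::{banach, second_countable_topology}"
  assumes "f \<in> borel_measurable disc_measure" "\<And>z. z \<in> disc \<Longrightarrow> norm (f z) \<le> C"
  shows "integrable disc_measure f"
  by (rule disc.integrable_const_bound[of _ C]) (use assms in \<open>auto intro!: AE_I2\<close>)

lemma disc_power_le_one: "z \<in> disc \<Longrightarrow> cmod z ^ n \<le> 1"
  by (intro power_le_one) auto

lemma integrable_disc_monomials: "integrable disc_measure (\<lambda>z. z ^ j * cnj z ^ k)"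
proof (rule disc_integrable_bounded[where C = 1])
  show "(\<lambda>z. z ^ j * cnj z ^ k) \<in> borel_measurable disc_measure"
    by (intro measurable_disc_continuous continuous_intros)
  fix z assume "z \<in> disc"
  then show "cmod (z ^ j * cnj z ^ k) \<le> 1"
    using disc_power_le_one[of z] by (auto simp: norm_mult norm_power intro!: mult_le_one)
qed

lemma disc_moment_off_diagonal:
  assumes "j \<noteq> k"
  shows "(\<integral>z. z ^ j * cnj z ^ k \<partial>disc_measure) = 0"
proof -
  define I where "I = (\<integral>z. z ^ j * cnj z ^ k \<partial>disc_measure)"
  \<comment> \<open>rotation by this angle multiplies the integrand by -1\<close>
  define t where "t = pi / (real j - real k)"
  have t: "real j * t - real k * t = pi"
  proof -
    have "real j * t - real k * t = (real j - real k) * t" by (simp add: algebra_simps)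
    then show ?thesis using assms by (simp add: t_def)
  qed
  have m: "(*) (cis t) \<in> measurable disc_measure disc_measure"
    by (intro measurable_into_disc measurable_disc_continuous continuous_intros) (auto simp: norm_mult)
  have "I = (\<integral>z. z ^ j * cnj z ^ k \<partial>distr disc_measure disc_measure ((*) (cis t)))"
    by (simp add: disc_measure_rotate I_def)
  also have "\<dots> = (\<integral>z. (cis t * z) ^ j * cnj (cis t * z) ^ k \<partial>disc_measure)"
    using m integrable_disc_monomials by (subst integral_distr) auto
  also have "\<dots> = (\<integral>z. (cis t ^ j * cnj (cis t) ^ k) * (z ^ j * cnj z ^ k) \<partial>disc_measure)"
    by (simp add: power_mult_distrib algebra_simps)
  also have "cis t ^ j * cnj (cis t) ^ k = cis (real j * t - real k * t)"
  proof -
    have "cnj (cis t) ^ k = cis (- (real k * t))"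
      by (metis Complex.DeMoivre cis_cnj complex_cnj_power)
    then show ?thesis by (simp add: Complex.DeMoivre cis_mult)
  qed
  also have "\<dots> = -1" unfolding t by simp
  finally have "I = - I" unfolding I_def by simp
  then show ?thesis unfolding I_def by simp
qed

text \<open>The radial moment is found without polar coordinates: dilating the disc by \<open>sqrt t\<close>
  multiplies the integral by \<open>t ^ (k + 1)\<close>, and on the thin annulus that is lost the integrand is nearly
  1; letting \<open>t\<close> tend to 1 determines the integral.\<close>

lemma disc_moment_radial: "(\<integral>z. (cmod z)\<^sup>2 ^ k \<partial>disc_measure) = 1 / (real k + 1)"
proof -
  define I where "I = (\<integral>z. (cmod z)\<^sup>2 ^ k \<partial>disc_measure)"
  have meas: "(\<lambda>z. (cmod z)\<^sup>2 ^ k) \<in> borel_measurable disc_measure"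
    by (intro measurable_disc_continuous continuous_intros)
  have int: "integrable disc_measure (\<lambda>z. (cmod z)\<^sup>2 ^ k)"
    by (rule disc_integrable_bounded[OF meas, of 1])
       (auto intro!: power_le_one simp: power2_eq_square mult_le_one)
  have bounds: "t ^ k \<le> I * (\<Sum>i\<le>k. t ^ i) \<and> I * (\<Sum>i\<le>k. t ^ i) \<le> 1" if t: "0 < t" "t < 1" for t
  proof -
    define r where "r = sqrt t"
    have r: "0 < r" "r < 1" "r\<^sup>2 = t" using t by (auto simp: r_def)
    have sub: "ball 0 r \<subseteq> disc" using r by auto
    have [measurable]: "ball 0 r \<in> sets disc_measure" "disc - ball 0 r \<in> sets disc_measure"
      using sub by (auto simp: sets_disc_measure_iff)
    have "t ^ k * I = (\<integral>z. (cmod (0 + of_real r * z))\<^sup>2 ^ k \<partial>disc_measure)"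
      using r by (simp add: I_def norm_mult power_mult_distrib)
    also have "\<dots> = (\<integral>z. (indicator (ball 0 r) z / r\<^sup>2) *\<^sub>R (cmod z)\<^sup>2 ^ k \<partial>disc_measure)"
      by (rule integral_disc_affine[OF r(1) sub meas])
    also have "\<dots> = (\<integral>z. (1 / t) * (indicator (ball 0 r) z * (cmod z)\<^sup>2 ^ k) \<partial>disc_measure)"
      using r(3) by (intro Bochner_Integration.integral_cong) auto
    also have "\<dots> = (1 / t) * (\<integral>z. indicator (ball 0 r) z * (cmod z)\<^sup>2 ^ k \<partial>disc_measure)"
      by simp
    finally have inner: "(\<integral>z. indicator (ball 0 r) z * (cmod z)\<^sup>2 ^ k \<partial>disc_measure) = t ^ (k + 1) * I"
      using t by (simp add: field_simps)
    have i1: "integrable disc_measure (\<lambda>z. indicator (ball 0 r) z * (cmod z)\<^sup>2 ^ k)"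
      using integrable_mult_indicator[OF _ int, of "ball 0 r"] by simp
    have "I - t ^ (k + 1) * I
        = (\<integral>z. (cmod z)\<^sup>2 ^ k - indicator (ball 0 r) z * (cmod z)\<^sup>2 ^ k \<partial>disc_measure)"
      unfolding I_def[symmetric] inner[symmetric] by (simp add: int i1 I_def)
    also have "\<dots> = (\<integral>z. indicator (disc - ball 0 r) z * (cmod z)\<^sup>2 ^ k \<partial>disc_measure)"
      by (intro Bochner_Integration.integral_cong) (auto split: split_indicator)
    finally have ann: "I * (1 - t ^ (k + 1)) = (\<integral>z. indicator (disc - ball 0 r) z * (cmod z)\<^sup>2 ^ k \<partial>disc_measure)"
      by (simp add: algebra_simps)
    have i2: "integrable disc_measure (\<lambda>z. indicator (disc - ball 0 r) z * (cmod z)\<^sup>2 ^ k)"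
      using integrable_mult_indicator[OF _ int, of "disc - ball 0 r"] by simp
    have "emeasure disc_measure (disc - ball 0 r) = 1 - ennreal (r\<^sup>2)"
      using emeasure_disc_ball[OF r(1) sub]
      by (subst emeasure_Diff) (auto simp: emeasure_disc sub sets_disc_measure_iff)
    also have "\<dots> = ennreal (1 - t)"
      using r t by (metis ennreal_1 ennreal_minus less_imp_le)
    finally have meas_ann: "measure disc_measure (disc - ball 0 r) = 1 - t"
      using t by (simp add: measure_def)
    have fin: "integrable disc_measure (indicat_real (disc - ball 0 r))"
      by (rule disc_integrable_bounded[where C = 1]) (auto split: split_indicator)
    have up: "(\<integral>z. indicator (disc - ball 0 r) z * (cmod z)\<^sup>2 ^ k \<partial>disc_measure)
        \<le> (\<integral>z. indicator (disc - ball 0 r) z \<partial>disc_measure)"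
      by (rule integral_mono[OF i2])
         (auto split: split_indicator intro!: power_le_one simp: power2_eq_square mult_le_one fin)
    have lo: "(\<integral>z. t ^ k * indicator (disc - ball 0 r) z \<partial>disc_measure)
        \<le> (\<integral>z. indicator (disc - ball 0 r) z * (cmod z)\<^sup>2 ^ k \<partial>disc_measure)"
    proof (rule integral_mono[OF _ i2])
      show "integrable disc_measure (\<lambda>z. t ^ k * indicator (disc - ball 0 r) z)"
        using fin by simp
      fix z
      show "t ^ k * indicator (disc - ball 0 r) z \<le> indicator (disc - ball 0 r) z * (cmod z)\<^sup>2 ^ k"
        using r t by (auto split: split_indicator intro!: power_mono simp flip: r(3))
    qed
    have mi: "(\<integral>z. indicator (disc - ball 0 r) z \<partial>disc_measure) = 1 - t"
        "(\<integral>z. t ^ k * indicator (disc - ball 0 r) z \<partial>disc_measure) = t ^ k * (1 - t)"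
    proof -
      have "(disc - ball 0 r) \<inter> disc = disc - ball (0::complex) r" by auto
      then show "(\<integral>z. indicator (disc - ball 0 r) z \<partial>disc_measure) = 1 - t"
        using meas_ann by simp
      then show "(\<integral>z. t ^ k * indicator (disc - ball 0 r) z \<partial>disc_measure) = t ^ k * (1 - t)"
        by simp
    qed
    have geo: "(1 - t) * (\<Sum>i\<le>k. t ^ i) = 1 - t ^ (k + 1)"
      using sum_gp_multiplied[of 0 k t] by (simp add: atMost_atLeast0)
    have "I * ((1 - t) * (\<Sum>i\<le>k. t ^ i)) \<le> 1 - t" "t ^ k * (1 - t) \<le> I * ((1 - t) * (\<Sum>i\<le>k. t ^ i))"
      using up lo unfolding geo ann mi by auto
    moreover have "0 < 1 - t" using t by simp
    moreover have "I * ((1 - t) * (\<Sum>i\<le>k. t ^ i)) = (1 - t) * (I * (\<Sum>i\<le>k. t ^ i))"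
      by simp
    ultimately have "(1 - t) * (I * (\<Sum>i\<le>k. t ^ i)) \<le> (1 - t) * 1"
        "(1 - t) * t ^ k \<le> (1 - t) * (I * (\<Sum>i\<le>k. t ^ i))"
      by (simp_all only: mult_1_right mult.commute[of "t ^ k"])
    then show ?thesis using \<open>0 < 1 - t\<close> mult_le_cancel_left_pos by blast
  qed
  have lim1: "((\<lambda>t. t ^ k) \<longlongrightarrow> 1) (at_left (1::real))"
    by (auto intro!: tendsto_eq_intros)
  have lim2: "((\<lambda>t. I * (\<Sum>i\<le>k. t ^ i)) \<longlongrightarrow> I * (real k + 1)) (at_left (1::real))"
    by (auto intro!: tendsto_eq_intros)
  have ev: "\<forall>\<^sub>F t in at_left (1::real). 0 < t \<and> t < 1"
    unfolding eventually_at_left_field by (rule exI[of _ 0]) auto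
  have "1 \<le> I * (real k + 1)"
    by (rule tendsto_le[OF _ lim2 lim1]) (use ev bounds in \<open>auto elim!: eventually_mono\<close>)
  moreover have "I * (real k + 1) \<le> 1"
    by (rule tendsto_le[OF _ tendsto_const lim2]) (use ev bounds in \<open>auto elim!: eventually_mono\<close>)
  ultimately show ?thesis
    unfolding I_def by (simp add: field_simps)
qed

lemma disc_moment:
  "(\<integral>z. z ^ j * cnj z ^ k \<partial>disc_measure) = (if j = k then 1 / (of_nat k + 1) else 0)"
proof (cases "j = k")
  case True
  have "(\<integral>z. z ^ k * cnj z ^ k \<partial>disc_measure) = (\<integral>z. complex_of_real ((cmod z)\<^sup>2 ^ k) \<partial>disc_measure)"
    by (simp add: power_mult_distrib[symmetric] complex_norm_square[symmetric])
  also have "\<dots> = of_real (1 / (real k + 1))"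
    unfolding disc_moment_radial[symmetric] by (rule integral_complex_of_real)
  finally show ?thesis using True by simp
qed (simp add: disc_moment_off_diagonal)

lemma integral_power_series:
  assumes abs: "summable (\<lambda>k. cmod (a k))" and f: "\<And>z. z \<in> disc \<Longrightarrow> (\<lambda>k. a k * z ^ k) sums f z"
  shows "(\<integral>z. f z * cnj z ^ n \<partial>disc_measure) = a n / (of_nat n + 1)"
proof -
  let ?g = "\<lambda>k z. a k * (z ^ k * cnj z ^ n)"
  have bd: "cmod (?g k z) \<le> cmod (a k)" if "z \<in> disc" for k z
  proof -
    have "cmod (z ^ k * cnj z ^ n) \<le> 1"
      using that disc_power_le_one[of z] by (auto simp: norm_mult norm_power intro!: mult_le_one)
    then show ?thesis
      using mult_left_mono[of _ 1 "cmod (a k)"] by (simp add: norm_mult)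
  qed
  have int: "integrable disc_measure (?g k)" for k
    using integrable_disc_monomials by simp
  have "(\<lambda>k. (\<integral>z. ?g k z \<partial>disc_measure)) sums (\<integral>z. suminf (\<lambda>k. ?g k z) \<partial>disc_measure)"
  proof (rule sums_integral[OF int])
    show "AE z in disc_measure. summable (\<lambda>k. cmod (?g k z))"
      by (intro AE_I2 summable_comparison_test'[OF abs, of 0]) (use bd in auto)
    have "(\<integral>z. cmod (?g k z) \<partial>disc_measure) \<le> cmod (a k)" for k
    proof -
      have "(\<integral>z. cmod (?g k z) \<partial>disc_measure) \<le> (\<integral>z. cmod (a k) \<partial>disc_measure)"
        by (intro integral_mono integrable_norm int) (use bd in auto)
      also have "\<dots> = cmod (a k)" by (simp add: measure_def emeasure_disc)
      finally show ?thesis .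
    qed
    then show "summable (\<lambda>k. \<integral>z. cmod (?g k z) \<partial>disc_measure)"
      by (intro summable_comparison_test'[OF abs, of 0]) (simp add: abs_of_nonneg)
  qed
  also have "(\<integral>z. suminf (\<lambda>k. ?g k z) \<partial>disc_measure) = (\<integral>z. f z * cnj z ^ n \<partial>disc_measure)"
  proof (intro Bochner_Integration.integral_cong HOL.refl)
    fix z assume "z \<in> space disc_measure"
    then have "(\<lambda>k. a k * z ^ k * cnj z ^ n) sums (f z * cnj z ^ n)"
      using f by (intro sums_mult2) auto
    then show "suminf (\<lambda>k. ?g k z) = f z * cnj z ^ n"
      by (simp add: sums_iff mult.assoc)
  qed
  also have "(\<lambda>k. (\<integral>z. ?g k z \<partial>disc_measure)) = (\<lambda>k. if k = n then a n / (of_nat n + 1) else 0)"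
    by (auto simp: disc_moment)
  finally have "(\<lambda>k. if k = n then a n / (of_nat n + 1) else 0) sums (\<integral>z. f z * cnj z ^ n \<partial>disc_measure)" .
  then show ?thesis
  proof (rule sums_unique2)
    have "(\<lambda>k. if k = n then a k / (of_nat k + 1) else 0) sums (a n / (of_nat n + 1))"
      by (rule sums_single)
    then show "(\<lambda>k. if k = n then a n / (of_nat n + 1) else 0) sums (a n / (of_nat n + 1))"
      by (simp cong: if_cong)
  qed
qed

text \<open>The area mean value property: the value of a holomorphic function at \<open>z0\<close> is its average over
  a disc around \<open>z0\<close>, that is, its pairing with a bounded function.\<close>

definition disc_bump :: "complex \<Rightarrow> complex \<Rightarrow> real" where
  "disc_bump z0 z = indicator (ball z0 ((1 - cmod z0) / 2)) z / ((1 - cmod z0) / 2)\<^sup>2"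

lemma disc_bump_measurable: 
  assumes "z0 \<in> disc"
  shows "disc_bump z0 \<in> borel_measurable disc_measure"
proof -
  have "ball z0 ((1 - cmod z0) / 2) \<subseteq> disc"
  proof
    fix z assume "z \<in> ball z0 ((1 - cmod z0) / 2)"
    then have "cmod (z0 - z) < (1 - cmod z0) / 2" by (simp add: dist_norm)
    moreover have "cmod z \<le> cmod z0 + cmod (z0 - z)" by norm
    ultimately show "z \<in> disc" using assms by simp
  qed
  then have [measurable]: "ball z0 ((1 - cmod z0) / 2) \<in> sets disc_measure"
    by (simp add: sets_disc_measure_iff)
  show ?thesis unfolding disc_bump_def by measurable
qed

lemma disc_bump_bound:
  "0 \<le> disc_bump z0 z" "disc_bump z0 z \<le> 1 / ((1 - cmod z0) / 2)\<^sup>2"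
  by (auto simp: disc_bump_def split: split_indicator)

text \<open>After an affine change of variables to the unit disc, only the constant Taylor coefficient has a
  non-zero integral.\<close>

lemma disc_mean_value:
  assumes hol: "f holomorphic_on disc" and z0: "z0 \<in> disc"
  shows "(\<integral>z. disc_bump z0 z *\<^sub>R f z \<partial>disc_measure) = f z0"
proof -
  define r where "r = (1 - cmod z0) / 2"
  have r: "0 < r" using z0 by (simp add: r_def)
  have sub2: "ball z0 (2 * r) \<subseteq> disc"
  proof
    fix z assume "z \<in> ball z0 (2 * r)"
    then have "cmod (z0 - z) < 1 - cmod z0" by (simp add: dist_norm r_def)
    moreover have "cmod z \<le> cmod z0 + cmod (z0 - z)" by norm
    ultimately show "z \<in> disc" by simp
  qed
  then have sub: "ball z0 r \<subseteq> disc" using subset_ball[of r "2 * r" z0] r by auto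
  define a where "a = (\<lambda>n. (deriv ^^ n) f z0 / fact n)"
  have ps: "(\<lambda>n. a n * (w - z0) ^ n) sums f w" if "w \<in> ball z0 (2 * r)" for w
    unfolding a_def using holomorphic_power_series[OF holomorphic_on_subset[OF hol sub2] that] .
  \<comment> \<open>convergence at radius \<open>3/2 * r < 2 * r\<close> makes the series absolutely convergent at radius \<open>r\<close>\<close>
  have "(\<lambda>n. a n * ((z0 + of_real (3/2 * r)) - z0) ^ n) sums f (z0 + of_real (3/2 * r))"
    by (rule ps) (use r in \<open>auto simp: dist_norm norm_mult\<close>)
  then have "summable (\<lambda>n. a n * (of_real (3/2 * r)) ^ n)" by (simp add: sums_iff)
  then have "summable (\<lambda>n. cmod (a n * of_real r ^ n))"
    by (rule powser_insidea) (use r in \<open>auto simp: norm_mult\<close>)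
  then have "(\<integral>z. f (z0 + of_real r * z) * cnj z ^ 0 \<partial>disc_measure) = (a 0 * of_real r ^ 0) / (of_nat 0 + 1)"
  proof (rule integral_power_series)
    fix z assume "z \<in> disc"
    then have "cmod (of_real r * z) < 2 * r" using r mult_strict_left_mono[of "cmod z" 2 r] by (simp add: norm_mult)
    then have "(\<lambda>n. a n * ((z0 + of_real r * z) - z0) ^ n) sums f (z0 + of_real r * z)"
      by (intro ps) (auto simp: dist_norm)
    then show "(\<lambda>k. a k * of_real r ^ k * z ^ k) sums f (z0 + of_real r * z)"
      by (simp add: power_mult_distrib mult.assoc)
  qed
  also have "\<dots> = f z0" by (simp add: a_def)
  also have "(\<integral>z. f (z0 + of_real r * z) * cnj z ^ 0 \<partial>disc_measure)
     = (\<integral>z. (indicator (ball z0 r) z / r\<^sup>2) *\<^sub>R f z \<partial>disc_measure)"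
    using integral_disc_affine[OF r sub measurable_disc_continuous[OF holomorphic_on_imp_continuous_on[OF hol]]]
    by simp
  finally show ?thesis unfolding disc_bump_def r_def .
qed

section \<open>Square-integrable functions\<close>

definition sqi :: "'a measure \<Rightarrow> ('a \<Rightarrow> complex) \<Rightarrow> bool" where
  "sqi M f \<longleftrightarrow> f \<in> borel_measurable M \<and> integrable M (\<lambda>x. (cmod (f x))\<^sup>2)"

definition ip :: "'a measure \<Rightarrow> ('a \<Rightarrow> complex) \<Rightarrow> ('a \<Rightarrow> complex) \<Rightarrow> complex" where
  "ip M f g = (\<integral>x. f x * cnj (g x) \<partial>M)"

definition nrm :: "'a measure \<Rightarrow> ('a \<Rightarrow> complex) \<Rightarrow> real" where
  "nrm M f = sqrt (\<integral>x. (cmod (f x))\<^sup>2 \<partial>M)"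

lemma measurable_cnj [measurable]:
  "f \<in> borel_measurable M \<Longrightarrow> (\<lambda>x. cnj (f x)) \<in> borel_measurable M"
  using measurable_compose[OF _ borel_measurable_continuous_onI[of cnj]] continuous_on_cnj[OF continuous_on_id]
  by auto

lemma sqi_measurable: "sqi M f \<Longrightarrow> f \<in> borel_measurable M"
  by (simp add: sqi_def)

lemma nrm_nonneg [simp]: "0 \<le> nrm M f"
  by (simp add: nrm_def)

lemma nrm_square: "(nrm M f)\<^sup>2 = (\<integral>x. (cmod (f x))\<^sup>2 \<partial>M)"
  by (simp add: nrm_def)

lemma sqi_mult_integrable:
  assumes "sqi M f" "sqi M g"
  shows "integrable M (\<lambda>x. f x * cnj (g x))"
proof (rule Bochner_Integration.integrable_bound)
  show "integrable M (\<lambda>x. (cmod (f x))\<^sup>2 + (cmod (g x))\<^sup>2)"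
    using assms by (simp add: sqi_def)
  have [measurable]: "f \<in> borel_measurable M" "g \<in> borel_measurable M"
    using assms by (auto simp: sqi_def)
  show "(\<lambda>x. f x * cnj (g x)) \<in> borel_measurable M" by measurable
  show "AE x in M. cmod (f x * cnj (g x)) \<le> norm ((cmod (f x))\<^sup>2 + (cmod (g x))\<^sup>2)"
  proof (rule AE_I2)
    fix x
    have "2 * (cmod (f x) * cmod (g x)) \<le> (cmod (f x))\<^sup>2 + (cmod (g x))\<^sup>2"
      using sum_squares_bound[of "cmod (f x)" "cmod (g x)"] by simp
    moreover have "0 \<le> cmod (f x) * cmod (g x)" by simp
    ultimately show "cmod (f x * cnj (g x)) \<le> norm ((cmod (f x))\<^sup>2 + (cmod (g x))\<^sup>2)"
      unfolding norm_mult complex_mod_cnj real_norm_def by linarith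
  qed
qed

lemma sqi_scale: "sqi M f \<Longrightarrow> sqi M (\<lambda>x. c * f x)"
  by (auto simp: sqi_def norm_mult power_mult_distrib)

lemma sqi_add:
  assumes "sqi M f" "sqi M g"
  shows "sqi M (\<lambda>x. f x + g x)"
proof -
  have [measurable]: "f \<in> borel_measurable M" "g \<in> borel_measurable M"
    using assms by (auto simp: sqi_def)
  have "integrable M (\<lambda>x. (cmod (f x + g x))\<^sup>2)"
  proof (rule Bochner_Integration.integrable_bound)
    show "integrable M (\<lambda>x. 2 * (cmod (f x))\<^sup>2 + 2 * (cmod (g x))\<^sup>2)"
      using assms by (simp add: sqi_def)
    show "AE x in M. norm ((cmod (f x + g x))\<^sup>2) \<le> norm (2 * (cmod (f x))\<^sup>2 + 2 * (cmod (g x))\<^sup>2)"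
    proof (rule AE_I2)
      fix x
      have "(cmod (f x + g x))\<^sup>2 \<le> (cmod (f x) + cmod (g x))\<^sup>2"
        by (intro power_mono norm_triangle_ineq) auto
      also have "\<dots> \<le> 2 * (cmod (f x))\<^sup>2 + 2 * (cmod (g x))\<^sup>2"
        using sum_squares_bound[of "cmod (f x)" "cmod (g x)"] by (simp add: power2_sum)
      finally show "norm ((cmod (f x + g x))\<^sup>2) \<le> norm (2 * (cmod (f x))\<^sup>2 + 2 * (cmod (g x))\<^sup>2)"
        by simp
    qed
  qed measurable
  then show ?thesis by (simp add: sqi_def)
qed

lemma sqi_diff: "sqi M f \<Longrightarrow> sqi M g \<Longrightarrow> sqi M (\<lambda>x. f x - g x)"
  using sqi_add[of M f "\<lambda>x. (-1) * g x"] sqi_scale[of M g "-1"] by simp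

lemma sqi_0: "sqi M (\<lambda>x. 0)"
  by (simp add: sqi_def)

lemma sqi_sum: "(\<And>i. i \<in> I \<Longrightarrow> sqi M (f i)) \<Longrightarrow> sqi M (\<lambda>x. \<Sum>i\<in>I. f i x)"
  by (induction I rule: infinite_finite_induct) (auto intro: sqi_add sqi_0)

lemma ip_add_left:
  "sqi M f \<Longrightarrow> sqi M g \<Longrightarrow> sqi M k \<Longrightarrow> ip M (\<lambda>x. f x + g x) k = ip M f k + ip M g k"
  by (simp add: ip_def sqi_mult_integrable ring_distribs)

lemma ip_scale_left: "ip M (\<lambda>x. c * f x) k = c * ip M f k"
  by (simp add: ip_def mult.assoc)

lemma ip_commute: "ip M g f = cnj (ip M f g)"
proof -
  have "cnj (ip M f g) = (\<integral>x. cnj (f x * cnj (g x)) \<partial>M)"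
    unfolding ip_def by (rule Bochner_Integration.integral_cnj[symmetric])
  then show ?thesis by (simp add: ip_def mult.commute)
qed

lemma ip_diff_left:
  "sqi M f \<Longrightarrow> sqi M g \<Longrightarrow> sqi M k \<Longrightarrow> ip M (\<lambda>x. f x - g x) k = ip M f k - ip M g k"
  by (simp add: ip_def sqi_mult_integrable left_diff_distrib)

lemma ip_add_right:
  "sqi M f \<Longrightarrow> sqi M g \<Longrightarrow> sqi M k \<Longrightarrow> ip M k (\<lambda>x. f x + g x) = ip M k f + ip M k g"
  by (simp add: ip_commute[of M k] ip_add_left)

lemma ip_diff_right:
  "sqi M f \<Longrightarrow> sqi M g \<Longrightarrow> sqi M k \<Longrightarrow> ip M k (\<lambda>x. f x - g x) = ip M k f - ip M k g"
  by (simp add: ip_commute[of M k] ip_diff_left)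

lemma ip_scale_right: "ip M k (\<lambda>x. c * f x) = cnj c * ip M k f"
  by (simp add: ip_commute[of M k] ip_scale_left)

lemma ip_sum_left:
  assumes "sqi M k" "\<And>i. i \<in> I \<Longrightarrow> sqi M (f i)"
  shows "ip M (\<lambda>x. \<Sum>i\<in>I. f i x) k = (\<Sum>i\<in>I. ip M (f i) k)"
  using assms by (induction I rule: infinite_finite_induct) (auto simp: ip_add_left sqi_sum, auto simp: ip_def)

lemma ip_self: "ip M f f = of_real ((nrm M f)\<^sup>2)"
  unfolding ip_def nrm_square complex_norm_square[symmetric]
  by (simp only: of_real_power[symmetric] integral_complex_of_real)

text \<open>The Cauchy-Schwarz inequality, from its version for nonnegative integrals.\<close>

lemma ip_bound:
  assumes f: "sqi M f" and g: "sqi M g"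
  shows "cmod (ip M f g) \<le> nrm M f * nrm M g"
proof -
  have [measurable]: "f \<in> borel_measurable M" "g \<in> borel_measurable M"
    using assms by (auto simp: sqi_def)
  have int: "integrable M (\<lambda>x. cmod (f x) * cmod (g x))"
    using integrable_norm[OF sqi_mult_integrable[OF f g]] by (simp add: norm_mult)
  define I where "I = (\<integral>x. cmod (f x) * cmod (g x) \<partial>M)"
  have I0: "0 \<le> I" unfolding I_def by simp
  have "cmod (ip M f g) \<le> (\<integral>x. cmod (f x * cnj (g x)) \<partial>M)"
    unfolding ip_def by (rule integral_norm_bound)
  also have "\<dots> = I" by (simp add: I_def norm_mult)
  finally have 1: "cmod (ip M f g) \<le> I" .
  have "ennreal (I\<^sup>2) = (ennreal I)\<^sup>2" using I0 by (simp add: ennreal_power)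
  also have "ennreal I = (\<integral>\<^sup>+x. ennreal (cmod (f x)) * ennreal (cmod (g x)) \<partial>M)"
    unfolding I_def using int by (subst nn_integral_eq_integral[symmetric]) (auto simp: ennreal_mult)
  also have "\<dots>\<^sup>2 \<le> (\<integral>\<^sup>+x. (ennreal (cmod (f x)))\<^sup>2 \<partial>M) * (\<integral>\<^sup>+x. (ennreal (cmod (g x)))\<^sup>2 \<partial>M)"
    by (rule Cauchy_Schwarz_nn_integral) measurable
  also have "\<dots> = ennreal ((nrm M f)\<^sup>2) * ennreal ((nrm M g)\<^sup>2)"
    using f g unfolding sqi_def nrm_square
    by (subst (1 2) nn_integral_eq_integral[symmetric]) (auto simp: ennreal_power)
  also have "\<dots> = ennreal ((nrm M f * nrm M g)\<^sup>2)"
    by (simp add: ennreal_mult power_mult_distrib)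
  finally have "I\<^sup>2 \<le> (nrm M f * nrm M g)\<^sup>2"
    by (subst (asm) ennreal_le_iff) auto
  then have "I \<le> nrm M f * nrm M g"
    by (rule power2_le_imp_le) simp
  with 1 show ?thesis by simp
qed

lemma nrm_diff_square:
  assumes "sqi M f" "sqi M g"
  shows "(nrm M (\<lambda>x. f x - g x))\<^sup>2 = (nrm M f)\<^sup>2 - 2 * Re (ip M f g) + (nrm M g)\<^sup>2"
proof -
  have "ip M (\<lambda>x. f x - g x) (\<lambda>x. f x - g x)
      = of_real ((nrm M f)\<^sup>2) - ip M f g - cnj (ip M f g) + of_real ((nrm M g)\<^sup>2)"
    using assms ip_commute[of M g f]
    by (simp add: ip_self[symmetric] ip_diff_left ip_diff_right sqi_diff del: of_real_power)
  then have "complex_of_real ((nrm M (\<lambda>x. f x - g x))\<^sup>2)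
      = complex_of_real ((nrm M f)\<^sup>2) - ip M f g - cnj (ip M f g) + of_real ((nrm M g)\<^sup>2)"
    by (simp only: ip_self)
  then have "Re (complex_of_real ((nrm M (\<lambda>x. f x - g x))\<^sup>2))
      = Re (of_real ((nrm M f)\<^sup>2) - ip M f g - cnj (ip M f g) + of_real ((nrm M g)\<^sup>2))"
    by (rule arg_cong)
  then show ?thesis by simp
qed

lemma (in finite_measure) sqi_bounded:
  assumes "f \<in> borel_measurable M" "\<And>x. x \<in> space M \<Longrightarrow> cmod (f x) \<le> C"
  shows "sqi M f"
  unfolding sqi_def
proof
  have "\<And>x. x \<in> space M \<Longrightarrow> (cmod (f x))\<^sup>2 \<le> C\<^sup>2"
    using assms(2) by (intro power_mono) auto
  then show "integrable M (\<lambda>x. (cmod (f x))\<^sup>2)"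
    using assms(1) by (intro integrable_const_bound[of _ "C\<^sup>2"]) (auto intro!: AE_I2)
qed fact

lemma (in finite_measure) nrm_le_bound:
  assumes "f \<in> borel_measurable M" "\<And>x. x \<in> space M \<Longrightarrow> cmod (f x) \<le> C" "0 \<le> C"
    and "measure M (space M) = 1"
  shows "nrm M f \<le> C"
proof -
  have "(\<integral>x. (cmod (f x))\<^sup>2 \<partial>M) \<le> (\<integral>x. C\<^sup>2 \<partial>M)"
    using sqi_bounded[OF assms(1,2)] assms(2)
    by (intro integral_mono) (auto simp: sqi_def intro!: power_mono)
  then have "(nrm M f)\<^sup>2 \<le> C\<^sup>2" using assms(4) by (simp add: nrm_square)
  then show ?thesis using assms(3) by (rule power2_le_imp_le)
qed

lemma (in finite_measure) sqi_integrable: 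
  assumes "sqi M f"
  shows "integrable M f"
  using sqi_mult_integrable[OF assms sqi_bounded[of "\<lambda>_. 1" 1]] by simp

text \<open>Point evaluations will be written as pairings with bounded kernels; Cauchy-Schwarz and total mass 1
  bound such a pairing by the supremum of the kernel.\<close>

lemma (in finite_measure) integral_bounded_functional:
  assumes f: "sqi M f" and K: "K \<in> borel_measurable M" "\<And>x. x \<in> space M \<Longrightarrow> cmod (K x) \<le> C" "0 \<le> C"
    and m: "measure M (space M) = 1"
  shows "integrable M (\<lambda>x. f x * K x)" "cmod (\<integral>x. f x * K x \<partial>M) \<le> C * nrm M f"
proof -
  have K': "(\<lambda>x. cnj (K x)) \<in> borel_measurable M" using K(1) by measurable
  have s: "sqi M (\<lambda>x. cnj (K x))" 
    by (rule sqi_bounded[OF K']) (use K(2) in auto)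
  show "integrable M (\<lambda>x. f x * K x)"
    using sqi_mult_integrable[OF f s] by simp
  have "cmod (ip M f (\<lambda>x. cnj (K x))) \<le> nrm M f * nrm M (\<lambda>x. cnj (K x))"
    by (rule ip_bound[OF f s])
  also have "\<dots> \<le> nrm M f * C"
    by (intro mult_left_mono nrm_le_bound[OF K']) (use K m in auto)
  finally show "cmod (\<integral>x. f x * K x \<partial>M) \<le> C * nrm M f"
    by (simp add: ip_def mult.commute)
qed

text \<open>This is how square-integrability passes from the partial sums of a power series to its sum.\<close>

lemma fatou_sqi:
  assumes g: "\<And>n. sqi M (g n)" and lim: "\<And>x. x \<in> space M \<Longrightarrow> (\<lambda>n. g n x) \<longlonglongrightarrow> f x"
    and bd: "\<And>n. nrm M (g n) \<le> C" and C: "0 \<le> C"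
  shows "sqi M f" "nrm M f \<le> C"
proof -
  have [measurable]: "g n \<in> borel_measurable M" for n using g by (simp add: sqi_def)
  have fm [measurable]: "f \<in> borel_measurable M"
    by (rule borel_measurable_LIMSEQ_metric[OF _ lim]) auto
  have "(\<integral>\<^sup>+x. ennreal ((cmod (f x))\<^sup>2) \<partial>M) = (\<integral>\<^sup>+x. liminf (\<lambda>n. ennreal ((cmod (g n x))\<^sup>2)) \<partial>M)"
  proof (rule nn_integral_cong)
    fix x assume "x \<in> space M"
    then have "(\<lambda>n. ennreal ((cmod (g n x))\<^sup>2)) \<longlonglongrightarrow> ennreal ((cmod (f x))\<^sup>2)"
      by (intro tendsto_intros lim)
    then show "ennreal ((cmod (f x))\<^sup>2) = liminf (\<lambda>n. ennreal ((cmod (g n x))\<^sup>2))"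
      by (intro lim_imp_Liminf[symmetric]) simp
  qed
  also have "\<dots> \<le> liminf (\<lambda>n. \<integral>\<^sup>+x. ennreal ((cmod (g n x))\<^sup>2) \<partial>M)"
    by (rule nn_integral_liminf) measurable
  also have "\<dots> \<le> liminf (\<lambda>n::nat. ennreal (C\<^sup>2))"
  proof (intro Liminf_mono always_eventually allI)
    fix n
    have "(\<integral>\<^sup>+x. ennreal ((cmod (g n x))\<^sup>2) \<partial>M) = ennreal ((nrm M (g n))\<^sup>2)"
      unfolding nrm_square using g[of n] by (intro nn_integral_eq_integral) (auto simp: sqi_def)
    also have "\<dots> \<le> ennreal (C\<^sup>2)"
      using bd[of n] by (intro ennreal_leI power_mono) auto
    finally show "(\<integral>\<^sup>+x. ennreal ((cmod (g n x))\<^sup>2) \<partial>M) \<le> ennreal (C\<^sup>2)" .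
  qed
  also have "\<dots> = ennreal (C\<^sup>2)" by (simp add: Liminf_const)
  finally have le: "(\<integral>\<^sup>+x. ennreal ((cmod (f x))\<^sup>2) \<partial>M) \<le> ennreal (C\<^sup>2)" .
  then have "(\<integral>\<^sup>+x. ennreal ((cmod (f x))\<^sup>2) \<partial>M) < \<infinity>"
    using ennreal_less_top le_less_trans by fastforce
  then show s: "sqi M f"
    unfolding sqi_def by (intro conjI fm integrableI_bounded) auto
  have "ennreal ((nrm M f)\<^sup>2) \<le> ennreal (C\<^sup>2)"
    using le s unfolding nrm_square sqi_def by (subst nn_integral_eq_integral[symmetric]) auto
  then have "(nrm M f)\<^sup>2 \<le> C\<^sup>2" by simp
  then show "nrm M f \<le> C" using C by (rule power2_le_imp_le)
qed

section \<open>The Bergman space of the disc\<close>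

lemma measure_disc [simp]: "measure disc_measure disc = 1"
  by (simp add: measure_def emeasure_disc)

lemma bergman_holomorphic: "a \<in> bergman \<Longrightarrow> a holomorphic_on disc"
  by (simp add: bergman_def)

lemma bergman_zero: "a \<in> bergman \<Longrightarrow> \<not> cmod z < 1 \<Longrightarrow> a z = 0"
  by (simp add: bergman_def)

lemma bergman_sqi: "a \<in> bergman \<Longrightarrow> sqi disc_measure a"
  unfolding sqi_def bergman_def
  by (auto intro!: measurable_disc_continuous holomorphic_on_imp_continuous_on)

lemma bergmanI: "a holomorphic_on disc \<Longrightarrow> sqi disc_measure a \<Longrightarrow> (\<And>z. z \<notin> disc \<Longrightarrow> a z = 0) \<Longrightarrow> a \<in> bergman"
  by (auto simp: bergman_def sqi_def)

lemma bergman_inner_ip: "bergman_inner a b = ip disc_measure a b"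
  by (simp add: bergman_inner_def ip_def)

lemma bergman_add: "a \<in> bergman \<Longrightarrow> b \<in> bergman \<Longrightarrow> (\<lambda>z. a z + b z) \<in> bergman"
  by (rule bergmanI) (simp_all add: bergman_holomorphic bergman_sqi bergman_zero holomorphic_on_add sqi_add)

lemma bergman_scale: "a \<in> bergman \<Longrightarrow> (\<lambda>z. c * a z) \<in> bergman"
  by (rule bergmanI) (simp_all add: bergman_holomorphic bergman_sqi bergman_zero holomorphic_on_mult sqi_scale)

lemma sqi_disc_poly: "sqi disc_measure (\<lambda>z. \<Sum>k\<le>N. c k * z ^ k)"
proof (rule disc.sqi_bounded)
  show "(\<lambda>z. \<Sum>k\<le>N. c k * z ^ k) \<in> borel_measurable disc_measure"
    by (intro measurable_disc_continuous continuous_intros)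
  fix z assume "z \<in> space disc_measure"
  then have "\<And>k. cmod z ^ k \<le> 1" using disc_power_le_one by auto
  then show "cmod (\<Sum>k\<le>N. c k * z ^ k) \<le> (\<Sum>k\<le>N. cmod (c k))"
    by (intro sum_norm_le) (auto simp: norm_mult norm_power intro: mult_left_le)
qed

lemma sqi_disc_power: "sqi disc_measure (\<lambda>z. z ^ k)"
proof (rule disc.sqi_bounded)
  show "(\<lambda>z. z ^ k) \<in> borel_measurable disc_measure"
    by (intro measurable_disc_continuous continuous_intros)
  show "\<And>z. z \<in> space disc_measure \<Longrightarrow> cmod (z ^ k) \<le> 1"
    using disc_power_le_one by (simp add: norm_power)
qed

definition taylor_coeff :: "(complex \<Rightarrow> complex) \<Rightarrow> nat \<Rightarrow> complex" where
  "taylor_coeff f n = (deriv ^^ n) f 0 / fact n"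

lemma taylor_coeff_sums: 
  assumes "f holomorphic_on disc" "z \<in> disc"
  shows "(\<lambda>n. taylor_coeff f n * z ^ n) sums f z"
  using holomorphic_power_series[OF assms] by (simp add: taylor_coeff_def)

text \<open>The coefficient formula holds for every square-integrable power series: on smaller discs the
  series converges uniformly, and the radius then tends to 1 by dominated convergence.\<close>

lemma ip_power:
  assumes a: "sqi disc_measure a" and c: "\<And>z. z \<in> disc \<Longrightarrow> (\<lambda>k. c k * z ^ k) sums a z"
  shows "ip disc_measure a (\<lambda>z. z ^ n) = c n / (of_nat n + 1)"
proof -
  \<comment> \<open>the radii are at least 1/2, so that the inverse powers of \<open>t m\<close> below are bounded\<close>
  define t :: "nat \<Rightarrow> real" where "t = (\<lambda>m. 1 - 1 / (real m + 2))"
  have t: "1/2 \<le> t m" "t m < 1" "0 < t m" for m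
    by (auto simp: t_def field_simps)
  have tl: "t \<longlonglongrightarrow> 1"
    unfolding t_def by real_asymp
  have am: "a \<in> borel_measurable disc_measure" using a by (rule sqi_measurable)
  have pm: "(\<lambda>z. cnj z ^ n) \<in> borel_measurable disc_measure" for n
    by (intro measurable_disc_continuous continuous_intros)
  let ?F = "\<lambda>m z. (indicator (ball 0 (t m)) z / (t m)\<^sup>2) *\<^sub>R (a z * cnj z ^ n / of_real (t m ^ n))"
  have eq: "(\<integral>z. ?F m z \<partial>disc_measure) = c n * of_real (t m ^ n) / (of_nat n + 1)" for m
  proof -
    have sub: "ball 0 (t m) \<subseteq> disc" using t[of m] by auto
    define u where "u = (1 + t m) / 2"
    have u: "0 < u" "u < 1" "t m < u" using t[of m] by (auto simp: u_def)
    have "(\<lambda>k. c k * of_real u ^ k) sums a (of_real u)"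
      by (rule c) (use u in auto)
    then have "summable (\<lambda>k. c k * of_real u ^ k)" by (simp add: sums_iff)
    then have "summable (\<lambda>k. cmod (c k * of_real (t m) ^ k))"
      by (rule powser_insidea) (use t[of m] u in auto)
    then have "(\<integral>z. a (of_real (t m) * z) * cnj z ^ n \<partial>disc_measure) = (c n * of_real (t m) ^ n) / (of_nat n + 1)"
    proof (rule integral_power_series)
      fix z assume "z \<in> disc"
      then have "of_real (t m) * z \<in> disc"
        using affine_into_disc[OF t(3) sub] by simp
      from c[OF this] show "(\<lambda>k. c k * of_real (t m) ^ k * z ^ k) sums a (of_real (t m) * z)"
        by (simp add: power_mult_distrib mult.assoc)
    qed
    also have "(\<integral>z. a (of_real (t m) * z) * cnj z ^ n \<partial>disc_measure)
        = (\<integral>z. (\<lambda>z. a z * cnj z ^ n / of_real (t m ^ n)) (0 + of_real (t m) * z) \<partial>disc_measure)"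
      using t[of m] by (simp add: power_mult_distrib)
    also have "\<dots> = (\<integral>z. ?F m z \<partial>disc_measure)"
      by (rule integral_disc_affine[OF t(3) sub]) (intro borel_measurable_times borel_measurable_divide am pm, simp)
    finally show ?thesis by simp
  qed
  have "(\<lambda>m. \<integral>z. ?F m z \<partial>disc_measure) \<longlonglongrightarrow> (\<integral>z. a z * cnj z ^ n \<partial>disc_measure)"
  proof (rule integral_dominated_convergence[where w = "\<lambda>z. 4 * 2 ^ n * cmod (a z)"])
    show "(\<lambda>z. a z * cnj z ^ n) \<in> borel_measurable disc_measure"
      by (intro borel_measurable_times am pm)
    fix m
    have [measurable]: "ball 0 (t m) \<in> sets disc_measure"
      using t[of m] by (auto simp: sets_disc_measure_iff)
    have "(\<lambda>z. indicat_real (ball 0 (t m)) z / (t m)\<^sup>2) \<in> borel_measurable disc_measure"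
      by measurable
    then show "(\<lambda>z. ?F m z) \<in> borel_measurable disc_measure"
      by (intro borel_measurable_scaleR borel_measurable_times borel_measurable_divide am pm) simp_all
    show "integrable disc_measure (\<lambda>z. 4 * 2 ^ n * cmod (a z))"
      using disc.sqi_integrable[OF a] by simp
    show "AE z in disc_measure. cmod (?F m z) \<le> 4 * 2 ^ n * cmod (a z)"
    proof (rule AE_I2)
      fix z assume "z \<in> space disc_measure"
      then have z1: "cmod z ^ n \<le> 1" using disc_power_le_one by auto
      have i1: "1 / t m \<le> 2" using t[of m] by (simp add: field_simps)
      have i2: "1 / (t m)\<^sup>2 \<le> 4"
        using power_mono[OF i1, of 2] t[of m] by (simp add: power_divide)
      have i3: "1 / t m ^ n \<le> 2 ^ n"
        using power_mono[OF i1, of n] t[of m] by (simp add: power_divide)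
      have "cmod (?F m z) = (indicator (ball 0 (t m)) z * (1 / (t m)\<^sup>2)) * (cmod (a z) * cmod z ^ n * (1 / t m ^ n))"
        using t[of m] by (simp add: norm_mult norm_divide norm_power)
      also have "\<dots> \<le> (1 * 4) * (cmod (a z) * 1 * 2 ^ n)"
        using t[of m] i2 i3 z1
        by (intro mult_mono) (auto split: split_indicator intro!: mult_nonneg_nonneg zero_le_power)
      finally show "cmod (?F m z) \<le> 4 * 2 ^ n * cmod (a z)" by (simp add: mult_ac)
    qed
    show "AE z in disc_measure. (\<lambda>m. ?F m z) \<longlonglongrightarrow> a z * cnj z ^ n"
    proof (rule AE_I2)
      fix z assume "z \<in> space disc_measure"
      then have "\<forall>\<^sub>F m in sequentially. cmod z < t m"
        using tl by (intro order_tendstoD) auto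
      then have ev: "\<forall>\<^sub>F m in sequentially. (1 / (t m)\<^sup>2) *\<^sub>R (a z * cnj z ^ n / of_real (t m ^ n)) = ?F m z"
        by eventually_elim (auto simp: )
      have "(\<lambda>m. (1 / (t m)\<^sup>2) *\<^sub>R (a z * cnj z ^ n / of_real (t m ^ n)))
          \<longlonglongrightarrow> (1 / 1\<^sup>2) *\<^sub>R (a z * cnj z ^ n / of_real (1 ^ n))"
        by (intro tendsto_intros tl) auto
      from Lim_transform_eventually[OF this ev] show "(\<lambda>m. ?F m z) \<longlonglongrightarrow> a z * cnj z ^ n"
        by simp
    qed
  qed
  moreover have "(\<lambda>m. \<integral>z. ?F m z \<partial>disc_measure) \<longlonglongrightarrow> c n * of_real (1 ^ n) / (of_nat n + 1)"
    unfolding eq by (intro tendsto_intros tl) (metis of_nat_Suc of_nat_neq_0 add.commute)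
  ultimately show ?thesis
    using LIMSEQ_unique by (fastforce simp: ip_def)
qed

lemma ip_poly:
  "ip disc_measure (\<lambda>z. \<Sum>k\<le>N. c k * z ^ k) f = (\<Sum>k\<le>N. c k * ip disc_measure (\<lambda>z. z ^ k) f)"
  if "sqi disc_measure f"
  by (subst ip_sum_left[OF that]) (auto intro: sqi_scale sqi_disc_power simp: ip_scale_left)

lemma nrm_poly: "(nrm disc_measure (\<lambda>z. \<Sum>k\<le>N. c k * z ^ k))\<^sup>2 = (\<Sum>k\<le>N. (cmod (c k))\<^sup>2 / (real k + 1))"
proof -
  let ?p = "\<lambda>z. \<Sum>k\<le>N. c k * z ^ k"
  have s: "(\<lambda>k. (if k \<le> N then c k else 0) * z ^ k) sums ?p z" for z
    using sums_finite[of "{..N}" "\<lambda>k. (if k \<le> N then c k else 0) * z ^ k"] by simp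
  have "ip disc_measure ?p ?p = (\<Sum>k\<le>N. c k * cnj (ip disc_measure ?p (\<lambda>z. z ^ k)))"
    unfolding ip_commute[of _ _ ?p, symmetric] by (rule ip_poly[OF sqi_disc_poly])
  also have "\<dots> = (\<Sum>k\<le>N. c k * cnj (c k / (of_nat k + 1)))"
    using ip_power[OF sqi_disc_poly s] by (intro sum.cong) auto
  also have "\<dots> = of_real (\<Sum>k\<le>N. (cmod (c k))\<^sup>2 / (real k + 1))"
    by (simp add: complex_norm_square del: of_real_power)
  finally show ?thesis unfolding ip_self of_real_eq_iff .
qed

text \<open>Taylor polynomials converge in the Bergman norm. By orthogonality the squared norm of the
  remainder is the difference of the squared norms, so it suffices that the latter converge to the full
  norm; they are bounded by it (Bessel), and Fatou's lemma gives the converse.\<close>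

lemma taylor_norm_convergence:
  assumes a: "sqi disc_measure a" and c: "\<And>z. z \<in> disc \<Longrightarrow> (\<lambda>k. c k * z ^ k) sums a z"
  shows "(\<lambda>N. nrm disc_measure (\<lambda>z. a z - (\<Sum>k\<le>N. c k * z ^ k))) \<longlonglongrightarrow> 0"
proof -
  let ?p = "\<lambda>N z. \<Sum>k\<le>N. c k * z ^ k"
  define s where "s = (\<lambda>N. (nrm disc_measure (?p N))\<^sup>2)"
  have s: "s N = (\<Sum>k\<le>N. (cmod (c k))\<^sup>2 / (real k + 1))" for N
    unfolding s_def by (rule nrm_poly)
  have ipa: "ip disc_measure a (?p N) = of_real (s N)" for N
  proof -
    have "ip disc_measure a (?p N) = cnj (\<Sum>k\<le>N. c k * ip disc_measure (\<lambda>z. z ^ k) a)"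
      unfolding ip_commute[of _ a] ip_poly[OF a] ..
    also have "\<dots> = (\<Sum>k\<le>N. cnj (c k) * (c k / (of_nat k + 1)))"
    proof -
      have "cnj (ip disc_measure (\<lambda>z. z ^ k) a) = c k / (of_nat k + 1)" for k
        unfolding ip_commute[of _ a, symmetric] by (rule ip_power[OF a c])
      then show ?thesis by simp
    qed
    also have "\<dots> = of_real (s N)"
      by (simp add: s complex_norm_square mult.commute del: of_real_power)
    finally show ?thesis .
  qed
  have diff: "(nrm disc_measure (\<lambda>z. a z - ?p N z))\<^sup>2 = (nrm disc_measure a)\<^sup>2 - s N" for N
    by (subst nrm_diff_square[OF a sqi_disc_poly]) (simp add: ipa s_def)
  have bessel: "s N \<le> (nrm disc_measure a)\<^sup>2" for N
    using diff[of N] by (metis diff_ge_0_iff_ge zero_le_power2)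
  have inc: "incseq s" unfolding s by (intro monoI sum_mono2) auto
  then obtain L where L: "s \<longlonglongrightarrow> L" "\<And>N. s N \<le> L"
    using incseq_convergent[OF inc, of "(nrm disc_measure a)\<^sup>2"] bessel by blast
  have L0: "0 \<le> L" using L(2)[of 0] by (simp add: s_def) (meson order_trans zero_le_power2)
  have "nrm disc_measure a \<le> sqrt L"
  proof (rule fatou_sqi(2)[OF sqi_disc_poly])
    show "\<And>z. z \<in> space disc_measure \<Longrightarrow> (\<lambda>N. ?p N z) \<longlonglongrightarrow> a z"
      using c by (simp add: sums_def_le)
    fix N
    show "nrm disc_measure (?p N) \<le> sqrt L"
      using L(2)[of N] unfolding s_def by (intro real_le_rsqrt)
  qed (use L0 in simp)
  then have "(nrm disc_measure a)\<^sup>2 \<le> L"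
    using L0 by (metis nrm_nonneg real_sqrt_le_iff real_sqrt_abs abs_of_nonneg)
  moreover have "L \<le> (nrm disc_measure a)\<^sup>2"
    by (rule LIMSEQ_le_const2[OF L(1)]) (use bessel in blast)
  ultimately have "L = (nrm disc_measure a)\<^sup>2" by simp
  then have "(\<lambda>N. (nrm disc_measure a)\<^sup>2 - s N) \<longlonglongrightarrow> (nrm disc_measure a)\<^sup>2 - (nrm disc_measure a)\<^sup>2"
    using L(1) by (intro tendsto_intros) auto
  then have "(\<lambda>N. sqrt ((nrm disc_measure (\<lambda>z. a z - ?p N z))\<^sup>2)) \<longlonglongrightarrow> sqrt 0"
    unfolding diff by (intro tendsto_intros) auto
  then show ?thesis by simp
qed

text \<open>Point values are pairings with bounded functions, hence are controlled by the norm.\<close>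

lemma bergman_eqI:
  assumes "a \<in> bergman" "b \<in> bergman" "nrm disc_measure (\<lambda>z. a z - b z) = 0"
  shows "a = b"
proof
  fix x
  show "a x = b x"
  proof (cases "x \<in> disc")
    case True
    have s: "sqi disc_measure (\<lambda>z. a z - b z)"
      by (intro sqi_diff bergman_sqi assms)
    have "(\<integral>z. disc_bump x z *\<^sub>R (a z - b z) \<partial>disc_measure) = a x - b x"
      using assms True by (intro disc_mean_value holomorphic_on_diff) (auto dest: bergman_holomorphic)
    moreover have "cmod (\<integral>z. (a z - b z) * of_real (disc_bump x z) \<partial>disc_measure)
         \<le> (1 / ((1 - cmod x) / 2)\<^sup>2) * nrm disc_measure (\<lambda>z. a z - b z)"
      using disc_bump_measurable[OF True] disc_bump_bound
      by (intro disc.integral_bounded_functional(2)[OF s]) auto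
    ultimately show ?thesis using assms(3) by (simp add: scaleR_conv_of_real mult.commute)
  qed (use assms in \<open>auto simp: bergman_def\<close>)
qed

section \<open>The adjoint attached to an affine map\<close>

lemma conj_affine_map: "conj_map (affine_map c r) = (\<lambda>z. of_real r * z + cnj c)"
  by (auto simp: conj_map_def affine_map_def)

lemma deriv_affine: "deriv (\<lambda>z. of_real r * z + c) z = of_real r"
  by (rule DERIV_imp_deriv) (auto intro!: derivative_eq_intros)

lemma deriv_affine_map: "deriv (affine_map c r) z = of_real r"
  unfolding affine_map_def by (rule deriv_affine)

lemma T_op_affine:
  "T_op (conj_map (affine_map c r)) f z = (if z \<in> disc then of_real r * f (cnj c + of_real r * z) else 0)"
  unfolding conj_affine_map T_op_def deriv_affine by (simp add: add.commute)

lemma ball_cnj_subset: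
  assumes "ball c r \<subseteq> disc"
  shows "ball (cnj c) r \<subseteq> disc"
proof
  fix z assume "z \<in> ball (cnj c) r"
  then have "cmod (cnj c - z) < r" by (simp add: dist_norm)
  then have "cmod (cnj (c - cnj z)) < r" by simp
  then have "cnj z \<in> ball c r" by (simp only: complex_mod_cnj) (simp add: dist_norm)
  with assms have "cnj z \<in> disc" by blast
  then show "z \<in> disc" by simp
qed

text \<open>Under the affine substitution the squared derivative cancels the Jacobian, so the norm only loses the
  part of \<open>f\<close> outside the image disc.\<close>

lemma T_op_contraction:
  assumes r: "0 < r" and sub: "ball c r \<subseteq> disc" and f: "sqi disc_measure f"
  shows "sqi disc_measure (T_op (conj_map (affine_map c r)) f)"
    "nrm disc_measure (T_op (conj_map (affine_map c r)) f) \<le> nrm disc_measure f"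
proof -
  let ?c = "cnj c" and ?g = "T_op (conj_map (affine_map c r)) f"
  note sub' = ball_cnj_subset[OF sub]
  have [measurable]: "f \<in> borel_measurable disc_measure" using f by (simp add: sqi_def)
  have "(\<lambda>z. of_real r * f (?c + of_real r * z)) \<in> borel_measurable disc_measure"
    using measurable_compose[OF measurable_affine_disc[OF r sub'], of f] by measurable
  then have gm [measurable]: "?g \<in> borel_measurable disc_measure"
    by (subst measurable_cong[where g = "\<lambda>z. of_real r * f (?c + of_real r * z)"]) (auto simp: T_op_affine)
  have "(\<integral>\<^sup>+z. ennreal ((cmod (?g z))\<^sup>2) \<partial>disc_measure)
      = (\<integral>\<^sup>+z. ennreal (r\<^sup>2) * ennreal ((cmod (f (?c + of_real r * z)))\<^sup>2) \<partial>disc_measure)"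
    by (intro nn_integral_cong)
       (simp add: T_op_affine norm_mult power_mult_distrib ennreal_mult)
  also have "\<dots> = ennreal (r\<^sup>2) * (\<integral>\<^sup>+z. ennreal ((cmod (f (?c + of_real r * z)))\<^sup>2) \<partial>disc_measure)"
    by (rule nn_integral_cmult)
       (use measurable_compose[OF measurable_affine_disc[OF r sub'], of "\<lambda>z. ennreal ((cmod (f z))\<^sup>2)"] in measurable)
  also have "(\<integral>\<^sup>+z. ennreal ((cmod (f (?c + of_real r * z)))\<^sup>2) \<partial>disc_measure)
      = (\<integral>\<^sup>+z. ennreal (indicator (ball ?c r) z / r\<^sup>2) * ennreal ((cmod (f z))\<^sup>2) \<partial>disc_measure)"
    by (rule nn_integral_disc_affine[OF r sub']) measurable
  also have "\<dots> \<le> (\<integral>\<^sup>+z. ennreal (1 / r\<^sup>2) * ennreal ((cmod (f z))\<^sup>2) \<partial>disc_measure)"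
    using r by (intro nn_integral_mono mult_right_mono ennreal_leI) (auto split: split_indicator)
  also have "\<dots> = ennreal (1 / r\<^sup>2) * (\<integral>\<^sup>+z. ennreal ((cmod (f z))\<^sup>2) \<partial>disc_measure)"
    by (rule nn_integral_cmult) measurable
  also have "(\<integral>\<^sup>+z. ennreal ((cmod (f z))\<^sup>2) \<partial>disc_measure) = ennreal ((nrm disc_measure f)\<^sup>2)"
    unfolding nrm_square using f by (intro nn_integral_eq_integral) (auto simp: sqi_def)
  also have "ennreal (r\<^sup>2) * (ennreal (1 / r\<^sup>2) * ennreal ((nrm disc_measure f)\<^sup>2)) = ennreal ((nrm disc_measure f)\<^sup>2)"
    using r by (simp add: mult.assoc[symmetric] ennreal_mult[symmetric])
  finally have le: "(\<integral>\<^sup>+z. ennreal ((cmod (?g z))\<^sup>2) \<partial>disc_measure) \<le> ennreal ((nrm disc_measure f)\<^sup>2)"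
    by (simp add: mult_left_mono)
  then have "(\<integral>\<^sup>+z. ennreal ((cmod (?g z))\<^sup>2) \<partial>disc_measure) < \<infinity>"
    using ennreal_less_top le_less_trans by fastforce
  then show s: "sqi disc_measure ?g"
    unfolding sqi_def by (intro conjI gm integrableI_bounded) auto
  have "ennreal ((nrm disc_measure ?g)\<^sup>2) \<le> ennreal ((nrm disc_measure f)\<^sup>2)"
    using le s unfolding nrm_square[of _ ?g] sqi_def by (subst nn_integral_eq_integral[symmetric]) auto
  then have "(nrm disc_measure ?g)\<^sup>2 \<le> (nrm disc_measure f)\<^sup>2" by simp
  then show "nrm disc_measure ?g \<le> nrm disc_measure f" by (rule power2_le_imp_le) simp
qed

text \<open>The adjoint is written down through its Taylor coefficients \<open>(k + 1) * rho_coeff c r a k\<close>, which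
  are forced by testing against monomials.\<close>

definition rho_coeff :: "complex \<Rightarrow> real \<Rightarrow> (complex \<Rightarrow> complex) \<Rightarrow> nat \<Rightarrow> complex" where
  "rho_coeff c r a k = (\<integral>z. a z * (of_real r * (of_real r * cnj z + c) ^ k) \<partial>disc_measure)"

definition rho_series :: "complex \<Rightarrow> real \<Rightarrow> (complex \<Rightarrow> complex) \<Rightarrow> complex \<Rightarrow> complex" where
  "rho_series c r a x = (if x \<in> disc then suminf (\<lambda>k. of_nat (Suc k) * rho_coeff c r a k * x ^ k) else 0)"

context
  fixes c :: complex and r :: real
  assumes r: "0 < r" and sub: "ball c r \<subseteq> disc"
begin

lemma affine_cnj_bound: "z \<in> disc \<Longrightarrow> cmod (of_real r * cnj z + c) < 1"
  using affine_into_disc[OF r sub, of "cnj z"] by (simp add: add.commute)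

lemma rho_kernel_bound: "z \<in> disc \<Longrightarrow> cmod (of_real r * (of_real r * cnj z + c) ^ k) \<le> r"
  using affine_cnj_bound[of z] r mult_left_mono[of "cmod (of_real r * cnj z + c) ^ k" 1 r]
  by (simp add: norm_mult norm_power power_le_one)

lemma rho_kernel_measurable: "(\<lambda>z. of_real r * (of_real r * cnj z + c) ^ k) \<in> borel_measurable disc_measure"
  by (intro measurable_disc_continuous continuous_intros)

lemma rho_coeff_bound:
  assumes "sqi disc_measure a"
  shows "cmod (rho_coeff c r a k) \<le> r * nrm disc_measure a"
  unfolding rho_coeff_def
  by (rule disc.integral_bounded_functional(2)[OF assms rho_kernel_measurable])
     (use rho_kernel_bound r in auto)

lemma ip_T_power:
  "ip disc_measure (T_op (conj_map (affine_map c r)) (\<lambda>z. z ^ k)) a = cnj (rho_coeff c r a k)"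
  unfolding ip_def rho_coeff_def Bochner_Integration.integral_cnj[symmetric]
  by (intro Bochner_Integration.integral_cong) (auto simp: T_op_affine algebra_simps)

lemma summable_Suc_power: "cmod x < 1 \<Longrightarrow> summable (\<lambda>k. real (Suc k) * cmod x ^ k)"
  using geometric_deriv_sums[of "cmod x"] by (simp add: sums_iff)

lemma rho_series_sums:
  assumes a: "sqi disc_measure a" and x: "x \<in> disc"
  shows "(\<lambda>k. of_nat (Suc k) * rho_coeff c r a k * x ^ k) sums rho_series c r a x"
proof -
  have "summable (\<lambda>k. (r * nrm disc_measure a) * (real (Suc k) * cmod x ^ k))"
    using x by (intro summable_mult summable_Suc_power) auto
  then have "summable (\<lambda>k. of_nat (Suc k) * rho_coeff c r a k * x ^ k)"
  proof (rule summable_comparison_test'[where N = 0])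
    fix k
    have "cmod (of_nat (Suc k) * rho_coeff c r a k * x ^ k) = cmod (rho_coeff c r a k) * (real (Suc k) * cmod x ^ k)"
      by (simp only: norm_mult norm_power norm_of_nat mult_ac)
    also have "\<dots> \<le> (r * nrm disc_measure a) * (real (Suc k) * cmod x ^ k)"
      by (intro mult_right_mono rho_coeff_bound a) auto
    finally show "cmod (of_nat (Suc k) * rho_coeff c r a k * x ^ k) \<le> (r * nrm disc_measure a) * (real (Suc k) * cmod x ^ k)" .
  qed
  then show ?thesis using x by (simp add: rho_series_def summable_sums)
qed

lemma rho_series_holomorphic: "sqi disc_measure a \<Longrightarrow> rho_series c r a holomorphic_on disc"
  using rho_series_sums
  by (intro power_series_holomorphic[where a = "\<lambda>k. of_nat (Suc k) * rho_coeff c r a k"]) auto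

text \<open>For the partial sums \<open>g\<close> of the series, \<open>nrm g ^ 2\<close> is the pairing of \<open>a\<close> with the image of \<open>g\<close>
  under a contraction, hence at most \<open>nrm a * nrm g\<close>.\<close>

lemma rho_series_sqi:
  assumes a: "sqi disc_measure a"
  shows "sqi disc_measure (rho_series c r a)"
proof (rule fatou_sqi(1)[OF sqi_disc_poly])
  let ?d = "\<lambda>k. of_nat (Suc k) * rho_coeff c r a k"
  let ?g = "\<lambda>N z. \<Sum>k\<le>N. ?d k * z ^ k"
  let ?T = "T_op (conj_map (affine_map c r))"
  show "(\<lambda>N. ?g N x) \<longlonglongrightarrow> rho_series c r a x" if "x \<in> space disc_measure" for x
    using rho_series_sums[OF a, of x] that by (simp add: sums_def_le)
  fix N
  have T: "?T (?g N) = (\<lambda>z. \<Sum>k\<le>N. ?d k * ?T (\<lambda>z. z ^ k) z)"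
    by (auto simp: T_op_affine sum_distrib_left mult_ac intro!: sum.cong)
  have "ip disc_measure (?T (?g N)) a = (\<Sum>k\<le>N. ?d k * cnj (rho_coeff c r a k))"
    unfolding T by (subst ip_sum_left[OF a])
      (auto simp: ip_scale_left ip_T_power intro!: sqi_scale T_op_contraction[OF r sub] sqi_disc_power)
  also have "\<dots> = of_real (\<Sum>k\<le>N. (cmod (?d k))\<^sup>2 / (real k + 1))"
  proof -
    have "?d k * cnj (rho_coeff c r a k) = of_real ((cmod (?d k))\<^sup>2 / (real k + 1))" for k
    proof -
      have "(cmod (?d k))\<^sup>2 / (real k + 1) = (real k + 1) * (cmod (rho_coeff c r a k))\<^sup>2"
        unfolding norm_mult norm_of_nat power_mult_distrib
        by (simp add: power2_eq_square add.commute[of 1])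
      then have "complex_of_real ((cmod (?d k))\<^sup>2 / (real k + 1))
          = of_real (real k + 1) * of_real ((cmod (rho_coeff c r a k))\<^sup>2)"
        by (simp only: of_real_mult)
      also have "\<dots> = ?d k * cnj (rho_coeff c r a k)"
        unfolding complex_norm_square by simp
      finally show ?thesis by (rule HOL.sym)
    qed
    then show ?thesis by simp
  qed
  finally have eq: "ip disc_measure (?T (?g N)) a = of_real ((nrm disc_measure (?g N))\<^sup>2)"
    by (simp only: nrm_poly)
  have "(nrm disc_measure (?g N))\<^sup>2 = cmod (ip disc_measure (?T (?g N)) a)"
    unfolding eq by (simp del: of_real_power)
  also have "\<dots> \<le> nrm disc_measure (?T (?g N)) * nrm disc_measure a"
    by (rule ip_bound[OF T_op_contraction(1)[OF r sub sqi_disc_poly] a])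
  also have "\<dots> \<le> nrm disc_measure (?g N) * nrm disc_measure a"
    by (intro mult_right_mono T_op_contraction[OF r sub] sqi_disc_poly) auto
  finally have "nrm disc_measure (?g N) * nrm disc_measure (?g N) \<le> nrm disc_measure (?g N) * nrm disc_measure a"
    by (simp add: power2_eq_square)
  then show "nrm disc_measure (?g N) \<le> nrm disc_measure a"
    by (cases "nrm disc_measure (?g N) = 0") (auto simp: mult_le_cancel_left order.strict_iff_order)
qed auto

lemma rho_series_bergman: "a \<in> bergman \<Longrightarrow> rho_series c r a \<in> bergman"
  by (rule bergmanI) (simp_all add: rho_series_holomorphic rho_series_sqi bergman_sqi, simp add: rho_series_def)

text \<open>On monomials \<open>f\<close> the identity is the choice of the coefficients; both sides are continuous in \<open>f\<close>,
  and Taylor polynomials are dense.\<close>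

lemma rho_series_adjoint:
  assumes a: "a \<in> bergman" and f: "f \<in> bergman"
  shows "ip disc_measure (T_op (conj_map (affine_map c r)) f) a = ip disc_measure f (rho_series c r a)"
proof -
  let ?T = "T_op (conj_map (affine_map c r))" and ?R = "rho_series c r a"
  let ?p = "\<lambda>N z. \<Sum>k\<le>N. taylor_coeff f k * z ^ k"
  note sq = bergman_sqi[OF a] bergman_sqi[OF f] rho_series_sqi[OF bergman_sqi[OF a]]
  have T: "?T (?p N) = (\<lambda>z. \<Sum>k\<le>N. taylor_coeff f k * ?T (\<lambda>z. z ^ k) z)" for N
    by (auto simp: T_op_affine sum_distrib_left mult_ac intro!: sum.cong)
  have "ip disc_measure (?T (?p N)) a = (\<Sum>k\<le>N. taylor_coeff f k * cnj (rho_coeff c r a k))" for N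
    unfolding T by (subst ip_sum_left[OF sq(1)])
      (auto simp: ip_scale_left ip_T_power intro!: sqi_scale T_op_contraction[OF r sub] sqi_disc_power)
  moreover have "ip disc_measure (?p N) ?R = (\<Sum>k\<le>N. taylor_coeff f k * cnj (rho_coeff c r a k))" for N
  proof -
    have "ip disc_measure ?R (\<lambda>z. z ^ k) = of_nat (Suc k) * rho_coeff c r a k / (of_nat k + 1)" for k
      by (rule ip_power[OF sq(3) rho_series_sums[OF sq(1)]])
    moreover have "of_nat (Suc k) * rho_coeff c r a k / (of_nat k + 1) = rho_coeff c r a k" for k
      by (simp del: of_nat_Suc add: of_nat_Suc[symmetric] add.commute[of _ 1])
    ultimately show ?thesis
      unfolding ip_poly[OF sq(3)] ip_commute[of _ "\<lambda>z. z ^ _" ?R] by simp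
  qed
  ultimately have poly: "ip disc_measure (?T (?p N)) a = ip disc_measure (?p N) ?R" for N by simp
  have bound: "cmod (ip disc_measure (?T f) a - ip disc_measure f ?R)
      \<le> nrm disc_measure (\<lambda>z. f z - ?p N z) * (nrm disc_measure a + nrm disc_measure ?R)" for N
  proof -
    have sd: "sqi disc_measure (\<lambda>z. f z - ?p N z)" by (intro sqi_diff sq sqi_disc_poly)
    have Td: "?T (\<lambda>z. f z - ?p N z) = (\<lambda>z. ?T f z - ?T (?p N) z)"
      by (auto simp: T_op_affine right_diff_distrib)
    have 1: "ip disc_measure (?T f) a - ip disc_measure (?T (?p N)) a = ip disc_measure (?T (\<lambda>z. f z - ?p N z)) a"
      unfolding Td by (subst ip_diff_left) (auto intro!: T_op_contraction[OF r sub] sq sqi_disc_poly)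
    have 2: "ip disc_measure f ?R - ip disc_measure (?p N) ?R = ip disc_measure (\<lambda>z. f z - ?p N z) ?R"
      by (subst ip_diff_left) (auto intro!: sq sqi_disc_poly)
    have "ip disc_measure (?T f) a - ip disc_measure f ?R
        = ip disc_measure (?T (\<lambda>z. f z - ?p N z)) a - ip disc_measure (\<lambda>z. f z - ?p N z) ?R"
      using poly[of N] by (simp add: 1[symmetric] 2[symmetric])
    then have "cmod (ip disc_measure (?T f) a - ip disc_measure f ?R) = cmod
        (ip disc_measure (?T (\<lambda>z. f z - ?p N z)) a - ip disc_measure (\<lambda>z. f z - ?p N z) ?R)"
      by (rule arg_cong)
    also have "\<dots> \<le> cmod (ip disc_measure (?T (\<lambda>z. f z - ?p N z)) a) + cmod (ip disc_measure (\<lambda>z. f z - ?p N z) ?R)"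
      by (rule norm_triangle_ineq4)
    also have "\<dots> \<le> nrm disc_measure (?T (\<lambda>z. f z - ?p N z)) * nrm disc_measure a
        + nrm disc_measure (\<lambda>z. f z - ?p N z) * nrm disc_measure ?R"
      by (rule add_mono[OF ip_bound[OF T_op_contraction(1)[OF r sub sd] sq(1)] ip_bound[OF sd sq(3)]])
    also have "\<dots> \<le> nrm disc_measure (\<lambda>z. f z - ?p N z) * nrm disc_measure a
        + nrm disc_measure (\<lambda>z. f z - ?p N z) * nrm disc_measure ?R"
      using mult_right_mono[OF T_op_contraction(2)[OF r sub sd], of "nrm disc_measure a"] by simp
    finally show ?thesis by (simp add: distrib_left)
  qed
  have "(\<lambda>N. nrm disc_measure (\<lambda>z. f z - ?p N z) * (nrm disc_measure a + nrm disc_measure ?R)) \<longlonglongrightarrow> 0 * (nrm disc_measure a + nrm disc_measure ?R)"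
    by (rule tendsto_mult[OF taylor_norm_convergence[OF sq(2) taylor_coeff_sums[OF bergman_holomorphic[OF f]]] tendsto_const])
  then have "cmod (ip disc_measure (?T f) a - ip disc_measure f ?R) \<le> 0 * (nrm disc_measure a + nrm disc_measure ?R)"
    by (rule LIMSEQ_le_const) (use bound in blast)
  then show ?thesis by simp
qed

text \<open>The adjoint is unique because the inner product is definite on holomorphic functions.\<close>

lemma rho_cl1_affine:
  assumes a: "a \<in> bergman"
  shows "rho_cl1 (affine_map c r) a = rho_series c r a"
  unfolding rho_cl1_def bergman_adjoint_def bergman_inner_ip
proof (rule the_equality)
  let ?T = "T_op (conj_map (affine_map c r))" and ?R = "rho_series c r a"
  show "?R \<in> bergman \<and> (\<forall>f\<in>bergman. ip disc_measure (?T f) a = ip disc_measure f ?R)"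
    using rho_series_bergman[OF a] rho_series_adjoint[OF a] by blast
  fix g assume g: "g \<in> bergman \<and> (\<forall>f\<in>bergman. ip disc_measure (?T f) a = ip disc_measure f g)"
  let ?d = "\<lambda>z. g z - ?R z"
  have d: "?d \<in> bergman"
    using bergman_add[of g "\<lambda>z. (-1) * ?R z"] bergman_scale[of ?R "-1"] g rho_series_bergman[OF a] by simp
  have "ip disc_measure ?d ?d = ip disc_measure ?d g - ip disc_measure ?d ?R"
    using g d rho_series_bergman[OF a] by (intro ip_diff_right bergman_sqi) auto
  also have "\<dots> = 0" using g d rho_series_adjoint[OF a d] by force
  finally have "nrm disc_measure ?d = 0" unfolding ip_self by simp
  then show "g = ?R" using g rho_series_bergman[OF a] by (intro bergman_eqI) auto
qed

text \<open>Summing the series under the integral: point evaluations of the adjoint are again pairings with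
  bounded functions.\<close>

lemma rho_series_integral:
  assumes a: "sqi disc_measure a" and x: "x \<in> disc"
  shows "rho_series c r a x = (\<integral>z. a z * (of_real r / (1 - x * (of_real r * cnj z + c))\<^sup>2) \<partial>disc_measure)"
proof -
  let ?f = "\<lambda>k z. a z * (of_nat (Suc k) * x ^ k * (of_real r * (of_real r * cnj z + c) ^ k))"
  have ai: "integrable disc_measure a" by (rule disc.sqi_integrable[OF a])
  have bd: "cmod (?f k z) \<le> cmod (a z) * (real (Suc k) * cmod x ^ k * r)" if "z \<in> disc" for k z
    unfolding norm_mult norm_power norm_of_nat
    using rho_kernel_bound[OF that, of k] by (intro mult_left_mono) (auto simp: norm_mult norm_power)
  have sm: "summable (\<lambda>k. C * (real (Suc k) * cmod x ^ k * r))" for C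
    using x by (intro summable_mult summable_mult2 summable_Suc_power) auto
  have int: "integrable disc_measure (?f k)" for k
  proof -
    have "integrable disc_measure (\<lambda>z. of_nat (Suc k) * x ^ k * (a z * (of_real r * (of_real r * cnj z + c) ^ k)))"
      by (intro integrable_mult_right
          disc.integral_bounded_functional(1)[OF a rho_kernel_measurable[of k], where C = r])
         (use rho_kernel_bound r in auto)
    then show ?thesis by (simp add: mult_ac)
  qed
  have "(\<lambda>k. \<integral>z. ?f k z \<partial>disc_measure) sums (\<integral>z. suminf (\<lambda>k. ?f k z) \<partial>disc_measure)"
  proof (rule sums_integral[OF int])
    show "AE z in disc_measure. summable (\<lambda>k. cmod (?f k z))"
      by (intro AE_I2 summable_comparison_test'[OF sm, where N = 0]) (use bd in auto)
    show "summable (\<lambda>k. \<integral>z. cmod (?f k z) \<partial>disc_measure)"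
    proof (rule summable_comparison_test'[OF sm[of "\<integral>z. cmod (a z) \<partial>disc_measure"], where N = 0])
      fix k
      have "(\<integral>z. cmod (?f k z) \<partial>disc_measure) \<le> (\<integral>z. cmod (a z) * (real (Suc k) * cmod x ^ k * r) \<partial>disc_measure)"
        using bd by (intro integral_mono integrable_norm int integrable_mult_left ai) auto
      then show "norm (\<integral>z. cmod (?f k z) \<partial>disc_measure) \<le> (\<integral>z. cmod (a z) \<partial>disc_measure) * (real (Suc k) * cmod x ^ k * r)"
        by simp
    qed
  qed
  also have "(\<lambda>k. \<integral>z. ?f k z \<partial>disc_measure) = (\<lambda>k. of_nat (Suc k) * rho_coeff c r a k * x ^ k)"
  proof
    fix k
    have "(\<integral>z. ?f k z \<partial>disc_measure)
        = (\<integral>z. (of_nat (Suc k) * x ^ k) * (a z * (of_real r * (of_real r * cnj z + c) ^ k)) \<partial>disc_measure)"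
      by (simp only: mult_ac)
    also have "\<dots> = (of_nat (Suc k) * x ^ k) * rho_coeff c r a k"
      unfolding rho_coeff_def by (rule integral_mult_right_zero)
    finally show "(\<integral>z. ?f k z \<partial>disc_measure) = of_nat (Suc k) * rho_coeff c r a k * x ^ k"
      by (simp only: mult_ac)
  qed
  also have "(\<integral>z. suminf (\<lambda>k. ?f k z) \<partial>disc_measure)
      = (\<integral>z. a z * (of_real r / (1 - x * (of_real r * cnj z + c))\<^sup>2) \<partial>disc_measure)"
  proof (intro Bochner_Integration.integral_cong HOL.refl)
    fix z assume "z \<in> space disc_measure"
    then have "cmod (of_real r * cnj z + c) < 1" using affine_cnj_bound by simp
    then have "cmod (x * (of_real r * cnj z + c)) < 1"
      using x mult_strict_mono[of "cmod x" 1 "cmod (of_real r * cnj z + c)" 1] by (simp add: norm_mult)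
    from geometric_deriv_sums[OF this]
    have "(\<lambda>k. (a z * of_real r) * (of_nat (Suc k) * (x * (of_real r * cnj z + c)) ^ k))
       sums ((a z * of_real r) * (1 / (1 - x * (of_real r * cnj z + c))\<^sup>2))"
      by (rule sums_mult)
    then have "(\<lambda>k. ?f k z) sums (a z * (of_real r / (1 - x * (of_real r * cnj z + c))\<^sup>2))"
      by (simp add: power_mult_distrib mult_ac del: of_nat_Suc)
    then show "suminf (\<lambda>k. ?f k z) = a z * (of_real r / (1 - x * (of_real r * cnj z + c))\<^sup>2)"
      by (simp add: sums_iff)
  qed
  finally show ?thesis
    using rho_series_sums[OF a x] sums_unique2 by blast
qed

lemma rho_point_kernel:
  assumes x: "x \<in> disc"
  shows "(\<lambda>z. of_real r / (1 - x * (of_real r * cnj z + c))\<^sup>2) \<in> borel_measurable disc_measure"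
    "z \<in> disc \<Longrightarrow> cmod (of_real r / (1 - x * (of_real r * cnj z + c))\<^sup>2) \<le> r / (1 - cmod x)\<^sup>2"
proof -
  have lower: "1 - cmod x \<le> cmod (1 - x * (of_real r * cnj z + c))" if "z \<in> disc" for z
  proof -
    have "cmod (x * (of_real r * cnj z + c)) \<le> cmod x"
      using affine_cnj_bound[OF that] by (simp add: norm_mult mult_left_le)
    moreover have "1 \<le> cmod (1 - x * (of_real r * cnj z + c)) + cmod (x * (of_real r * cnj z + c))"
      using norm_triangle_ineq[of "1 - x * (of_real r * cnj z + c)" "x * (of_real r * cnj z + c)"] by simp
    ultimately show ?thesis by simp
  qed
  have "1 - x * (of_real r * cnj z + c) \<noteq> 0" if "z \<in> disc" for z
    using lower[OF that] x by auto
  then show "(\<lambda>z. of_real r / (1 - x * (of_real r * cnj z + c))\<^sup>2) \<in> borel_measurable disc_measure"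
    by (intro measurable_disc_continuous continuous_intros) auto
  assume "z \<in> disc"
  then show "cmod (of_real r / (1 - x * (of_real r * cnj z + c))\<^sup>2) \<le> r / (1 - cmod x)\<^sup>2"
    using r x lower[of z] by (auto simp: norm_divide norm_power intro!: divide_left_mono power_mono mult_pos_pos zero_less_power)
qed

end

section \<open>Basis vectors and the contraction kernel\<close>

definition conj_moment :: "(complex \<Rightarrow> complex) \<Rightarrow> nat \<Rightarrow> complex" where
  "conj_moment a n = ip disc_measure a (\<lambda>z. z ^ n)"

lemma conj_moment_integral: "conj_moment a n = (\<integral>z. a z * cnj z ^ n \<partial>disc_measure)"
  by (simp add: conj_moment_def ip_def)

lemma conj_moment_kernel: "(\<lambda>z. cnj z ^ n) \<in> borel_measurable disc_measure" "z \<in> disc \<Longrightarrow> cmod (cnj z ^ n) \<le> 1"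
  by (intro measurable_disc_continuous continuous_intros)
     (use disc_power_le_one in \<open>simp add: norm_power\<close>)

lemma conj_moment_integrable: "sqi disc_measure a \<Longrightarrow> integrable disc_measure (\<lambda>z. a z * cnj z ^ n)"
  by (rule disc.integral_bounded_functional(1)[OF _ conj_moment_kernel(1), where C = 1]) (use conj_moment_kernel(2) in auto)

lemma conj_moment_add: "sqi disc_measure a \<Longrightarrow> sqi disc_measure b \<Longrightarrow> conj_moment (\<lambda>z. a z + b z) n = conj_moment a n + conj_moment b n"
  unfolding conj_moment_def by (rule ip_add_left[OF _ _ sqi_disc_power])

lemma conj_moment_scale: "conj_moment (\<lambda>z. c * a z) n = c * conj_moment a n"
  unfolding conj_moment_def by (rule ip_scale_left)

lemma bergman_h_sqi: "sqi disc_measure (bergman_h j)"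
proof -
  have "sqi disc_measure (\<lambda>z. of_nat (j + 1) * z ^ j)" by (rule sqi_scale[OF sqi_disc_power])
  moreover have "bergman_h j z = of_nat (j + 1) * z ^ j" if "z \<in> space disc_measure" for z
    using that by (simp add: bergman_h_def)
  ultimately show ?thesis
    unfolding sqi_def
    by (metis (no_types, lifting) measurable_cong Bochner_Integration.integrable_cong[OF HOL.refl])
qed

lemma bergman_h_bergman: "bergman_h j \<in> bergman"
proof (rule bergmanI[OF _ bergman_h_sqi])
  show "bergman_h j holomorphic_on disc"
    by (rule holomorphic_transform[of "\<lambda>z. of_nat (j + 1) * z ^ j"])
       (auto intro!: holomorphic_intros simp: bergman_h_def)
qed (auto simp: bergman_h_def)

lemma conj_moment_bergman_h: "conj_moment (bergman_h j) n = (if n = j then 1 else 0)"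
proof -
  have "conj_moment (bergman_h j) n = (\<integral>z. of_nat (j + 1) * (z ^ j * cnj z ^ n) \<partial>disc_measure)"
    unfolding conj_moment_integral by (intro Bochner_Integration.integral_cong) (auto simp: bergman_h_def)
  also have "\<dots> = of_nat (j + 1) * (if j = n then 1 / (of_nat n + 1) else 0)"
    by (simp only: integral_mult_right_zero disc_moment)
  also have "\<dots> = (if n = j then 1 else 0)"
    using of_nat_neq_0[of n, where 'a = complex] by (auto simp: add.commute)
  finally show ?thesis .
qed

lemma bergman_h_bound: "cmod (bergman_h j x) \<le> real (j + 1)"
proof (cases "x \<in> disc")
  case True
  then have "cmod x ^ j \<le> 1" by (rule disc_power_le_one)
  then show ?thesis using True mult_left_le[of "cmod x ^ j" "real (j + 1)"]
    by (simp add: bergman_h_def norm_mult norm_power del: of_nat_add of_nat_Suc)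
qed (auto simp: bergman_h_def)

text \<open>A one-particle vector is given by a list of coefficients and basis indices, so that linear
  combinations can be treated by induction on the list.\<close>

definition one_particle :: "(complex \<times> nat) list \<Rightarrow> complex \<Rightarrow> complex" where
  "one_particle al z = (\<Sum>(c, j)\<leftarrow>al. c * bergman_h j z)"

lemma one_particle_simps: "one_particle [] = (\<lambda>z. 0)" "one_particle ((c, j) # al) = (\<lambda>z. c * bergman_h j z + one_particle al z)"
  by (auto simp: one_particle_def)

lemma bergman_zero_fun: "(\<lambda>z. 0) \<in> bergman"
  by (rule bergmanI) (auto simp: sqi_0)

lemma one_particle_bergman: "one_particle al \<in> bergman"
proof (induction al)
  case (Cons x al)
  then show ?case
    by (cases x) (auto simp: one_particle_simps intro: bergman_add[OF bergman_scale[OF bergman_h_bergman]])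
qed (simp add: one_particle_simps bergman_zero_fun)

lemma rho_coeff_conj_moment:
  assumes "sqi disc_measure a"
  shows "rho_coeff c r a k = of_real r * (\<Sum>n\<le>k. of_nat (k choose n) * of_real r ^ n * c ^ (k - n) * conj_moment a n)"
proof -
  have "rho_coeff c r a k = (\<integral>z. (\<Sum>n\<le>k. (of_real r * of_nat (k choose n) * of_real r ^ n * c ^ (k - n)) * (a z * cnj z ^ n)) \<partial>disc_measure)"
    unfolding rho_coeff_def binomial_ring
    by (intro Bochner_Integration.integral_cong)
       (auto simp: sum_distrib_left power_mult_distrib mult_ac)
  also have "\<dots> = (\<Sum>n\<le>k. (of_real r * of_nat (k choose n) * of_real r ^ n * c ^ (k - n)) * conj_moment a n)"
    unfolding conj_moment_integral
    by (subst Bochner_Integration.integral_sum) (auto intro!: integrable_mult_right conj_moment_integrable assms)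
  finally show ?thesis by (simp add: sum_distrib_left mult_ac)
qed

lemma rho_coeff_bergman_h:
  "rho_coeff c r (bergman_h j) k = (if j \<le> k then of_nat (k choose j) * of_real r ^ (j + 1) * c ^ (k - j) else 0)"
proof -
  have "(\<Sum>n\<le>k. of_nat (k choose n) * of_real r ^ n * c ^ (k - n) * conj_moment (bergman_h j) n)
      = (\<Sum>n\<le>k. if n = j then of_nat (k choose n) * of_real r ^ n * c ^ (k - n) else 0)"
    by (intro sum.cong) (auto simp: conj_moment_bergman_h)
  then show ?thesis unfolding rho_coeff_conj_moment[OF bergman_h_sqi] by simp
qed

context
  fixes c :: complex and r :: real
  assumes r: "0 < r" and sub: "ball c r \<subseteq> disc"
begin

lemma rho_series_add:
  assumes "sqi disc_measure a" "sqi disc_measure b"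
  shows "rho_series c r (\<lambda>z. a z + b z) x = rho_series c r a x + rho_series c r b x"
proof (cases "x \<in> disc")
  case True
  define K where "K = (\<lambda>z. of_real r / (1 - x * (of_real r * cnj z + c))\<^sup>2)"
  note K = rho_point_kernel[OF r sub True, folded K_def]
  note I = rho_series_integral[OF r sub _ True]
  have I: "rho_series c r f x = (\<integral>z. f z * K z \<partial>disc_measure)" if "sqi disc_measure f" for f
    unfolding K_def by (rule I[OF that])
  have "integrable disc_measure (\<lambda>z. f z * K z)" if "sqi disc_measure f" for f
    by (rule disc.integral_bounded_functional(1)[OF that K(1), where C = "r / (1 - cmod x)\<^sup>2"])
       (use K(2) r in \<open>simp_all add: K_def\<close>)
  then show ?thesis
    using assms by (simp add: I sqi_add distrib_right)
qed (simp add: rho_series_def)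

lemma rho_series_scale:
  assumes "sqi disc_measure a"
  shows "rho_series c r (\<lambda>z. d * a z) x = d * rho_series c r a x"
proof (cases "x \<in> disc")
  case True
  define K where "K = (\<lambda>z. of_real r / (1 - x * (of_real r * cnj z + c))\<^sup>2)"
  have I: "rho_series c r f x = (\<integral>z. f z * K z \<partial>disc_measure)" if "sqi disc_measure f" for f
    unfolding K_def by (rule rho_series_integral[OF r sub that True])
  show ?thesis
    using assms by (simp add: I sqi_scale mult.assoc)
qed (simp add: rho_series_def)

lemma rho_series_one_particle: "rho_series c r (one_particle al) x = (\<Sum>(d, j)\<leftarrow>al. d * rho_series c r (bergman_h j) x)"
proof (induction al)
  case Nil
  show ?case using rho_series_scale[OF sqi_0, of 0] by (simp add: one_particle_simps)
next
  case (Cons y al)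
  obtain d j where y: "y = (d, j)" by (cases y)
  show ?case
    unfolding y one_particle_simps using Cons
    by (simp add: rho_series_add[OF sqi_scale[OF bergman_h_sqi] bergman_sqi[OF one_particle_bergman]]
        rho_series_scale[OF bergman_h_sqi])
qed

text \<open>The series in this form reappears as the creation part of the field, where \<open>h (- int (Suc (i + j)))\<close>
  stands in place of \<open>bergman_h (i + j)\<close>.\<close>

lemma rho_bergman_h_has_sum:
  assumes x: "x \<in> disc"
  shows "((\<lambda>i. of_nat (i + j choose i) * c ^ i * bergman_h (i + j) x)
    has_sum (rho_series c r (bergman_h j) x / of_real r ^ (j + 1))) UNIV"
proof -
  let ?q = "\<lambda>k. of_nat (Suc k) * rho_coeff c r (bergman_h j) k"
  note sums = rho_series_sums[OF r sub bergman_h_sqi]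
  define u where "u = (1 + cmod x) / 2"
  have u: "cmod x < u" "0 < u" "u < 1" using x norm_ge_zero[of x] unfolding u_def by (auto simp del: norm_ge_zero)
  then have "complex_of_real u \<in> disc" by simp
  from sums[OF this] have "summable (\<lambda>k. ?q k * of_real u ^ k)" by (simp add: sums_iff)
  then have "summable (\<lambda>k. cmod (?q k * x ^ k))"
    by (rule powser_insidea) (use u in auto)
  then have "((\<lambda>k. ?q k * x ^ k) has_sum rho_series c r (bergman_h j) x) UNIV"
    by (rule norm_summable_imp_has_sum[OF _ sums[OF x]])
  then have "((\<lambda>k. ?q k * x ^ k) has_sum rho_series c r (bergman_h j) x) {j..}"
    by (rule has_sum_cong_neutral[THEN iffD1, rotated -1]) (auto simp: rho_coeff_bergman_h)
  moreover have "bij_betw (\<lambda>i. i + j) UNIV {j..}"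
    by (rule bij_betwI[where g = "\<lambda>k. k - j"]) auto
  ultimately have "((\<lambda>i. ?q (i + j) * x ^ (i + j)) has_sum rho_series c r (bergman_h j) x) UNIV"
    by (subst has_sum_reindex_bij_betw[of "\<lambda>i. i + j" UNIV "{j..}"])
  then have "((\<lambda>i. ?q (i + j) * x ^ (i + j) / of_real r ^ (j + 1)) has_sum (rho_series c r (bergman_h j) x / of_real r ^ (j + 1))) UNIV"
    by (rule has_sum_divide_const)
  moreover have "?q (i + j) * x ^ (i + j) / of_real r ^ (j + 1) = of_nat (i + j choose i) * c ^ i * bergman_h (i + j) x" for i
  proof -
    have "(i + j choose j) = (i + j choose i)" by (simp add: binomial_symmetric[of j "i + j"])
    then show ?thesis
      using r x by (simp add: rho_coeff_bergman_h bergman_h_def del: of_nat_Suc)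
  qed
  ultimately show ?thesis by simp
qed

end

lemma rho_series_zero:
  assumes s: "0 < s" "s < 1"
  shows "rho_series 0 s (bergman_h j) x = of_real s ^ (j + 1) * bergman_h j x"
proof (cases "x \<in> disc")
  case True
  have sub: "ball 0 s \<subseteq> disc" using s by auto
  have "((\<lambda>i. of_nat (i + j choose i) * 0 ^ i * bergman_h (i + j) x) has_sum bergman_h j x) {0}"
    by (rule has_sum_finiteI) auto
  then have "((\<lambda>i. of_nat (i + j choose i) * 0 ^ i * bergman_h (i + j) x) has_sum bergman_h j x) UNIV"
    by (rule has_sum_cong_neutral[THEN iffD1, rotated -1]) auto
  with rho_bergman_h_has_sum[OF s(1) sub True, of j]
  have "rho_series 0 s (bergman_h j) x / of_real s ^ (j + 1) = bergman_h j x"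
    by (rule has_sum_unique)
  then show ?thesis using s by (simp add: field_simps)
qed (simp add: rho_series_def bergman_h_def)

text \<open>The Taylor coefficients of the kernel \<open>r * s / (\<zeta> + r * z - s * w)\<^sup>2\<close>.\<close>

definition G_coeff :: "complex \<Rightarrow> real \<Rightarrow> real \<Rightarrow> nat \<Rightarrow> nat \<Rightarrow> complex" where
  "G_coeff \<zeta> r s k l = of_real (r * s) * of_nat (k + l + 1) / \<zeta> ^ (k + l + 2)
     * (of_nat (k + l choose k) * (- of_real r) ^ k * of_real s ^ l)"

interpretation dd: pair_sigma_finite disc_measure disc_measure
  by standard

context
  fixes \<zeta> :: complex and r s :: real
  assumes rs: "0 < r" "0 < s" "r + s < cmod \<zeta>"
begin

text \<open>By the binomial theorem the block of total degree \<open>N\<close> is a constant times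
  \<open>(N + 1) * ((r + s) / cmod \<zeta>) ^ N\<close>; this is where the separation of the two discs enters.\<close>

lemma G_coeff_summable: "summable (\<lambda>N. \<Sum>k\<le>N. cmod (G_coeff \<zeta> r s k (N - k)))"
proof -
  have z: "0 < cmod \<zeta>" using rs by linarith
  have "(\<Sum>k\<le>N. cmod (G_coeff \<zeta> r s k (N - k))) = (r * s / (cmod \<zeta>)\<^sup>2) * (real (Suc N) * ((r + s) / cmod \<zeta>) ^ N)" for N
  proof -
    have "(\<Sum>k\<le>N. cmod (G_coeff \<zeta> r s k (N - k)))
        = (\<Sum>k\<le>N. (r * s * real (N + 1) / cmod \<zeta> ^ (N + 2)) * (real (N choose k) * r ^ k * s ^ (N - k)))"
      using rs by (intro sum.cong)
        (auto simp: G_coeff_def norm_mult norm_divide norm_power simp del: of_nat_add of_nat_Suc)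
    also have "\<dots> = (r * s * real (N + 1) / cmod \<zeta> ^ (N + 2)) * (r + s) ^ N"
      unfolding binomial_ring sum_distrib_left by simp
    also have "\<dots> = (r * s / (cmod \<zeta>)\<^sup>2) * (real (Suc N) * ((r + s) / cmod \<zeta>) ^ N)"
      by (simp add: power_add power_divide power2_eq_square)
    finally show ?thesis .
  qed
  moreover have "norm ((r + s) / cmod \<zeta>) < 1" using rs z by simp
  then have "summable (\<lambda>N. (r * s / (cmod \<zeta>)\<^sup>2) * (real (Suc N) * ((r + s) / cmod \<zeta>) ^ N))"
    using geometric_deriv_sums sums_summable by (intro summable_mult) blast
  ultimately show ?thesis by simp
qed

text \<open>The kernel is the derivative of a geometric series in \<open>u = (s * cnj w - r * cnj z) / \<zeta>\<close>.\<close>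

lemma G_kernel_expansion:
  assumes "z \<in> disc" "w \<in> disc"
  shows "(\<lambda>N. \<Sum>k\<le>N. G_coeff \<zeta> r s k (N - k) * (cnj z ^ k * cnj w ^ (N - k)))
     sums G_kernel (affine_map \<zeta> r) (affine_map 0 s) (cnj z) (cnj w)"
proof -
  have z0: "\<zeta> \<noteq> 0" using rs by auto
  define u where "u = (of_real s * cnj w - of_real r * cnj z) / \<zeta>"
  have "cmod (of_real s * cnj w - of_real r * cnj z) \<le> s * cmod w + r * cmod z"
    using norm_triangle_ineq4[of "of_real s * cnj w" "of_real r * cnj z"] rs by (simp add: norm_mult)
  also have "\<dots> \<le> s * 1 + r * 1" using assms rs by (intro add_mono mult_left_mono) auto
  also have "\<dots> < cmod \<zeta>" using rs by simp
  finally have u: "cmod u < 1" using z0 by (simp add: u_def norm_divide)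
  have "(\<lambda>N. (of_real (r * s) / \<zeta>\<^sup>2) * (of_nat (Suc N) * u ^ N)) sums ((of_real (r * s) / \<zeta>\<^sup>2) * (1 / (1 - u)\<^sup>2))"
    by (rule sums_mult[OF geometric_deriv_sums[OF u]])
  moreover have "(of_real (r * s) / \<zeta>\<^sup>2) * (1 / (1 - u)\<^sup>2) = G_kernel (affine_map \<zeta> r) (affine_map 0 s) (cnj z) (cnj w)"
  proof -
    have "\<zeta> * (1 - u) = of_real r * cnj z + \<zeta> - of_real s * cnj w"
      using z0 by (simp add: u_def field_simps)
    then have "\<zeta>\<^sup>2 * (1 - u)\<^sup>2 = (of_real r * cnj z + \<zeta> - of_real s * cnj w)\<^sup>2"
      by (metis power_mult_distrib)
    then show ?thesis
      by (simp add: G_kernel_def deriv_affine_map affine_map_def)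
  qed
  moreover have "(of_real (r * s) / \<zeta>\<^sup>2) * (of_nat (Suc N) * u ^ N)
      = (\<Sum>k\<le>N. G_coeff \<zeta> r s k (N - k) * (cnj z ^ k * cnj w ^ (N - k)))" for N
  proof -
    have "(of_real s * cnj w - of_real r * cnj z) ^ N = (- of_real r * cnj z + of_real s * cnj w) ^ N" by simp
    also have "\<dots> = (\<Sum>k\<le>N. of_nat (N choose k) * (- of_real r * cnj z) ^ k * (of_real s * cnj w) ^ (N - k))"
      by (rule binomial_ring)
    finally have "(of_real (r * s) / \<zeta>\<^sup>2) * (of_nat (Suc N) * u ^ N)
      = (\<Sum>k\<le>N. (of_real (r * s) / \<zeta>\<^sup>2) * (of_nat (Suc N) * ((of_nat (N choose k) * (- of_real r * cnj z) ^ k * (of_real s * cnj w) ^ (N - k)) / \<zeta> ^ N)))"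
      by (simp only: u_def power_divide sum_distrib_left sum_divide_distrib)
    also have "\<dots> = (\<Sum>k\<le>N. G_coeff \<zeta> r s k (N - k) * (cnj z ^ k * cnj w ^ (N - k)))"
    proof (rule sum.cong[OF HOL.refl])
      fix k assume "k \<in> {..N}"
      then have e: "k + (N - k) = N" by simp
      show "(of_real (r * s) / \<zeta>\<^sup>2) * (of_nat (Suc N) * ((of_nat (N choose k) * (- of_real r * cnj z) ^ k * (of_real s * cnj w) ^ (N - k)) / \<zeta> ^ N))
         = G_coeff \<zeta> r s k (N - k) * (cnj z ^ k * cnj w ^ (N - k))"
        unfolding G_coeff_def e power_mult_distrib power_add[of \<zeta> N 2]
        by (simp add: mult_ac del: of_nat_Suc)
    qed
    finally show ?thesis .
  qed
  ultimately show ?thesis by simp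
qed

lemma pair_product_integral:
  fixes f g :: "complex \<Rightarrow> complex"
  assumes f: "integrable disc_measure f" and g: "integrable disc_measure g"
  shows "integrable (disc_measure \<Otimes>\<^sub>M disc_measure) (\<lambda>p. f (fst p) * g (snd p))"
    "(\<integral>p. f (fst p) * g (snd p) \<partial>(disc_measure \<Otimes>\<^sub>M disc_measure)) = (\<integral>z. f z \<partial>disc_measure) * (\<integral>z. g z \<partial>disc_measure)"
proof -
  have [measurable]: "f \<in> borel_measurable disc_measure" "g \<in> borel_measurable disc_measure"
    using f g by auto
  show int: "integrable (disc_measure \<Otimes>\<^sub>M disc_measure) (\<lambda>p. f (fst p) * g (snd p))"
  proof (rule dd.Fubini_integrable)
    show "(\<lambda>p. f (fst p) * g (snd p)) \<in> borel_measurable (disc_measure \<Otimes>\<^sub>M disc_measure)" by measurable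
    show "integrable disc_measure (\<lambda>x. \<integral>y. norm (f (fst (x, y)) * g (snd (x, y))) \<partial>disc_measure)"
      using f by (simp add: norm_mult)
    show "AE x in disc_measure. integrable disc_measure (\<lambda>y. f (fst (x, y)) * g (snd (x, y)))"
      using g by simp
  qed
  show "(\<integral>p. f (fst p) * g (snd p) \<partial>(disc_measure \<Otimes>\<^sub>M disc_measure)) = (\<integral>z. f z \<partial>disc_measure) * (\<integral>z. g z \<partial>disc_measure)"
    using dd.integral_fst'[OF int] by simp
qed

lemma kernel_pairing_sums:
  assumes a: "sqi disc_measure a" and b: "sqi disc_measure b"
  shows "(\<lambda>N. \<Sum>k\<le>N. G_coeff \<zeta> r s k (N - k) * (conj_moment a k * conj_moment b (N - k)))
     sums kernel_pairing (G_kernel (affine_map \<zeta> r) (affine_map 0 s)) a b"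
proof -
  let ?P = "disc_measure \<Otimes>\<^sub>M disc_measure"
  let ?t = "\<lambda>N p. \<Sum>k\<le>N. G_coeff \<zeta> r s k (N - k) * ((a (fst p) * cnj (fst p) ^ k) * (b (snd p) * cnj (snd p) ^ (N - k)))"
  let ?c = "\<lambda>N. \<Sum>k\<le>N. cmod (G_coeff \<zeta> r s k (N - k))"
  have ab: "integrable ?P (\<lambda>p. a (fst p) * b (snd p))"
    by (rule pair_product_integral(1)[OF disc.sqi_integrable[OF a] disc.sqi_integrable[OF b]])
  have int: "integrable ?P (?t N)" for N
    by (intro Bochner_Integration.integrable_sum integrable_mult_right
        pair_product_integral(1)[OF conj_moment_integrable[OF a] conj_moment_integrable[OF b]])
  have bd: "cmod (?t N p) \<le> ?c N * cmod (a (fst p) * b (snd p))" if "p \<in> space ?P" for N p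
    unfolding sum_distrib_right
  proof (rule sum_norm_le)
    fix k
    have "fst p \<in> disc" "snd p \<in> disc" using that by (auto simp: space_pair_measure)
    then have "cmod (fst p) ^ k * cmod (snd p) ^ (N - k) \<le> 1"
      using disc_power_le_one by (intro mult_le_one) auto
    then have "cmod (G_coeff \<zeta> r s k (N - k)) * cmod (a (fst p) * b (snd p)) * (cmod (fst p) ^ k * cmod (snd p) ^ (N - k))
        \<le> cmod (G_coeff \<zeta> r s k (N - k)) * cmod (a (fst p) * b (snd p))"
      by (intro mult_left_le) auto
    then show "cmod (G_coeff \<zeta> r s k (N - k) * ((a (fst p) * cnj (fst p) ^ k) * (b (snd p) * cnj (snd p) ^ (N - k))))
        \<le> cmod (G_coeff \<zeta> r s k (N - k)) * cmod (a (fst p) * b (snd p))"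
      by (simp add: norm_mult norm_power mult_ac)
  qed
  have "(\<lambda>N. \<integral>p. ?t N p \<partial>?P) sums (\<integral>p. suminf (\<lambda>N. ?t N p) \<partial>?P)"
  proof (rule sums_integral[OF int])
    show "AE p in ?P. summable (\<lambda>N. cmod (?t N p))"
    proof (rule AE_I2)
      fix p assume "p \<in> space ?P"
      then show "summable (\<lambda>N. cmod (?t N p))"
        by (intro summable_comparison_test'[OF summable_mult2[OF G_coeff_summable, of "cmod (a (fst p) * b (snd p))"], where N = 0])
           (use bd in simp)
    qed
    show "summable (\<lambda>N. \<integral>p. cmod (?t N p) \<partial>?P)"
    proof (rule summable_comparison_test'[OF summable_mult2[OF G_coeff_summable, of "\<integral>p. cmod (a (fst p) * b (snd p)) \<partial>?P"], where N = 0])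
      fix N
      have "(\<integral>p. cmod (?t N p) \<partial>?P) \<le> (\<integral>p. ?c N * cmod (a (fst p) * b (snd p)) \<partial>?P)"
        by (intro integral_mono integrable_norm int integrable_mult_right ab) (use bd in auto)
      then show "norm (\<integral>p. cmod (?t N p) \<partial>?P) \<le> ?c N * (\<integral>p. cmod (a (fst p) * b (snd p)) \<partial>?P)"
        by simp
    qed
  qed
  moreover have "(\<integral>p. ?t N p \<partial>?P) = (\<Sum>k\<le>N. G_coeff \<zeta> r s k (N - k) * (conj_moment a k * conj_moment b (N - k)))" for N
    unfolding conj_moment_integral
    by (subst Bochner_Integration.integral_sum)
       (simp_all add: pair_product_integral[OF conj_moment_integrable[OF a] conj_moment_integrable[OF b]])
  moreover have "(\<integral>p. suminf (\<lambda>N. ?t N p) \<partial>?P) = kernel_pairing (G_kernel (affine_map \<zeta> r) (affine_map 0 s)) a b"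
    unfolding kernel_pairing_def
  proof (intro Bochner_Integration.integral_cong HOL.refl)
    fix p assume "p \<in> space ?P"
    then obtain z w where p: "p = (z, w)" "z \<in> disc" "w \<in> disc"
      by (cases p) (auto simp: space_pair_measure)
    have "(\<lambda>N. (\<Sum>k\<le>N. G_coeff \<zeta> r s k (N - k) * (cnj z ^ k * cnj w ^ (N - k))) * (a z * b w))
       sums (G_kernel (affine_map \<zeta> r) (affine_map 0 s) (cnj z) (cnj w) * (a z * b w))"
      by (rule sums_mult2[OF G_kernel_expansion[OF p(2,3)]])
    then have "(\<lambda>N. ?t N p) sums (G_kernel (affine_map \<zeta> r) (affine_map 0 s) (cnj z) (cnj w) * (a z * b w))"
      by (simp only: p(1) fst_conv snd_conv sum_distrib_left sum_distrib_right mult_ac)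
    then show "suminf (\<lambda>N. ?t N p) = (case p of (z, w) \<Rightarrow> G_kernel (affine_map \<zeta> r) (affine_map 0 s) (cnj z) (cnj w) * (a z * b w))"
      by (simp add: p(1) sums_iff)
  qed
  ultimately show ?thesis by simp
qed

lemma kernel_pairing_add_left:
  assumes "sqi disc_measure a" "sqi disc_measure a'" "sqi disc_measure b"
  shows "kernel_pairing (G_kernel (affine_map \<zeta> r) (affine_map 0 s)) (\<lambda>z. a z + a' z) b
    = kernel_pairing (G_kernel (affine_map \<zeta> r) (affine_map 0 s)) a b + kernel_pairing (G_kernel (affine_map \<zeta> r) (affine_map 0 s)) a' b"
  by (rule sums_unique2[OF kernel_pairing_sums[OF sqi_add[OF assms(1,2)] assms(3)]])
     (use sums_add[OF kernel_pairing_sums[OF assms(1,3)] kernel_pairing_sums[OF assms(2,3)]] in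
       \<open>simp add: conj_moment_add assms sum.distrib[symmetric] algebra_simps\<close>)

lemma kernel_pairing_add_right:
  assumes "sqi disc_measure a" "sqi disc_measure b" "sqi disc_measure b'"
  shows "kernel_pairing (G_kernel (affine_map \<zeta> r) (affine_map 0 s)) a (\<lambda>z. b z + b' z)
    = kernel_pairing (G_kernel (affine_map \<zeta> r) (affine_map 0 s)) a b + kernel_pairing (G_kernel (affine_map \<zeta> r) (affine_map 0 s)) a b'"
  by (rule sums_unique2[OF kernel_pairing_sums[OF assms(1) sqi_add[OF assms(2,3)]]])
     (use sums_add[OF kernel_pairing_sums[OF assms(1,2)] kernel_pairing_sums[OF assms(1,3)]] in
       \<open>simp add: conj_moment_add assms sum.distrib[symmetric] algebra_simps\<close>)

lemma kernel_pairing_scale: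
  "kernel_pairing K (\<lambda>z. c * a z) b = c * kernel_pairing K a b"
  "kernel_pairing K a (\<lambda>z. c * b z) = c * kernel_pairing K a b"
proof -
  have "(\<lambda>(z, w). K (cnj z) (cnj w) * (c * a z * b w)) = (\<lambda>p. c * (case p of (z, w) \<Rightarrow> K (cnj z) (cnj w) * (a z * b w)))"
    "(\<lambda>(z, w). K (cnj z) (cnj w) * (a z * (c * b w))) = (\<lambda>p. c * (case p of (z, w) \<Rightarrow> K (cnj z) (cnj w) * (a z * b w)))"
    by (auto simp: fun_eq_iff)
  then show "kernel_pairing K (\<lambda>z. c * a z) b = c * kernel_pairing K a b"
    "kernel_pairing K a (\<lambda>z. c * b z) = c * kernel_pairing K a b"
    unfolding kernel_pairing_def by simp_all
qed

lemma kernel_pairing_bergman_h: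
  "kernel_pairing (G_kernel (affine_map \<zeta> r) (affine_map 0 s)) (bergman_h i) (bergman_h j) = G_coeff \<zeta> r s i j"
proof (rule sums_unique2[OF kernel_pairing_sums[OF bergman_h_sqi bergman_h_sqi]])
  have "(\<Sum>k\<le>N. G_coeff \<zeta> r s k (N - k) * (conj_moment (bergman_h i) k * conj_moment (bergman_h j) (N - k)))
      = (if N = i + j then G_coeff \<zeta> r s i j else 0)" for N
  proof -
    have "(\<Sum>k\<le>N. G_coeff \<zeta> r s k (N - k) * (conj_moment (bergman_h i) k * conj_moment (bergman_h j) (N - k)))
       = (\<Sum>k\<le>N. if k = i then (if N = i + j then G_coeff \<zeta> r s i j else 0) else 0)"
      by (intro sum.cong) (auto simp: conj_moment_bergman_h)
    then show ?thesis by auto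
  qed
  then show "(\<lambda>N. \<Sum>k\<le>N. G_coeff \<zeta> r s k (N - k) * (conj_moment (bergman_h i) k * conj_moment (bergman_h j) (N - k))) sums G_coeff \<zeta> r s i j"
    using sums_single[of "i + j" "\<lambda>_. G_coeff \<zeta> r s i j"] by (simp cong: if_cong)
qed

lemma kernel_pairing_one_particle:
  "kernel_pairing (G_kernel (affine_map \<zeta> r) (affine_map 0 s)) (one_particle al) (one_particle be)
    = (\<Sum>(c, i)\<leftarrow>al. \<Sum>(d, j)\<leftarrow>be. c * d * G_coeff \<zeta> r s i j)"
proof -
  let ?K = "G_kernel (affine_map \<zeta> r) (affine_map 0 s)"
  have right: "kernel_pairing ?K (bergman_h i) (one_particle be) = (\<Sum>(d, j)\<leftarrow>be. d * G_coeff \<zeta> r s i j)" for i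
  proof (induction be)
    case Nil
    show ?case using kernel_pairing_scale(2)[of ?K _ 0] by (simp add: one_particle_simps)
  next
    case (Cons y be)
    obtain d j where y: "y = (d, j)" by (cases y)
    show ?case
      unfolding y one_particle_simps using Cons
      by (simp add: kernel_pairing_add_right[OF bergman_h_sqi sqi_scale[OF bergman_h_sqi] bergman_sqi[OF one_particle_bergman]]
          kernel_pairing_scale kernel_pairing_bergman_h)
  qed
  show ?thesis
  proof (induction al)
    case Nil
    show ?case using kernel_pairing_scale(1)[of ?K 0] by (simp add: one_particle_simps)
  next
    case (Cons y al)
    obtain c i where y: "y = (c, i)" by (cases y)
    show ?case
      unfolding y one_particle_simps using Cons
      by (simp add: kernel_pairing_add_left[OF sqi_scale[OF bergman_h_sqi] bergman_sqi[OF one_particle_bergman] bergman_sqi[OF one_particle_bergman]]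
          kernel_pairing_scale right sum_list_const_mult[symmetric] case_prod_unfold mult.assoc)
  qed
qed

end

section \<open>Bergman spaces of polydiscs\<close>

interpretation discs: product_sigma_finite "\<lambda>_::nat. disc_measure"
  by standard

lemma space_polydisc_measure [simp]: "space (polydisc_measure p) = polydisc p"
  by (simp add: polydisc_measure_def polydisc_def space_PiM)

lemma polydisc_coordinate: "x \<in> polydisc p \<Longrightarrow> i < p \<Longrightarrow> x i \<in> disc"
  by (auto simp: polydisc_def PiE_iff)

lemma emeasure_polydisc: "emeasure (polydisc_measure p) (polydisc p) = 1"
proof -
  interpret finite_product_sigma_finite "\<lambda>_::nat. disc_measure" "{..<p}"
    by standard auto
  have "emeasure (PiM {..<p} (\<lambda>_. disc_measure)) (PiE {..<p} (\<lambda>_. disc)) = (\<Prod>i<p. emeasure disc_measure disc)"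
    by (rule measure_times) (simp add: sets_disc_measure_iff)
  then show ?thesis by (simp add: polydisc_measure_def polydisc_def emeasure_disc)
qed

interpretation polyd: finite_measure "polydisc_measure p" for p
  by standard (simp add: emeasure_polydisc)

lemma measure_polydisc [simp]: "measure (polydisc_measure p) (polydisc p) = 1"
  by (simp add: measure_def emeasure_polydisc)

lemma measurable_polydisc_coordinate:
  assumes "f \<in> borel_measurable disc_measure" "i < p"
  shows "(\<lambda>x. f (x i)) \<in> borel_measurable (polydisc_measure p)"
  unfolding polydisc_measure_def
  by (rule measurable_compose[OF measurable_component_singleton[of i "{..<p}" "\<lambda>_. disc_measure"] assms(1)])
     (use assms(2) in auto)

lemma continuous_on_coordinate: "continuous_on S (\<lambda>x::nat \<Rightarrow> complex. x i)"
  by (rule continuous_on_subset[OF continuous_on_product_coordinates]) auto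

text \<open>Continuous functions on the polydisc are measurable: the product Borel structure is the Borel
  structure of the full function space, in which the polydisc is a Borel set.\<close>

lemma polydisc_borel: "polydisc p \<in> sets (borel :: (nat \<Rightarrow> complex) measure)"
proof -
  have eq: "polydisc p = (\<Inter>i. {x. (i < p \<longrightarrow> x i \<in> disc) \<and> (\<not> i < p \<longrightarrow> x i = undefined)})"
  proof (rule set_eqI)
    fix x :: "nat \<Rightarrow> complex"
    have "x \<in> polydisc p \<longleftrightarrow> (\<forall>i<p. x i \<in> disc) \<and> (\<forall>i. \<not> i < p \<longrightarrow> x i = undefined)"
      unfolding polydisc_def PiE_iff extensional_def by (simp only: mem_Collect_eq Ball_def lessThan_iff)
    then show "x \<in> polydisc p \<longleftrightarrow> x \<in> (\<Inter>i. {x. (i < p \<longrightarrow> x i \<in> disc) \<and> (\<not> i < p \<longrightarrow> x i = undefined)})"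
      unfolding INT_iff mem_Collect_eq by blast
  qed
  have c: "(\<lambda>x::nat \<Rightarrow> complex. x i) \<in> borel_measurable borel" for i
    by (rule borel_measurable_continuous_onI[OF continuous_on_coordinate])
  have "{x. (i < p \<longrightarrow> x i \<in> disc) \<and> (\<not> i < p \<longrightarrow> x i = undefined)} \<in> sets (borel :: (nat \<Rightarrow> complex) measure)" for i
  proof (cases "i < p")
    case True
    have "(\<lambda>x::nat \<Rightarrow> complex. x i) -` disc \<inter> space borel \<in> sets borel"
      by (rule measurable_sets[OF c]) simp
    moreover have "{x. (i < p \<longrightarrow> x i \<in> disc) \<and> (\<not> i < p \<longrightarrow> x i = undefined)} = (\<lambda>x. x i) -` disc \<inter> space borel"
      using True by auto
    ultimately show ?thesis by simp
  next
    case False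
    have "(\<lambda>x::nat \<Rightarrow> complex. x i) -` {undefined} \<inter> space borel \<in> sets borel"
      by (rule measurable_sets[OF c]) simp
    moreover have "{x. (i < p \<longrightarrow> x i \<in> disc) \<and> (\<not> i < p \<longrightarrow> x i = undefined)} = (\<lambda>x. x i) -` {undefined} \<inter> space borel"
      using False by auto
    ultimately show ?thesis by simp
  qed
  then show ?thesis unfolding eq by (intro sets.countable_INT'') auto
qed

lemma measurable_polydisc_continuous:
  fixes f :: polyfun
  assumes "continuous_on (polydisc p) f"
  shows "f \<in> borel_measurable (polydisc_measure p)"
proof -
  have 1: "(\<lambda>x. indicator (polydisc p) x *\<^sub>R f x) \<in> borel_measurable borel"
    by (rule borel_measurable_continuous_on_indicator[OF polydisc_borel assms])
  have "(\<lambda>x. x) \<in> measurable (polydisc_measure p) (PiM UNIV (\<lambda>_. borel))"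
  proof (rule measurable_PiM_single')
    fix i :: nat
    show "(\<lambda>x. x i) \<in> borel_measurable (polydisc_measure p)"
    proof (cases "i < p")
      case True
      show ?thesis
        using measurable_polydisc_coordinate[OF measurable_disc_continuous[OF continuous_on_id] True] .
    next
      case False
      then have "x i = undefined" if "x \<in> space (polydisc_measure p)" for x
        using that by (auto simp: polydisc_def PiE_iff extensional_def)
      then show ?thesis
        by (subst measurable_cong[where g = "\<lambda>_. undefined"]) simp_all
    qed
  qed auto
  then have 2: "(\<lambda>x. x) \<in> measurable (polydisc_measure p) borel"
    by (subst measurable_cong_sets[OF HOL.refl sets_PiM_equal_borel[symmetric]])
  have "(\<lambda>x. indicator (polydisc p) x *\<^sub>R f x) \<in> borel_measurable (polydisc_measure p)"
    using measurable_compose[OF 2 1] .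
  then show ?thesis
    by (subst measurable_cong[where g = "\<lambda>x. indicator (polydisc p) x *\<^sub>R f x"]) auto
qed

lemma A2_sqi: "f \<in> A2 p \<Longrightarrow> sqi (polydisc_measure p) f"
  by (simp add: A2_def sqi_def polydisc_holomorphic_def measurable_polydisc_continuous)

lemma A2I:
  "polydisc_holomorphic p f \<Longrightarrow> sqi (polydisc_measure p) f \<Longrightarrow> (\<And>x. x \<notin> polydisc p \<Longrightarrow> f x = 0) \<Longrightarrow> f \<in> A2 p"
  by (simp add: A2_def sqi_def)

lemma A2_holomorphic: "f \<in> A2 p \<Longrightarrow> polydisc_holomorphic p f"
  by (simp add: A2_def)

lemma A2_zero_outside: "f \<in> A2 p \<Longrightarrow> x \<notin> polydisc p \<Longrightarrow> f x = 0"
  by (simp add: A2_def)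

lemma A2_norm_nrm: "A2_norm p f = nrm (polydisc_measure p) f"
  by (simp add: A2_norm_def nrm_def)

lemma A2_add:
  assumes "f \<in> A2 p" "g \<in> A2 p"
  shows "(\<lambda>x. f x + g x) \<in> A2 p"
proof (rule A2I)
  show "polydisc_holomorphic p (\<lambda>x. f x + g x)"
    using assms[THEN A2_holomorphic] unfolding polydisc_holomorphic_def
    by (auto intro!: continuous_on_add holomorphic_on_add)
qed (use assms in \<open>simp_all add: sqi_add A2_sqi A2_zero_outside\<close>)

lemma A2_scale:
  assumes "f \<in> A2 p"
  shows "(\<lambda>x. c * f x) \<in> A2 p"
proof (rule A2I)
  show "polydisc_holomorphic p (\<lambda>x. c * f x)"
    using assms[THEN A2_holomorphic] unfolding polydisc_holomorphic_def
    by (auto intro!: continuous_on_mult_left holomorphic_on_mult)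
qed (use assms in \<open>simp_all add: sqi_scale A2_sqi A2_zero_outside\<close>)

lemma A2_zero: "(\<lambda>x. 0) \<in> A2 p"
  by (rule A2I) (auto simp: polydisc_holomorphic_def sqi_0)

lemma A2_diff: "f \<in> A2 p \<Longrightarrow> g \<in> A2 p \<Longrightarrow> (\<lambda>x. f x - g x) \<in> A2 p"
  using A2_add[of f p "\<lambda>x. (-1) * g x"] A2_scale[of g p "-1"] by simp

lemma A2_sum: "(\<And>i. i \<in> I \<Longrightarrow> f i \<in> A2 p) \<Longrightarrow> (\<lambda>x. \<Sum>i\<in>I. f i x) \<in> A2 p"
  by (induction I rule: infinite_finite_induct) (auto simp: A2_zero intro: A2_add)

lemma lin_comb_simps:
  "lin_comb P [] = (\<lambda>x. 0)"
  "lin_comb P ((c, i) # u) = (\<lambda>x. c * P i x + lin_comb P u x)"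
  by (auto simp: lin_comb_def)

lemma lin_comb_append: "lin_comb P (u @ v) = (\<lambda>x. lin_comb P u x + lin_comb P v x)"
  by (auto simp: lin_comb_def)

lemma lin_comb_scale: "lin_comb P (map (\<lambda>(d, i). (c * d, i)) u) = (\<lambda>x. c * lin_comb P u x)"
  by (induction u) (auto simp: lin_comb_simps algebra_simps)

lemma A2_lin_comb: "(\<And>c i. (c, i) \<in> set u \<Longrightarrow> P i \<in> A2 p) \<Longrightarrow> lin_comb P u \<in> A2 p"
proof (induction u)
  case (Cons y u)
  obtain c i where "y = (c, i)" by (cases y)
  with Cons show ?case by (auto simp: lin_comb_simps intro!: A2_add A2_scale)
qed (simp add: lin_comb_simps A2_zero)

lemma polydisc_upd: "x \<in> polydisc p \<Longrightarrow> i < p \<Longrightarrow> z \<in> disc \<Longrightarrow> x(i := z) \<in> polydisc p"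
  by (auto simp: polydisc_def PiE_iff extensional_def)

lemma pure_tensor_A2:
  assumes as: "set as \<subseteq> bergman"
  shows "pure_tensor as \<in> A2 (length as)"
proof (rule A2I)
  let ?n = "length as"
  have asi: "as ! i \<in> bergman" if "i < ?n" for i using as that by auto
  have cont: "continuous_on (polydisc ?n) (\<lambda>x. \<Prod>i<?n. (as ! i) (x i))"
  proof (rule continuous_on_prod)
    fix i assume "i \<in> {..<?n}"
    then have i: "i < ?n" by simp
    show "continuous_on (polydisc ?n) (\<lambda>x. (as ! i) (x i))"
      by (rule continuous_on_compose2[OF holomorphic_on_imp_continuous_on[OF bergman_holomorphic[OF asi[OF i]]]
            continuous_on_coordinate])
         (use i polydisc_coordinate in auto)
  qed
  show "polydisc_holomorphic ?n (pure_tensor as)"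
    unfolding polydisc_holomorphic_def
  proof (intro conjI ballI allI impI)
    show "continuous_on (polydisc ?n) (pure_tensor as)"
      by (rule continuous_on_cong[THEN iffD1, OF HOL.refl _ cont]) (simp add: pure_tensor_def)
    fix x j assume x: "x \<in> polydisc ?n" and j: "j < ?n"
    have "(\<lambda>z. \<Prod>i<?n. (as ! i) ((x(j := z)) i)) holomorphic_on disc"
    proof (rule holomorphic_on_prod)
      fix i assume "i \<in> {..<?n}"
      then show "(\<lambda>z. (as ! i) ((x(j := z)) i)) holomorphic_on disc"
        using bergman_holomorphic[OF asi, of i] by (cases "i = j") auto
    qed
    then show "(\<lambda>z. pure_tensor as (x(j := z))) holomorphic_on disc"
      by (rule holomorphic_transform) (use x j polydisc_upd in \<open>auto simp: pure_tensor_def\<close>)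
  qed
  then have m: "pure_tensor as \<in> borel_measurable (polydisc_measure ?n)"
    by (simp add: polydisc_holomorphic_def measurable_polydisc_continuous)
  have "integrable (polydisc_measure ?n) (\<lambda>x. \<Prod>i<?n. (cmod ((as ! i) (x i)))\<^sup>2)"
    unfolding polydisc_measure_def
    by (rule discs.product_integrable_prod[where f = "\<lambda>i z. (cmod ((as ! i) z))\<^sup>2"])
       (use asi in \<open>auto simp: bergman_def\<close>)
  then have "integrable (polydisc_measure ?n) (\<lambda>x. (cmod (pure_tensor as x))\<^sup>2)"
    by (rule Bochner_Integration.integrable_cong[THEN iffD1, OF HOL.refl, rotated])
       (simp add: pure_tensor_def prod_norm[symmetric] prod_power_distrib)
  with m show "sqi (polydisc_measure ?n) (pure_tensor as)" by (simp add: sqi_def)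
qed (simp add: pure_tensor_def)

text \<open>Point evaluations are bounded: the mean value property is applied in one variable after the
  other.\<close>

lemma disc_evaluation_bound:
  assumes f: "f holomorphic_on disc" and x: "x \<in> disc"
  shows "ennreal (cmod (f x)) \<le> ennreal (1 / ((1 - cmod x) / 2)\<^sup>2) * (\<integral>\<^sup>+z. ennreal (cmod (f z)) \<partial>disc_measure)"
proof -
  have [measurable]: "f \<in> borel_measurable disc_measure" "disc_bump x \<in> borel_measurable disc_measure"
    using f measurable_disc_continuous holomorphic_on_imp_continuous_on disc_bump_measurable[OF x] by auto
  have "ennreal (cmod (f x)) = ennreal (cmod (\<integral>z. disc_bump x z *\<^sub>R f z \<partial>disc_measure))"
    by (simp add: disc_mean_value[OF f x])
  also have "\<dots> \<le> (\<integral>\<^sup>+z. ennreal (cmod (disc_bump x z *\<^sub>R f z)) \<partial>disc_measure)"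
  proof (cases "integrable disc_measure (\<lambda>z. disc_bump x z *\<^sub>R f z)")
    case True
    then show ?thesis by (rule integral_norm_bound_ennreal)
  qed (simp add: not_integrable_integral_eq)
  also have "\<dots> \<le> (\<integral>\<^sup>+z. ennreal (1 / ((1 - cmod x) / 2)\<^sup>2) * ennreal (cmod (f z)) \<partial>disc_measure)"
  proof (rule nn_integral_mono)
    fix z
    have "disc_bump x z * cmod (f z) \<le> 1 / ((1 - cmod x) / 2)\<^sup>2 * cmod (f z)"
      by (rule mult_right_mono[OF disc_bump_bound(2)]) simp
    then show "ennreal (cmod (disc_bump x z *\<^sub>R f z)) \<le> ennreal (1 / ((1 - cmod x) / 2)\<^sup>2) * ennreal (cmod (f z))"
      using disc_bump_bound(1)[of x z] by (subst ennreal_mult[symmetric]) (auto intro: ennreal_leI)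
  qed
  also have "\<dots> = ennreal (1 / ((1 - cmod x) / 2)\<^sup>2) * (\<integral>\<^sup>+z. ennreal (cmod (f z)) \<partial>disc_measure)"
    by (rule nn_integral_cmult) measurable
  finally show ?thesis .
qed

lemma polydisc_evaluation_L1:
  assumes "polydisc_holomorphic p f" "x \<in> polydisc p"
  shows "ennreal (cmod (f x))
     \<le> (\<Prod>i<p. ennreal (1 / ((1 - cmod (x i)) / 2)\<^sup>2)) * (\<integral>\<^sup>+y. ennreal (cmod (f y)) \<partial>polydisc_measure p)"
  using assms
proof (induction p arbitrary: f x)
  case 0
  then have "x = (\<lambda>k. undefined)" by (auto simp: polydisc_def)
  then show ?case by (simp add: polydisc_measure_def discs.nn_integral_empty)
next
  case (Suc p)
  let ?C = "ennreal (1 / ((1 - cmod (x p)) / 2)\<^sup>2)"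
  \<comment> \<open>points of \<open>polydisc p\<close> are extensional, so the dropped coordinate becomes \<open>undefined\<close>\<close>
  let ?x = "x(p := undefined)"
  have xp: "x p \<in> disc" using Suc.prems(2) by (rule polydisc_coordinate) simp
  have x': "?x \<in> polydisc p"
    using Suc.prems(2) by (auto simp: polydisc_def PiE_iff extensional_def less_Suc_eq)
  have ext: "y(p := z) \<in> polydisc (Suc p)" if "y \<in> polydisc p" "z \<in> disc" for y z
    using that by (auto simp: polydisc_def PiE_iff extensional_def less_Suc_eq)
  have cont: "continuous_on (polydisc (Suc p)) f"
    and hol: "\<And>x i. x \<in> polydisc (Suc p) \<Longrightarrow> i < Suc p \<Longrightarrow> (\<lambda>z. f (x(i := z))) holomorphic_on disc"
    using Suc.prems(1) by (auto simp: polydisc_holomorphic_def)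
  have fm: "f \<in> borel_measurable (polydisc_measure (Suc p))"
    by (rule measurable_polydisc_continuous[OF cont])
  have "polydisc_holomorphic p (\<lambda>y. f (y(p := x p)))"
    unfolding polydisc_holomorphic_def
  proof (intro conjI ballI allI impI)
    have "continuous_on (polydisc p) (\<lambda>y. (y(p := x p)) i)" for i
      by (cases "i = p") (auto intro: continuous_on_coordinate)
    then have "continuous_on (polydisc p) (\<lambda>y. y(p := x p))"
      by (intro continuous_on_coordinatewise_then_product)
    then show "continuous_on (polydisc p) (\<lambda>y. f (y(p := x p)))"
      by (rule continuous_on_compose2[OF cont]) (use ext xp in auto)
    fix y i assume y: "y \<in> polydisc p" and i: "i < p"
    have "(\<lambda>z. f ((y(p := x p))(i := z))) holomorphic_on disc"
      by (rule hol) (use y i ext xp in auto)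
    then show "(\<lambda>z. f ((y(i := z))(p := x p))) holomorphic_on disc"
      using i by (simp add: fun_upd_twist)
  qed
  from Suc.IH[OF this x']
  have ih: "ennreal (cmod (f (?x(p := x p)))) \<le> (\<Prod>i<p. ennreal (1 / ((1 - cmod (?x i)) / 2)\<^sup>2))
      * (\<integral>\<^sup>+y. ennreal (cmod (f (y(p := x p)))) \<partial>polydisc_measure p)" .
  have "?x(p := x p) = x" by auto
  moreover have "(\<Prod>i<p. ennreal (1 / ((1 - cmod (?x i)) / 2)\<^sup>2)) = (\<Prod>i<p. ennreal (1 / ((1 - cmod (x i)) / 2)\<^sup>2))"
    by (intro prod.cong) auto
  ultimately have ih': "ennreal (cmod (f x)) \<le> (\<Prod>i<p. ennreal (1 / ((1 - cmod (x i)) / 2)\<^sup>2))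
      * (\<integral>\<^sup>+y. ennreal (cmod (f (y(p := x p)))) \<partial>polydisc_measure p)"
    using ih by (simp only:)
  have "(\<integral>\<^sup>+y. ennreal (cmod (f (y(p := x p)))) \<partial>polydisc_measure p)
      \<le> (\<integral>\<^sup>+y. ?C * (\<integral>\<^sup>+z. ennreal (cmod (f (y(p := z)))) \<partial>disc_measure) \<partial>polydisc_measure p)"
  proof (rule nn_integral_mono)
    fix y assume "y \<in> space (polydisc_measure p)"
    then have y: "y \<in> polydisc p" by simp
    have "(\<lambda>z. f ((y(p := x p))(p := z))) holomorphic_on disc"
      by (rule hol) (use y ext xp in auto)
    then show "ennreal (cmod (f (y(p := x p)))) \<le> ?C * (\<integral>\<^sup>+z. ennreal (cmod (f (y(p := z)))) \<partial>disc_measure)"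
      using disc_evaluation_bound[OF _ xp, of "\<lambda>z. f (y(p := z))"] by simp
  qed
  also have "\<dots> = ?C * (\<integral>\<^sup>+y. (\<integral>\<^sup>+z. ennreal (cmod (f (y(p := z)))) \<partial>disc_measure) \<partial>polydisc_measure p)"
  proof (rule nn_integral_cmult)
    have "(\<lambda>(y, z). y(p := z)) \<in> measurable (PiM {..<p} (\<lambda>_. disc_measure) \<Otimes>\<^sub>M disc_measure) (PiM (insert p {..<p}) (\<lambda>_. disc_measure))"
      by (rule measurable_add_dim)
    moreover have "(\<lambda>x. ennreal (cmod (f x))) \<in> borel_measurable (PiM (insert p {..<p}) (\<lambda>_. disc_measure))"
      using fm unfolding polydisc_measure_def lessThan_Suc by measurable
    ultimately have "(\<lambda>w. ennreal (cmod (f ((fst w)(p := snd w))))) \<in> borel_measurable (PiM {..<p} (\<lambda>_. disc_measure) \<Otimes>\<^sub>M disc_measure)"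
      using measurable_compose by (fastforce simp: case_prod_unfold)
    then show "(\<lambda>y. \<integral>\<^sup>+z. ennreal (cmod (f (y(p := z)))) \<partial>disc_measure) \<in> borel_measurable (polydisc_measure p)"
      unfolding polydisc_measure_def
      by (intro disc.borel_measurable_nn_integral) (simp add: case_prod_unfold)
  qed
  also have "(\<integral>\<^sup>+y. (\<integral>\<^sup>+z. ennreal (cmod (f (y(p := z)))) \<partial>disc_measure) \<partial>polydisc_measure p)
      = (\<integral>\<^sup>+y. ennreal (cmod (f y)) \<partial>polydisc_measure (Suc p))"
    unfolding polydisc_measure_def lessThan_Suc
    by (rule discs.product_nn_integral_insert[symmetric])
       (use fm in \<open>auto simp: polydisc_measure_def lessThan_Suc\<close>)
  finally have "(\<integral>\<^sup>+y. ennreal (cmod (f (y(p := x p)))) \<partial>polydisc_measure p)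
      \<le> ?C * (\<integral>\<^sup>+y. ennreal (cmod (f y)) \<partial>polydisc_measure (Suc p))" .
  from order_trans[OF ih' mult_left_mono[OF this]] show ?case
    by (simp add: lessThan_Suc mult_ac)
qed

lemma A2_evaluation_bound:
  assumes x: "x \<in> polydisc p"
  shows "\<exists>C\<ge>0. \<forall>f\<in>A2 p. cmod (f x) \<le> C * A2_norm p f"
proof (intro exI conjI ballI)
  let ?C = "\<Prod>i<p. 1 / ((1 - cmod (x i)) / 2)\<^sup>2"
  show C: "0 \<le> ?C" by (intro prod_nonneg) auto
  fix f assume f: "f \<in> A2 p"
  note s = A2_sqi[OF f]
  have int: "integrable (polydisc_measure p) f" by (rule polyd.sqi_integrable[OF s])
  have "ennreal (cmod (f x)) \<le> ennreal ?C * (\<integral>\<^sup>+y. ennreal (cmod (f y)) \<partial>polydisc_measure p)"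
    using polydisc_evaluation_L1[OF A2_holomorphic[OF f] x] by (simp add: prod_ennreal)
  also have "(\<integral>\<^sup>+y. ennreal (cmod (f y)) \<partial>polydisc_measure p) = ennreal (\<integral>y. cmod (f y) \<partial>polydisc_measure p)"
    using int by (intro nn_integral_eq_integral) auto
  also have "ennreal ?C * \<dots> = ennreal (?C * (\<integral>y. cmod (f y) \<partial>polydisc_measure p))"
    using C by (simp add: ennreal_mult)
  finally have 1: "cmod (f x) \<le> ?C * (\<integral>y. cmod (f y) \<partial>polydisc_measure p)"
    using C by (subst (asm) ennreal_le_iff) auto
  let ?g = "\<lambda>y. complex_of_real (cmod (f y))"
  have gs: "sqi (polydisc_measure p) ?g"
    using s by (auto simp: sqi_def)
  have "cmod (\<integral>y. ?g y * 1 \<partial>polydisc_measure p) \<le> 1 * nrm (polydisc_measure p) ?g"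
    by (rule polyd.integral_bounded_functional(2)[OF gs]) auto
  then have "\<bar>\<integral>y. cmod (f y) \<partial>polydisc_measure p\<bar> \<le> nrm (polydisc_measure p) ?g"
    by (simp only: mult_1_right mult_1 integral_complex_of_real norm_of_real)
  also have "nrm (polydisc_measure p) ?g = A2_norm p f"
    by (simp add: nrm_def A2_norm_def)
  finally have "(\<integral>y. cmod (f y) \<partial>polydisc_measure p) \<le> A2_norm p f" by simp
  with 1 C show "cmod (f x) \<le> ?C * A2_norm p f"
    by (meson mult_left_mono order_trans)
qed

section \<open>Extending maps from pure tensors\<close>

text \<open>Linearity is demanded on \<open>A2 p\<close> only: Bochner integrals of functions that are not integrable are 0,
  so the functionals used below are not additive on all functions.\<close>

definition bounded_functional :: "nat \<Rightarrow> (polyfun \<Rightarrow> complex) \<Rightarrow> bool" where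
  "bounded_functional p \<Lambda> \<longleftrightarrow> (\<forall>f\<in>A2 p. \<forall>g\<in>A2 p. \<Lambda> (\<lambda>x. f x + g x) = \<Lambda> f + \<Lambda> g) \<and>
     (\<forall>f\<in>A2 p. \<forall>c. \<Lambda> (\<lambda>x. c * f x) = c * \<Lambda> f) \<and>
     (\<exists>C\<ge>0. \<forall>f\<in>A2 p. cmod (\<Lambda> f) \<le> C * A2_norm p f)"

lemma bounded_functionalI:
  assumes "\<And>f g. f \<in> A2 p \<Longrightarrow> g \<in> A2 p \<Longrightarrow> \<Lambda> (\<lambda>x. f x + g x) = \<Lambda> f + \<Lambda> g"
    and "\<And>f c. f \<in> A2 p \<Longrightarrow> \<Lambda> (\<lambda>x. c * f x) = c * \<Lambda> f"
    and "0 \<le> C" "\<And>f. f \<in> A2 p \<Longrightarrow> cmod (\<Lambda> f) \<le> C * A2_norm p f"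
  shows "bounded_functional p \<Lambda>"
  unfolding bounded_functional_def using assms by blast

lemma bounded_functional_add: "bounded_functional p \<Lambda> \<Longrightarrow> f \<in> A2 p \<Longrightarrow> g \<in> A2 p \<Longrightarrow> \<Lambda> (\<lambda>x. f x + g x) = \<Lambda> f + \<Lambda> g"
  by (simp add: bounded_functional_def)

lemma bounded_functional_scale: "bounded_functional p \<Lambda> \<Longrightarrow> f \<in> A2 p \<Longrightarrow> \<Lambda> (\<lambda>x. c * f x) = c * \<Lambda> f"
  by (simp add: bounded_functional_def)

lemma bounded_functional_diff:
  assumes "bounded_functional p \<Lambda>" "f \<in> A2 p" "g \<in> A2 p"
  shows "\<Lambda> (\<lambda>x. f x - g x) = \<Lambda> f - \<Lambda> g"
  using bounded_functional_add[OF assms(1,2) A2_scale[OF assms(3), of "-1"]] bounded_functional_scale[OF assms(1,3), of "-1"] by simp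

lemma bounded_functional_lin_comb:
  assumes "bounded_functional p \<Lambda>" "\<And>c i. (c, i) \<in> set u \<Longrightarrow> P i \<in> A2 p"
  shows "\<Lambda> (lin_comb P u) = (\<Sum>(c, i)\<leftarrow>u. c * \<Lambda> (P i))"
  using assms(2)
proof (induction u)
  case Nil
  show ?case using bounded_functional_scale[OF assms(1) A2_zero, of 0] by (simp add: lin_comb_simps)
next
  case (Cons y u)
  obtain c i where y: "y = (c, i)" by (cases y)
  have "P i \<in> A2 p" "lin_comb P u \<in> A2 p"
    using Cons.prems by (auto simp: y intro!: A2_lin_comb)
  with Cons show ?case
    by (auto simp: y lin_comb_simps bounded_functional_add[OF assms(1)] bounded_functional_scale[OF assms(1)] A2_scale)
qed

lemma bounded_functional_zero: "bounded_functional p (\<lambda>f. 0)"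
  by (rule bounded_functionalI[of _ _ 0]) auto

lemma bounded_functional_cmult:
  assumes "bounded_functional p \<Lambda>"
  shows "bounded_functional p (\<lambda>f. c * \<Lambda> f)"
proof -
  obtain C where C: "C \<ge> 0" "\<And>f. f \<in> A2 p \<Longrightarrow> cmod (\<Lambda> f) \<le> C * A2_norm p f"
    using assms unfolding bounded_functional_def by blast
  show ?thesis
  proof (rule bounded_functionalI)
    show "0 \<le> cmod c * C" using C(1) by simp
    show "cmod (c * \<Lambda> f) \<le> cmod c * C * A2_norm p f" if "f \<in> A2 p" for f
      using mult_left_mono[OF C(2)[OF that], of "cmod c"] by (simp add: norm_mult mult.assoc)
  qed (simp_all add: bounded_functional_add[OF assms] bounded_functional_scale[OF assms] distrib_left mult.left_commute)
qed

lemma bounded_functional_sum: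
  assumes "\<And>i. i \<in> I \<Longrightarrow> bounded_functional p (\<Lambda> i)"
  shows "bounded_functional p (\<lambda>f. \<Sum>i\<in>I. \<Lambda> i f)"
proof -
  have "\<exists>C\<ge>0. \<forall>f\<in>A2 p. cmod (\<Lambda> i f) \<le> C * A2_norm p f" if "i \<in> I" for i
    using assms[OF that] by (simp add: bounded_functional_def)
  then obtain C where C: "\<And>i. i \<in> I \<Longrightarrow> 0 \<le> C i" "\<And>i f. i \<in> I \<Longrightarrow> f \<in> A2 p \<Longrightarrow> cmod (\<Lambda> i f) \<le> C i * A2_norm p f"
    by metis
  show ?thesis
  proof (rule bounded_functionalI)
    show "0 \<le> (\<Sum>i\<in>I. C i)" using C by (intro sum_nonneg)
    fix f assume "f \<in> A2 p"
    then show "cmod (\<Sum>i\<in>I. \<Lambda> i f) \<le> (\<Sum>i\<in>I. C i) * A2_norm p f"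
      unfolding sum_distrib_right using C by (intro sum_norm_le) auto
    show "(\<Sum>i\<in>I. \<Lambda> i (\<lambda>x. c * f x)) = c * (\<Sum>i\<in>I. \<Lambda> i f)" for c
      unfolding sum_distrib_left by (rule sum.cong[OF HOL.refl]) (rule bounded_functional_scale[OF assms \<open>f \<in> A2 p\<close>])
    fix g assume "g \<in> A2 p"
    show "(\<Sum>i\<in>I. \<Lambda> i (\<lambda>x. f x + g x)) = (\<Sum>i\<in>I. \<Lambda> i f) + (\<Sum>i\<in>I. \<Lambda> i g)"
      unfolding sum.distrib[symmetric]
      by (rule sum.cong[OF HOL.refl]) (rule bounded_functional_add[OF assms \<open>f \<in> A2 p\<close> \<open>g \<in> A2 p\<close>])
  qed
qed

lemma bounded_functional_series:
  assumes \<Lambda>: "\<And>N. bounded_functional p (\<Lambda> N)" and c: "summable c" "\<And>N. 0 \<le> c N" and M: "0 \<le> M"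
    and bd: "\<And>N f. f \<in> A2 p \<Longrightarrow> cmod (\<Lambda> N f) \<le> c N * (M * A2_norm p f)"
  shows "bounded_functional p (\<lambda>f. suminf (\<lambda>N. \<Lambda> N f))"
proof -
  have sn: "summable (\<lambda>N. cmod (\<Lambda> N f))" if "f \<in> A2 p" for f
    by (rule summable_comparison_test'[OF summable_mult2[OF c(1), of "M * A2_norm p f"], where N = 0])
       (use bd[OF that] in simp)
  have s: "summable (\<lambda>N. \<Lambda> N f)" if "f \<in> A2 p" for f
    by (rule summable_norm_cancel[OF sn[OF that]])
  show ?thesis
  proof (rule bounded_functionalI)
    show "0 \<le> suminf c * M" using c M by (intro mult_nonneg_nonneg suminf_nonneg) auto
    fix f assume f: "f \<in> A2 p"
    have "cmod (suminf (\<lambda>N. \<Lambda> N f)) \<le> suminf (\<lambda>N. cmod (\<Lambda> N f))"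
      by (rule summable_norm[OF sn[OF f]])
    also have "\<dots> \<le> suminf (\<lambda>N. c N * (M * A2_norm p f))"
      by (rule suminf_le[OF bd[OF f] sn[OF f] summable_mult2[OF c(1)]])
    also have "\<dots> = suminf c * M * A2_norm p f"
      by (simp add: suminf_mult2[OF c(1), symmetric] mult.assoc)
    finally show "cmod (suminf (\<lambda>N. \<Lambda> N f)) \<le> suminf c * M * A2_norm p f" .
    show "suminf (\<lambda>N. \<Lambda> N (\<lambda>x. d * f x)) = d * suminf (\<lambda>N. \<Lambda> N f)" for d
      by (simp add: bounded_functional_scale[OF \<Lambda> f] suminf_mult[OF s[OF f]])
    fix g assume g: "g \<in> A2 p"
    show "suminf (\<lambda>N. \<Lambda> N (\<lambda>x. f x + g x)) = suminf (\<lambda>N. \<Lambda> N f) + suminf (\<lambda>N. \<Lambda> N g)"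
      by (simp add: bounded_functional_add[OF \<Lambda> f g] suminf_add[OF s[OF f] s[OF g]])
  qed
qed

text \<open>Pairing with a product of bounded one-variable functions.\<close>

definition product_pairing :: "nat \<Rightarrow> (nat \<Rightarrow> complex \<Rightarrow> complex) \<Rightarrow> polyfun \<Rightarrow> complex" where
  "product_pairing p \<kappa> f = (\<integral>y. f y * (\<Prod>i<p. \<kappa> i (y i)) \<partial>polydisc_measure p)"

lemma
  assumes \<kappa>: "\<And>i. i < p \<Longrightarrow> \<kappa> i \<in> borel_measurable disc_measure"
    and M: "\<And>i z. i < p \<Longrightarrow> z \<in> disc \<Longrightarrow> cmod (\<kappa> i z) \<le> M i"
  shows product_pairing_bound: "f \<in> A2 p \<Longrightarrow> cmod (product_pairing p \<kappa> f) \<le> (\<Prod>i<p. M i) * A2_norm p f"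
    and product_pairing_bounded_functional: "bounded_functional p (product_pairing p \<kappa>)"
    and product_pairing_pure_tensor: "length as = p \<Longrightarrow> set as \<subseteq> bergman \<Longrightarrow>
       product_pairing p \<kappa> (pure_tensor as) = (\<Prod>i<p. \<integral>z. (as ! i) z * \<kappa> i z \<partial>disc_measure)"
proof -
  have M0: "0 \<le> M i" if "i < p" for i
    using order_trans[OF norm_ge_zero M[OF that, of 0]] by simp
  let ?K = "\<lambda>y. \<Prod>i<p. \<kappa> i (y i)"
  have Km: "?K \<in> borel_measurable (polydisc_measure p)"
    by (intro borel_measurable_prod measurable_polydisc_coordinate \<kappa>) auto
  have Kb: "cmod (?K y) \<le> (\<Prod>i<p. M i)" if "y \<in> polydisc p" for y
    unfolding prod_norm[symmetric]
    using M polydisc_coordinate[OF that] by (intro prod_mono) auto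
  have P0: "0 \<le> (\<Prod>i<p. M i)" by (intro prod_nonneg) (use M0 in auto)
  have int: "integrable (polydisc_measure p) (\<lambda>y. f y * ?K y)" if "f \<in> A2 p" for f
    by (rule polyd.integral_bounded_functional(1)[OF A2_sqi[OF that] Km, where C = "\<Prod>i<p. M i"])
       (use Kb P0 in auto)
  have bd: "cmod (product_pairing p \<kappa> f) \<le> (\<Prod>i<p. M i) * A2_norm p f" if "f \<in> A2 p" for f
    unfolding product_pairing_def A2_norm_nrm
    by (rule polyd.integral_bounded_functional(2)[OF A2_sqi[OF that] Km]) (use Kb P0 in auto)
  then show "f \<in> A2 p \<Longrightarrow> cmod (product_pairing p \<kappa> f) \<le> (\<Prod>i<p. M i) * A2_norm p f" .
  show "bounded_functional p (product_pairing p \<kappa>)"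
    by (rule bounded_functionalI[OF _ _ P0 bd]) (simp_all add: product_pairing_def distrib_right int mult.assoc)
  assume as: "length as = p" "set as \<subseteq> bergman"
  have "product_pairing p \<kappa> (pure_tensor as) = (\<integral>y. (\<Prod>i<p. (as ! i) (y i) * \<kappa> i (y i)) \<partial>polydisc_measure p)"
    unfolding product_pairing_def
    by (intro Bochner_Integration.integral_cong) (auto simp: pure_tensor_def as prod.distrib)
  also have "\<dots> = (\<Prod>i<p. \<integral>z. (as ! i) z * \<kappa> i z \<partial>disc_measure)"
    unfolding polydisc_measure_def
  proof (rule discs.product_integral_prod[where f = "\<lambda>i z. (as ! i) z * \<kappa> i z"])
    fix i assume "i \<in> {..<p}"
    then have i: "i < p" by simp
    then have "sqi disc_measure (as ! i)" using as by (intro bergman_sqi) auto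
    then show "integrable disc_measure (\<lambda>z. (as ! i) z * \<kappa> i z)"
      by (rule disc.integral_bounded_functional(1)[OF _ \<kappa>[OF i], where C = "M i"])
         (use M[OF i] M0[OF i] in auto)
  qed simp
  finally show "product_pairing p \<kappa> (pure_tensor as) = (\<Prod>i<p. \<integral>z. (as ! i) z * \<kappa> i z \<partial>disc_measure)" .
qed

text \<open>The combinations of pure tensors admitted as approximations in \<open>tensor_extend\<close>.\<close>

definition valid_comb :: "nat \<Rightarrow> (complex \<times> (complex \<Rightarrow> complex) list) list \<Rightarrow> bool" where
  "valid_comb p u \<longleftrightarrow> (\<forall>(c, as)\<in>set u. length as = p \<and> set as \<subseteq> bergman)"

text \<open>In general a map given on pure tensors need not extend to a well-defined bounded map. It is enough here
  that each value of \<open>Q as\<close> at a point is a bounded functional of the tensor; in particular \<open>Q\<close>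
  is then multilinear.\<close>

definition closable :: "nat \<Rightarrow> nat \<Rightarrow> ((complex \<Rightarrow> complex) list \<Rightarrow> polyfun) \<Rightarrow> bool" where
  "closable p m Q \<longleftrightarrow> (\<forall>as. length as = p \<longrightarrow> set as \<subseteq> bergman \<longrightarrow> Q as \<in> A2 m) \<and>
     (\<forall>x\<in>polydisc m. \<exists>\<Lambda>. bounded_functional p \<Lambda> \<and>
        (\<forall>as. length as = p \<longrightarrow> set as \<subseteq> bergman \<longrightarrow> Q as x = \<Lambda> (pure_tensor as)))"

lemma valid_combD: "valid_comb p u \<Longrightarrow> (c, as) \<in> set u \<Longrightarrow> length as = p \<and> set as \<subseteq> bergman"
  by (auto simp: valid_comb_def)

lemma A2_pure_lin_comb: "valid_comb p u \<Longrightarrow> lin_comb pure_tensor u \<in> A2 p"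
  using valid_combD pure_tensor_A2 by (intro A2_lin_comb) blast

lemma closable_A2: "closable p m Q \<Longrightarrow> valid_comb p u \<Longrightarrow> lin_comb Q u \<in> A2 m"
  using valid_combD unfolding closable_def by (intro A2_lin_comb) blast

text \<open>If every value of \<open>Q\<close> at a point is a bounded functional of the tensor, then limits of
  combinations of the \<open>Q as\<close> depend only on the limit of the tensors, because point evaluations are
  bounded too. The description of the extension is then unambiguous.\<close>

lemma tensor_extend_lin_comb:
  assumes Q: "closable p m Q" and u: "valid_comb p u"
  shows "tensor_extend p m Q (lin_comb pure_tensor u) = lin_comb Q u"
  unfolding tensor_extend_def
proof (rule the_equality)
  let ?f = "lin_comb pure_tensor u"
  note fA = A2_pure_lin_comb[OF u]
  have z: "A2_norm k 0 = 0" for k by (simp add: A2_norm_def)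
  show "lin_comb Q u \<in> A2 m \<and> (\<exists>v. (\<forall>n. \<forall>(c, as)\<in>set (v n). length as = p \<and> set as \<subseteq> bergman) \<and>
      (\<lambda>n. A2_norm p (?f - lin_comb pure_tensor (v n))) \<longlonglongrightarrow> 0 \<and>
      (\<lambda>n. A2_norm m (lin_comb Q u - lin_comb Q (v n))) \<longlonglongrightarrow> 0)"
    using closable_A2[OF Q u] u unfolding valid_comb_def
    by (intro conjI exI[of _ "\<lambda>n. u"]) (simp_all add: z)
  fix g assume "g \<in> A2 m \<and> (\<exists>v. (\<forall>n. \<forall>(c, as)\<in>set (v n). length as = p \<and> set as \<subseteq> bergman) \<and>
      (\<lambda>n. A2_norm p (?f - lin_comb pure_tensor (v n))) \<longlonglongrightarrow> 0 \<and>
      (\<lambda>n. A2_norm m (g - lin_comb Q (v n))) \<longlonglongrightarrow> 0)"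
  then obtain v where gA: "g \<in> A2 m" and v: "\<And>n. valid_comb p (v n)"
    and l1: "(\<lambda>n. A2_norm p (?f - lin_comb pure_tensor (v n))) \<longlonglongrightarrow> 0"
    and l2: "(\<lambda>n. A2_norm m (g - lin_comb Q (v n))) \<longlonglongrightarrow> 0"
    unfolding valid_comb_def by blast
  show "g = lin_comb Q u"
  proof
    fix x
    show "g x = lin_comb Q u x"
    proof (cases "x \<in> polydisc m")
      case True
      then obtain \<Lambda> where \<Lambda>: "bounded_functional p \<Lambda>"
        and Qx: "\<And>as. length as = p \<Longrightarrow> set as \<subseteq> bergman \<Longrightarrow> Q as x = \<Lambda> (pure_tensor as)"
        using Q unfolding closable_def by meson
      have val: "lin_comb Q w x = \<Lambda> (lin_comb pure_tensor w)" if w: "valid_comb p w" for w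
      proof -
        have "\<Lambda> (lin_comb pure_tensor w) = (\<Sum>(c, as)\<leftarrow>w. c * \<Lambda> (pure_tensor as))"
          by (rule bounded_functional_lin_comb[OF \<Lambda>]) (use valid_combD[OF w] pure_tensor_A2 in blast)
        also have "\<dots> = lin_comb Q w x"
          unfolding lin_comb_def
          by (intro arg_cong[where f = sum_list] map_cong) (use valid_combD[OF w] Qx in auto)
        finally show ?thesis by simp
      qed
      obtain C where C: "0 \<le> C" "\<And>f. f \<in> A2 p \<Longrightarrow> cmod (\<Lambda> f) \<le> C * A2_norm p f"
        using \<Lambda> by (auto simp: bounded_functional_def)
      obtain C' where C': "0 \<le> C'" "\<And>f. f \<in> A2 m \<Longrightarrow> cmod (f x) \<le> C' * A2_norm m f"
        using A2_evaluation_bound[OF True] by auto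
      have b: "cmod (g x - lin_comb Q u x) \<le> C' * A2_norm m (g - lin_comb Q (v n))
          + C * A2_norm p (?f - lin_comb pure_tensor (v n))" for n
      proof -
        have 1: "cmod (g x - lin_comb Q (v n) x) \<le> C' * A2_norm m (g - lin_comb Q (v n))"
          using C'(2)[OF A2_diff[OF gA closable_A2[OF Q v]]] by (simp add: fun_diff_def)
        have "lin_comb Q u x - lin_comb Q (v n) x = \<Lambda> (\<lambda>y. ?f y - lin_comb pure_tensor (v n) y)"
          unfolding val[OF u] val[OF v] by (rule bounded_functional_diff[OF \<Lambda> fA A2_pure_lin_comb[OF v], symmetric])
        then have 2: "cmod (lin_comb Q u x - lin_comb Q (v n) x) \<le> C * A2_norm p (?f - lin_comb pure_tensor (v n))"
          using C(2)[OF A2_diff[OF fA A2_pure_lin_comb[OF v]]] by (simp add: fun_diff_def)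
        have "cmod (g x - lin_comb Q u x) \<le> cmod (g x - lin_comb Q (v n) x) + cmod (lin_comb Q u x - lin_comb Q (v n) x)"
          using norm_triangle_ineq4[of "g x - lin_comb Q (v n) x" "lin_comb Q u x - lin_comb Q (v n) x"] by simp
        with 1 2 show ?thesis by linarith
      qed
      have "(\<lambda>n. C' * A2_norm m (g - lin_comb Q (v n)) + C * A2_norm p (?f - lin_comb pure_tensor (v n))) \<longlonglongrightarrow> C' * 0 + C * 0"
        by (intro tendsto_intros l1 l2)
      then have "cmod (g x - lin_comb Q u x) \<le> C' * 0 + C * 0"
        by (rule LIMSEQ_le_const) (use b in blast)
      then show ?thesis by simp
    next
      case False
      then show ?thesis using A2_zero_outside gA closable_A2[OF Q u] by metis
    qed
  qed
qed

text \<open>The algebraic tensors. The images of \<open>\<Psi>\<close> have such components and the operations preserve them, so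
  the operations need only be computed on them.\<close>

definition alg_polyfun :: "nat \<Rightarrow> polyfun set" where
  "alg_polyfun p = {lin_comb pure_tensor u |u. valid_comb p u}"

lemma alg_polyfun_A2: "f \<in> alg_polyfun p \<Longrightarrow> f \<in> A2 p"
  by (auto simp: alg_polyfun_def A2_pure_lin_comb)

lemma alg_polyfun_zero: "(\<lambda>x. 0) \<in> alg_polyfun p"
  unfolding alg_polyfun_def by (auto intro!: exI[of _ "[]"] simp: lin_comb_simps valid_comb_def)

lemma alg_polyfun_add: "f \<in> alg_polyfun p \<Longrightarrow> g \<in> alg_polyfun p \<Longrightarrow> (\<lambda>x. f x + g x) \<in> alg_polyfun p"
  unfolding alg_polyfun_def by (auto simp: valid_comb_def lin_comb_append[symmetric])
    (metis (no_types, lifting) Un_iff set_append)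

lemma alg_polyfun_scale: "f \<in> alg_polyfun p \<Longrightarrow> (\<lambda>x. c * f x) \<in> alg_polyfun p"
proof -
  assume "f \<in> alg_polyfun p"
  then obtain u where u: "valid_comb p u" "f = lin_comb pure_tensor u" by (auto simp: alg_polyfun_def)
  then have "valid_comb p (map (\<lambda>(d, i). (c * d, i)) u)" by (auto simp: valid_comb_def)
  then show ?thesis unfolding alg_polyfun_def u(2) lin_comb_scale[symmetric] by blast
qed

lemma pure_tensor_lin_comb: "lin_comb P [(1, as)] = P as"
  by (auto simp: lin_comb_simps)

lemma alg_polyfun_pure: "set as \<subseteq> bergman \<Longrightarrow> pure_tensor as \<in> alg_polyfun (length as)"
  unfolding alg_polyfun_def
  by (auto intro!: exI[of _ "[(1, as)]"] simp: pure_tensor_lin_comb valid_comb_def)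

lemma alg_polyfun_sum: "(\<And>i. i \<in> I \<Longrightarrow> f i \<in> alg_polyfun p) \<Longrightarrow> (\<lambda>x. \<Sum>i\<in>I. f i x) \<in> alg_polyfun p"
  by (induction I rule: infinite_finite_induct) (auto simp: alg_polyfun_zero intro: alg_polyfun_add)

lemma alg_polyfun_lin_comb: "(\<And>c i. (c, i) \<in> set u \<Longrightarrow> P i \<in> alg_polyfun p) \<Longrightarrow> lin_comb P u \<in> alg_polyfun p"
proof (induction u)
  case (Cons y u)
  obtain c i where "y = (c, i)" by (cases y)
  with Cons show ?case by (auto simp: lin_comb_simps intro!: alg_polyfun_add alg_polyfun_scale)
qed (simp add: lin_comb_simps alg_polyfun_zero)

context
  fixes p m Q
  assumes Q: "closable p m Q"
begin

lemma tensor_extend_pure: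
  "length as = p \<Longrightarrow> set as \<subseteq> bergman \<Longrightarrow> tensor_extend p m Q (pure_tensor as) = Q as"
  using tensor_extend_lin_comb[OF Q, of "[(1, as)]"] by (simp add: pure_tensor_lin_comb valid_comb_def)

lemma tensor_extend_zero: "tensor_extend p m Q (\<lambda>x. 0) = (\<lambda>x. 0)"
  using tensor_extend_lin_comb[OF Q, of "[]"] by (simp add: lin_comb_simps valid_comb_def)

lemma tensor_extend_add:
  assumes "f \<in> alg_polyfun p" "g \<in> alg_polyfun p"
  shows "tensor_extend p m Q (\<lambda>x. f x + g x) = (\<lambda>x. tensor_extend p m Q f x + tensor_extend p m Q g x)"
proof -
  obtain u v where u: "valid_comb p u" "f = lin_comb pure_tensor u" and v: "valid_comb p v" "g = lin_comb pure_tensor v"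
    using assms by (auto simp: alg_polyfun_def)
  have "valid_comb p (u @ v)" using u v by (auto simp: valid_comb_def)
  from tensor_extend_lin_comb[OF Q this] show ?thesis
    unfolding u(2) v(2) lin_comb_append by (simp add: tensor_extend_lin_comb[OF Q] u v)
qed

lemma tensor_extend_scale:
  assumes "f \<in> alg_polyfun p"
  shows "tensor_extend p m Q (\<lambda>x. c * f x) = (\<lambda>x. c * tensor_extend p m Q f x)"
proof -
  obtain u where u: "valid_comb p u" "f = lin_comb pure_tensor u"
    using assms by (auto simp: alg_polyfun_def)
  have "valid_comb p (map (\<lambda>(d, i). (c * d, i)) u)" using u by (auto simp: valid_comb_def)
  from tensor_extend_lin_comb[OF Q this] show ?thesis
    unfolding u(2) lin_comb_scale by (simp add: tensor_extend_lin_comb[OF Q] u)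
qed

lemma tensor_extend_alg_polyfun:
  assumes "f \<in> alg_polyfun p" "\<And>as. length as = p \<Longrightarrow> set as \<subseteq> bergman \<Longrightarrow> Q as \<in> alg_polyfun m"
  shows "tensor_extend p m Q f \<in> alg_polyfun m"
proof -
  obtain u where u: "valid_comb p u" "f = lin_comb pure_tensor u"
    using assms by (auto simp: alg_polyfun_def)
  show ?thesis unfolding u(2) tensor_extend_lin_comb[OF Q u(1)]
    by (rule alg_polyfun_lin_comb) (use assms(2) valid_combD[OF u(1)] in blast)
qed

end

lemma closable_zero: "closable p m (\<lambda>as x. 0)"
  unfolding closable_def using A2_zero bounded_functional_zero by (auto intro!: exI[of _ "\<lambda>f. 0"])

text \<open>The one-variable condition that makes tensor products of such maps closable.\<close>

definition point_kernel :: "((complex \<Rightarrow> complex) \<Rightarrow> complex \<Rightarrow> complex) \<Rightarrow> bool" where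
  "point_kernel R \<longleftrightarrow> (\<forall>a\<in>bergman. R a \<in> bergman) \<and>
     (\<forall>x\<in>disc. \<exists>\<kappa> M. \<kappa> \<in> borel_measurable disc_measure \<and> (\<forall>z\<in>disc. cmod (\<kappa> z) \<le> M) \<and>
        (\<forall>a\<in>bergman. R a x = (\<integral>z. a z * \<kappa> z \<partial>disc_measure)))"

lemma closable_tensor_map:
  assumes R: "\<And>i. i < p \<Longrightarrow> point_kernel (R i)"
    and Q: "\<And>as. length as = p \<Longrightarrow> set as \<subseteq> bergman \<Longrightarrow> Q as = pure_tensor (map (\<lambda>i. R i (as ! i)) [0..<p])"
  shows "closable p p Q"
  unfolding closable_def
proof (intro conjI allI impI ballI)
  have img: "set (map (\<lambda>i. R i (as ! i)) [0..<p]) \<subseteq> bergman" if "length as = p" "set as \<subseteq> bergman" for as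
  proof -
    have "as ! i \<in> bergman" if "i < p" for i
      using \<open>length as = p\<close> \<open>set as \<subseteq> bergman\<close> that by auto
    then show ?thesis using R unfolding point_kernel_def by (simp add: image_subset_iff)
  qed
  show "Q as \<in> A2 p" if "length as = p" "set as \<subseteq> bergman" for as
    using pure_tensor_A2[OF img[OF that]] by (simp add: Q[OF that])
  fix x assume x: "x \<in> polydisc p"
  have "\<exists>\<kappa> M. \<kappa> \<in> borel_measurable disc_measure \<and> (\<forall>z\<in>disc. cmod (\<kappa> z) \<le> M) \<and>
        (\<forall>a\<in>bergman. R i a (x i) = (\<integral>z. a z * \<kappa> z \<partial>disc_measure))" if "i < p" for i
    using R[OF that] polydisc_coordinate[OF x that] unfolding point_kernel_def by blast
  then obtain \<kappa> M where \<kappa>: "\<And>i. i < p \<Longrightarrow> \<kappa> i \<in> borel_measurable disc_measure"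
    "\<And>i z. i < p \<Longrightarrow> z \<in> disc \<Longrightarrow> cmod (\<kappa> i z) \<le> M i"
    "\<And>i a. i < p \<Longrightarrow> a \<in> bergman \<Longrightarrow> R i a (x i) = (\<integral>z. a z * \<kappa> i z \<partial>disc_measure)"
    by metis
  show "\<exists>\<Lambda>. bounded_functional p \<Lambda> \<and> (\<forall>as. length as = p \<longrightarrow> set as \<subseteq> bergman \<longrightarrow> Q as x = \<Lambda> (pure_tensor as))"
  proof (intro exI[of _ "product_pairing p \<kappa>"] conjI allI impI)
    show "bounded_functional p (product_pairing p \<kappa>)" using \<kappa>(1,2) by (rule product_pairing_bounded_functional)
    fix as assume as: "length as = p" "set as \<subseteq> bergman"
    have "product_pairing p \<kappa> (pure_tensor as) = (\<Prod>i<p. \<integral>z. (as ! i) z * \<kappa> i z \<partial>disc_measure)"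
      using \<kappa>(1,2) as by (rule product_pairing_pure_tensor)
    also have "\<dots> = Q as x"
      unfolding Q[OF as] using x as \<kappa>(3) by (simp add: pure_tensor_def subset_iff)
    finally show "Q as x = product_pairing p \<kappa> (pure_tensor as)" by simp
  qed
qed

lemma point_kernel_rho:
  assumes r: "0 < r" and sub: "ball c r \<subseteq> disc"
  shows "point_kernel (rho_cl1 (affine_map c r))"
  unfolding point_kernel_def
proof (intro conjI ballI)
  show "a \<in> bergman \<Longrightarrow> rho_cl1 (affine_map c r) a \<in> bergman" for a
    using rho_series_bergman[OF r sub] rho_cl1_affine[OF r sub] by simp
  fix x assume x: "x \<in> disc"
  show "\<exists>\<kappa> M. \<kappa> \<in> borel_measurable disc_measure \<and> (\<forall>z\<in>disc. cmod (\<kappa> z) \<le> M) \<and>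
        (\<forall>a\<in>bergman. rho_cl1 (affine_map c r) a x = (\<integral>z. a z * \<kappa> z \<partial>disc_measure))"
    using rho_point_kernel[OF r sub x] rho_series_integral[OF r sub bergman_sqi x] rho_cl1_affine[OF r sub]
    by (intro exI[of _ "\<lambda>z. of_real r / (1 - x * (of_real r * cnj z + c))\<^sup>2"] exI[of _ "r / (1 - cmod x)\<^sup>2"]) auto
qed

text \<open>Once the positions outside \<open>S\<close> are deleted, the factor at position \<open>t\<close> depends on the variable
  whose index counts the remaining positions before \<open>t\<close>.\<close>

lemma nths_product:
  "(\<Prod>i<length (nths as S). (nths as S ! i) (x i))
    = (\<Prod>t\<in>{t. t < length as \<and> t \<in> S}. (as ! t) (x (card {u. u < t \<and> u \<in> S})))"
  for x :: "nat \<Rightarrow> complex" and as :: "(complex \<Rightarrow> complex) list"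
proof (induction as rule: rev_induct)
  case (snoc a as)
  have *: "(\<Prod>t\<in>{t. t < length as \<and> t \<in> S}. ((as @ [a]) ! t) (x (card {u. u < t \<and> u \<in> S})))
      = (\<Prod>t\<in>{t. t < length as \<and> t \<in> S}. (as ! t) (x (card {u. u < t \<and> u \<in> S})))"
    by (intro prod.cong) (auto simp: nth_append)
  have **: "(\<Prod>i<length (nths as S). ((nths as S @ [a]) ! i) (x i)) = (\<Prod>i<length (nths as S). (nths as S ! i) (x i))"
    by (intro prod.cong) (auto simp: nth_append)
  show ?case
  proof (cases "length as \<in> S")
    case True
    then have s: "{t. t < length (as @ [a]) \<and> t \<in> S} = insert (length as) {t. t < length as \<and> t \<in> S}"
      by auto
    have "nths (as @ [a]) S = nths as S @ [a]" using True by (simp add: nths_append)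
    then show ?thesis
      unfolding s using * ** snoc.IH by (simp add: nth_append length_nths lessThan_Suc mult.commute)
  next
    case False
    then have s: "{t. t < length (as @ [a]) \<and> t \<in> S} = {t. t < length as \<and> t \<in> S}"
      by (auto simp: less_Suc_eq)
    have "nths (as @ [a]) S = nths as S" using False by (simp add: nths_append)
    then show ?thesis unfolding s using * snoc.IH by simp
  qed
qed simp

lemma nths_take_drop:
  assumes "i < length vs"
  shows "nths vs (- {i}) @ nths ws (- {j}) = nths (vs @ ws) (- {i, length vs + j})"
proof -
  have "nths vs (- {i}) = nths vs (- {i, length vs + j})"
    unfolding nths_def by (intro arg_cong[where f = "map fst"] filter_cong) (auto simp: set_zip)
  moreover have "{k. k + length vs \<in> - {i, length vs + j}} = - {j}"
    using assms by auto
  ultimately show ?thesis by (simp add: nths_append)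
qed

lemma length_nths_remove: "i < length vs \<Longrightarrow> length (nths vs (- {i})) = length vs - 1"
proof -
  assume i: "i < length vs"
  have "{t. t < length vs \<and> t \<in> - {i}} = {..<length vs} - {i}" by auto
  then show ?thesis using i by (simp add: length_nths)
qed

text \<open>The contraction of two legs is closable because the coefficients of its kernel are absolutely
  summable: each of them contributes a pairing with a product of bounded functions, all with the same
  bound.\<close>

lemma closable_cross_contraction:
  fixes \<zeta> :: complex
  assumes rs: "0 < r" "0 < s" "r + s < cmod \<zeta>"
  shows "closable (Suc p + Suc q) (p + q)
     (\<lambda>as. cross_contraction (affine_map \<zeta> r) (affine_map 0 s) (take (Suc p) as) (drop (Suc p) as))"
  unfolding closable_def
proof (intro conjI allI impI ballI)
  let ?n = "Suc p + Suc q"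
  let ?kp = "kernel_pairing (G_kernel (affine_map \<zeta> r) (affine_map 0 s))"
  {
    fix as :: "(complex \<Rightarrow> complex) list" assume as: "length as = ?n" "set as \<subseteq> bergman"
    have "pure_tensor (nths (take (Suc p) as) (- {i}) @ nths (drop (Suc p) as) (- {j})) \<in> A2 (p + q)"
      if "i < Suc p" "j < Suc q" for i j
    proof -
      have "length (nths (take (Suc p) as) (- {i}) @ nths (drop (Suc p) as) (- {j})) = p + q"
        using that as by (simp add: length_nths_remove)
      moreover have "set (nths (take (Suc p) as) (- {i}) @ nths (drop (Suc p) as) (- {j})) \<subseteq> bergman"
        using as(2) by (auto dest!: in_set_nthsD in_set_takeD in_set_dropD)
      ultimately show ?thesis using pure_tensor_A2 by metis
    qed
    then show "cross_contraction (affine_map \<zeta> r) (affine_map 0 s) (take (Suc p) as) (drop (Suc p) as) \<in> A2 (p + q)"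
      unfolding cross_contraction_def using as(1) by (intro A2_sum A2_scale) auto
  }
  fix x assume x: "x \<in> polydisc (p + q)"
  define pos where "pos = (\<lambda>i j t. card {u. u < t \<and> u \<in> - {i, Suc p + j}})"
  \<comment> \<open>the contracted legs are tested against monomials, the others against the mean value kernel
      of the coordinate at which they are evaluated\<close>
  define \<kappa> :: "nat \<Rightarrow> nat \<Rightarrow> nat \<Rightarrow> nat \<Rightarrow> nat \<Rightarrow> complex \<Rightarrow> complex" where
    "\<kappa> = (\<lambda>i j k l t z. if t = i then cnj z ^ k else if t = Suc p + j then cnj z ^ l
                     else of_real (disc_bump (x (pos i j t)) z))"
  define M where "M = (\<lambda>i j t. if t = i \<or> t = Suc p + j then 1 else 1 / ((1 - cmod (x (pos i j t))) / 2)\<^sup>2)"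
  have pos: "x (pos i j t) \<in> disc" if "i < Suc p" "j < Suc q" "t < ?n" "t \<noteq> i" "t \<noteq> Suc p + j" for i j t
  proof (rule polydisc_coordinate[OF x])
    have "{u. u < t \<and> u \<in> - {i, Suc p + j}} \<subset> {..<?n} - {i, Suc p + j}"
      using that by auto
    then have "pos i j t < card ({..<?n} - {i, Suc p + j})"
      unfolding pos_def by (intro psubset_card_mono) auto
    also have "\<dots> = p + q" using that by (subst card_Diff_subset) auto
    finally show "pos i j t < p + q" .
  qed
  have \<kappa>m: "\<kappa> i j k l t \<in> borel_measurable disc_measure"
    and \<kappa>b: "z \<in> disc \<Longrightarrow> cmod (\<kappa> i j k l t z) \<le> M i j t"
    if "i < Suc p" "j < Suc q" "t < ?n" for i j k l t z
  proof -
    have b: "(\<lambda>z. complex_of_real (disc_bump (x (pos i j t)) z)) \<in> borel_measurable disc_measure"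
      if "t \<noteq> i" "t \<noteq> Suc p + j"
      using disc_bump_measurable[OF pos[of i j t]] \<open>i < Suc p\<close> \<open>j < Suc q\<close> \<open>t < ?n\<close> that by measurable
    consider "t = i" | "t \<noteq> i" "t = Suc p + j" | "t \<noteq> i" "t \<noteq> Suc p + j" by blast
    then show "\<kappa> i j k l t \<in> borel_measurable disc_measure"
      by cases (simp_all add: \<kappa>_def conj_moment_kernel b del: power_Suc)
    show "z \<in> disc \<Longrightarrow> cmod (\<kappa> i j k l t z) \<le> M i j t"
      using conj_moment_kernel(2)[of z] disc_bump_bound[of "x (pos i j t)" z]
      by (auto simp: \<kappa>_def M_def)
  qed
  define \<Lambda>0 where "\<Lambda>0 = (\<lambda>i j N f. \<Sum>k\<le>N. G_coeff \<zeta> r s k (N - k) * product_pairing ?n (\<kappa> i j k (N - k)) f)"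
  define \<Lambda> where "\<Lambda> = (\<lambda>f. \<Sum>i<Suc p. \<Sum>j<Suc q. suminf (\<lambda>N. \<Lambda>0 i j N f))"
  have b0: "bounded_functional ?n (\<lambda>f. suminf (\<lambda>N. \<Lambda>0 i j N f))" if ij: "i < Suc p" "j < Suc q" for i j
  proof (rule bounded_functional_series)
    have kb: "bounded_functional ?n (product_pairing ?n (\<kappa> i j k l))" for k l
      by (rule product_pairing_bounded_functional[OF \<kappa>m[OF ij] \<kappa>b[OF ij]])
    have "bounded_functional ?n (\<lambda>f. G_coeff \<zeta> r s k l * product_pairing ?n (\<kappa> i j k l) f)" for k l
      by (rule bounded_functional_cmult[OF kb])
    then show "bounded_functional ?n (\<Lambda>0 i j N)" for N
      unfolding \<Lambda>0_def by (intro bounded_functional_sum)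
    show "summable (\<lambda>N. \<Sum>k\<le>N. cmod (G_coeff \<zeta> r s k (N - k)))" by (rule G_coeff_summable[OF rs])
    show "0 \<le> (\<Sum>k\<le>N. cmod (G_coeff \<zeta> r s k (N - k)))" for N by (intro sum_nonneg) auto
    show "0 \<le> (\<Prod>t<?n. M i j t)" by (intro prod_nonneg) (auto simp: M_def)
    show "cmod (\<Lambda>0 i j N f) \<le> (\<Sum>k\<le>N. cmod (G_coeff \<zeta> r s k (N - k))) * ((\<Prod>t<?n. M i j t) * A2_norm ?n f)"
      if "f \<in> A2 ?n" for N f
      unfolding \<Lambda>0_def sum_distrib_right
    proof (rule sum_norm_le)
      fix k
      have "cmod (product_pairing ?n (\<kappa> i j k (N - k)) f) \<le> (\<Prod>t<?n. M i j t) * A2_norm ?n f"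
        by (rule product_pairing_bound[OF \<kappa>m[OF ij] \<kappa>b[OF ij] that])
      then show "cmod (G_coeff \<zeta> r s k (N - k) * product_pairing ?n (\<kappa> i j k (N - k)) f)
          \<le> cmod (G_coeff \<zeta> r s k (N - k)) * ((\<Prod>t<?n. M i j t) * A2_norm ?n f)"
        unfolding norm_mult by (rule mult_left_mono) simp
    qed
  qed
  show "\<exists>\<Lambda>. bounded_functional ?n \<Lambda> \<and> (\<forall>as. length as = ?n \<longrightarrow> set as \<subseteq> bergman \<longrightarrow>
     cross_contraction (affine_map \<zeta> r) (affine_map 0 s) (take (Suc p) as) (drop (Suc p) as) x = \<Lambda> (pure_tensor as))"
  proof (intro exI[of _ \<Lambda>] conjI allI impI)
    show "bounded_functional ?n \<Lambda>" unfolding \<Lambda>_def by (intro bounded_functional_sum b0) auto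
    fix as :: "(complex \<Rightarrow> complex) list" assume as: "length as = ?n" "set as \<subseteq> bergman"
    have asq: "sqi disc_measure (as ! t)" if "t < ?n" for t
      using as that by (intro bergman_sqi) auto
    have "suminf (\<lambda>N. \<Lambda>0 i j N (pure_tensor as)) = ?kp (as ! i) (as ! (Suc p + j)) *
        pure_tensor (nths (take (Suc p) as) (- {i}) @ nths (drop (Suc p) as) (- {j})) x"
      if ij: "i < Suc p" "j < Suc q" for i j
    proof -
      let ?S = "- {i, Suc p + j}"
      have j': "i \<noteq> Suc p + j" "i < ?n" "Suc p + j < ?n" using ij by auto
      define E where "E = (\<Prod>t\<in>{..<?n} - {i} - {Suc p + j}. (as ! t) (x (pos i j t)))"
      have ptx: "pure_tensor (nths (take (Suc p) as) (- {i}) @ nths (drop (Suc p) as) (- {j})) x = E"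
      proof -
        have "nths (take (Suc p) as) (- {i}) @ nths (drop (Suc p) as) (- {j}) = nths as ?S"
          using nths_take_drop[of i "take (Suc p) as" "drop (Suc p) as" j] ij as by simp
        moreover have "length (nths (take (Suc p) as) (- {i}) @ nths (drop (Suc p) as) (- {j})) = p + q"
          using ij as by (simp add: length_nths_remove)
        ultimately have "pure_tensor (nths (take (Suc p) as) (- {i}) @ nths (drop (Suc p) as) (- {j})) x
            = (\<Prod>u<length (nths as ?S). (nths as ?S ! u) (x u))"
          using x by (simp add: pure_tensor_def)
        also have "\<dots> = E"
          unfolding nths_product E_def pos_def by (rule prod.cong) (use as in auto)
        finally show ?thesis .
      qed
      have kapv: "product_pairing ?n (\<kappa> i j k l) (pure_tensor as) = (conj_moment (as ! i) k * conj_moment (as ! (Suc p + j)) l) * E" for k l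
      proof -
        let ?F = "\<lambda>t. \<integral>z. (as ! t) z * \<kappa> i j k l t z \<partial>disc_measure"
        have "product_pairing ?n (\<kappa> i j k l) (pure_tensor as) = (\<Prod>t<?n. ?F t)"
          by (rule product_pairing_pure_tensor[OF \<kappa>m[OF ij] \<kappa>b[OF ij] as])
        also have "\<dots> = ?F i * (?F (Suc p + j) * (\<Prod>t\<in>{..<?n} - {i} - {Suc p + j}. ?F t))"
          using j' by (subst prod.remove[of _ i]; simp; subst prod.remove[of _ "Suc (p + j)"]) auto
        also have "?F i = conj_moment (as ! i) k"
          by (simp add: conj_moment_integral \<kappa>_def)
        also have "?F (Suc p + j) = conj_moment (as ! (Suc p + j)) l"
          using j'(1) by (simp add: conj_moment_integral \<kappa>_def)
        also have "(\<Prod>t\<in>{..<?n} - {i} - {Suc p + j}. ?F t) = E"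
          unfolding E_def
        proof (rule prod.cong[OF HOL.refl])
          fix t assume t: "t \<in> {..<?n} - {i} - {Suc p + j}"
          then have "?F t = (\<integral>z. disc_bump (x (pos i j t)) z *\<^sub>R (as ! t) z \<partial>disc_measure)"
            by (simp add: \<kappa>_def scaleR_conv_of_real mult.commute)
          also have "\<dots> = (as ! t) (x (pos i j t))"
            by (rule disc_mean_value) (use t as pos[OF ij, of t] in \<open>auto intro!: bergman_holomorphic\<close>)
          finally show "?F t = (as ! t) (x (pos i j t))" .
        qed
        finally show ?thesis by (simp add: mult.assoc)
      qed
      have "(\<lambda>N. (\<Sum>k\<le>N. G_coeff \<zeta> r s k (N - k) * (conj_moment (as ! i) k * conj_moment (as ! (Suc p + j)) (N - k))) * E)
         sums (?kp (as ! i) (as ! (Suc p + j)) * E)"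
        by (rule sums_mult2[OF kernel_pairing_sums[OF rs asq[OF j'(2)] asq[OF j'(3)]]])
      then have "(\<lambda>N. \<Lambda>0 i j N (pure_tensor as)) sums (?kp (as ! i) (as ! (Suc p + j)) * E)"
        by (simp only: \<Lambda>0_def kapv sum_distrib_right mult.assoc)
      then show ?thesis by (simp add: sums_iff ptx)
    qed
    then have "\<Lambda> (pure_tensor as) = (\<Sum>i<Suc p. \<Sum>j<Suc q. ?kp (as ! i) (as ! (Suc p + j)) *
        pure_tensor (nths (take (Suc p) as) (- {i}) @ nths (drop (Suc p) as) (- {j})) x)"
      unfolding \<Lambda>_def by (intro sum.cong HOL.refl) auto
    also have "\<dots> = cross_contraction (affine_map \<zeta> r) (affine_map 0 s) (take (Suc p) as) (drop (Suc p) as) x"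
      unfolding cross_contraction_def using as(1) by (intro sum.cong) auto
    finally show "cross_contraction (affine_map \<zeta> r) (affine_map 0 s) (take (Suc p) as) (drop (Suc p) as) x = \<Lambda> (pure_tensor as)"
      by simp
  qed
qed

section \<open>The exponential of the contraction\<close>

text \<open>There is no self-contraction for affine maps, so \<open>rho1\<close> reduces to \<open>rho_cl\<close>.\<close>

lemma F_kernel_affine: "r \<noteq> 0 \<Longrightarrow> F_kernel (affine_map c r) = (\<lambda>z w. 0)"
proof (intro ext)
  fix z w assume r: "r \<noteq> 0"
  have "affine_map c r z - affine_map c r w = of_real r * (z - w)"
    by (simp add: affine_map_def right_diff_distrib)
  then show "F_kernel (affine_map c r) z w = 0"
    using r by (simp add: F_kernel_def deriv_affine_map power2_eq_square)
qed

lemma self_contraction_affine: "r \<noteq> 0 \<Longrightarrow> self_contraction (affine_map c r) = (\<lambda>as x. 0)"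
  by (intro ext) (simp add: self_contraction_def F_kernel_affine kernel_pairing_def case_prod_unfold)

lemma closable_cong:
  assumes "closable p m Q" "\<And>as. length as = p \<Longrightarrow> set as \<subseteq> bergman \<Longrightarrow> Q' as = Q as"
  shows "closable p m Q'"
  using assms unfolding closable_def by simp

lemma tensor_extend_eq_zero:
  assumes "f \<in> alg_polyfun p" "\<And>as. length as = p \<Longrightarrow> set as \<subseteq> bergman \<Longrightarrow> Q as = (\<lambda>x. 0)"
  shows "tensor_extend p m Q f = (\<lambda>x. 0)"
proof -
  obtain u where u: "valid_comb p u" "f = lin_comb pure_tensor u" using assms(1) by (auto simp: alg_polyfun_def)
  have Q: "closable p m Q" by (rule closable_cong[OF closable_zero assms(2)])
  have "lin_comb Q u x = 0" for x
  proof -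
    have "map (\<lambda>(c, i). c * Q i x) u = map (\<lambda>_. 0) u"
      using valid_combD[OF u(1)] assms(2) by (intro map_cong) auto
    then show ?thesis by (simp only: lin_comb_def sum_list_0)
  qed
  then show ?thesis unfolding u(2) tensor_extend_lin_comb[OF Q u(1)] by auto
qed

lemma sum_fun_apply: "(\<Sum>i\<in>I. f i) x = (\<Sum>i\<in>I. f i x)"
  for f :: "'i \<Rightarrow> 'a \<Rightarrow> 'b::comm_monoid_add"
  by (induction I rule: infinite_finite_induct) simp_all

lemma zero_polyfun: "(0 :: polyfun) = (\<lambda>x. 0)" by auto

lemma in_degree_alg_polyfun: "f \<in> alg_polyfun p \<Longrightarrow> in_degree p f m \<in> alg_polyfun m"
  by (simp add: in_degree_def zero_polyfun alg_polyfun_zero)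

lemma del_op_affine:
  assumes "r \<noteq> 0" "\<And>p. X p \<in> alg_polyfun p"
  shows "del_op (affine_map c r) X = 0"
  unfolding del_op_def self_contraction_affine[OF assms(1)]
  by (simp add: tensor_extend_eq_zero[OF assms(2)] fun_eq_iff)

lemma op_exp_zero:
  assumes "D x = 0" "D 0 = 0" "\<And>c. sc c 0 = 0" "sc 1 x = x"
  shows "op_exp sc D x = x"
proof -
  have "(D ^^ k) 0 = 0" for k by (induction k) (simp_all add: assms)
  then have z: "(D ^^ Suc k) x = 0" for k by (simp only: funpow_Suc_right o_def assms)
  have "sc (1 / fact k) ((D ^^ k) x) = (if k = 0 then x else 0)" for k
    using z by (cases k) (simp_all add: assms del: funpow.simps)
  then have "op_exp sc D x = Sum_any (\<lambda>k::nat. if k = 0 then x else 0)"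
    by (simp add: op_exp_def)
  also have "\<dots> = (\<Sum>k\<in>{0::nat}. if k = 0 then x else 0)"
    by (rule Sum_any.expand_superset) auto
  finally show ?thesis by simp
qed

lemma tens_scale_add: "tens_scale c (x + y) = tens_scale c x + tens_scale c y"
  "tens_scale c (tens_scale d x) = tens_scale (c * d) x"
  by (auto simp: tens_scale_def fun_eq_iff algebra_simps)

lemma tens_scale_sum: "tens_scale c (\<Sum>i\<in>I. f i) = (\<Sum>i\<in>I. tens_scale c (f i))"
  by (intro ext) (simp add: tens_scale_def sum_fun_apply sum_distrib_left)

lemma nths_replicate_remove: "i < Suc n \<Longrightarrow> nths (replicate (Suc n) a) (- {i}) = replicate n a"
proof -
  assume i: "i < Suc n"
  have "length (nths (replicate (Suc n) a) (- {i})) = n"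
    using length_nths_remove[of i "replicate (Suc n) a"] i by simp
  moreover have "\<forall>y\<in>set (nths (replicate (Suc n) a) (- {i})). y = a"
    by (auto dest!: in_set_nthsD)
  ultimately show ?thesis by (metis replicate_eqI)
qed

lemma symmetrize_lin: "symmetrize n (\<lambda>x. f x + g x) x = symmetrize n f x + symmetrize n g x"
  "symmetrize n (\<lambda>x. c * f x) x = c * symmetrize n f x"
  by (simp_all add: symmetrize_def sum.distrib add_divide_distrib sum_distrib_left)

lemma closable_rho_cl:
  assumes "0 < r" "ball c r \<subseteq> disc"
  shows "closable p p (\<lambda>as. pure_tensor (map (rho_cl1 (affine_map c r)) as))"
proof (rule closable_tensor_map[where R = "\<lambda>_. rho_cl1 (affine_map c r)"])
  show "point_kernel (rho_cl1 (affine_map c r))" by (rule point_kernel_rho[OF assms])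
  fix as :: "(complex \<Rightarrow> complex) list" assume "length as = p"
  then have "map (rho_cl1 (affine_map c r)) as = map (\<lambda>i. rho_cl1 (affine_map c r) (as ! i)) [0..<p]"
    by (intro nth_equalityI) auto
  then show "pure_tensor (map (rho_cl1 (affine_map c r)) as) = pure_tensor (map (\<lambda>i. rho_cl1 (affine_map c r) (as ! i)) [0..<p])"
    by simp
qed

lemma rho1_pure:
  assumes r: "0 < r" "ball c r \<subseteq> disc" and as: "length as = p" "set as \<subseteq> bergman"
  shows "rho1 (affine_map c r) (in_degree p (pure_tensor as)) m
    = (if m = p then pure_tensor (map (rho_cl1 (affine_map c r)) as) else (\<lambda>x. 0))"
proof -
  have a: "in_degree p (pure_tensor as) k \<in> alg_polyfun k" for k
    using alg_polyfun_pure[OF as(2)] as(1) by (auto intro!: in_degree_alg_polyfun)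
  have "op_exp tens_scale (del_op (affine_map c r)) (in_degree p (pure_tensor as)) = in_degree p (pure_tensor as)"
  proof (rule op_exp_zero)
    show "del_op (affine_map c r) (in_degree p (pure_tensor as)) = 0"
      by (rule del_op_affine[OF _ a]) (use r in simp)
    show "del_op (affine_map c r) 0 = 0"
      by (rule del_op_affine) (use r in \<open>simp_all add: zero_polyfun alg_polyfun_zero\<close>)
  qed simp_all
  then show ?thesis
    using tensor_extend_pure[OF closable_rho_cl[OF r] as] tensor_extend_zero[OF closable_rho_cl[OF r]]
    by (simp add: rho1_def rho_cl_def in_degree_def zero_polyfun)
qed

lemma polydisc_restrict: "x \<in> polydisc (p + q) \<Longrightarrow> restrict x {..<p} \<in> polydisc p"
  by (simp add: polydisc_def PiE_iff)

lemma polydisc_shift: "x \<in> polydisc (p + q) \<Longrightarrow> (\<lambda>i\<in>{..<q}. x (p + i)) \<in> polydisc q"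
  by (simp add: polydisc_def PiE_iff)

lemma prod_lessThan_add: "(\<Prod>i<p + q. f i) = (\<Prod>i<p. f i) * (\<Prod>i<q. f (p + i))" for f :: "nat \<Rightarrow> complex"
  by (induction q) (auto simp: mult.assoc)

lemma tensor_prod_pure:
  "length as = p \<Longrightarrow> length bs = q \<Longrightarrow> tensor_prod p q (pure_tensor as) (pure_tensor bs) = pure_tensor (as @ bs)"
proof
  fix x assume l: "length as = p" "length bs = q"
  show "tensor_prod p q (pure_tensor as) (pure_tensor bs) x = pure_tensor (as @ bs) x"
  proof (cases "x \<in> polydisc (p + q)")
    case True
    have "(\<Prod>i<p + q. ((as @ bs) ! i) (x i)) = (\<Prod>i<p. (as ! i) (x i)) * (\<Prod>i<q. (bs ! i) (x (p + i)))"
      unfolding prod_lessThan_add using l by (intro arg_cong2[where f = "(*)"] prod.cong) (auto simp: nth_append)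
    with True polydisc_restrict[OF True] polydisc_shift[OF True] show ?thesis
      by (simp add: tensor_prod_def pure_tensor_def l)
  qed (simp add: tensor_prod_def pure_tensor_def l)
qed

lemma tensor_prod_zero: "tensor_prod p q (\<lambda>x. 0) g = (\<lambda>x. 0)" "tensor_prod p q f (\<lambda>x. 0) = (\<lambda>x. 0)"
  by (auto simp: tensor_prod_def)

lemma tensor_prod_alg_polyfun:
  assumes f: "f \<in> alg_polyfun p" and g: "g \<in> alg_polyfun q"
  shows "tensor_prod p q f g \<in> alg_polyfun (p + q)"
proof -
  obtain u v where u: "valid_comb p u" "f = lin_comb pure_tensor u" and v: "valid_comb q v" "g = lin_comb pure_tensor v"
    using assms by (auto simp: alg_polyfun_def)
  have 1: "tensor_prod p q (pure_tensor as) (lin_comb pure_tensor v) \<in> alg_polyfun (p + q)"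
    if as: "length as = p" "set as \<subseteq> bergman" for as
    using v(1)
  proof (induction v)
    case Nil
    show ?case by (simp add: lin_comb_simps tensor_prod_zero alg_polyfun_zero)
  next
    case (Cons y v)
    obtain c bs where y: "y = (c, bs)" by (cases y)
    have "tensor_prod p q (pure_tensor as) (lin_comb pure_tensor (y # v))
       = (\<lambda>x. c * tensor_prod p q (pure_tensor as) (pure_tensor bs) x + tensor_prod p q (pure_tensor as) (lin_comb pure_tensor v) x)"
      by (auto simp: y lin_comb_simps tensor_prod_def algebra_simps)
    moreover have "tensor_prod p q (pure_tensor as) (pure_tensor bs) \<in> alg_polyfun (p + q)"
      using Cons.prems as alg_polyfun_pure[of "as @ bs"] by (simp add: y valid_comb_def tensor_prod_pure)
    ultimately show ?case using Cons by (auto simp: valid_comb_def intro!: alg_polyfun_add alg_polyfun_scale)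
  qed
  show ?thesis unfolding u(2) v(2)
    using u(1)
  proof (induction u)
    case Nil
    show ?case by (simp add: lin_comb_simps tensor_prod_zero alg_polyfun_zero)
  next
    case (Cons y u)
    obtain c as where y: "y = (c, as)" by (cases y)
    have "tensor_prod p q (lin_comb pure_tensor (y # u)) (lin_comb pure_tensor v)
       = (\<lambda>x. c * tensor_prod p q (pure_tensor as) (lin_comb pure_tensor v) x + tensor_prod p q (lin_comb pure_tensor u) (lin_comb pure_tensor v) x)"
      by (auto simp: y lin_comb_simps tensor_prod_def algebra_simps)
    moreover have "tensor_prod p q (pure_tensor as) (lin_comb pure_tensor v) \<in> alg_polyfun (p + q)"
      using Cons.prems by (intro 1) (auto simp: y valid_comb_def)
    ultimately show ?case using Cons by (auto simp: valid_comb_def intro!: alg_polyfun_add alg_polyfun_scale)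
  qed
qed

text \<open>A bound on the left degree alone already makes the contraction, which lowers both degrees, nilpotent.\<close>

definition alg_bitens :: "nat \<Rightarrow> bitens set" where
  "alg_bitens K = {X. (\<forall>p q. X p q \<in> alg_polyfun (p + q)) \<and> (\<forall>p q. p > K \<longrightarrow> X p q = 0)}"

definition in_bidegree :: "nat \<Rightarrow> nat \<Rightarrow> polyfun \<Rightarrow> bitens" where
  "in_bidegree p q f = (\<lambda>p' q'. if p' = p \<and> q' = q then f else 0)"

lemma alg_bitens_add: "X \<in> alg_bitens K \<Longrightarrow> Y \<in> alg_bitens K \<Longrightarrow> X + Y \<in> alg_bitens K"
  by (auto simp: alg_bitens_def plus_fun_def intro: alg_polyfun_add)

lemma alg_bitens_scale: "X \<in> alg_bitens K \<Longrightarrow> bitens_scale c X \<in> alg_bitens K"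
  by (auto simp: alg_bitens_def bitens_scale_def zero_polyfun intro: alg_polyfun_scale)

lemma alg_bitens_mono: "X \<in> alg_bitens K \<Longrightarrow> K \<le> K' \<Longrightarrow> X \<in> alg_bitens K'"
  by (auto simp: alg_bitens_def)

lemma alg_bitens_zero: "0 \<in> alg_bitens K"
  by (simp add: alg_bitens_def zero_polyfun alg_polyfun_zero)

lemma alg_bitens_in_bidegree: "f \<in> alg_polyfun (p + q) \<Longrightarrow> in_bidegree p q f \<in> alg_bitens p"
  by (auto simp: alg_bitens_def in_bidegree_def zero_polyfun alg_polyfun_zero)

lemma alg_bitens_sum: "(\<And>i. i \<in> I \<Longrightarrow> X i \<in> alg_bitens K) \<Longrightarrow> (\<Sum>i\<in>I. X i) \<in> alg_bitens K"
  by (induction I rule: infinite_finite_induct) (auto simp: alg_bitens_zero intro: alg_bitens_add)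

lemma bitens_scale_simps:
  "bitens_scale c 0 = 0" "bitens_scale 0 X = 0" "bitens_scale 1 X = X"
  "bitens_scale c (X + Y) = bitens_scale c X + bitens_scale c Y"
  "bitens_scale c (bitens_scale d X) = bitens_scale (c * d) X"
  by (auto simp: bitens_scale_def fun_eq_iff algebra_simps)

lemma alg_bitensD: "X \<in> alg_bitens K \<Longrightarrow> X p q \<in> alg_polyfun (p + q)"
  by (simp add: alg_bitens_def)

context
  fixes \<zeta> :: complex and r s :: real
  assumes rs: "0 < r" "0 < s" "r + s < cmod \<zeta>"
    and sub: "ball \<zeta> r \<subseteq> disc" "ball 0 s \<subseteq> disc"
begin

abbreviation (input) "phi \<equiv> affine_map \<zeta> r"
abbreviation (input) "psi \<equiv> affine_map 0 s"
abbreviation (input) "contract \<equiv> C_hat phi psi"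

lemmas closable_cross = closable_cross_contraction[OF rs]

lemma cross_contraction_alg_polyfun:
  assumes "length as = Suc p + Suc q" "set as \<subseteq> bergman"
  shows "cross_contraction phi psi (take (Suc p) as) (drop (Suc p) as) \<in> alg_polyfun (p + q)"
proof -
  have "pure_tensor (nths (take (Suc p) as) (- {i}) @ nths (drop (Suc p) as) (- {j})) \<in> alg_polyfun (p + q)"
    if "i < Suc p" "j < Suc q" for i j
  proof -
    have "length (nths (take (Suc p) as) (- {i}) @ nths (drop (Suc p) as) (- {j})) = p + q"
      using that assms by (simp add: length_nths_remove)
    moreover have "set (nths (take (Suc p) as) (- {i}) @ nths (drop (Suc p) as) (- {j})) \<subseteq> bergman"
      using assms(2) by (auto dest!: in_set_nthsD in_set_takeD in_set_dropD)
    ultimately show ?thesis using alg_polyfun_pure by metis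
  qed
  then show ?thesis
    unfolding cross_contraction_def using assms(1) by (intro alg_polyfun_sum alg_polyfun_scale) auto
qed

lemma contract_alg_bitens:
  assumes X: "X \<in> alg_bitens K"
  shows "contract X \<in> alg_bitens K"
  unfolding alg_bitens_def
proof (intro CollectI conjI allI impI)
  show "contract X p q \<in> alg_polyfun (p + q)" for p q
    unfolding C_hat_def by (rule tensor_extend_alg_polyfun[OF closable_cross alg_bitensD[OF X] cross_contraction_alg_polyfun])
  show "contract X p q = 0" if "K < p" for p q
  proof -
    have "X (Suc p) (Suc q) = (\<lambda>x. 0)" using X that by (auto simp: alg_bitens_def)
    then show ?thesis unfolding C_hat_def zero_polyfun by (simp add: tensor_extend_zero[OF closable_cross] del: add_Suc add_Suc_right)
  qed
qed

lemma contract_add: "X \<in> alg_bitens K \<Longrightarrow> Y \<in> alg_bitens K \<Longrightarrow> contract (X + Y) = contract X + contract Y"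
  unfolding C_hat_def plus_fun_def
  by (intro ext) (simp only: tensor_extend_add[OF closable_cross alg_bitensD alg_bitensD])

lemma contract_scale: "X \<in> alg_bitens K \<Longrightarrow> contract (bitens_scale c X) = bitens_scale c (contract X)"
  unfolding C_hat_def bitens_scale_def
  by (intro ext) (simp only: tensor_extend_scale[OF closable_cross alg_bitensD])

lemma contract_pow_alg_bitens: "X \<in> alg_bitens K \<Longrightarrow> (contract ^^ k) X \<in> alg_bitens K"
  by (induction k) (auto intro: contract_alg_bitens)

lemma contract_pow_add: "X \<in> alg_bitens K \<Longrightarrow> Y \<in> alg_bitens K \<Longrightarrow> (contract ^^ k) (X + Y) = (contract ^^ k) X + (contract ^^ k) Y"
  by (induction k) (auto simp: contract_add[OF contract_pow_alg_bitens contract_pow_alg_bitens])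

lemma contract_pow_scale: "X \<in> alg_bitens K \<Longrightarrow> (contract ^^ k) (bitens_scale c X) = bitens_scale c ((contract ^^ k) X)"
  by (induction k) (auto simp: contract_scale[OF contract_pow_alg_bitens])

lemma contract_pow_support: "X \<in> alg_bitens K \<Longrightarrow> p + k > K \<Longrightarrow> (contract ^^ k) X p q = 0"
proof (induction k arbitrary: p q)
  case (Suc k)
  have "(contract ^^ k) X (Suc p) (Suc q) = (\<lambda>x. 0)" using Suc.IH[OF Suc.prems(1), of "Suc p"] Suc.prems(2) by auto
  then show ?case
    unfolding funpow.simps o_def C_hat_def[of _ _ "(contract ^^ k) X"] zero_polyfun
    by (simp add: tensor_extend_zero[OF closable_cross] del: add_Suc add_Suc_right)
qed (simp add: alg_bitens_def)

lemma op_exp_contract: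
  assumes X: "X \<in> alg_bitens K"
  shows "op_exp bitens_scale contract X = (\<Sum>k\<le>K. bitens_scale (1 / fact k) ((contract ^^ k) X))"
  unfolding op_exp_def
proof (rule Sum_any.expand_superset)
  show "{k. bitens_scale (1 / fact k) ((contract ^^ k) X) \<noteq> 0} \<subseteq> {..K}"
  proof (rule subsetI, rule ccontr)
    fix k assume k: "k \<in> {k. bitens_scale (1 / fact k) ((contract ^^ k) X) \<noteq> 0}" "k \<notin> {..K}"
    then have "(contract ^^ k) X p q = 0" for p q using contract_pow_support[OF X, of p k q] by simp
    then have "(contract ^^ k) X = 0" by (intro ext) simp
    then show False using k by (simp add: bitens_scale_simps)
  qed
qed simp

text \<open>The tensor product of the two maps \<open>rho_cl1\<close>, the first \<open>m\<close> factors belonging to the left one.\<close>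

definition rho_cl_tensor :: "nat \<Rightarrow> (complex \<Rightarrow> complex) list \<Rightarrow> polyfun" where
  "rho_cl_tensor m as = pure_tensor (map (rho_cl1 phi) (take m as) @ map (rho_cl1 psi) (drop m as))"

lemma closable_rho_cl_tensor: "closable (m + n) (m + n) (rho_cl_tensor m)"
proof (rule closable_tensor_map[where R = "\<lambda>i. rho_cl1 (if i < m then phi else psi)"])
  show "point_kernel (rho_cl1 (if i < m then phi else psi))" for i
    using point_kernel_rho[OF rs(1) sub(1)] point_kernel_rho[OF rs(2) sub(2)] by simp
  fix as :: "(complex \<Rightarrow> complex) list" assume "length as = m + n"
  then have "map (rho_cl1 phi) (take m as) @ map (rho_cl1 psi) (drop m as)
      = map (\<lambda>i. rho_cl1 (if i < m then phi else psi) (as ! i)) [0..<m + n]"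
    by (intro nth_equalityI) (auto simp: nth_append min_def)
  then show "rho_cl_tensor m as = pure_tensor (map (\<lambda>i. rho_cl1 (if i < m then phi else psi) (as ! i)) [0..<m + n])"
    by (simp add: rho_cl_tensor_def)
qed

text \<open>As \<open>rho1\<close> preserves degrees here, only the summand of bidegree \<open>(m, n)\<close> survives.\<close>

lemma rho1_tensor_eq:
  assumes X: "\<And>p q. X p q \<in> alg_polyfun (p + q)"
  shows "rho1_tensor phi psi X m n = tensor_extend (m + n) (m + n) (rho_cl_tensor m) (X m n)"
proof -
  let ?Q = "\<lambda>p q as. tensor_prod m n
        (rho1 phi (in_degree p (pure_tensor (take p as))) m)
        (rho1 psi (in_degree q (pure_tensor (drop p as))) n)"
  have val: "?Q p q as = (if m = p \<and> n = q then rho_cl_tensor m as else (\<lambda>x. 0))"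
    if as: "length as = p + q" "set as \<subseteq> bergman" for p q as
  proof -
    have sets: "set (take p as) \<subseteq> bergman" "set (drop p as) \<subseteq> bergman"
      using as(2) set_take_subset set_drop_subset by fastforce+
    have 1: "rho1 phi (in_degree p (pure_tensor (take p as))) m
        = (if m = p then pure_tensor (map (rho_cl1 phi) (take p as)) else (\<lambda>x. 0))"
      by (rule rho1_pure[OF rs(1) sub(1)]) (use as sets in auto)
    have 2: "rho1 psi (in_degree q (pure_tensor (drop p as))) n
        = (if n = q then pure_tensor (map (rho_cl1 psi) (drop p as)) else (\<lambda>x. 0))"
      by (rule rho1_pure[OF rs(2) sub(2)]) (use as sets in auto)
    show ?thesis
      unfolding 1 2 rho_cl_tensor_def using as(1) by (auto simp: tensor_prod_zero tensor_prod_pure)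
  qed
  have other: "tensor_extend (p + q) (m + n) (?Q p q) (X p q) = (\<lambda>x. 0)" if "(p, q) \<noteq> (m, n)" for p q
    by (rule tensor_extend_eq_zero[OF X]) (use val that in auto)
  have same: "tensor_extend (m + n) (m + n) (?Q m n) (X m n) = tensor_extend (m + n) (m + n) (rho_cl_tensor m) (X m n)"
  proof -
    obtain u where u: "valid_comb (m + n) u" "X m n = lin_comb pure_tensor u"
      using X[of m n] by (auto simp: alg_polyfun_def)
    have Q: "closable (m + n) (m + n) (?Q m n)"
      by (rule closable_cong[OF closable_rho_cl_tensor]) (use val in auto)
    have "lin_comb (?Q m n) u = lin_comb (rho_cl_tensor m) u"
      unfolding lin_comb_def
      by (intro ext arg_cong[where f = sum_list] map_cong) (use valid_combD[OF u(1)] val in auto)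
    then show ?thesis
      unfolding u(2) tensor_extend_lin_comb[OF Q u(1)] tensor_extend_lin_comb[OF closable_rho_cl_tensor u(1)] .
  qed
  have "rho1_tensor phi psi X m n = (\<Sum>(p, q)\<in>{(m, n)}. tensor_extend (p + q) (m + n) (?Q p q) (X p q))"
    unfolding rho1_tensor_def
    by (rule Sum_any.expand_superset) (use other in \<open>auto simp: zero_polyfun\<close>)
  then show ?thesis using same by simp
qed

text \<open>The part of the binary operation that follows the exponential.\<close>

definition push_forward :: "bitens \<Rightarrow> tens" where
  "push_forward X = S_hat (rho1_tensor phi psi X)"

lemma push_forward_eq:
  assumes "X \<in> alg_bitens K"
  shows "push_forward X = (\<lambda>n x. \<Sum>p\<le>n. symmetrize n (tensor_extend n n (rho_cl_tensor p) (X p (n - p))) x)"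
proof (intro ext)
  fix n x
  have "rho1_tensor phi psi X p (n - p) = tensor_extend n n (rho_cl_tensor p) (X p (n - p))" if "p \<le> n" for p
    using rho1_tensor_eq[of X p "n - p"] assms that by (simp add: alg_bitens_def)
  then show "push_forward X n x = (\<Sum>p\<le>n. symmetrize n (tensor_extend n n (rho_cl_tensor p) (X p (n - p))) x)"
    by (simp add: push_forward_def S_hat_def sum_fun_apply)
qed

lemma closable_Qmap': "p \<le> n \<Longrightarrow> closable n n (rho_cl_tensor p)"
  using closable_rho_cl_tensor[of p "n - p"] by simp

lemma alg_bitensD': "X \<in> alg_bitens K \<Longrightarrow> p \<le> n \<Longrightarrow> X p (n - p) \<in> alg_polyfun n"
  using alg_bitensD[of X K p "n - p"] by simp

lemma push_forward_add:
  assumes "X \<in> alg_bitens K" "Y \<in> alg_bitens K"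
  shows "push_forward (X + Y) = push_forward X + push_forward Y"
proof (intro ext)
  fix n x
  have "tensor_extend n n (rho_cl_tensor p) ((X + Y) p (n - p))
      = (\<lambda>x. tensor_extend n n (rho_cl_tensor p) (X p (n - p)) x + tensor_extend n n (rho_cl_tensor p) (Y p (n - p)) x)"
    if "p \<le> n" for p
    unfolding plus_fun_def
    by (rule tensor_extend_add[OF closable_Qmap'[OF that] alg_bitensD'[OF assms(1) that] alg_bitensD'[OF assms(2) that]])
  then show "push_forward (X + Y) n x = (push_forward X + push_forward Y) n x"
    unfolding push_forward_eq[OF alg_bitens_add[OF assms]] push_forward_eq[OF assms(1)] push_forward_eq[OF assms(2)]
    by (simp add: symmetrize_lin sum.distrib)
qed

lemma push_forward_scale:
  assumes "X \<in> alg_bitens K"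
  shows "push_forward (bitens_scale c X) = tens_scale c (push_forward X)"
proof (intro ext)
  fix n x
  have "tensor_extend n n (rho_cl_tensor p) (bitens_scale c X p (n - p))
      = (\<lambda>x. c * tensor_extend n n (rho_cl_tensor p) (X p (n - p)) x)" if "p \<le> n" for p
    unfolding bitens_scale_def
    by (rule tensor_extend_scale[OF closable_Qmap'[OF that] alg_bitensD'[OF assms that]])
  then show "push_forward (bitens_scale c X) n x = tens_scale c (push_forward X) n x"
    unfolding push_forward_eq[OF alg_bitens_scale[OF assms]] push_forward_eq[OF assms]
    by (simp add: symmetrize_lin sum_distrib_left tens_scale_def)
qed

lemma push_forward_zero: "push_forward 0 = 0"
proof -
  have "tens_scale 0 (push_forward 0) = 0" by (simp add: tens_scale_def fun_eq_iff)
  then show ?thesis using push_forward_scale[OF alg_bitens_zero, of 0] unfolding bitens_scale_simps by (simp only:)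
qed

lemma push_forward_sum:
  assumes "\<And>i. i \<in> I \<Longrightarrow> X i \<in> alg_bitens K"
  shows "push_forward (\<Sum>i\<in>I. X i) = (\<Sum>i\<in>I. push_forward (X i))"
  using assms
proof (induction I rule: infinite_finite_induct)
  case (insert i I)
  have "push_forward (X i + (\<Sum>i\<in>I. X i)) = push_forward (X i) + push_forward (\<Sum>i\<in>I. X i)"
    by (rule push_forward_add[OF insert.prems alg_bitens_sum[OF insert.prems]]) auto
  moreover have "push_forward (\<Sum>i\<in>I. X i) = (\<Sum>i\<in>I. push_forward (X i))"
    by (rule insert.IH) (auto intro: insert.prems)
  ultimately show ?case by (simp only: sum.insert[OF insert.hyps])
qed (simp_all add: push_forward_zero)

lemma push_forward_in_bidegree_pure:
  assumes "length as = p + q" "set as \<subseteq> bergman"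
  shows "push_forward (in_bidegree p q (pure_tensor as)) = in_degree (p + q) (symmetrize (p + q) (rho_cl_tensor p as))"
proof (intro ext)
  fix n x
  have b: "in_bidegree p q (pure_tensor as) \<in> alg_bitens p"
    using alg_polyfun_pure[OF assms(2)] assms(1) by (intro alg_bitens_in_bidegree) simp
  have sz: "symmetrize n (\<lambda>x. 0) x = 0" for n x by (simp add: symmetrize_def)
  have "symmetrize n (tensor_extend n n (rho_cl_tensor p') (in_bidegree p q (pure_tensor as) p' (n - p'))) x
      = (if p' = p then (if n = p + q then symmetrize n (rho_cl_tensor p as) x else 0) else 0)" if "p' \<le> n" for p'
  proof (cases "p' = p \<and> n - p' = q")
    case True
    then have n: "n = p + q" using that by auto
    then have "tensor_extend n n (rho_cl_tensor p) (pure_tensor as) = rho_cl_tensor p as"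
      using tensor_extend_pure[OF closable_rho_cl_tensor[of p q]] assms by simp
    then show ?thesis using True n by (simp add: in_bidegree_def)
  next
    case False
    then have z: "in_bidegree p q (pure_tensor as) p' (n - p') = (\<lambda>x. 0)" by (auto simp: in_bidegree_def)
    have "tensor_extend n n (rho_cl_tensor p') (\<lambda>x. 0) = (\<lambda>x. 0)"
      by (rule tensor_extend_zero[OF closable_Qmap'[OF that]])
    then show ?thesis using False that by (auto simp: z sz)
  qed
  then have "push_forward (in_bidegree p q (pure_tensor as)) n x
      = (\<Sum>p'\<le>n. if p' = p then (if n = p + q then symmetrize n (rho_cl_tensor p as) x else 0) else 0)"
    unfolding push_forward_eq[OF b] by (intro sum.cong) auto
  also have "\<dots> = in_degree (p + q) (symmetrize (p + q) (rho_cl_tensor p as)) n x"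
    by (auto simp: in_degree_def)
  finally show "push_forward (in_bidegree p q (pure_tensor as)) n x = in_degree (p + q) (symmetrize (p + q) (rho_cl_tensor p as)) n x" .
qed

definition rho_raw :: "bitens \<Rightarrow> tens" where
  "rho_raw X = push_forward (op_exp bitens_scale contract X)"

lemma rho_raw_eq:
  assumes "X \<in> alg_bitens K"
  shows "rho_raw X = (\<Sum>k\<le>K. tens_scale (1 / fact k) (push_forward ((contract ^^ k) X)))"
  unfolding rho_raw_def op_exp_contract[OF assms]
  by (subst push_forward_sum[where K = K])
     (auto intro!: alg_bitens_scale contract_pow_alg_bitens assms sum.cong simp: push_forward_scale[OF contract_pow_alg_bitens[OF assms]])

lemma rho_raw_add:
  assumes "X \<in> alg_bitens K" "Y \<in> alg_bitens K"
  shows "rho_raw (X + Y) = rho_raw X + rho_raw Y"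
  unfolding rho_raw_eq[OF alg_bitens_add[OF assms]] rho_raw_eq[OF assms(1)] rho_raw_eq[OF assms(2)]
    contract_pow_add[OF assms] push_forward_add[OF contract_pow_alg_bitens[OF assms(1)] contract_pow_alg_bitens[OF assms(2)]]
    tens_scale_add sum.distrib ..

lemma rho_raw_scale:
  assumes "X \<in> alg_bitens K"
  shows "rho_raw (bitens_scale c X) = tens_scale c (rho_raw X)"
  unfolding rho_raw_eq[OF alg_bitens_scale[OF assms]] rho_raw_eq[OF assms] contract_pow_scale[OF assms]
    push_forward_scale[OF contract_pow_alg_bitens[OF assms]] tens_scale_add tens_scale_sum
  by (simp add: mult.commute)

context
  fixes A B :: "complex \<Rightarrow> complex"
  assumes AB: "A \<in> bergman" "B \<in> bergman"
begin

abbreviation (input) "cAB \<equiv> kernel_pairing (G_kernel phi psi) A B"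
abbreviation (input) "AB p q \<equiv> pure_tensor (replicate p A @ replicate q B)"

lemma AB_list: "length (replicate p A @ replicate q B) = p + q" "set (replicate p A @ replicate q B) \<subseteq> bergman"
  using AB by (auto simp: set_replicate_conv_if)

lemma AB_alg_polyfun: "AB p q \<in> alg_polyfun (p + q)"
  using alg_polyfun_pure[OF AB_list(2), of p q] by simp

lemma contract_power: "contract (in_bidegree (Suc p) (Suc q) (AB (Suc p) (Suc q)))
    = bitens_scale (of_nat (Suc p) * of_nat (Suc q) * cAB) (in_bidegree p q (AB p q))"
proof (intro ext)
  fix p' q' x
  show "contract (in_bidegree (Suc p) (Suc q) (AB (Suc p) (Suc q))) p' q' x
    = bitens_scale (of_nat (Suc p) * of_nat (Suc q) * cAB) (in_bidegree p q (AB p q)) p' q' x"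
  proof (cases "p' = p \<and> q' = q")
    case True
    have "tensor_extend (Suc p + Suc q) (p + q) (\<lambda>as. cross_contraction phi psi (take (Suc p) as) (drop (Suc p) as)) (AB (Suc p) (Suc q))
        = cross_contraction phi psi (replicate (Suc p) A) (replicate (Suc q) B)"
      using tensor_extend_pure[OF closable_cross AB_list[of "Suc p" "Suc q"]] by (simp del: replicate_Suc)
    also have "\<dots> = (\<lambda>x. \<Sum>i<Suc p. \<Sum>j<Suc q. cAB * AB p q x)"
      unfolding cross_contraction_def
    proof (intro ext, unfold length_replicate, intro sum.cong HOL.refl)
      fix x i j assume "i \<in> {..<Suc p}" "j \<in> {..<Suc q}"
      then have ij: "i < Suc p" "j < Suc q" by auto
      show "kernel_pairing (G_kernel phi psi) (replicate (Suc p) A ! i) (replicate (Suc q) B ! j) *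
          pure_tensor (nths (replicate (Suc p) A) (- {i}) @ nths (replicate (Suc q) B) (- {j})) x = cAB * AB p q x"
        unfolding nths_replicate_remove[OF ij(1)] nths_replicate_remove[OF ij(2)] using ij
        by (simp del: replicate_Suc)
    qed
    finally show ?thesis
      using True by (simp add: C_hat_def in_bidegree_def bitens_scale_def mult.assoc del: replicate_Suc of_nat_Suc add_Suc add_Suc_right)
  next
    case False
    then have "in_bidegree (Suc p) (Suc q) (AB (Suc p) (Suc q)) (Suc p') (Suc q') = (\<lambda>x. 0)" "in_bidegree p q (AB p q) p' q' = (\<lambda>x. 0)"
      by (auto simp: in_bidegree_def)
    then show ?thesis
      by (simp add: C_hat_def bitens_scale_def tensor_extend_zero[OF closable_cross] del: add_Suc add_Suc_right)
  qed
qed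

lemma contract_power_0:
  assumes "p = 0 \<or> q = 0"
  shows "contract (in_bidegree p q f) = 0"
proof (intro ext)
  fix p' q' x
  have "in_bidegree p q f (Suc p') (Suc q') = (\<lambda>x. 0)" using assms by (auto simp: in_bidegree_def)
  then show "contract (in_bidegree p q f) p' q' x = 0 p' q' x"
    by (simp add: C_hat_def tensor_extend_zero[OF closable_cross] del: add_Suc add_Suc_right)
qed

lemma contract_iterate:
  "k \<le> min p q \<Longrightarrow> (contract ^^ k) (in_bidegree p q (AB p q))
    = bitens_scale (fact p * fact q / (fact (p - k) * fact (q - k)) * cAB ^ k) (in_bidegree (p - k) (q - k) (AB (p - k) (q - k)))"
proof (induction k)
  case (Suc k)
  define p' q' where "p' = p - Suc k" and "q' = q - Suc k"
  have e: "p - k = Suc p'" "q - k = Suc q'" using Suc.prems by (auto simp: p'_def q'_def)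
  have "(contract ^^ Suc k) (in_bidegree p q (AB p q))
      = contract (bitens_scale (fact p * fact q / (fact (p - k) * fact (q - k)) * cAB ^ k) (in_bidegree (p - k) (q - k) (AB (p - k) (q - k))))"
    using Suc by simp
  also have "\<dots> = bitens_scale (fact p * fact q / (fact (p - k) * fact (q - k)) * cAB ^ k) (contract (in_bidegree (p - k) (q - k) (AB (p - k) (q - k))))"
    by (rule contract_scale[OF alg_bitens_in_bidegree[OF AB_alg_polyfun]])
  also have "\<dots> = bitens_scale (fact p * fact q / (fact (p - k) * fact (q - k)) * cAB ^ k *
      (of_nat (Suc p') * of_nat (Suc q') * cAB)) (in_bidegree p' q' (AB p' q'))"
    unfolding e contract_power bitens_scale_simps ..
  also have "fact p * fact q / (fact (p - k) * fact (q - k)) * cAB ^ k * (of_nat (Suc p') * of_nat (Suc q') * cAB)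
      = fact p * fact q / (fact p' * fact q') * cAB ^ Suc k"
  proof -
    have n: "complex_of_nat (Suc p') \<noteq> 0" "complex_of_nat (Suc q') \<noteq> 0" by (simp_all only: of_nat_neq_0 not_False_eq_True)
    show ?thesis unfolding e fact_Suc using n
      by (simp add: field_simps del: of_nat_Suc)
  qed
  finally show ?case unfolding p'_def q'_def .
qed (simp add: bitens_scale_simps)

lemma contract_iterate_0: "min p q < k \<Longrightarrow> (contract ^^ k) (in_bidegree p q (AB p q)) = 0"
proof (induction k)
  case (Suc k)
  show ?case
  proof (cases "k \<le> min p q")
    case True
    then have k: "k = min p q" using Suc.prems by linarith
    have "(contract ^^ Suc k) (in_bidegree p q (AB p q))
      = contract (bitens_scale (fact p * fact q / (fact (p - k) * fact (q - k)) * cAB ^ k) (in_bidegree (p - k) (q - k) (AB (p - k) (q - k))))"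
      using contract_iterate[OF True] by simp
    also have "\<dots> = bitens_scale (fact p * fact q / (fact (p - k) * fact (q - k)) * cAB ^ k) (contract (in_bidegree (p - k) (q - k) (AB (p - k) (q - k))))"
      by (rule contract_scale[OF alg_bitens_in_bidegree[OF AB_alg_polyfun]])
    also have "\<dots> = 0"
      by (subst contract_power_0) (use k in \<open>auto simp: bitens_scale_simps min_def\<close>)
    finally show ?thesis .
  next
    case False
    then have "min p q < k" by linarith
    then have "(contract ^^ k) (in_bidegree p q (AB p q)) = 0" by (rule Suc.IH)
    moreover have "contract 0 = 0"
      using contract_scale[OF alg_bitens_zero, of 0] unfolding bitens_scale_simps .
    ultimately show ?thesis unfolding funpow.simps o_apply by (simp only:)
  qed
qed simp

text \<open>On a pair of powers the exponential of the contraction becomes an explicit sum over the number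
  \<open>k\<close> of contracted pairs.\<close>

lemma rho_raw_powers:
  "rho_raw (in_bidegree p q (AB p q)) = (\<Sum>k\<le>min p q.
     tens_scale (cAB ^ k * fact p * fact q / (fact k * fact (p - k) * fact (q - k)))
      (in_degree (p - k + (q - k)) (symmetrize (p - k + (q - k))
         (pure_tensor (replicate (p - k) (rho_cl1 phi A) @ replicate (q - k) (rho_cl1 psi B))))))"
proof -
  have "rho_raw (in_bidegree p q (AB p q)) = (\<Sum>k\<le>p. tens_scale (1 / fact k) (push_forward ((contract ^^ k) (in_bidegree p q (AB p q)))))"
    by (rule rho_raw_eq[OF alg_bitens_in_bidegree[OF AB_alg_polyfun]])
  also have "\<dots> = (\<Sum>k\<le>min p q. tens_scale (1 / fact k) (push_forward ((contract ^^ k) (in_bidegree p q (AB p q)))))"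
    by (rule sum.mono_neutral_right) (auto simp: contract_iterate_0 push_forward_zero)
  also have "\<dots> = (\<Sum>k\<le>min p q.
     tens_scale (cAB ^ k * fact p * fact q / (fact k * fact (p - k) * fact (q - k)))
      (in_degree (p - k + (q - k)) (symmetrize (p - k + (q - k))
         (pure_tensor (replicate (p - k) (rho_cl1 phi A) @ replicate (q - k) (rho_cl1 psi B))))))"
  proof (rule sum.cong[OF HOL.refl])
    fix k assume "k \<in> {..min p q}"
    then have k: "k \<le> min p q" by simp
    have "rho_cl_tensor (p - k) (replicate (p - k) A @ replicate (q - k) B)
        = pure_tensor (replicate (p - k) (rho_cl1 phi A) @ replicate (q - k) (rho_cl1 psi B))"
      by (simp add: rho_cl_tensor_def)
    then have "push_forward ((contract ^^ k) (in_bidegree p q (AB p q)))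
        = tens_scale (fact p * fact q / (fact (p - k) * fact (q - k)) * cAB ^ k)
           (in_degree (p - k + (q - k)) (symmetrize (p - k + (q - k))
         (pure_tensor (replicate (p - k) (rho_cl1 phi A) @ replicate (q - k) (rho_cl1 psi B)))))"
      unfolding contract_iterate[OF k] push_forward_scale[OF alg_bitens_in_bidegree[OF AB_alg_polyfun]] push_forward_in_bidegree_pure[OF AB_list] by simp
    then show "tens_scale (1 / fact k) (push_forward ((contract ^^ k) (in_bidegree p q (AB p q))))
      = tens_scale (cAB ^ k * fact p * fact q / (fact k * fact (p - k) * fact (q - k)))
        (in_degree (p - k + (q - k)) (symmetrize (p - k + (q - k))
         (pure_tensor (replicate (p - k) (rho_cl1 phi A) @ replicate (q - k) (rho_cl1 psi B)))))"
      by (simp add: tens_scale_add field_simps)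
  qed
  finally show ?thesis .
qed

end

end

section \<open>Symmetric tensors and multiplication operators\<close>

definition alg_tens :: "tens set" where
  "alg_tens = {x. (\<forall>p. x p \<in> alg_polyfun p) \<and> (\<exists>K. \<forall>p>K. x p = 0)}"

lemma alg_tensI: "(\<And>p. x p \<in> alg_polyfun p) \<Longrightarrow> (\<And>p. K < p \<Longrightarrow> x p = 0) \<Longrightarrow> x \<in> alg_tens"
  by (auto simp: alg_tens_def)

lemma alg_tens_add:
  assumes "x \<in> alg_tens" "y \<in> alg_tens"
  shows "x + y \<in> alg_tens"
proof -
  obtain K L where K: "\<forall>p>K. x p = 0" and L: "\<forall>p>L. y p = 0" using assms by (auto simp: alg_tens_def)
  show ?thesis
  proof (rule alg_tensI)
    have "(x + y) p = (\<lambda>z. x p z + y p z)" for p by auto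
    then show "(x + y) p \<in> alg_polyfun p" for p using assms by (simp only: alg_polyfun_add alg_tens_def mem_Collect_eq)
    show "(x + y) p = 0" if "max K L < p" for p using K L that by simp
  qed
qed

lemma alg_tens_scale_degreewise:
  assumes "x \<in> alg_tens"
  shows "(\<lambda>p z. c p * x p z) \<in> alg_tens"
proof -
  obtain K where K: "\<forall>p>K. x p = 0" using assms by (auto simp: alg_tens_def)
  show ?thesis
    by (rule alg_tensI[of _ K]) (use assms K in \<open>auto simp: alg_tens_def zero_polyfun intro: alg_polyfun_scale\<close>)
qed

lemma alg_tens_scale: "x \<in> alg_tens \<Longrightarrow> tens_scale c x \<in> alg_tens"
  unfolding tens_scale_def by (rule alg_tens_scale_degreewise)

lemma alg_tens_zero: "0 \<in> alg_tens"
  by (simp add: alg_tens_def zero_polyfun alg_polyfun_zero)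

lemma alg_tens_in_degree: "f \<in> alg_polyfun p \<Longrightarrow> in_degree p f \<in> alg_tens"
  unfolding alg_tens_def by (auto simp: in_degree_alg_polyfun) (auto simp: in_degree_def)

lemma N_inv_alg_tens: "x \<in> alg_tens \<Longrightarrow> N_inv x \<in> alg_tens"
  using alg_tens_scale_degreewise[of x "\<lambda>p. 1 / of_real (sqrt (fact p))"] by (simp add: N_inv_def)

lemma tens_tensor_alg_bitens:
  assumes "x \<in> alg_tens" "y \<in> alg_tens"
  shows "\<exists>K. tens_tensor x y \<in> alg_bitens K"
proof -
  obtain K where K: "\<forall>p>K. x p = 0" using assms by (auto simp: alg_tens_def)
  then have "tens_tensor x y \<in> alg_bitens K"
    using assms by (auto simp: alg_bitens_def tens_tensor_def alg_tens_def zero_polyfun tensor_prod_zero intro: tensor_prod_alg_polyfun)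
  then show ?thesis ..
qed

lemma tens_tensor_lin:
  "tens_tensor (x + x') y = tens_tensor x y + tens_tensor x' y"
  "tens_tensor x (y + y') = tens_tensor x y + tens_tensor x y'"
  "tens_tensor (tens_scale c x) y = bitens_scale c (tens_tensor x y)"
  "tens_tensor x (tens_scale c y) = bitens_scale c (tens_tensor x y)"
  by (auto simp: tens_tensor_def tensor_prod_def tens_scale_def bitens_scale_def fun_eq_iff algebra_simps)

lemma N_inv_lin: "N_inv (x + y) = N_inv x + N_inv y" "N_inv (tens_scale c x) = tens_scale c (N_inv x)"
  by (auto simp: N_inv_def tens_scale_def fun_eq_iff add_divide_distrib)

lemma N_op_lin: "N_op (x + y) = N_op x + N_op y" "N_op (tens_scale c x) = tens_scale c (N_op x)"
  by (auto simp: N_op_def tens_scale_def fun_eq_iff algebra_simps)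

text \<open>Under \<open>\<Psi>\<close> these are the images of products of creation operators applied to the vacuum.\<close>

definition sym_tensor :: "(complex \<Rightarrow> complex) list \<Rightarrow> tens" where
  "sym_tensor as = in_degree (length as) (\<lambda>x. of_real (sqrt (fact (length as))) * symmetrize (length as) (pure_tensor as) x)"

lemma permute_polydisc:
  assumes "\<sigma> permutes {..<p}"
  shows "x \<circ> \<sigma> \<in> polydisc p \<longleftrightarrow> x \<in> polydisc p"
proof -
  have *: "y \<circ> \<tau> \<in> polydisc p" if "\<tau> permutes {..<p}" "y \<in> polydisc p" for y \<tau>
    using that permutes_in_image[OF that(1)] permutes_not_in[OF that(1)]
    by (auto simp: polydisc_def PiE_iff extensional_def)
  have "(x \<circ> \<sigma>) \<circ> inv \<sigma> = x" using permutes_inv_o[OF assms] by (simp add: o_assoc[symmetric])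
  then show ?thesis using *[OF assms] *[OF permutes_inv[OF assms], of "x \<circ> \<sigma>"] by auto
qed

lemma symmetrize_pure_mset:
  assumes "mset as = mset bs" "length bs = n"
  shows "symmetrize n (pure_tensor as) = symmetrize n (pure_tensor bs)"
proof
  fix x
  obtain \<pi> where \<pi>: "\<pi> permutes {..<length bs}" "permute_list \<pi> bs = as"
    using mset_eq_permutation[OF assms(1)] by blast
  have l: "length as = n" using assms by (metis size_mset)
  note \<pi>n = \<pi>(1)[unfolded assms(2)]
  have pt: "pure_tensor as y = pure_tensor bs (y \<circ> inv \<pi>)" for y
  proof (cases "y \<in> polydisc n")
    case True
    have "(\<Prod>i<n. (as ! i) (y i)) = (\<Prod>i<n. (bs ! \<pi> i) (y (inv \<pi> (\<pi> i))))"
      using permute_list_nth[OF \<pi>(1)] permutes_inverses(2)[OF \<pi>n] \<pi>(2) assms(2)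
      by (intro prod.cong) auto
    also have "\<dots> = (\<Prod>i<n. (bs ! i) (y (inv \<pi> i)))"
      using prod.permute[OF \<pi>n, of "\<lambda>i. (bs ! i) (y (inv \<pi> i))"] by (simp add: o_def)
    finally show ?thesis
      using True permute_polydisc[OF permutes_inv[OF \<pi>n], of y] by (simp add: pure_tensor_def l assms(2))
  qed (use permute_polydisc[OF permutes_inv[OF \<pi>n], of y] in \<open>simp add: pure_tensor_def l assms(2)\<close>)
  have "(\<Sum>\<sigma> | \<sigma> permutes {..<n}. pure_tensor bs (x \<circ> \<sigma>)) = (\<Sum>\<sigma> | \<sigma> permutes {..<n}. pure_tensor bs (x \<circ> (\<sigma> \<circ> inv \<pi>)))"
    by (rule sum_permutations_compose_right[OF permutes_inv[OF \<pi>n]])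
  then show "symmetrize n (pure_tensor as) x = symmetrize n (pure_tensor bs) x"
    by (simp add: symmetrize_def pt o_assoc)
qed

lemma sym_tensor_mset: "mset as = mset bs \<Longrightarrow> sym_tensor as = sym_tensor bs"
  using symmetrize_pure_mset[of as bs "length bs"] mset_eq_length[of as bs] by (simp add: sym_tensor_def)

text \<open>Symmetrised multiplication by \<open>A\<close>, with the normalisation of a creation operator.\<close>

definition tens_creation :: "(complex \<Rightarrow> complex) \<Rightarrow> tens \<Rightarrow> tens" where
  "tens_creation A F = (\<lambda>m x. case m of 0 \<Rightarrow> 0 | Suc n \<Rightarrow>
     if x \<in> polydisc (Suc n)
     then (\<Sum>b\<le>n. A (x b) * F n (restrict (x \<circ> Transposition.transpose n b) {..<n})) / of_real (sqrt (real (Suc n)))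
     else 0)"

lemma tens_creation_lin: "tens_creation A (x + y) = tens_creation A x + tens_creation A y" "tens_creation A (tens_scale c x) = tens_scale c (tens_creation A x)"
  "tens_creation (\<lambda>z. A z + B z) x = tens_creation A x + tens_creation B x" "tens_creation (\<lambda>z. c * A z) x = tens_scale c (tens_creation A x)"
  "tens_creation A 0 = 0" "tens_creation (\<lambda>z. 0) x = 0"
  by (auto simp: tens_creation_def tens_scale_def fun_eq_iff algebra_simps sum.distrib sum_distrib_left
      add_divide_distrib split: nat.split)

text \<open>A permutation of \<open>Suc n\<close> variables is a permutation of the first \<open>n\<close>, followed by the transposition
  that gives the last factor its variable \<open>x b\<close>.\<close>

lemma symmetrize_pure_snoc:
  assumes n: "length as = n" and x: "x \<in> polydisc (Suc n)"
  shows "symmetrize (Suc n) (pure_tensor (as @ [A])) x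
     = (\<Sum>b\<le>n. A (x b) * symmetrize n (pure_tensor as) (restrict (x \<circ> Transposition.transpose n b) {..<n})) / of_nat (Suc n)"
proof -
  have ins: "{..<Suc n} = insert n {..<n}" by auto
  have term_eq: "pure_tensor (as @ [A]) (x \<circ> (Transposition.transpose n b \<circ> q))
      = A (x b) * pure_tensor as (restrict (x \<circ> Transposition.transpose n b) {..<n} \<circ> q)"
    if b: "b \<le> n" and q: "q permutes {..<n}" for b q
  proof -
    have tp: "Transposition.transpose n b permutes {..<Suc n}" using b by (intro permutes_swap_id) auto
    have qS: "q permutes {..<Suc n}" using q by (rule permutes_subset) auto
    have 1: "x \<circ> (Transposition.transpose n b \<circ> q) \<in> polydisc (Suc n)"
      using permute_polydisc[OF permutes_compose[OF qS tp]] x by (simp add: o_assoc)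
    have x2: "x \<circ> Transposition.transpose n b \<in> polydisc (Suc n)" using permute_polydisc[OF tp] x by simp
    have 2: "restrict (x \<circ> Transposition.transpose n b) {..<n} \<circ> q \<in> polydisc n"
      using permute_polydisc[OF q, of "restrict (x \<circ> Transposition.transpose n b) {..<n}"] polydisc_restrict[of "x \<circ> Transposition.transpose n b" n 1] x2 by simp
    have "(\<Prod>i<n. (as ! i) ((x \<circ> (Transposition.transpose n b \<circ> q)) i)) = (\<Prod>i<n. (as ! i) ((restrict (x \<circ> Transposition.transpose n b) {..<n} \<circ> q) i))"
      using permutes_in_image[OF q] by (intro prod.cong) auto
    moreover have "(x \<circ> (Transposition.transpose n b \<circ> q)) n = x b" using permutes_not_in[OF q, of n] by simp
    moreover have "(\<Prod>i<n. ((as @ [A]) ! i) (y i)) = (\<Prod>i<n. (as ! i) (y i))" for y :: "nat \<Rightarrow> complex"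
      using n by (intro prod.cong) (auto simp: nth_append)
    ultimately show ?thesis
      using 1 2 n by (simp add: pure_tensor_def nth_append)
  qed
  have "(\<Sum>\<sigma> | \<sigma> permutes {..<Suc n}. pure_tensor (as @ [A]) (x \<circ> \<sigma>))
      = (\<Sum>b\<in>insert n {..<n}. \<Sum>q | q permutes {..<n}. pure_tensor (as @ [A]) (x \<circ> (Transposition.transpose n b \<circ> q)))"
    unfolding ins by (rule sum_over_permutations_insert) auto
  also have "insert n {..<n} = {..n}" by auto
  also have "(\<Sum>b\<le>n. \<Sum>q | q permutes {..<n}. pure_tensor (as @ [A]) (x \<circ> (Transposition.transpose n b \<circ> q)))
      = (\<Sum>b\<le>n. A (x b) * (\<Sum>q | q permutes {..<n}. pure_tensor as (restrict (x \<circ> Transposition.transpose n b) {..<n} \<circ> q)))"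
    unfolding sum_distrib_left using term_eq by (intro sum.cong) auto
  finally show ?thesis
    unfolding symmetrize_def fact_Suc times_divide_eq_right sum_divide_distrib[symmetric] divide_divide_eq_left
    by (simp only: mult.commute)
qed

text \<open>The average over \<open>Suc n\<close> positions and the ratio \<open>sqrt (Suc n)\<close> of the two normalisations combine to
  the factor \<open>1 / sqrt (Suc n)\<close> in \<open>tens_creation\<close>.\<close>

lemma sym_tensor_Cons: "sym_tensor (A # as) = tens_creation A (sym_tensor as)"
proof -
  have "sym_tensor (A # as) = sym_tensor (as @ [A])" by (rule sym_tensor_mset) simp
  also have "\<dots> = tens_creation A (sym_tensor as)"
  proof (intro ext)
    fix m x
    let ?n = "length as"
    show "sym_tensor (as @ [A]) m x = tens_creation A (sym_tensor as) m x"
    proof (cases "m = Suc ?n \<and> x \<in> polydisc m")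
      case True
      have "complex_of_real (sqrt (fact (Suc ?n))) / of_nat (Suc ?n) = of_real (sqrt (fact ?n) / sqrt (real (Suc ?n)))"
      proof -
        have "sqrt (fact (Suc ?n)) / real (Suc ?n) = (sqrt (real (Suc ?n)) * sqrt (fact ?n)) / (sqrt (real (Suc ?n)) * sqrt (real (Suc ?n)))"
          by (simp only: fact_Suc real_sqrt_mult real_sqrt_mult_self abs_of_nat)
        also have "\<dots> = sqrt (fact ?n) / sqrt (real (Suc ?n))"
          by (rule mult_divide_mult_cancel_left) simp
        finally show ?thesis by (metis of_real_divide of_real_of_nat_eq)
      qed
      then have e: "complex_of_real (sqrt (fact (Suc ?n))) * (y / of_nat (Suc ?n)) = of_real (sqrt (fact ?n)) * y / of_real (sqrt (real (Suc ?n)))" for y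
        by (simp add: field_simps del: of_nat_Suc fact_Suc)
      define S where "S = (\<Sum>b\<le>?n. A (x b) * symmetrize ?n (pure_tensor as) (restrict (x \<circ> Transposition.transpose ?n b) {..<?n}))"
      have m: "m = Suc ?n" and x: "x \<in> polydisc (Suc ?n)" using True by auto
      have "sym_tensor (as @ [A]) m x = of_real (sqrt (fact (Suc ?n))) * symmetrize (Suc ?n) (pure_tensor (as @ [A])) x"
        by (simp add: sym_tensor_def in_degree_def m del: of_nat_Suc fact_Suc)
      also have "\<dots> = of_real (sqrt (fact ?n)) * S / of_real (sqrt (real (Suc ?n)))"
        unfolding symmetrize_pure_snoc[OF HOL.refl x] S_def[symmetric] by (rule e)
      also have "\<dots> = tens_creation A (sym_tensor as) m x"
        unfolding S_def sum_distrib_left using x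
        by (simp add: m tens_creation_def sym_tensor_def in_degree_def mult.left_commute del: of_nat_Suc)
      finally show ?thesis .
    next
      case False
      have "symmetrize (Suc ?n) (pure_tensor (as @ [A])) x = 0" if "x \<notin> polydisc (Suc ?n)"
        unfolding symmetrize_def using permute_polydisc[of _ "Suc ?n" x] that
        by (auto simp: pure_tensor_def intro!: sum.neutral)
      then show ?thesis
        using False by (auto simp: sym_tensor_def tens_creation_def in_degree_def split: nat.split)
    qed
  qed
  finally show ?thesis .
qed

lemma sym_tensor_Nil: "sym_tensor [] = in_degree 0 (pure_tensor [])"
proof -
  have "{\<sigma>. \<sigma> permutes {..<0::nat}} = {id}"
    by (auto simp: permutes_def fun_eq_iff)
  then have "symmetrize 0 f x = f x" for f x
    by (simp add: symmetrize_def del: permutes_empty)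
  then show ?thesis by (simp add: sym_tensor_def)
qed

lemma pure_tensor_replicate_perm:
  assumes "\<sigma> permutes {..<p}"
  shows "pure_tensor (replicate p A) (x \<circ> \<sigma>) = pure_tensor (replicate p A) x"
proof -
  have "(\<Prod>i<p. A (x (\<sigma> i))) = (\<Prod>i<p. A (x i))"
    using prod.permute[OF assms, of "\<lambda>i. A (x i)"] by (simp add: o_def)
  then show ?thesis using permute_polydisc[OF assms, of x] by (simp add: pure_tensor_def)
qed

lemma sym_tensor_replicate: "sym_tensor (replicate p A) = in_degree p (\<lambda>x. of_real (sqrt (fact p)) * pure_tensor (replicate p A) x)"
proof -
  have "symmetrize p (pure_tensor (replicate p A)) x = pure_tensor (replicate p A) x" for x
    unfolding symmetrize_def
    by (simp add: pure_tensor_replicate_perm card_permutations[of "{..<p}" p])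
  then show ?thesis by (simp add: sym_tensor_def)
qed

lemma sym_tensor_replicate_alg_tens: "A \<in> bergman \<Longrightarrow> sym_tensor (replicate p A) \<in> alg_tens"
  unfolding sym_tensor_replicate using alg_polyfun_pure[of "replicate p A"]
  by (intro alg_tens_in_degree alg_polyfun_scale) (simp add: set_replicate_conv_if)

context
  fixes \<zeta> :: complex and r s :: real
  assumes rs: "0 < r" "0 < s" "r + s < cmod \<zeta>"
    and sub: "ball \<zeta> r \<subseteq> disc" "ball 0 s \<subseteq> disc"
begin

abbreviation (input) "rho \<equiv> rho2_N (affine_map \<zeta> r) (affine_map 0 s)"

lemma rho_rho_raw: "rho x y = N_op (rho_raw \<zeta> r s (tens_tensor (N_inv x) (N_inv y)))"
  by (simp add: rho2_N_def rho2_def rho_raw_def[OF rs sub] push_forward_def[OF rs sub])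

lemma rho_add_left:
  assumes "x \<in> alg_tens" "x' \<in> alg_tens" "y \<in> alg_tens"
  shows "rho (x + x') y = rho x y + rho x' y"
proof -
  obtain K L where "tens_tensor (N_inv x) (N_inv y) \<in> alg_bitens K" "tens_tensor (N_inv x') (N_inv y) \<in> alg_bitens L"
    using assms tens_tensor_alg_bitens N_inv_alg_tens by meson
  then have "tens_tensor (N_inv x) (N_inv y) \<in> alg_bitens (max K L)" "tens_tensor (N_inv x') (N_inv y) \<in> alg_bitens (max K L)"
    by (auto elim: alg_bitens_mono)
  then show ?thesis
    unfolding rho_rho_raw N_inv_lin tens_tensor_lin by (simp only: rho_raw_add[OF rs sub] N_op_lin)
qed

lemma rho_add_right:
  assumes "x \<in> alg_tens" "y \<in> alg_tens" "y' \<in> alg_tens"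
  shows "rho x (y + y') = rho x y + rho x y'"
proof -
  obtain K L where "tens_tensor (N_inv x) (N_inv y) \<in> alg_bitens K" "tens_tensor (N_inv x) (N_inv y') \<in> alg_bitens L"
    using assms tens_tensor_alg_bitens N_inv_alg_tens by meson
  then have "tens_tensor (N_inv x) (N_inv y) \<in> alg_bitens (max K L)" "tens_tensor (N_inv x) (N_inv y') \<in> alg_bitens (max K L)"
    by (auto elim: alg_bitens_mono)
  then show ?thesis
    unfolding rho_rho_raw N_inv_lin tens_tensor_lin by (simp only: rho_raw_add[OF rs sub] N_op_lin)
qed

lemma rho_scale:
  assumes "x \<in> alg_tens" "y \<in> alg_tens"
  shows "rho (tens_scale c x) y = tens_scale c (rho x y)" "rho x (tens_scale c y) = tens_scale c (rho x y)"
proof -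
  obtain K where "tens_tensor (N_inv x) (N_inv y) \<in> alg_bitens K"
    using assms tens_tensor_alg_bitens N_inv_alg_tens by meson
  then show "rho (tens_scale c x) y = tens_scale c (rho x y)" "rho x (tens_scale c y) = tens_scale c (rho x y)"
    unfolding rho_rho_raw N_inv_lin tens_tensor_lin by (simp_all only: rho_raw_scale[OF rs sub] N_op_lin)
qed

lemma N_inv_sym_tensor_replicate: "N_inv (sym_tensor (replicate p A)) = in_degree p (pure_tensor (replicate p A))"
  by (auto simp: N_inv_def sym_tensor_replicate in_degree_def fun_eq_iff)

lemma N_op_sum: "N_op (\<Sum>i\<in>I. x i) = (\<Sum>i\<in>I. N_op (x i))"
  by (intro ext) (simp add: N_op_def sum_fun_apply sum_distrib_left)

lemma rho_powers:
  assumes AB: "A \<in> bergman" "B \<in> bergman"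
  defines "C \<equiv> kernel_pairing (G_kernel (affine_map \<zeta> r) (affine_map 0 s)) A B"
  shows "rho (sym_tensor (replicate p A)) (sym_tensor (replicate q B)) = (\<Sum>k\<le>min p q.
     tens_scale (C ^ k * fact p * fact q / (fact k * fact (p - k) * fact (q - k)))
       (sym_tensor (replicate (p - k) (rho_cl1 (affine_map \<zeta> r) A) @ replicate (q - k) (rho_cl1 (affine_map 0 s) B))))"
proof -
  have "tens_tensor (in_degree p (pure_tensor (replicate p A))) (in_degree q (pure_tensor (replicate q B)))
      = in_bidegree p q (pure_tensor (replicate p A @ replicate q B))"
    by (intro ext) (auto simp: tens_tensor_def in_degree_def in_bidegree_def zero_polyfun tensor_prod_zero tensor_prod_pure)
  moreover have "N_op (in_degree n f) = in_degree n (\<lambda>x. of_real (sqrt (fact n)) * f x)" for n f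
    by (auto simp: N_op_def in_degree_def fun_eq_iff)
  ultimately show ?thesis
    unfolding rho_rho_raw N_inv_sym_tensor_replicate C_def
    by (simp add: rho_raw_powers[OF rs sub AB] N_op_sum N_op_lin sym_tensor_def)
qed

end

section \<open>The Heisenberg module and polarisation\<close>

lemma linearD:
  assumes "Vector_Spaces.linear s1 s2 f"
  shows "f (x + y) = f x + f y" "f (s1 c x) = s2 c (f x)" "f 0 = 0" "f (- x) = - f x" "f (x - y) = f x - f y"
    "f (\<Sum>i\<in>I. g i) = (\<Sum>i\<in>I. f (g i))"
proof -
  interpret Vector_Spaces.linear s1 s2 f by fact
  show "f (x + y) = f x + f y" "f (s1 c x) = s2 c (f x)" "f 0 = 0" "f (- x) = - f x" "f (x - y) = f x - f y"
    "f (\<Sum>i\<in>I. g i) = (\<Sum>i\<in>I. f (g i))"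
    by (rule add scale zero neg diff sum)+
qed

lemmas h_lin = linearD[OF h_linear]

abbreviation (input) "monos \<equiv> {h_monomial ks |ks. \<forall>k\<in>set ks. k \<ge> 1}"

lemma h_monomial_simps: "h_monomial [] = vac" "h_monomial (k # ks) = h (- int k) (h_monomial ks)"
  by (simp_all add: h_monomial_def)

lemma h_commute: "n + m \<noteq> 0 \<Longrightarrow> h n (h m a) = h m (h n a)"
  using h_commutator[of n m a] by simp

lemma h_swap: "h n (h m a) = h m (h n a) + fock_scale (if n + m = 0 then of_int n else 0) a"
  using h_commutator[of n m a] by (simp add: algebra_simps)

lemma M_upto_monomial: "length ks \<le> p \<Longrightarrow> \<forall>k\<in>set ks. k \<ge> 1 \<Longrightarrow> h_monomial ks \<in> M_upto p"
  unfolding M_upto_def M_deg_def by (rule fock.span_base) (auto intro!: bexI[of _ "length ks"] fock.span_base)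

lemma M_upto_eq: "M_upto p = fock.span {h_monomial ks |ks. length ks \<le> p \<and> (\<forall>k\<in>set ks. k \<ge> 1)}"
  (is "_ = fock.span ?S")
proof
  have "M_deg k \<subseteq> fock.span ?S" if "k \<le> p" for k
    unfolding M_deg_def by (rule fock.span_mono) (use that in auto)
  then show "M_upto p \<subseteq> fock.span ?S"
    unfolding M_upto_def by (intro fock.span_minimal) auto
  show "fock.span ?S \<subseteq> M_upto p"
    unfolding M_upto_def by (rule fock.span_minimal) (use M_upto_monomial[unfolded M_upto_def] in auto)
qed

lemma M_upto_subspace:
  "0 \<in> M_upto p" "a \<in> M_upto p \<Longrightarrow> b \<in> M_upto p \<Longrightarrow> a + b \<in> M_upto p"
  "a \<in> M_upto p \<Longrightarrow> b \<in> M_upto p \<Longrightarrow> a - b \<in> M_upto p"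
  "a \<in> M_upto p \<Longrightarrow> fock_scale c a \<in> M_upto p"
  "(\<And>i. i \<in> I \<Longrightarrow> f i \<in> M_upto p) \<Longrightarrow> (\<Sum>i\<in>I. f i) \<in> M_upto p"
  unfolding M_upto_def by (auto intro: fock.span_zero fock.span_add fock.span_diff fock.span_scale fock.span_sum)

lemma M_upto_mono: "p \<le> q \<Longrightarrow> M_upto p \<subseteq> M_upto q"
  unfolding M_upto_eq by (rule fock.span_mono) auto

lemma h_neg_M_upto:
  assumes "a \<in> M_upto p" "k \<ge> 1"
  shows "h (- int k) a \<in> M_upto (Suc p)"
  using assms(1) unfolding M_upto_eq[of p]
proof (induction rule: fock.span_induct_alt)
  case base
  show ?case by (simp add: h_lin M_upto_subspace)
next
  case (step c x y)
  then obtain ks where "x = h_monomial ks" "length ks \<le> p" "\<forall>k\<in>set ks. k \<ge> 1" by auto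
  then have "h (- int k) x \<in> M_upto (Suc p)"
    using assms(2) M_upto_monomial[of "k # ks" "Suc p"] by (simp add: h_monomial_simps)
  then show ?case using step by (simp add: h_lin M_upto_subspace)
qed

lemma h_nonneg_monomial:
  assumes "n \<ge> 0" "\<forall>k\<in>set ks. k \<ge> 1"
  shows "h n (h_monomial ks) \<in> M_upto (length ks)"
  using assms(2)
proof (induction ks)
  case Nil
  show ?case using assms(1) by (simp add: h_monomial_simps h_vac M_upto_subspace)
next
  case (Cons k ks)
  have "h (- int k) (h n (h_monomial ks)) \<in> M_upto (Suc (length ks))"
    using Cons by (intro h_neg_M_upto) auto
  moreover have "h_monomial ks \<in> M_upto (Suc (length ks))"
    using Cons.prems by (intro M_upto_monomial) auto
  ultimately show ?case
    unfolding h_monomial_simps h_swap[of n] by (simp add: M_upto_subspace)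
qed

lemma h_nonneg_M_upto:
  assumes "a \<in> M_upto p" "n \<ge> 0"
  shows "h n a \<in> M_upto p"
  using assms(1) unfolding M_upto_eq[of p]
proof (induction rule: fock.span_induct_alt)
  case base
  show ?case using fock.span_zero by (simp add: h_lin)
next
  case (step c x y)
  then obtain ks where ks: "x = h_monomial ks" "length ks \<le> p" "\<forall>k\<in>set ks. k \<ge> 1" by auto
  then have "h n x \<in> M_upto p"
    using h_nonneg_monomial[OF assms(2) ks(3)] M_upto_mono[OF ks(2)] by auto
  then show ?case using step unfolding M_upto_eq[of p] h_lin by (intro fock.span_add fock.span_scale)
qed

text \<open>Induction on the expressions that represent vectors of the module; annihilation operators do not raise
  the length of monomials.\<close>

lemma fock_union: "\<exists>p. a \<in> M_upto p"
proof -
  have "\<exists>p. abs_fock t \<in> M_upto p" for t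
  proof (induction t)
    case TVac
    then show ?case using M_upto_monomial[of "[]" 0] by (auto simp: h_monomial_simps vac.abs_eq)
  next
    case TZero
    then show ?case using M_upto_subspace(1) by (auto simp: zero_fock.abs_eq)
  next
    case (TAdd t u)
    then obtain p q where pq: "abs_fock t \<in> M_upto p" "abs_fock u \<in> M_upto q" by auto
    have "abs_fock (TAdd t u) = abs_fock t + abs_fock u" by (simp add: plus_fock.abs_eq)
    then have "abs_fock (TAdd t u) \<in> M_upto (max p q)"
      using pq M_upto_mono[of p "max p q"] M_upto_mono[of q "max p q"] by (auto intro!: M_upto_subspace)
    then show ?case ..
  next
    case (TScale c t)
    then obtain p where "abs_fock t \<in> M_upto p" by auto
    then have "abs_fock (TScale c t) \<in> M_upto p" 
      using M_upto_subspace(4)[of "abs_fock t" p c] by (simp add: fock_scale.abs_eq)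
    then show ?case ..
  next
    case (TH n t)
    then obtain p where p: "abs_fock t \<in> M_upto p" by auto
    have e: "abs_fock (TH n t) = h n (abs_fock t)" by (simp add: h.abs_eq)
    have "h n (abs_fock t) \<in> M_upto (Suc p)"
    proof (cases "n \<ge> 0")
      case True
      then show ?thesis using h_nonneg_M_upto[OF p] M_upto_mono[of p "Suc p"] by auto
    next
      case False
      then show ?thesis using h_neg_M_upto[OF p, of "nat (- n)"] by simp
    qed
    then show ?case unfolding e ..
  qed
  then show ?thesis by (induct a rule: fock.abs_induct)
qed

lemma fock_span: "a \<in> fock.span monos"
proof -
  obtain p where "a \<in> M_upto p" using fock_union by auto
  then show ?thesis
    unfolding M_upto_eq using fock.span_mono[of "{h_monomial ks |ks. length ks \<le> p \<and> (\<forall>k\<in>set ks. k \<ge> 1)}" "monos"]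
    by auto
qed

lemma fock_induct [case_names zero step]:
  assumes "P 0" "\<And>c ks a. \<forall>k\<in>set ks. k \<ge> 1 \<Longrightarrow> P a \<Longrightarrow> P (fock_scale c (h_monomial ks) + a)"
  shows "P a"
  using fock_span[of a] by (induction rule: fock.span_induct_alt) (auto intro: assms)

lemma linear_eq_on_monos:
  assumes f: "Vector_Spaces.linear fock_scale s2 f" and g: "Vector_Spaces.linear fock_scale s2 g"
    and eq: "\<And>ks. \<forall>k\<in>set ks. k \<ge> 1 \<Longrightarrow> f (h_monomial ks) = g (h_monomial ks)"
  shows "f a = g a"
  by (induction a rule: fock_induct) (simp_all add: linearD[OF f] linearD[OF g] eq)

text \<open>The operator \<open>r ^ L(0)\<close> is defined by recursion on expressions: it fixes the vacuum and rescales
  \<open>h(n)\<close> by \<open>r ^ (- n)\<close>, which is compatible with the commutation relations.\<close>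

primrec weight_scaling_term :: "complex \<Rightarrow> fock_term \<Rightarrow> fock" where
  "weight_scaling_term r TVac = vac"
| "weight_scaling_term r TZero = 0"
| "weight_scaling_term r (TAdd t u) = weight_scaling_term r t + weight_scaling_term r u"
| "weight_scaling_term r (TScale c t) = fock_scale c (weight_scaling_term r t)"
| "weight_scaling_term r (TH n t) = fock_scale (r powi (- n)) (h n (weight_scaling_term r t))"

lemma weight_scaling_respects:
  assumes r: "r \<noteq> 0"
  shows "fock_eq t u \<Longrightarrow> weight_scaling_term r t = weight_scaling_term r u"
proof (induction rule: fock_eq.induct)
  case (H_commutator n m t)
  have "r powi (- n) * r powi (- m) = 1" if "n + m = 0"
    using that r by (metis add.commute add_eq_0_iff power_int_add power_int_0_right minus_minus)
  then show ?case
    by (simp add: h_lin fock.scale_scale mult.commute h_swap[of n] fock.scale_right_distrib)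
next
  case (scale_add_right c t u) then show ?case by (simp add: fock.scale_right_distrib)
next
  case (scale_add_left c d t) then show ?case by (simp add: fock.scale_left_distrib)
next
  case (H_add n t u) then show ?case by (simp add: h_lin fock.scale_right_distrib)
next
  case (H_scale n c t) then show ?case by (simp add: h_lin fock.scale_scale mult.commute)
qed (simp_all add: h_lin h_vac algebra_simps)

definition weight_scaling :: "complex \<Rightarrow> fock \<Rightarrow> fock" where
  "weight_scaling r a = weight_scaling_term r (rep_fock a)"

lemma weight_scaling_abs: "r \<noteq> 0 \<Longrightarrow> weight_scaling r (abs_fock t) = weight_scaling_term r t"
  unfolding weight_scaling_def
  by (rule weight_scaling_respects) (auto intro: Quotient3_rep_abs[OF Quotient3_fock] fock_eq.refl)

lemma weight_scaling_simps:
  assumes r: "r \<noteq> 0"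
  shows "weight_scaling r vac = vac" "weight_scaling r (a + b) = weight_scaling r a + weight_scaling r b"
    "weight_scaling r (fock_scale c a) = fock_scale c (weight_scaling r a)"
    "weight_scaling r (h n a) = fock_scale (r powi (- n)) (h n (weight_scaling r a))"
proof -
  have "\<exists>t. x = abs_fock t" for x by (induct x rule: fock.abs_induct) auto
  then obtain t u where tu: "a = abs_fock t" "b = abs_fock u" by meson
  show "weight_scaling r vac = vac" "weight_scaling r (a + b) = weight_scaling r a + weight_scaling r b"
    "weight_scaling r (fock_scale c a) = fock_scale c (weight_scaling r a)"
    "weight_scaling r (h n a) = fock_scale (r powi (- n)) (h n (weight_scaling r a))"
    unfolding tu vac.abs_eq plus_fock.abs_eq fock_scale.abs_eq h.abs_eq weight_scaling_abs[OF r] by simp_all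
       (simp_all add: vac.abs_eq)
qed

lemma weight_scaling_linear: "r \<noteq> 0 \<Longrightarrow> Vector_Spaces.linear fock_scale fock_scale (weight_scaling r)"
  by unfold_locales (auto simp: weight_scaling_simps)

lemma weight_scaling_monomial:
  "r \<noteq> 0 \<Longrightarrow> weight_scaling r (h_monomial ks) = fock_scale (r ^ sum_list ks) (h_monomial ks)"
  by (induction ks) (simp_all add: h_monomial_simps weight_scaling_simps h_lin fock.scale_scale power_add)

text \<open>\<open>L0_power\<close> is characterised on all eigenvectors of \<open>L0\<close>, and these may be written as sums of monomials of
  different weights. The terms \<open>f b\<close> of wrong weight are removed one after the other.\<close>

lemma eigen_decomposition:
  assumes L: "Vector_Spaces.linear fock_scale fock_scale L" and R: "Vector_Spaces.linear fock_scale fock_scale R"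
    and "finite T" and eig: "\<And>b. b \<in> T \<Longrightarrow> L (f b) = fock_scale (of_nat (w b)) (f b) \<and> R (f b) = fock_scale (r ^ w b) (f b)"
    and a: "L (\<Sum>b\<in>T. f b) = fock_scale (of_nat k) (\<Sum>b\<in>T. f b)"
  shows "R (\<Sum>b\<in>T. f b) = fock_scale (r ^ k) (\<Sum>b\<in>T. f b)"
  using assms(3,4,5)
proof (induction "card T" arbitrary: T f)
  case 0
  then show ?case by (simp add: linearD[OF R])
next
  case (Suc n)
  show ?case
  proof (cases "\<exists>b0\<in>T. w b0 \<noteq> k")
    case False
    then have "R (f b) = fock_scale (r ^ k) (f b)" if "b \<in> T" for b using Suc.prems(2)[OF that] that by auto
    then show ?thesis by (simp add: linearD[OF R] fock.scale_sum_right)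
  next
    case True
    then obtain b0 where b0: "b0 \<in> T" "w b0 \<noteq> k" by auto
    let ?a = "\<Sum>b\<in>T. f b"
    define d :: complex where "d = of_nat k - of_nat (w b0)"
    have d: "d \<noteq> 0" using b0(2) by (simp add: d_def)
    \<comment> \<open>\<open>(L - w b0) / d\<close> fixes the sum and annihilates its term at \<open>b0\<close>\<close>
    define g where "g = (\<lambda>b. fock_scale ((of_nat (w b) - of_nat (w b0)) / d) (f b))"
    have La: "L ?a = (\<Sum>b\<in>T. fock_scale (of_nat (w b)) (f b))"
      using Suc.prems(2) by (simp add: linearD(6)[OF L])
    have "fock_scale d ?a = L ?a - fock_scale (of_nat (w b0)) ?a"
      by (simp add: Suc.prems(3) d_def fock.scale_left_diff_distrib)
    also have "\<dots> = (\<Sum>b\<in>T. fock_scale (of_nat (w b) - of_nat (w b0)) (f b))"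
      by (simp add: La fock.scale_sum_right sum_subtractf[symmetric] fock.scale_left_diff_distrib)
    finally have "fock_scale (1 / d) (fock_scale d ?a) = fock_scale (1 / d) (\<Sum>b\<in>T. fock_scale (of_nat (w b) - of_nat (w b0)) (f b))"
      by simp
    then have "?a = (\<Sum>b\<in>T. g b)"
      using d by (simp add: fock.scale_scale fock.scale_sum_right g_def)
    also have "\<dots> = (\<Sum>b\<in>T - {b0}. g b)"
      using sum.remove[OF Suc.prems(1) b0(1), of g] by (simp add: g_def)
    finally have eq: "?a = (\<Sum>b\<in>T - {b0}. g b)" .
    have "R (\<Sum>b\<in>T - {b0}. g b) = fock_scale (r ^ k) (\<Sum>b\<in>T - {b0}. g b)"
    proof (rule Suc.hyps(1))
      show "n = card (T - {b0})" using Suc.hyps(2) Suc.prems(1) b0(1) by simp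
      show "finite (T - {b0})" using Suc.prems(1) by simp
      show "L (\<Sum>b\<in>T - {b0}. g b) = fock_scale (of_nat k) (\<Sum>b\<in>T - {b0}. g b)"
        unfolding eq[symmetric] by (rule Suc.prems(3))
      fix b assume "b \<in> T - {b0}"
      then show "L (g b) = fock_scale (of_nat (w b)) (g b) \<and> R (g b) = fock_scale (r ^ w b) (g b)"
        using Suc.prems(2)[of b] by (simp add: g_def linearD[OF L] linearD[OF R] fock.scale_scale mult.commute)
    qed
    then show ?thesis unfolding eq[symmetric] .
  qed
qed

lemma L0_power_eq:
  assumes L0: "is_L0 L0" and r: "r > 0"
  shows "L0_power L0 r = weight_scaling (of_real r)"
  unfolding L0_power_def
proof (rule the_equality)
  let ?R = "weight_scaling (of_real r)"
  have r0: "complex_of_real r \<noteq> 0" using r by simp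
  note R = weight_scaling_linear[OF r0]
  have L: "Vector_Spaces.linear fock_scale fock_scale L0"
    and Lm: "\<And>ks. \<forall>k\<in>set ks. k \<ge> 1 \<Longrightarrow> L0 (h_monomial ks) = fock_scale (of_nat (sum_list ks)) (h_monomial ks)"
    using L0 by (auto simp: is_L0_def)
  have "?R a = fock_scale (of_real (r ^ k)) a" if a: "L0 a = fock_scale (of_nat k) a" for k :: nat and a
  proof -
    obtain T c where T: "finite T" "T \<subseteq> monos" "a = (\<Sum>b\<in>T. fock_scale (c b) b)"
      using fock_span[of a] unfolding fock.span_explicit by auto
    have "\<forall>b\<in>T. \<exists>ks. b = h_monomial ks \<and> (\<forall>k\<in>set ks. k \<ge> 1)" using T(2) by auto
    then obtain ks where ks: "\<And>b. b \<in> T \<Longrightarrow> b = h_monomial (ks b)" "\<And>b. b \<in> T \<Longrightarrow> \<forall>k\<in>set (ks b). k \<ge> 1"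
      by metis
    have "?R (\<Sum>b\<in>T. fock_scale (c b) b) = fock_scale (of_real r ^ k) (\<Sum>b\<in>T. fock_scale (c b) b)"
    proof (rule eigen_decomposition[OF L R T(1), where w = "\<lambda>b. sum_list (ks b)"])
      fix b assume b: "b \<in> T"
      have "L0 b = fock_scale (of_nat (sum_list (ks b))) b" "?R b = fock_scale (of_real r ^ sum_list (ks b)) b"
        using Lm[OF ks(2)[OF b]] weight_scaling_monomial[OF r0, of "ks b"] ks(1)[OF b] by simp_all
      then show "L0 (fock_scale (c b) b) = fock_scale (of_nat (sum_list (ks b))) (fock_scale (c b) b) \<and>
         ?R (fock_scale (c b) b) = fock_scale (of_real r ^ sum_list (ks b)) (fock_scale (c b) b)"
        by (simp add: linearD[OF L] linearD[OF R] fock.scale_scale mult.commute)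
    qed (use a T(3) in simp)
    then show ?thesis by (simp add: T(3))
  qed
  then show "Vector_Spaces.linear fock_scale fock_scale ?R \<and>
     (\<forall>(k::nat) a. L0 a = fock_scale (of_nat k) a \<longrightarrow> ?R a = fock_scale (of_real (r ^ k)) a)"
    using R by blast
  fix S assume S: "Vector_Spaces.linear fock_scale fock_scale S \<and>
     (\<forall>(k::nat) a. L0 a = fock_scale (of_nat k) a \<longrightarrow> S a = fock_scale (of_real (r ^ k)) a)"
  show "S = ?R"
  proof
    fix a
    show "S a = ?R a"
      by (rule linear_eq_on_monos[of fock_scale]) (use S R Lm weight_scaling_monomial[OF r0] in auto)
  qed
qed

text \<open>One-particle creation operators, and the polarisation argument: products of commuting operators
  lie in the span of powers of their linear combinations, because the coefficients of a vector-valued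
  polynomial are combinations of its values.\<close>

definition fock_creation :: "(complex \<times> nat) list \<Rightarrow> fock \<Rightarrow> fock" where
  "fock_creation al v = (\<Sum>(c, j)\<leftarrow>al. fock_scale c (h (- int (Suc j)) v))"

lemma fock_creation_simps: "fock_creation [] v = 0" "fock_creation ((c, j) # al) v = fock_scale c (h (- int (Suc j)) v) + fock_creation al v"
  by (simp_all add: fock_creation_def)

lemma fock_creation_lin: "fock_creation al (a + b) = fock_creation al a + fock_creation al b" "fock_creation al (fock_scale c a) = fock_scale c (fock_creation al a)" "fock_creation al 0 = 0"
  by (induction al) (auto simp: fock_creation_simps h_lin algebra_simps fock.scale_scale fock.scale_right_distrib mult.commute)

lemma fock_creation_append: "fock_creation (al @ be) v = fock_creation al v + fock_creation be v"
  by (induction al) (auto simp: fock_creation_simps add.assoc)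

lemma fock_creation_scale: "fock_creation (map (\<lambda>(c, j). (t * c, j)) al) v = fock_scale t (fock_creation al v)"
  by (induction al) (auto simp: fock_creation_simps fock.scale_right_distrib fock.scale_scale)

lemma fock_creation_h_commute: "fock_creation al (h (- int (Suc k)) v) = h (- int (Suc k)) (fock_creation al v)"
proof (induction al)
  case (Cons y al)
  obtain c j where y: "y = (c, j)" by (cases y)
  have "h (- int (Suc j)) (h (- int (Suc k)) v) = h (- int (Suc k)) (h (- int (Suc j)) v)"
    by (rule h_commute) simp
  with Cons show ?case unfolding y fock_creation_simps h_lin by (simp only:)
qed (simp add: fock_creation_simps h_lin)

lemma fock_creation_commute: "fock_creation al (fock_creation be v) = fock_creation be (fock_creation al v)"
proof (induction be)
  case (Cons y be)
  obtain c j where y: "y = (c, j)" by (cases y)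
  from Cons show ?case unfolding y fock_creation_simps fock_creation_lin fock_creation_h_commute by (simp only:)
qed (simp add: fock_creation_simps fock_creation_lin)

lemma fock_creation_pow_commute: "(fock_creation al ^^ n) (fock_creation be v) = fock_creation be ((fock_creation al ^^ n) v)"
  by (induction n) (simp_all add: fock_creation_commute)

text \<open>If \<open>P\<close> has degree \<open>Suc d\<close>, then \<open>P (2 * t) - 2 ^ Suc d * P t\<close> has degree \<open>d\<close> and the same lower
  coefficients up to non-zero factors.\<close>

lemma polynomial_coefficients_in_subspace:
  fixes w :: "nat \<Rightarrow> fock"
  assumes W: "fock.subspace W"
  shows "(\<And>t::complex. (\<Sum>i\<le>d. fock_scale (t ^ i) (w i)) \<in> W) \<Longrightarrow> i \<le> d \<Longrightarrow> w i \<in> W"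
proof (induction d arbitrary: w i)
  case 0
  then show ?case using "0.prems"(1)[of 1] by simp
next
  case (Suc d)
  let ?P = "\<lambda>t. \<Sum>i\<le>Suc d. fock_scale (t ^ i) (w i)"
  have low: "w i \<in> W" if i: "i \<le> d" for i
  proof -
    define v where "v = (\<lambda>i. fock_scale (2 ^ i - 2 ^ Suc d) (w i))"
    have "(\<Sum>i\<le>d. fock_scale (t ^ i) (v i)) \<in> W" for t :: complex
    proof -
      have "?P (2 * t) - fock_scale (2 ^ Suc d) (?P t) = (\<Sum>i\<le>Suc d. fock_scale ((2 * t) ^ i - 2 ^ Suc d * t ^ i) (w i))"
        by (simp only: fock.scale_sum_right fock.scale_scale sum_subtractf[symmetric] fock.scale_left_diff_distrib)
      also have "\<dots> = (\<Sum>i\<le>d. fock_scale ((2 * t) ^ i - 2 ^ Suc d * t ^ i) (w i))"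
        by (simp add: power_mult_distrib)
      also have "\<dots> = (\<Sum>i\<le>d. fock_scale (t ^ i) (v i))"
        by (intro sum.cong) (auto simp: v_def fock.scale_scale power_mult_distrib algebra_simps)
      finally show ?thesis
        using Suc.prems(1) W by (metis fock.subspace_diff fock.subspace_scale)
    qed
    from Suc.IH[OF this i] have "fock_scale (1 / (2 ^ i - 2 ^ Suc d)) (v i) \<in> W"
      using W by (simp add: fock.subspace_scale)
    moreover have "(2::complex) ^ i - 2 ^ Suc d \<noteq> 0"
    proof
      assume "(2::complex) ^ i - 2 ^ Suc d = 0"
      then have "of_nat (2 ^ i) = (of_nat (2 ^ Suc d) :: complex)" by simp
      then have "(2::nat) ^ i = 2 ^ Suc d" by (simp only: of_nat_eq_iff)
      then show False using i by (simp only: power_inject_exp)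
    qed
    ultimately show ?thesis by (simp add: v_def fock.scale_scale)
  qed
  show ?case
  proof (cases "i \<le> d")
    case False
    then have i: "i = Suc d" using Suc.prems(2) by simp
    have "w (Suc d) = ?P 1 - (\<Sum>i\<le>d. w i)" by simp
    moreover have "(\<Sum>i\<le>d. w i) \<in> W" using low W by (intro fock.subspace_sum) auto
    ultimately show ?thesis unfolding i using Suc.prems(1)[of 1] W fock.subspace_diff by metis
  qed (rule low)
qed

lemma fock_creation_binomial:
  "(fock_creation (al @ map (\<lambda>(c, j). (t * c, j)) be) ^^ n) v
    = (\<Sum>i\<le>n. fock_scale (t ^ i) (fock_scale (of_nat (n choose i)) ((fock_creation al ^^ (n - i)) ((fock_creation be ^^ i) v))))"
proof (induction n)
  case (Suc n)
  let ?T = "\<lambda>n i. (fock_creation al ^^ (n - i)) ((fock_creation be ^^ i) v)"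
  let ?c = "fock_creation (al @ map (\<lambda>(c, j). (t * c, j)) be)"
  have c: "?c u = fock_creation al u + fock_scale t (fock_creation be u)" for u
    by (simp add: fock_creation_append fock_creation_scale)
  have c_sum: "fock_creation ga (\<Sum>i\<in>I. f i) = (\<Sum>i\<in>I. fock_creation ga (f i))" for ga f and I :: "nat set"
    by (induction I rule: infinite_finite_induct) (auto simp: fock_creation_lin)
  have "(?c ^^ Suc n) v = (\<Sum>i\<le>n. fock_scale (t ^ i * of_nat (n choose i)) (fock_creation al (?T n i)))
      + (\<Sum>i\<le>n. fock_scale (t ^ Suc i * of_nat (n choose i)) (fock_creation be (?T n i)))"
  proof -
    have "(?c ^^ Suc n) v = ?c ((?c ^^ n) v)" by (simp only: funpow.simps o_apply)
    then show ?thesis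
      unfolding Suc c c_sum fock_creation_lin fock.scale_sum_right fock.scale_scale fock.scale_right_distrib sum.distrib
      by (simp only: power_Suc mult_ac)
  qed
  also have "(\<Sum>i\<le>n. fock_scale (t ^ i * of_nat (n choose i)) (fock_creation al (?T n i)))
      = (\<Sum>i\<le>n. fock_scale (t ^ i * of_nat (n choose i)) (?T (Suc n) i))"
    by (intro sum.cong) (auto simp: Suc_diff_le)
  also have "\<dots> = (\<Sum>i\<le>Suc n. fock_scale (t ^ i * of_nat (n choose i)) (?T (Suc n) i))" by simp
  also have "\<dots> = ?T (Suc n) 0 + (\<Sum>i\<le>n. fock_scale (t ^ Suc i * of_nat (n choose Suc i)) (?T (Suc n) (Suc i)))"
    by (subst sum.atMost_Suc_shift) simp
  also have "(\<Sum>i\<le>n. fock_scale (t ^ Suc i * of_nat (n choose i)) (fock_creation be (?T n i)))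
      = (\<Sum>i\<le>n. fock_scale (t ^ Suc i * of_nat (n choose i)) (?T (Suc n) (Suc i)))"
    by (simp add: fock_creation_pow_commute)
  also have "?T (Suc n) 0 + (\<Sum>i\<le>n. fock_scale (t ^ Suc i * of_nat (n choose Suc i)) (?T (Suc n) (Suc i)))
      + (\<Sum>i\<le>n. fock_scale (t ^ Suc i * of_nat (n choose i)) (?T (Suc n) (Suc i)))
      = ?T (Suc n) 0 + (\<Sum>i\<le>n. fock_scale (t ^ Suc i * of_nat (Suc n choose Suc i)) (?T (Suc n) (Suc i)))"
    by (simp add: sum.distrib[symmetric] fock.scale_left_distrib[symmetric] distrib_left add.commute add.assoc)
  also have "\<dots> = (\<Sum>i\<le>Suc n. fock_scale (t ^ i * of_nat (Suc n choose i)) (?T (Suc n) i))"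
    by (subst sum.atMost_Suc_shift) simp
  finally show ?case by (simp add: fock.scale_scale)
qed simp

text \<open>The coefficient of \<open>t\<close> in \<open>(A + t * B) ^ Suc n\<close> is \<open>Suc n\<close> times \<open>A ^ n * B\<close>: each further operator
  is traded for one power.\<close>

lemma powers_span:
  fixes W :: "fock set"
  assumes W: "fock.subspace W" and base: "\<And>al. (fock_creation al ^^ N) vac \<in> W"
  shows "length bes + n = N \<Longrightarrow> (fock_creation al ^^ n) (foldr fock_creation bes vac) \<in> W"
proof (induction bes arbitrary: n al)
  case Nil
  then show ?case using base by simp
next
  case (Cons be bes)
  let ?v = "foldr fock_creation bes vac"
  have "(\<Sum>i\<le>Suc n. fock_scale (t ^ i) (fock_scale (of_nat (Suc n choose i)) ((fock_creation al ^^ (Suc n - i)) ((fock_creation be ^^ i) ?v)))) \<in> W" for t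
    unfolding fock_creation_binomial[symmetric] by (rule Cons.IH) (use Cons.prems in simp)
  from polynomial_coefficients_in_subspace[OF W this, of 1]
  have "fock_scale (of_nat (Suc n)) ((fock_creation al ^^ n) (fock_creation be ?v)) \<in> W"
    by (simp del: of_nat_Suc)
  then have "fock_scale (1 / of_nat (Suc n)) (fock_scale (of_nat (Suc n)) ((fock_creation al ^^ n) (fock_creation be ?v))) \<in> W"
    by (rule fock.subspace_scale[OF W])
  moreover have "fock_scale (1 / of_nat (Suc n)) (fock_scale (of_nat (Suc n)) a) = a" for a
    unfolding fock.scale_scale by (simp del: of_nat_Suc)
  ultimately show ?case by (simp only: foldr.simps o_apply)
qed

lemma monomial_foldr_fock_creation: "\<forall>k\<in>set ks. k \<ge> 1 \<Longrightarrow> h_monomial ks = foldr fock_creation (map (\<lambda>k. [(1, k - 1)]) ks) vac"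
  by (induction ks) (auto simp: h_monomial_simps fock_creation_simps of_nat_diff)

lemma polarisation:
  assumes "fock.subspace W" "\<And>al n. n \<le> p \<Longrightarrow> (fock_creation al ^^ n) vac \<in> W" "a \<in> M_upto p"
  shows "a \<in> W"
proof -
  have "h_monomial ks \<in> W" if "length ks \<le> p" "\<forall>k\<in>set ks. k \<ge> 1" for ks
    using powers_span[OF assms(1) assms(2)[OF that(1)], of "map (\<lambda>k. [(1, k - 1)]) ks" 0]
    by (simp add: monomial_foldr_fock_creation[OF that(2)])
  then have "M_upto p \<subseteq> W"
    unfolding M_upto_eq by (intro fock.span_minimal assms(1)) auto
  then show ?thesis using assms(3) by auto
qed

section \<open>Vertex operators and the invariant form\<close>

lemma h_monomial_mset:
  assumes "mset ks = mset ls" "\<forall>k\<in>set ks. k \<ge> 1"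
  shows "h_monomial ks = h_monomial ls"
proof -
  have "fold (\<lambda>k. h (- int k)) (rev ks) = fold (\<lambda>k. h (- int k)) (rev ls)"
  proof (rule fold_multiset_equiv)
    show "mset (rev ks) = mset (rev ls)" using assms(1) by simp
    fix x y assume "x \<in> set (rev ks)" "y \<in> set (rev ks)"
    then have "- int x + - int y \<noteq> 0" using assms(2) by fastforce
    then show "h (- int x) \<circ> h (- int y) = h (- int y) \<circ> h (- int x)"
      by (intro ext) (simp only: o_apply, rule h_commute)
  qed
  then show ?thesis by (simp add: h_monomial_def foldr_conv_fold)
qed

context
  fixes \<Psi> :: "fock \<Rightarrow> tens"
  assumes Psi: "is_Psi \<Psi>"
begin

lemma Psi_linear: "Vector_Spaces.linear fock_scale tens_scale \<Psi>"
  using Psi by (simp add: is_Psi_def)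

lemmas Psi_lin = linearD[OF Psi_linear]

text \<open>\<open>\<Psi>\<close> is prescribed on weakly decreasing monomials; neither side depends on the order of the factors.\<close>

lemma Psi_monomial:
  assumes "\<forall>k\<in>set ks. k \<ge> 1"
  shows "\<Psi> (h_monomial ks) = sym_tensor (map (\<lambda>k. bergman_h (k - 1)) ks)"
proof -
  define js where "js = map (\<lambda>k. k - 1) ks"
  define js' where "js' = rev (sort js)"
  have ks: "ks = map Suc js" unfolding js_def using assms by (induction ks) auto
  have ms: "mset js' = mset js" by (simp add: js'_def)
  have "sorted_wrt (\<ge>) js'" unfolding js'_def sorted_wrt_rev by simp
  then have "\<Psi> (h_monomial (map Suc js')) = sym_tensor (map bergman_h js')"
    using Psi by (simp add: is_Psi_def sym_tensor_def)
  also have "sym_tensor (map bergman_h js') = sym_tensor (map bergman_h js)"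
    by (rule sym_tensor_mset) (simp add: ms)
  also have "h_monomial (map Suc js') = h_monomial (map Suc js)"
    by (rule h_monomial_mset) (auto simp: ms)
  finally show ?thesis unfolding ks by (simp add: o_def)
qed

lemma Psi_h: "\<Psi> (h (- int (Suc j)) v) = tens_creation (bergman_h j) (\<Psi> v)"
proof (induction v rule: fock_induct)
  case zero
  show ?case unfolding h_lin Psi_lin tens_creation_lin ..
next
  case (step c ks a)
  have "\<Psi> (h (- int (Suc j)) (h_monomial ks)) = tens_creation (bergman_h j) (\<Psi> (h_monomial ks))"
    using Psi_monomial[of "Suc j # ks"] Psi_monomial[of ks] step(1) by (simp add: h_monomial_simps sym_tensor_Cons)
  then show ?case using step(2) unfolding h_lin Psi_lin tens_creation_lin by (simp only:)
qed

lemma Psi_fock_creation: "\<Psi> (fock_creation al v) = tens_creation (one_particle al) (\<Psi> v)"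
proof (induction al)
  case Nil
  show ?case unfolding fock_creation_simps one_particle_simps tens_creation_lin Psi_lin ..
next
  case (Cons y al)
  obtain c j where y: "y = (c, j)" by (cases y)
  from Cons show ?case unfolding y fock_creation_simps one_particle_simps tens_creation_lin Psi_lin Psi_h by (simp only:)
qed

lemma Psi_power: "\<Psi> ((fock_creation al ^^ p) vac) = sym_tensor (replicate p (one_particle al))"
proof (induction p)
  case 0
  show ?case using Psi by (simp add: is_Psi_def sym_tensor_Nil)
qed (simp add: Psi_fock_creation sym_tensor_Cons)

lemma Psi_alg_tens: "\<Psi> v \<in> alg_tens"
proof -
  obtain p where "v \<in> M_upto p" using fock_union by auto
  moreover have "fock.subspace {v. \<Psi> v \<in> alg_tens}"
    by (rule fock.subspaceI) (auto simp: Psi_lin alg_tens_zero intro: alg_tens_add alg_tens_scale)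
  moreover have "(fock_creation al ^^ n) vac \<in> {v. \<Psi> v \<in> alg_tens}" for al n
    using sym_tensor_replicate_alg_tens[OF one_particle_bergman] by (simp add: Psi_power)
  ultimately show ?thesis using polarisation[of "{v. \<Psi> v \<in> alg_tens}" p v] by blast
qed

lemma Psi_A2: "\<Psi> v m \<in> A2 m"
  using Psi_alg_tens[of v] alg_polyfun_A2 by (auto simp: alg_tens_def)

lemma Psi_degree: "v \<in> M_upto p \<Longrightarrow> p < m \<Longrightarrow> \<Psi> v m = 0"
  unfolding M_upto_eq
proof (induction rule: fock.span_induct_alt)
  case base
  show ?case by (simp add: Psi_lin)
next
  case (step c x y)
  then obtain ks where ks: "x = h_monomial ks" "length ks \<le> p" "\<forall>k\<in>set ks. k \<ge> 1" by auto
  have "\<Psi> x m = 0" using ks step by (simp add: Psi_monomial[OF ks(3)] sym_tensor_def in_degree_def)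
  then show ?case using step by (simp add: Psi_lin tens_scale_def zero_polyfun)
qed

end

text \<open>The inner product that belongs to \<open>Sym_dist N\<close>.\<close>

definition tens_ip :: "nat \<Rightarrow> tens \<Rightarrow> tens \<Rightarrow> complex" where
  "tens_ip N x y = (\<Sum>m\<le>N. ip (polydisc_measure m) (x m) (y m))"

lemma tens_ip_left:
  assumes "\<And>m. x m \<in> A2 m" "\<And>m. x' m \<in> A2 m" "\<And>m. y m \<in> A2 m"
  shows "tens_ip N (x + x') y = tens_ip N x y + tens_ip N x' y"
proof -
  have "(x + x') m = (\<lambda>z. x m z + x' m z)" for m by auto
  then show "tens_ip N (x + x') y = tens_ip N x y + tens_ip N x' y"
    using assms[THEN A2_sqi] by (simp add: tens_ip_def ip_add_left sum.distrib)
qed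

lemma tens_ip_scale: "tens_ip N (tens_scale c x) y = c * tens_ip N x y"
  by (simp add: tens_ip_def tens_scale_def ip_scale_left sum_distrib_left)

lemma tens_ip_commute: "tens_ip N y x = cnj (tens_ip N x y)"
  unfolding tens_ip_def cnj_sum by (intro sum.cong HOL.refl ip_commute)

lemma tens_ip_self: "(\<And>m. x m \<in> A2 m) \<Longrightarrow> tens_ip N x x = of_real (\<Sum>m\<le>N. (A2_norm m (x m))\<^sup>2)"
  by (simp add: tens_ip_def ip_self A2_norm_nrm)

lemma ip_pure_replicate:
  assumes "A \<in> bergman" "B \<in> bergman"
  shows "ip (polydisc_measure p) (pure_tensor (replicate p A)) (pure_tensor (replicate p B)) = (ip disc_measure A B) ^ p"
proof -
  have "ip (polydisc_measure p) (pure_tensor (replicate p A)) (pure_tensor (replicate p B))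
      = (\<integral>x. (\<Prod>i<p. A (x i) * cnj (B (x i))) \<partial>polydisc_measure p)"
    unfolding ip_def by (intro Bochner_Integration.integral_cong) (auto simp: pure_tensor_def prod.distrib)
  also have "\<dots> = (\<Prod>i<p. \<integral>z. A z * cnj (B z) \<partial>disc_measure)"
    unfolding polydisc_measure_def
    by (rule discs.product_integral_prod[where f = "\<lambda>_ z. A z * cnj (B z)"])
       (auto intro!: sqi_mult_integrable bergman_sqi assms)
  finally show ?thesis by (simp add: ip_def)
qed

lemma tens_ip_sym_tensor_replicate:
  assumes "A \<in> bergman" "B \<in> bergman" "p \<le> N"
  shows "tens_ip N (sym_tensor (replicate p A)) (sym_tensor (replicate q B)) = (if p = q then fact p * (ip disc_measure A B) ^ p else 0)"
proof -
  have z: "ip M (0 :: polyfun) f = 0" "ip M f (0 :: polyfun) = 0" for M f by (simp_all add: ip_def)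
  have "ip (polydisc_measure m) (sym_tensor (replicate p A) m) (sym_tensor (replicate q B) m)
      = (if m = p then (if p = q then fact p * (ip disc_measure A B) ^ p else 0) else 0)" for m
  proof (cases "m = p \<and> m = q")
    case True
    have "complex_of_real (sqrt (fact p)) * complex_of_real (sqrt (fact p)) = of_real (fact p)"
      unfolding of_real_mult[symmetric] by simp
    then have "complex_of_real (sqrt (fact p)) * complex_of_real (sqrt (fact p)) = fact p"
      by (simp only: of_real_fact)
    moreover have "m = p" "q = p" using True by auto
    ultimately show ?thesis
      by (simp add: sym_tensor_replicate in_degree_def ip_scale_left ip_scale_right ip_pure_replicate assms(1,2))
  qed (auto simp: sym_tensor_replicate in_degree_def z)
  then show ?thesis using assms(3) by (simp add: tens_ip_def)
qed

lemma ip_one_particle: "ip disc_measure (one_particle be) (one_particle al) = (\<Sum>(c, i)\<leftarrow>al. cnj c * (of_nat (Suc i) * (\<Sum>(d, j)\<leftarrow>be. if j = i then d else 0)))"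
proof -
  have m: "conj_moment (one_particle be) i = (\<Sum>(d, j)\<leftarrow>be. if j = i then d else 0)" for i
  proof (induction be)
    case Nil
    show ?case by (simp add: one_particle_simps conj_moment_integral)
  next
    case (Cons y be)
    obtain d j where y: "y = (d, j)" by (cases y)
    from Cons show ?case
      unfolding y one_particle_simps
      by (simp add: conj_moment_add[OF sqi_scale[OF bergman_h_sqi] bergman_sqi[OF one_particle_bergman]] conj_moment_scale conj_moment_bergman_h)
  qed
  have e: "ip disc_measure (one_particle be) (bergman_h i) = of_nat (Suc i) * conj_moment (one_particle be) i" for i
  proof -
    have "ip disc_measure (one_particle be) (bergman_h i) = ip disc_measure (one_particle be) (\<lambda>z. of_nat (Suc i) * z ^ i)"
      unfolding ip_def by (intro Bochner_Integration.integral_cong) (auto simp: bergman_h_def)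
    then show ?thesis by (simp add: ip_scale_right conj_moment_def del: of_nat_Suc)
  qed
  show ?thesis
  proof (induction al)
    case Nil
    show ?case by (simp add: one_particle_simps ip_def)
  next
    case (Cons y al)
    obtain c i where y: "y = (c, i)" by (cases y)
    from Cons show ?case
      unfolding y one_particle_simps
      by (simp add: ip_add_right[OF sqi_scale[OF bergman_h_sqi] bergman_sqi[OF one_particle_bergman] bergman_sqi[OF one_particle_bergman]]
          ip_scale_right e m del: of_nat_Suc)
  qed
qed

text \<open>The commutator is a scalar, to which only the modes of \<open>be\<close> opposite to \<open>n\<close> contribute.\<close>

lemma h_fock_creation:
  assumes "n \<ge> 0"
  shows "h n (fock_creation be v) = fock_creation be (h n v) + fock_scale (of_int n * (\<Sum>(d, j)\<leftarrow>be. if int (Suc j) = n then d else 0)) v"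
proof (induction be)
  case Nil
  show ?case by (simp add: fock_creation_simps h_lin)
next
  case (Cons y be)
  obtain d j where y: "y = (d, j)" by (cases y)
  have "h n (h (- int (Suc j)) v) = h (- int (Suc j)) (h n v) + fock_scale (if int (Suc j) = n then of_int n else 0) v"
    unfolding h_swap[of n "- int (Suc j)"] by (intro arg_cong2[where f = "(+)"] arg_cong2[where f = fock_scale]) auto
  then show ?case
    unfolding y fock_creation_simps h_lin Cons by (simp add: fock.scale_right_distrib fock.scale_left_distrib fock.scale_scale algebra_simps)
qed

text \<open>An annihilation operator acts like a derivative. For \<open>q = 0\<close> the coefficient vanishes, whatever the
  truncated exponent \<open>q - 1\<close> is.\<close>

lemma h_fock_creation_power:
  assumes "n \<ge> 0"
  shows "h n ((fock_creation be ^^ q) vac) = fock_scale (of_nat q * (of_int n * (\<Sum>(d, j)\<leftarrow>be. if int (Suc j) = n then d else 0))) ((fock_creation be ^^ (q - 1)) vac)"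
proof (induction q)
  case 0
  show ?case using assms by (simp add: h_vac)
next
  case (Suc q)
  let ?s = "of_int n * (\<Sum>(d, j)\<leftarrow>be. if int (Suc j) = n then d else 0)"
  have "h n ((fock_creation be ^^ Suc q) vac) = fock_creation be (h n ((fock_creation be ^^ q) vac)) + fock_scale ?s ((fock_creation be ^^ q) vac)"
    unfolding funpow.simps o_apply by (rule h_fock_creation[OF assms])
  also have "fock_creation be (h n ((fock_creation be ^^ q) vac)) = fock_scale (of_nat q * ?s) ((fock_creation be ^^ q) vac)"
    unfolding Suc fock_creation_lin by (cases q) simp_all
  finally show ?case by (simp add: fock.scale_left_distrib[symmetric] distrib_right add.commute)
qed

context
  fixes Y :: "fock \<Rightarrow> int \<Rightarrow> fock \<Rightarrow> fock"
  assumes Y: "is_M0_vertex_algebra Y"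
begin

lemma VA: "vertex_algebra fock_scale vac Y"
  using Y by (simp add: is_M0_vertex_algebra_def)

lemma Y_generator: "Y (h (- 1) vac) n = h n"
  using Y by (simp add: is_M0_vertex_algebra_def)

lemmas Y_left = linearD[OF vertex_algebra.linear_left[OF VA]]
lemmas Y_right = linearD[OF vertex_algebra.linear_right[OF VA]]

lemma Y_vac: "Y vac n b = (if n = - 1 then b else 0)"
  by (rule vertex_algebra.vacuum[OF VA])

text \<open>The Borcherds identity with \<open>k = 0\<close> and the generator in front is the formula for the normally
  ordered product of a derivative of \<open>h(z)\<close> with \<open>Y(a, z)\<close>.\<close>

lemma Y_h:
  "\<exists>K0. (\<forall>i\<ge>K0. h (int i) b = 0 \<and> Y a (l + int i) b = 0) \<and>
    (\<forall>K\<ge>K0. Y (h (- int (Suc j)) a) l b = (\<Sum>i<K. fock_scale (of_nat (i + j choose i))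
      (h (- int (Suc (i + j))) (Y a (l + int i) b)
       + fock_scale ((- 1) ^ j) (Y a (l - int (Suc (i + j))) (h (int i) b)))))"
proof -
  let ?x = "h (- 1) vac" and ?m = "- int (Suc j)"
  obtain N1 where N1: "\<And>n. n \<ge> N1 \<Longrightarrow> Y a n b = 0" using vertex_algebra.truncation[OF VA] by blast
  obtain N2 where N2: "\<And>n. n \<ge> N2 \<Longrightarrow> h n b = 0" using vertex_algebra.truncation[OF VA, of ?x b] unfolding Y_generator by blast
  define K0 where "K0 = nat (max N2 (N1 - l))"
  have z: "h (int i) b = 0 \<and> Y a (l + int i) b = 0" if "i \<ge> K0" for i
    using that N1 N2 by (simp add: K0_def)
  have lhs: "Sum_any (\<lambda>i::nat. fock_scale (of_int 0 gchoose i) (Y (Y ?x (?m + int i) a) (0 + l - int i) b)) = Y (h ?m a) l b"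
  proof -
    have "fock_scale (of_int 0 gchoose i) (Y (Y ?x (?m + int i) a) (0 + l - int i) b) = (if i = 0 then Y (h ?m a) l b else 0)" for i
      by (cases i) (simp_all add: Y_generator)
    then have "Sum_any (\<lambda>i::nat. fock_scale (of_int 0 gchoose i) (Y (Y ?x (?m + int i) a) (0 + l - int i) b))
       = Sum_any (\<lambda>i::nat. if i = 0 then Y (h ?m a) l b else 0)" by simp
    also have "\<dots> = (\<Sum>i\<in>{0::nat}. if i = 0 then Y (h ?m a) l b else 0)"
      by (rule Sum_any.expand_superset) auto
    finally show ?thesis by simp
  qed
  have binom: "(- 1) ^ i * (complex_of_int ?m gchoose i) = of_nat (i + j choose i)" for i
  proof -
    have "complex_of_int ?m = - of_nat (Suc j)" by simp
    then have "(complex_of_int ?m gchoose i) = (- 1) ^ i * (of_nat (Suc j) + of_nat i - 1 gchoose i)"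
      by (simp only: gbinomial_minus)
    also have "complex_of_nat (Suc j) + of_nat i - 1 = of_nat (i + j)" by simp
    finally have "(complex_of_int ?m gchoose i) = (- 1) ^ i * of_nat (i + j choose i)"
      by (simp only: binomial_gbinomial)
    then show ?thesis by (simp add: mult.assoc[symmetric] power_mult_distrib[symmetric])
  qed
  have sgn: "(- 1 :: complex) powi ?m = - ((- 1) ^ j)"
    unfolding power_int_minus by (simp add: power_inverse[symmetric] del: of_nat_Suc)
  have fun_eq: "fock_scale ((- 1) ^ i * (complex_of_int ?m gchoose i))
        (Y ?x (0 + ?m - int i) (Y a (l + int i) b)
         - fock_scale ((- 1) powi ?m) (Y a (l + ?m - int i) (Y ?x (0 + int i) b)))
      = fock_scale (of_nat (i + j choose i))
      (h (- int (Suc (i + j))) (Y a (l + int i) b)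
       + fock_scale ((- 1) ^ j) (Y a (l - int (Suc (i + j))) (h (int i) b)))" for i
  proof -
    have e: "0 + ?m - int i = - int (Suc (i + j))" "l + ?m - int i = l - int (Suc (i + j))" by simp_all
    show ?thesis unfolding binom sgn Y_generator e by simp
  qed
  have "Y (h ?m a) l b = Sum_any (\<lambda>i. fock_scale (of_nat (i + j choose i))
      (h (- int (Suc (i + j))) (Y a (l + int i) b)
       + fock_scale ((- 1) ^ j) (Y a (l - int (Suc (i + j))) (h (int i) b))))"
    using vertex_algebra.borcherds[OF VA, of 0 ?x ?m a l b] unfolding lhs fun_eq .
  moreover have "Sum_any (\<lambda>i. fock_scale (of_nat (i + j choose i))
      (h (- int (Suc (i + j))) (Y a (l + int i) b)
       + fock_scale ((- 1) ^ j) (Y a (l - int (Suc (i + j))) (h (int i) b))))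
      = (\<Sum>i<K. fock_scale (of_nat (i + j choose i))
      (h (- int (Suc (i + j))) (Y a (l + int i) b)
       + fock_scale ((- 1) ^ j) (Y a (l - int (Suc (i + j))) (h (int i) b))))" if "K \<ge> K0" for K
  proof (rule Sum_any.expand_superset)
    show "{i. fock_scale (of_nat (i + j choose i))
      (h (- int (Suc (i + j))) (Y a (l + int i) b)
       + fock_scale ((- 1) ^ j) (Y a (l - int (Suc (i + j))) (h (int i) b))) \<noteq> 0} \<subseteq> {..<K}"
    proof (rule subsetI, rule ccontr)
      fix i assume i: "i \<in> {i. fock_scale (of_nat (i + j choose i))
      (h (- int (Suc (i + j))) (Y a (l + int i) b)
       + fock_scale ((- 1) ^ j) (Y a (l - int (Suc (i + j))) (h (int i) b))) \<noteq> 0}" "i \<notin> {..<K}"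
      then have "i \<ge> K0" using that by simp
      from z[OF this] i(1) show False by (simp add: h_lin Y_right)
    qed
  qed simp
  ultimately show ?thesis using z by (intro exI[of _ K0]) auto
qed

lemma Y_M_upto:
  assumes "b \<in> M_upto q" "a \<in> M_upto p"
  shows "Y a l b \<in> M_upto (p + q)"
proof -
  have mono: "Y (h_monomial ks) l b \<in> M_upto (length ks + q)" if "\<forall>k\<in>set ks. k \<ge> 1" "b \<in> M_upto q" for ks l b
    using that
  proof (induction ks arbitrary: l b)
    case Nil
    then show ?case by (simp add: h_monomial_simps Y_vac M_upto_subspace)
  next
    case (Cons k ks)
    let ?a = "h_monomial ks"
    have k: "k = Suc (k - 1)" using Cons.prems by simp
    obtain K where K: "Y (h (- int (Suc (k - 1))) ?a) l b = (\<Sum>i<K. fock_scale (of_nat (i + (k - 1) choose i))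
      (h (- int (Suc (i + (k - 1)))) (Y ?a (l + int i) b)
       + fock_scale ((- 1) ^ (k - 1)) (Y ?a (l - int (Suc (i + (k - 1)))) (h (int i) b))))"
      using Y_h[of b ?a l "k - 1"] by blast
    have "Y ?a (l + int i) b \<in> M_upto (length ks + q)" for i
      using Cons by simp
    then have 1: "h (- int (Suc (i + (k - 1)))) (Y ?a (l + int i) b) \<in> M_upto (Suc (length ks + q))" for i
      by (intro h_neg_M_upto) auto
    have "Y ?a (l - int (Suc (i + (k - 1)))) (h (int i) b) \<in> M_upto (length ks + q)" for i
      using Cons.prems by (intro Cons.IH h_nonneg_M_upto) auto
    then have 2: "Y ?a (l - int (Suc (i + (k - 1)))) (h (int i) b) \<in> M_upto (Suc (length ks + q))" for i
      using M_upto_mono[of "length ks + q" "Suc (length ks + q)"] by auto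
    have "Y (h (- int k) ?a) l b \<in> M_upto (Suc (length ks + q))"
      using K k by (simp only:) (intro M_upto_subspace(5) M_upto_subspace(4) M_upto_subspace(2) 1 2)
    then show ?case by (simp add: h_monomial_simps)
  qed
  show ?thesis
    using assms(2) unfolding M_upto_eq[of p]
  proof (induction rule: fock.span_induct_alt)
    case base
    show ?case by (simp add: Y_left M_upto_subspace)
  next
    case (step c x y)
    then obtain ks where ks: "x = h_monomial ks" "length ks \<le> p" "\<forall>k\<in>set ks. k \<ge> 1" by auto
    have "Y x l b \<in> M_upto (p + q)"
      using mono[OF ks(3) assms(1), of l] M_upto_mono[of "length ks + q" "p + q"] ks by auto
    then show ?case using step by (simp add: Y_left M_upto_subspace)
  qed
qed

text \<open>The generator is primary, so that in the invariance of the form only the term without \<open>L(1)\<close> remains.\<close>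

lemma L1_generator: "L1_op Y (h (- 1) vac) = 0"
proof -
  let ?x = "h (- 1) vac"
  have hx: "h n ?x = (if n = 1 then vac else 0)" if "n \<ge> 0" for n
    using h_swap[of n "-1" vac] that by (auto simp: h_vac h_lin)
  obtain K where K: "Y (h (- int (Suc 0)) ?x) 2 ?x = (\<Sum>i<K. fock_scale (of_nat (i + 0 choose i))
      (h (- int (Suc (i + 0))) (Y ?x (2 + int i) ?x)
       + fock_scale ((- 1) ^ 0) (Y ?x (2 - int (Suc (i + 0))) (h (int i) ?x))))"
    using Y_h[of ?x ?x 2 0] by blast
  have "fock_scale (of_nat (i + 0 choose i))
      (h (- int (Suc (i + 0))) (Y ?x (2 + int i) ?x)
       + fock_scale ((- 1) ^ 0) (Y ?x (2 - int (Suc (i + 0))) (h (int i) ?x))) = 0" for i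
    unfolding Y_generator using hx[of "2 + int i"] hx[of "int i"] by (auto simp: h_lin h_vac)
  then have "Y (h (- int (Suc 0)) ?x) 2 ?x = 0" unfolding K by simp
  then show ?thesis by (simp add: L1_op_def Y_left)
qed

context
  fixes L0 \<theta> :: "fock \<Rightarrow> fock" and B :: "fock \<Rightarrow> fock \<Rightarrow> complex"
  assumes L0: "is_L0 L0" and \<theta>: "is_theta \<theta>" and B: "is_invariant_form Y L0 B"
begin

lemma B_right: "Vector_Spaces.linear fock_scale (*) (B a)"
  using B unfolding is_invariant_form_def by blast

lemma B_sym: "B a b = B b a"
  using B unfolding is_invariant_form_def by blast

lemma B_lin:
  "B a (b + c) = B a b + B a c" "B a (fock_scale k b) = k * B a b" "B a 0 = 0"
  "B (b + c) a = B b a + B c a" "B (fock_scale k b) a = k * B b a" "B 0 a = 0"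
  using linearD[OF B_right[of a]] by (simp_all add: B_sym[of _ a])

lemma B_h: "B (h n b) c = - B b (h (- n) c)"
proof -
  let ?x = "h (- 1) vac"
  have "L0 (h_monomial [1]) = fock_scale (of_nat (sum_list [1])) (h_monomial [1])"
    using L0 unfolding is_L0_def by (metis (no_types, lifting) empty_iff empty_set le_refl set_ConsD)
  then have x: "L0 ?x = fock_scale (of_nat 1) ?x" by (simp add: h_monomial_simps)
  have inv: "B (Y ?x n b) c = (- 1) ^ 1 * Sum_any (\<lambda>j::nat.
          B b (Y ((L1_op Y ^^ j) ?x) (2 * int 1 - n - int j - 2) c) / fact j)"
    using B x unfolding is_invariant_form_def by blast
  have L10: "L1_op Y 0 = 0" by (simp add: L1_op_def Y_right)
  have "(L1_op Y ^^ j) ?x = (if j = 0 then ?x else 0)" for j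
    by (induction j) (simp_all add: L1_generator L10)
  then have "B b (Y ((L1_op Y ^^ j) ?x) (2 * int 1 - n - int j - 2) c) / fact j = (if j = 0 then B b (h (- n) c) else 0)" for j
    by (simp add: Y_generator Y_left B_lin)
  then have "Sum_any (\<lambda>j::nat. B b (Y ((L1_op Y ^^ j) ?x) (2 * int 1 - n - int j - 2) c) / fact j)
     = Sum_any (\<lambda>j::nat. if j = 0 then B b (h (- n) c) else 0)" by simp
  also have "\<dots> = (\<Sum>j\<in>{0::nat}. if j = 0 then B b (h (- n) c) else 0)"
    by (rule Sum_any.expand_superset) auto
  finally show ?thesis using inv by (simp add: Y_generator)
qed

lemma theta_lin: "\<theta> (a + b) = \<theta> a + \<theta> b" "\<theta> (fock_scale c a) = fock_scale (cnj c) (\<theta> a)" "\<theta> 0 = 0"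
proof -
  show 1: "\<theta> (a + b) = \<theta> a + \<theta> b" "\<theta> (fock_scale c a) = fock_scale (cnj c) (\<theta> a)" for a b c
    using \<theta> unfolding is_theta_def by blast+
  show "\<theta> 0 = 0" using 1(2)[of 0 0] by simp
qed

lemma theta_monomial: "\<forall>k\<in>set ks. k \<ge> 1 \<Longrightarrow> \<theta> (h_monomial ks) = fock_scale ((- 1) ^ length ks) (h_monomial ks)"
  using \<theta> unfolding is_theta_def by blast

lemma theta_h: "\<theta> (h (- int (Suc j)) a) = fock_scale (- 1) (h (- int (Suc j)) (\<theta> a))"
proof (induction a rule: fock_induct)
  case zero
  show ?case by (simp only: h_lin theta_lin fock.scale_zero_right)
next
  case (step c ks a)
  have "\<theta> (h (- int (Suc j)) (h_monomial ks)) = fock_scale (- 1) (h (- int (Suc j)) (\<theta> (h_monomial ks)))"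
    using theta_monomial[of "Suc j # ks"] theta_monomial[OF step(1)] step(1)
    by (simp add: h_monomial_simps h_lin fock.scale_scale)
  then show ?case
    using step(2) unfolding h_lin theta_lin by (simp only: fock.scale_right_distrib fock.scale_scale mult.commute)
qed

lemma M_inner_lin:
  "M_inner \<theta> B (a + b) c = M_inner \<theta> B a c + M_inner \<theta> B b c" "M_inner \<theta> B (fock_scale k a) c = cnj k * M_inner \<theta> B a c"
  "M_inner \<theta> B 0 c = 0"
  "M_inner \<theta> B c (a + b) = M_inner \<theta> B c a + M_inner \<theta> B c b" "M_inner \<theta> B c (fock_scale k a) = k * M_inner \<theta> B c a"
  "M_inner \<theta> B c 0 = 0"
  by (simp_all add: M_inner_def theta_lin B_lin)

lemma M_inner_h: "M_inner \<theta> B (h (- int (Suc j)) a) b = M_inner \<theta> B a (h (int (Suc j)) b)"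
  unfolding M_inner_def theta_h B_lin B_h by (simp add: add.commute)

text \<open>Creation operators are adjoint to annihilation operators, which lower the power on the right.\<close>

lemma M_inner_fock_creation_power:
  "M_inner \<theta> B (fock_creation al a) ((fock_creation be ^^ q) vac)
    = of_nat q * ip disc_measure (one_particle be) (one_particle al) * M_inner \<theta> B a ((fock_creation be ^^ (q - 1)) vac)"
  unfolding ip_one_particle
proof (induction al)
  case Nil
  show ?case by (simp add: fock_creation_simps M_inner_lin)
next
  case (Cons y al)
  obtain c i where y: "y = (c, i)" by (cases y)
  have s: "(\<Sum>(d, j)\<leftarrow>be. if int (Suc j) = int (Suc i) then d else 0) = (\<Sum>(d, j)\<leftarrow>be. if j = i then d else (0::complex))"
    by (intro arg_cong[where f = sum_list] map_cong) auto
  show ?case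
    unfolding y fock_creation_simps M_inner_lin Cons M_inner_h
    by (subst h_fock_creation_power) (simp_all only: s M_inner_lin, simp_all add: algebra_simps)
qed

lemma M_inner_vac: "M_inner \<theta> B vac ((fock_creation be ^^ q) vac) = (if q = 0 then 1 else 0)"
proof -
  have tv: "\<theta> vac = vac" using theta_monomial[of "[]"] by (simp add: h_monomial_simps)
  have "B vac vac = 1" using B unfolding is_invariant_form_def by blast
  moreover have "B vac (fock_creation be v) = 0" for v
  proof (induction be)
    case (Cons y be)
    obtain d j where y: "y = (d, j)" by (cases y)
    have "B vac (h (- int (Suc j)) v) = - B v (h (int (Suc j)) vac)"
      unfolding B_sym[of vac] B_h by (simp add: add.commute)
    also have "\<dots> = 0" by (simp add: h_vac B_lin)
    finally show ?case using Cons unfolding y fock_creation_simps B_lin by simp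
  qed (simp add: fock_creation_simps B_lin)
  ultimately show ?thesis unfolding M_inner_def tv by (cases q) simp_all
qed

lemma M_inner_powers:
  "M_inner \<theta> B ((fock_creation al ^^ p) vac) ((fock_creation be ^^ q) vac) = (if p = q then fact p * (ip disc_measure (one_particle be) (one_particle al)) ^ p else 0)"
proof (induction p arbitrary: q)
  case 0
  show ?case by (simp add: M_inner_vac)
next
  case (Suc p)
  show ?case
    unfolding funpow.simps o_apply M_inner_fock_creation_power Suc by (cases q) (auto simp: algebra_simps)
qed

text \<open>On powers both forms are \<open>p! * (A, B) ^ p\<close>; polarisation gives the isometry.\<close>

lemma Psi_isometry:
  assumes Psi: "is_Psi \<Psi>" and ab: "a \<in> M_upto N" "b \<in> M_upto N"
  shows "M_inner \<theta> B a b = tens_ip N (\<Psi> b) (\<Psi> a)"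
proof -
  note lin = Psi_lin[OF Psi] and A2 = Psi_A2[OF Psi]
  have right: "tens_ip N z (x + y) = tens_ip N z x + tens_ip N z y"
    if "\<And>m. x m \<in> A2 m" "\<And>m. y m \<in> A2 m" "\<And>m. z m \<in> A2 m" for x y z
    using tens_ip_left[OF that, of N] unfolding tens_ip_commute[of N z] by (simp only: complex_cnj_add)
  have right_scale: "tens_ip N z (tens_scale c x) = cnj c * tens_ip N z x" for x z c
    unfolding tens_ip_commute[of N z] tens_ip_scale by simp
  have z0: "tens_ip N z 0 = 0" "tens_ip N 0 z = 0" for z by (simp_all add: tens_ip_def ip_def)
  have 1: "M_inner \<theta> B ((fock_creation al ^^ n) vac) b = tens_ip N (\<Psi> b) (\<Psi> ((fock_creation al ^^ n) vac))" if n: "n \<le> N" for al n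
  proof -
    let ?W = "{b. M_inner \<theta> B ((fock_creation al ^^ n) vac) b = tens_ip N (\<Psi> b) (\<Psi> ((fock_creation al ^^ n) vac))}"
    have "b \<in> ?W"
    proof (rule polarisation[OF _ _ ab(2)])
      show "fock.subspace ?W"
        by (rule fock.subspaceI)
           (simp_all only: mem_Collect_eq M_inner_lin lin z0 tens_ip_left[OF A2 A2 A2] tens_ip_scale)
      show "(fock_creation be ^^ q) vac \<in> ?W" if "q \<le> N" for be q
        using tens_ip_sym_tensor_replicate[OF one_particle_bergman one_particle_bergman that, of be n al]
        by (auto simp: M_inner_powers Psi_power[OF Psi])
    qed
    then show ?thesis by simp
  qed
  have "a \<in> {a. M_inner \<theta> B a b = tens_ip N (\<Psi> b) (\<Psi> a)}"
  proof (rule polarisation[OF _ _ ab(1)])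
    show "fock.subspace {a. M_inner \<theta> B a b = tens_ip N (\<Psi> b) (\<Psi> a)}"
      by (rule fock.subspaceI)
         (simp_all only: mem_Collect_eq M_inner_lin lin z0 right[OF A2 A2 A2] right_scale)
  qed (use 1 in auto)
  then show ?thesis by simp
qed

lemma M_dist_Sym_dist:
  assumes Psi: "is_Psi \<Psi>" and ab: "a \<in> M_upto N" "b \<in> M_upto N"
  shows "M_dist \<theta> B a b = Sym_dist N (\<Psi> a) (\<Psi> b)"
proof -
  have "M_inner \<theta> B (a - b) (a - b) = tens_ip N (\<Psi> (a - b)) (\<Psi> (a - b))"
    by (rule Psi_isometry[OF Psi]) (use ab M_upto_subspace in auto)
  also have "\<dots> = of_real (\<Sum>m\<le>N. (A2_norm m (\<Psi> (a - b) m))\<^sup>2)"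
    by (rule tens_ip_self[OF Psi_A2[OF Psi]])
  finally show ?thesis by (simp add: M_dist_def Sym_dist_def Psi_lin[OF Psi])
qed

end

end

section \<open>Absolute convergence of the mode expansion\<close>

text \<open>Fubini for absolutely convergent double series, regrouped by the difference of the two indices. It
  separates the modes of the field from the modes of the operator it acts with.\<close>

lemma shifted_product_has_sum:
  fixes f :: "int \<Rightarrow> 'a::{real_normed_field, banach}" and g :: "nat \<Rightarrow> 'a"
  assumes f: "(f has_sum S) UNIV" "(\<lambda>l. norm (f l)) summable_on UNIV"
    and g: "(g has_sum G) UNIV" "(\<lambda>i. norm (g i)) summable_on UNIV"
    and w: "\<And>l. ((\<lambda>i. g i * f (l + int i)) has_sum w l) UNIV"
  shows "(w has_sum G * S) UNIV"
proof -
  let ?F = "\<lambda>(l, i). g i * f l"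
  have "(\<lambda>(l, i). norm (g i) * norm (f l)) summable_on (UNIV \<times> UNIV)"
  proof (rule summable_on_SigmaI)
    show "((\<lambda>i. case (l, i) of (l, i) \<Rightarrow> norm (g i) * norm (f l)) has_sum (infsum (\<lambda>i. norm (g i)) UNIV * norm (f l))) UNIV" for l
      using has_sum_cmult_left[OF has_sum_infsum[OF g(2)]] by simp
    show "(\<lambda>l. infsum (\<lambda>i. norm (g i)) UNIV * norm (f l)) summable_on UNIV"
      by (rule summable_on_cmult_right[OF f(2)])
  qed auto
  then have "(\<lambda>p. norm (?F p)) summable_on (UNIV \<times> UNIV)"
    by (simp add: case_prod_unfold norm_mult)
  then have s: "?F summable_on (UNIV \<times> UNIV)"
    by (rule abs_summable_summable)
  have "(?F has_sum G * S) (UNIV \<times> UNIV)"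
  proof (rule has_sum_SigmaI[OF _ _ s])
    show "((\<lambda>i. case (l, i) of (l, i) \<Rightarrow> g i * f l) has_sum G * f l) UNIV" for l
      using has_sum_cmult_left[OF g(1)] by simp
    show "((\<lambda>l. G * f l) has_sum G * S) UNIV"
      by (rule has_sum_cmult_right[OF f(1)])
  qed
  moreover have "bij_betw (\<lambda>(l, i). (l + int i, i)) (UNIV \<times> UNIV) (UNIV \<times> UNIV)"
    by (rule bij_betwI[where g = "\<lambda>(l, i). (l - int i, i)"]) auto
  ultimately have "((\<lambda>p. ?F (case p of (l, i) \<Rightarrow> (l + int i, i))) has_sum G * S) (UNIV \<times> UNIV)"
    by (subst has_sum_reindex_bij_betw)
  then have "((\<lambda>(l, i). g i * f (l + int i)) has_sum G * S) (Sigma UNIV (\<lambda>_. UNIV))"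
    by (simp add: case_prod_unfold)
  then show ?thesis
    by (rule has_sum_SigmaD) (use w in simp)
qed

lemma has_sum_over_sum:
  fixes f :: "'i \<Rightarrow> 'a \<Rightarrow> 'b::{topological_comm_monoid_add, t2_space}"
  assumes "\<And>i. i \<in> I \<Longrightarrow> (f i has_sum s i) A"
  shows "((\<lambda>x. \<Sum>i\<in>I. f i x) has_sum (\<Sum>i\<in>I. s i)) A"
  using assms by (induction I rule: infinite_finite_induct) (auto intro: has_sum_add)

lemma summable_on_over_sum:
  fixes f :: "'i \<Rightarrow> 'a \<Rightarrow> 'b::{topological_comm_monoid_add, t2_space}"
  assumes "\<And>i. i \<in> I \<Longrightarrow> f i summable_on A"
  shows "(\<lambda>x. \<Sum>i\<in>I. f i x) summable_on A"
  using assms by (induction I rule: infinite_finite_induct) (auto intro: summable_on_add)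

lemma binomial_absorb: "(i + j + 1) * (i + j choose i) = (j + 1) * (i + j + 1 choose i)"
proof -
  have "i + j + 1 - i = Suc j" by simp
  then show ?thesis
    using binomial_absorb_comp[of "i + j + 1" i] by simp
qed

text \<open>The weight \<open>i + j + 1\<close> is the supremum of \<open>bergman_h (i + j)\<close>. It is absorbed into the binomial
  coefficient, which turns the series into the one for \<open>(1 - t) powr (- j - 2)\<close>.\<close>

lemma weighted_binomial_summable:
  fixes t :: real
  assumes "0 \<le> t" "t < 1"
  shows "(\<lambda>i. real (i + j choose i) * t ^ i * real (i + j + 1)) summable_on UNIV"
proof -
  have e: "(- real (Suc (Suc j)) gchoose i) * (- t) ^ i = real (i + j + 1 choose i) * t ^ i" for i
  proof -
    have "(- real (Suc (Suc j)) gchoose i) = (- 1) ^ i * (real (Suc (Suc j)) + real i - 1 gchoose i)"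
      by (rule gbinomial_minus)
    also have "real (Suc (Suc j)) + real i - 1 = real (i + j + 1)" by simp
    finally have "(- real (Suc (Suc j)) gchoose i) = (- 1) ^ i * real (i + j + 1 choose i)"
      by (simp only: binomial_gbinomial)
    moreover have "(- t) ^ i = (- 1) ^ i * t ^ i" by (rule power_minus)
    ultimately show ?thesis by (simp add: power_mult_distrib[symmetric])
  qed
  have "summable (\<lambda>i. (- real (Suc (Suc j)) gchoose i) * (- t) ^ i)"
    using gen_binomial_real[of "- t" "- real (Suc (Suc j))"] assms by (auto simp: sums_iff)
  then have "summable (\<lambda>i. real (j + 1) * (real (i + j + 1 choose i) * t ^ i))"
    unfolding e by (rule summable_mult)
  moreover have "real (j + 1) * (real (i + j + 1 choose i) * t ^ i) = real (i + j choose i) * t ^ i * real (i + j + 1)" for i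
    using arg_cong[OF binomial_absorb[of i j], of real] unfolding of_nat_mult by (simp only: mult_ac)
  ultimately have "summable (\<lambda>i. real (i + j choose i) * t ^ i * real (i + j + 1))" by (simp only:)
  then show ?thesis
    using assms by (subst summable_on_UNIV_nonneg_real_iff) auto
qed

lemma tens_creation_bound:
  assumes F: "\<And>m x. cmod (F m x) \<le> S" "\<And>m. m > p \<Longrightarrow> F m = 0" and A: "\<And>z. cmod (A z) \<le> c"
  shows "cmod (tens_creation A F m x) \<le> real (p + 1) * c * S"
proof -
  have c0: "0 \<le> c" using order_trans[OF norm_ge_zero A] .
  have S0: "0 \<le> S" using order_trans[OF norm_ge_zero F(1)] .
  show ?thesis
  proof (cases m)
    case 0
    then show ?thesis using c0 S0 by (simp add: tens_creation_def)
  next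
    case (Suc n)
    show ?thesis
    proof (cases "x \<in> polydisc (Suc n) \<and> n \<le> p")
      case False
      then have "tens_creation A F m x = 0" using F(2)[of n] by (auto simp: tens_creation_def Suc)
      then show ?thesis using c0 S0 by simp
    next
      case True
      let ?s = "\<Sum>b\<le>n. A (x b) * F n (restrict (x \<circ> Transposition.transpose n b) {..<n})"
      have "cmod ?s \<le> (\<Sum>b\<le>n. c * S)"
        by (intro sum_norm_le) (simp add: norm_mult mult_mono A F c0)
      then have 1: "cmod ?s \<le> real (p + 1) * c * S"
        using True c0 S0 mult_right_mono[of "real (Suc n)" "real (p + 1)" "c * S"] by (simp add: mult.assoc)
      have "cmod (tens_creation A F m x) = cmod ?s / sqrt (real (Suc n))"
        using True by (simp add: tens_creation_def Suc norm_divide del: of_nat_Suc)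
      also have "\<dots> \<le> cmod ?s / 1"
        by (rule divide_left_mono) simp_all
      finally show ?thesis using 1 by simp
    qed
  qed
qed

context
  fixes Y :: "fock \<Rightarrow> int \<Rightarrow> fock \<Rightarrow> fock" and \<Psi> :: "fock \<Rightarrow> tens" and \<zeta> :: complex
  assumes Y: "is_M0_vertex_algebra Y" and Psi: "is_Psi \<Psi>" and z0: "\<zeta> \<noteq> 0" and z1: "cmod \<zeta> < 1"
begin

text \<open>The term with index \<open>l\<close> of the expansion of \<open>Y(a, \<zeta>)b\<close>.\<close>

definition Y_term :: "fock \<Rightarrow> int \<Rightarrow> fock \<Rightarrow> fock" where
  "Y_term a l b = fock_scale (\<zeta> powi (- l - 1)) (Y a l b)"

lemma Y_term_lin:
  "Y_term (a + a') l b = Y_term a l b + Y_term a' l b" "Y_term (fock_scale c a) l b = fock_scale c (Y_term a l b)" "Y_term 0 l b = 0"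
  "Y_term a l (b + b') = Y_term a l b + Y_term a l b'" "Y_term a l (fock_scale c b) = fock_scale c (Y_term a l b)" "Y_term a l 0 = 0"
  by (simp_all add: Y_term_def Y_left[OF Y] Y_right[OF Y] fock.scale_right_distrib fock.scale_scale mult.commute)

lemma Y_term_M_upto: "b \<in> M_upto q \<Longrightarrow> a \<in> M_upto p \<Longrightarrow> Y_term a l b \<in> M_upto (p + q)"
  unfolding Y_term_def by (intro M_upto_subspace Y_M_upto[OF Y])

lemmas Psi_simps = Psi_lin[OF Psi]

lemma Psi_sum_apply: "\<Psi> (\<Sum>i\<in>I. f i) m x = (\<Sum>i\<in>I. \<Psi> (f i) m x)"
  by (simp add: Psi_simps sum_fun_apply)

lemma Psi_scale_apply: "\<Psi> (fock_scale c a) m x = c * \<Psi> a m x"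
  by (simp add: Psi_simps tens_scale_def)

lemma Psi_add_apply: "\<Psi> (a + b) m x = \<Psi> a m x + \<Psi> b m x"
  by (simp add: Psi_simps)

lemma Psi_zero_apply: "\<Psi> 0 m x = 0"
  by (simp add: Psi_simps)

text \<open>The factor with which the annihilation mode \<open>h (int i)\<close> enters \<open>Y(h(- j - 1)a, \<zeta>)\<close>.\<close>

definition annihilation_coeff :: "nat \<Rightarrow> nat \<Rightarrow> complex" where
  "annihilation_coeff j i = of_nat (i + j choose i) * (- 1) ^ j * \<zeta> powi (- int (Suc (i + j)))"

text \<open>The effect of one more creation mode in the first argument: the creation part of the field acts
  on the result, the annihilation part on the second argument.\<close>

lemma Y_term_h_has_sum:
  assumes Kb: "\<And>i. i \<ge> Kb \<Longrightarrow> h (int i) b = 0"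
  shows "((\<lambda>i. (of_nat (i + j choose i) * \<zeta> ^ i) * tens_creation (bergman_h (i + j)) (\<Psi> (Y_term a (l + int i) b)) m x)
    has_sum (\<Psi> (Y_term (h (- int (Suc j)) a) l b) m x - (\<Sum>i<Kb. annihilation_coeff j i * \<Psi> (Y_term a (l - int (Suc (i + j))) (h (int i) b)) m x))) UNIV"
proof -
  let ?\<beta> = "\<lambda>i. of_nat (i + j choose i) :: complex"
  obtain K0 where K0: "\<And>i. i \<ge> K0 \<Longrightarrow> Y a (l + int i) b = 0"
    and eq: "\<And>K. K \<ge> K0 \<Longrightarrow> Y (h (- int (Suc j)) a) l b = (\<Sum>i<K. fock_scale (?\<beta> i)
      (h (- int (Suc (i + j))) (Y a (l + int i) b)
       + fock_scale ((- 1) ^ j) (Y a (l - int (Suc (i + j))) (h (int i) b))))"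
    using Y_h[OF Y, of b a l j] by blast
  define K where "K = max K0 Kb"
  have p1: "\<zeta> powi (- l - 1) = \<zeta> ^ i * \<zeta> powi (- (l + int i) - 1)" for i
  proof -
    have "\<zeta> powi (- l - 1) = \<zeta> powi (int i + (- (l + int i) - 1))" by (rule arg_cong) simp
    also have "\<dots> = \<zeta> powi (int i) * \<zeta> powi (- (l + int i) - 1)" by (rule power_int_add) (use z0 in simp)
    finally show ?thesis by simp
  qed
  have p2: "\<zeta> powi (- l - 1) = \<zeta> powi (- int (Suc (i + j))) * \<zeta> powi (- (l - int (Suc (i + j))) - 1)" for i
  proof -
    have "\<zeta> powi (- l - 1) = \<zeta> powi (- int (Suc (i + j)) + (- (l - int (Suc (i + j))) - 1))" by (rule arg_cong) simp
    then show ?thesis using power_int_add[of \<zeta> "- int (Suc (i + j))"] z0 by metis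
  qed
  have summand: "fock_scale (\<zeta> powi (- l - 1)) (fock_scale (?\<beta> i)
      (h (- int (Suc (i + j))) (Y a (l + int i) b)
       + fock_scale ((- 1) ^ j) (Y a (l - int (Suc (i + j))) (h (int i) b))))
     = fock_scale (?\<beta> i * \<zeta> ^ i) (h (- int (Suc (i + j))) (Y_term a (l + int i) b))
       + fock_scale (annihilation_coeff j i) (Y_term a (l - int (Suc (i + j))) (h (int i) b))" for i
  proof -
    have 1: "fock_scale (\<zeta> powi (- l - 1)) (fock_scale (?\<beta> i) u) = fock_scale (?\<beta> i * \<zeta> ^ i) (fock_scale (\<zeta> powi (- (l + int i) - 1)) u)" for u
      unfolding fock.scale_scale p1[of i] by (simp only: mult_ac)
    have 2: "fock_scale (\<zeta> powi (- l - 1)) (fock_scale (?\<beta> i) (fock_scale ((- 1) ^ j) u))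
       = fock_scale (annihilation_coeff j i) (fock_scale (\<zeta> powi (- (l - int (Suc (i + j))) - 1)) u)" for u
      unfolding fock.scale_scale p2[of i] annihilation_coeff_def by (simp only: mult_ac)
    show ?thesis
      unfolding Y_term_def fock.scale_right_distrib h_lin
        1[of "h (- int (Suc (i + j))) (Y a (l + int i) b)"] 2[of "Y a (l - int (Suc (i + j))) (h (int i) b)"] ..
  qed
  have VK: "Y_term (h (- int (Suc j)) a) l b = (\<Sum>i<K. fock_scale (?\<beta> i * \<zeta> ^ i) (h (- int (Suc (i + j))) (Y_term a (l + int i) b))
       + fock_scale (annihilation_coeff j i) (Y_term a (l - int (Suc (i + j))) (h (int i) b)))"
    unfolding Y_term_def[of "h (- int (Suc j)) a"] eq[of K, unfolded K_def, OF max.cobounded1, folded K_def]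
      fock.scale_sum_right summand ..
  have "\<Psi> (Y_term (h (- int (Suc j)) a) l b) m x
      = (\<Sum>i<K. (?\<beta> i * \<zeta> ^ i) * tens_creation (bergman_h (i + j)) (\<Psi> (Y_term a (l + int i) b)) m x)
       + (\<Sum>i<K. annihilation_coeff j i * \<Psi> (Y_term a (l - int (Suc (i + j))) (h (int i) b)) m x)"
    unfolding VK Psi_sum_apply Psi_add_apply Psi_scale_apply Psi_h[OF Psi] sum.distrib ..
  also have "(\<Sum>i<K. annihilation_coeff j i * \<Psi> (Y_term a (l - int (Suc (i + j))) (h (int i) b)) m x)
      = (\<Sum>i<Kb. annihilation_coeff j i * \<Psi> (Y_term a (l - int (Suc (i + j))) (h (int i) b)) m x)"
    by (rule sum.mono_neutral_right) (auto simp: K_def Kb Y_term_lin Psi_zero_apply)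
  finally have e: "\<Psi> (Y_term (h (- int (Suc j)) a) l b) m x - (\<Sum>i<Kb. annihilation_coeff j i * \<Psi> (Y_term a (l - int (Suc (i + j))) (h (int i) b)) m x)
      = (\<Sum>i<K. (?\<beta> i * \<zeta> ^ i) * tens_creation (bergman_h (i + j)) (\<Psi> (Y_term a (l + int i) b)) m x)" by simp
  have z: "tens_creation (bergman_h (i + j)) (\<Psi> (Y_term a (l + int i) b)) m x = 0" if "i \<notin> {..<K}" for i
  proof -
    have "Y_term a (l + int i) b = 0" using K0[of i] that by (simp add: Y_term_def K_def)
    then have "\<Psi> (Y_term a (l + int i) b) = 0" using Psi_simps(3) by simp
    then have "tens_creation (bergman_h (i + j)) (\<Psi> (Y_term a (l + int i) b)) = 0" by (simp only: tens_creation_lin)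
    then show ?thesis by simp
  qed
  show ?thesis unfolding e
    by (rule has_sum_cong_neutral[THEN iffD1, OF _ _ _ has_sum_finite[OF finite_lessThan[of K]]])
       (use z in auto)
qed

text \<open>A bound by suprema rather than norms: it is stable under the recursion in \<open>a\<close>, gives the pointwise
  absolute convergence needed for rearrangements, and bounds norms because the measures have mass 1.\<close>

definition Y_terms_dominated :: "fock \<Rightarrow> fock \<Rightarrow> bool" where
  "Y_terms_dominated a b \<longleftrightarrow> (\<exists>g. g summable_on UNIV \<and> (\<forall>l m x. cmod (\<Psi> (Y_term a l b) m x) \<le> g l))"

text \<open>The components are polynomials, built up by finitely many creation operators.\<close>

lemma Psi_bounded: "\<exists>S. \<forall>m x. cmod (\<Psi> b m x) \<le> S"
proof (induction b rule: fock_induct)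
  case zero
  show ?case by (intro exI[of _ 0]) (simp add: Psi_zero_apply)
next
  case (step c ks a)
  have "\<exists>S. \<forall>m x. cmod (\<Psi> (h_monomial ks) m x) \<le> S" using step(1)
  proof (induction ks)
    case Nil
    have "cmod (\<Psi> vac m x) \<le> 1" for m x
      using Psi by (auto simp: is_Psi_def in_degree_def pure_tensor_def)
    then show ?case by (auto simp: h_monomial_simps)
  next
    case (Cons k ks)
    then obtain S where S: "\<And>m x. cmod (\<Psi> (h_monomial ks) m x) \<le> S" by auto
    have k: "k = Suc (k - 1)" using Cons.prems by simp
    have "\<Psi> (h_monomial (k # ks)) = tens_creation (bergman_h (k - 1)) (\<Psi> (h_monomial ks))"
      using Psi_h[OF Psi, of "k - 1"] k by (simp add: h_monomial_simps)
    moreover have "\<Psi> (h_monomial ks) m = 0" if "m > length ks" for m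
      using Psi_degree[OF Psi M_upto_monomial] Cons.prems that by auto
    ultimately have "cmod (\<Psi> (h_monomial (k # ks)) m x) \<le> real (length ks + 1) * real (k - 1 + 1) * S" for m x
      using tens_creation_bound[of "\<Psi> (h_monomial ks)" S "length ks" "bergman_h (k - 1)" "real (k - 1 + 1)"] S bergman_h_bound
      by metis
    then show ?case by auto
  qed
  then obtain S1 S2 where S: "\<And>m x. cmod (\<Psi> (h_monomial ks) m x) \<le> S1" "\<And>m x. cmod (\<Psi> a m x) \<le> S2"
    using step(2) by auto
  have "cmod (\<Psi> (fock_scale c (h_monomial ks) + a) m x) \<le> cmod c * S1 + S2" for m x
    unfolding Psi_add_apply Psi_scale_apply
    by (rule norm_triangle_le) (simp add: norm_mult add_mono mult_left_mono S)
  then show ?case by auto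
qed

lemma Y_terms_dominated_vac: "Y_terms_dominated vac b"
proof -
  obtain S where S: "\<And>m x. cmod (\<Psi> b m x) \<le> S" using Psi_bounded[of b] by auto
  have "cmod (\<Psi> (Y_term vac l b) m x) \<le> (if l = -1 then S else 0)" for l m x
    using S by (simp add: Y_term_def Y_vac[OF Y] Psi_zero_apply)
  moreover have "(\<lambda>l::int. if l = -1 then S else 0) summable_on UNIV"
  proof -
    have "(\<lambda>l::int. if l = -1 then S else 0) summable_on {-1}" by simp
    then show ?thesis by (rule summable_on_cong_neutral[THEN iffD1, rotated -1]) auto
  qed
  ultimately show ?thesis unfolding Y_terms_dominated_def by blast
qed

lemma Y_terms_dominated_lin:
  assumes "Y_terms_dominated a b" "Y_terms_dominated a' b"
  shows "Y_terms_dominated (fock_scale c a + a') b"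
proof -
  obtain g g' where g: "g summable_on UNIV" "\<And>l m x. cmod (\<Psi> (Y_term a l b) m x) \<le> g l"
    and g': "g' summable_on UNIV" "\<And>l m x. cmod (\<Psi> (Y_term a' l b) m x) \<le> g' l"
    using assms unfolding Y_terms_dominated_def by blast
  have "(\<lambda>l. cmod c * g l + g' l) summable_on UNIV"
    by (intro summable_on_add summable_on_cmult_right g g')
  moreover have "cmod (\<Psi> (Y_term (fock_scale c a + a') l b) m x) \<le> cmod c * g l + g' l" for l m x
    unfolding Y_term_lin Psi_add_apply Psi_scale_apply
    by (rule norm_triangle_le) (simp add: norm_mult add_mono mult_left_mono g g')
  ultimately show ?thesis unfolding Y_terms_dominated_def by blast
qed

text \<open>The creation part is a convolution of the bound for \<open>a\<close> with a summable sequence; the annihilation part is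
  a finite sum of shifted bounds for other second arguments.\<close>

lemma Y_terms_dominated_h:
  assumes IH: "\<And>b. Y_terms_dominated a b"
  shows "Y_terms_dominated (h (- int (Suc j)) a) b"
proof -
  obtain g where g: "g summable_on UNIV" "\<And>l m x. cmod (\<Psi> (Y_term a l b) m x) \<le> g l"
    using IH[of b] unfolding Y_terms_dominated_def by blast
  obtain Kb where Kb: "\<And>i. i \<ge> Kb \<Longrightarrow> h (int i) b = 0" using Y_h[OF Y, of b vac 0 0] by blast
  have "\<forall>i. \<exists>g. g summable_on UNIV \<and> (\<forall>l m x. cmod (\<Psi> (Y_term a l (h (int i) b)) m x) \<le> g l)"
    using IH unfolding Y_terms_dominated_def by blast
  then obtain gi where gi: "\<And>i. gi i summable_on UNIV" "\<And>i l m x. cmod (\<Psi> (Y_term a l (h (int i) b)) m x) \<le> gi i l"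
    by metis
  obtain p q where p: "a \<in> M_upto p" and q: "b \<in> M_upto q" using fock_union by meson
  have g0: "0 \<le> g l" for l using order_trans[OF norm_ge_zero g(2)] .
  let ?c = "\<lambda>i. real (i + j choose i) * cmod \<zeta> ^ i * real (i + j + 1)"
  have cs: "?c summable_on UNIV" using z1 by (intro weighted_binomial_summable) auto
  define Gm where "Gm = infsum g UNIV"
  have gG: "g l \<le> Gm" for l
    unfolding Gm_def using infsum_mono_neutral[of g "{l}" g UNIV] g g0 by auto
  have ws: "(\<lambda>i. ?c i * g (l + int i)) summable_on UNIV" for l
    by (rule summable_on_comparison_test[OF summable_on_cmult_left[OF cs, of Gm]])
       (auto intro!: mult_left_mono gG mult_nonneg_nonneg g0)
  define w where "w = (\<lambda>l. infsum (\<lambda>i. ?c i * g (l + int i)) UNIV)"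
  have "(w has_sum infsum ?c UNIV * infsum g UNIV) UNIV"
  proof (rule shifted_product_has_sum)
    show "(g has_sum infsum g UNIV) UNIV" "(?c has_sum infsum ?c UNIV) UNIV" using g cs by simp_all
    show "(\<lambda>l. norm (g l)) summable_on UNIV" using g g0 by simp
    show "(\<lambda>i. norm (?c i)) summable_on UNIV" using cs by simp
    show "((\<lambda>i. ?c i * g (l + int i)) has_sum w l) UNIV" for l unfolding w_def using ws by simp
  qed
  then have wsum: "w summable_on UNIV" by (rule has_sum_imp_summable)
  let ?acoeff = "\<lambda>l. \<Sum>i<Kb. cmod (annihilation_coeff j i) * gi i (l - int (Suc (i + j)))"
  have lowsum: "?acoeff summable_on UNIV"
  proof (intro summable_on_over_sum summable_on_cmult_right)
    fix i
    have "bij (\<lambda>l::int. l - int (Suc (i + j)))" by (rule bij_betwI[where g = "\<lambda>l. l + int (Suc (i + j))"]) auto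
    then show "(\<lambda>l. gi i (l - int (Suc (i + j)))) summable_on UNIV"
      using summable_on_reindex_bij_betw[of _ UNIV UNIV "gi i"] gi(1) by blast
  qed
  have bound: "cmod (\<Psi> (Y_term (h (- int (Suc j)) a) l b) m x) \<le> real (p + q + 1) * w l + ?acoeff l" for l m x
  proof -
    let ?t = "\<lambda>i. (of_nat (i + j choose i) * \<zeta> ^ i) * tens_creation (bergman_h (i + j)) (\<Psi> (Y_term a (l + int i) b)) m x"
    let ?L = "\<Sum>i<Kb. annihilation_coeff j i * \<Psi> (Y_term a (l - int (Suc (i + j))) (h (int i) b)) m x"
    note hs = Y_term_h_has_sum[OF Kb, where a = a and j = j and l = l and m = m and x = x]
    have tb: "norm (?t i) \<le> real (p + q + 1) * (?c i * g (l + int i))" for i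
    proof -
      have "cmod (tens_creation (bergman_h (i + j)) (\<Psi> (Y_term a (l + int i) b)) m x) \<le> real (p + q + 1) * real (i + j + 1) * g (l + int i)"
      proof (rule tens_creation_bound)
        show "\<Psi> (Y_term a (l + int i) b) m = 0" if "m > p + q" for m
          by (rule Psi_degree[OF Psi Y_term_M_upto[OF q p] that])
      qed (rule g bergman_h_bound)+
      then have "real (i + j choose i) * cmod \<zeta> ^ i * cmod (tens_creation (bergman_h (i + j)) (\<Psi> (Y_term a (l + int i) b)) m x)
         \<le> real (i + j choose i) * cmod \<zeta> ^ i * (real (p + q + 1) * real (i + j + 1) * g (l + int i))"
        by (intro mult_left_mono) auto
      then show ?thesis by (simp add: norm_mult norm_power mult_ac del: of_nat_add)
    qed
    have ts: "(\<lambda>i. norm (?t i)) summable_on UNIV"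
      by (rule summable_on_comparison_test[OF summable_on_cmult_right[OF ws]]) (use tb in auto)
    have "cmod (infsum ?t UNIV) \<le> infsum (\<lambda>i. norm (?t i)) UNIV"
      by (rule norm_infsum_bound[OF ts])
    also have "\<dots> \<le> infsum (\<lambda>i. real (p + q + 1) * (?c i * g (l + int i))) UNIV"
      by (rule infsum_mono[OF ts summable_on_cmult_right[OF ws] tb])
    also have "\<dots> = real (p + q + 1) * w l"
      unfolding w_def by (rule infsum_cmult_right) (use ws in simp)
    finally have 1: "cmod (infsum ?t UNIV) \<le> real (p + q + 1) * w l" .
    have 2: "cmod ?L \<le> ?acoeff l"
      by (intro sum_norm_le) (simp add: norm_mult mult_left_mono gi)
    have "\<Psi> (Y_term (h (- int (Suc j)) a) l b) m x = infsum ?t UNIV + ?L"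
      using infsumI[OF hs] by simp
    then show ?thesis using norm_triangle_mono[OF 1 2] by (simp only:)
  qed
  have "(\<lambda>l. real (p + q + 1) * w l + ?acoeff l) summable_on UNIV"
    by (intro summable_on_add summable_on_cmult_right wsum lowsum)
  then show ?thesis unfolding Y_terms_dominated_def using bound by (intro exI[of _ "\<lambda>l. real (p + q + 1) * w l + ?acoeff l"]) blast
qed

lemma Y_bound: "Y_terms_dominated a b"
proof (induction a rule: fock_induct)
  case zero
  show ?case unfolding Y_terms_dominated_def by (intro exI[of _ "\<lambda>_. 0"]) (simp add: Y_term_lin Psi_zero_apply)
next
  case (step c ks a)
  have "\<forall>b. Y_terms_dominated (h_monomial ks) b" using step(1)
  proof (induction ks)
    case Nil
    show ?case by (simp add: h_monomial_simps Y_terms_dominated_vac)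
  next
    case (Cons k ks)
    then have "Y_terms_dominated (h_monomial ks) b" for b by auto
    then have "Y_terms_dominated (h (- int (Suc (k - 1))) (h_monomial ks)) b" for b by (rule Y_terms_dominated_h)
    moreover have "Suc (k - 1) = k" using Cons.prems by simp
    ultimately show ?case by (simp only: h_monomial_simps simp_thms)
  qed
  then show ?case using step(2) by (intro Y_terms_dominated_lin) auto
qed

lemma Y_term_summable: "(\<lambda>l. norm (\<Psi> (Y_term a l b) m x)) summable_on UNIV"
proof -
  obtain g where g: "g summable_on UNIV" "\<And>l m x. cmod (\<Psi> (Y_term a l b) m x) \<le> g l"
    using Y_bound[of a b] unfolding Y_terms_dominated_def by blast
  show ?thesis by (rule summable_on_comparison_test[OF g(1)]) (simp_all add: g(2))
qed

text \<open>Convergence is pointwise here; convergence in the completion follows separately from \<open>Y_terms_dominated\<close>.\<close>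

definition Y_sum_is :: "fock \<Rightarrow> fock \<Rightarrow> tens \<Rightarrow> bool" where
  "Y_sum_is a b S \<longleftrightarrow> (\<forall>m x. ((\<lambda>l. \<Psi> (Y_term a l b) m x) has_sum S m x) UNIV)"

lemma Y_sum_is_lin:
  "Y_sum_is a b S \<Longrightarrow> Y_sum_is a' b S' \<Longrightarrow> Y_sum_is (a + a') b (S + S')"
  "Y_sum_is a b S \<Longrightarrow> Y_sum_is (fock_scale c a) b (tens_scale c S)" "Y_sum_is 0 b 0"
  "Y_sum_is a b S \<Longrightarrow> Y_sum_is a b' S' \<Longrightarrow> Y_sum_is a (b + b') (S + S')"
  "Y_sum_is a b S \<Longrightarrow> Y_sum_is a (fock_scale c b) (tens_scale c S)" "Y_sum_is a 0 0"
  unfolding Y_sum_is_def Y_term_lin Psi_add_apply Psi_scale_apply Psi_zero_apply tens_scale_def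
  by (auto intro!: has_sum_add has_sum_cmult_right)

text \<open>\<open>W j\<close> stands for the image of the \<open>j\<close>-th basis vector under the creation part of the field.\<close>

context
  fixes W :: "nat \<Rightarrow> complex \<Rightarrow> complex"
  assumes W: "\<And>j x. x \<in> disc \<Longrightarrow> ((\<lambda>i. of_nat (i + j choose i) * \<zeta> ^ i * bergman_h (i + j) x) has_sum W j x) UNIV"
begin

lemma W_summable: 
  "(\<lambda>i. norm (of_nat (i + j choose i) * \<zeta> ^ i * bergman_h (i + j) x)) summable_on UNIV"
proof (rule summable_on_comparison_test[OF weighted_binomial_summable[of "cmod \<zeta>" j]])
  fix i
  show "norm (of_nat (i + j choose i) * \<zeta> ^ i * bergman_h (i + j) x) \<le> real (i + j choose i) * cmod \<zeta> ^ i * real (i + j + 1)"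
    unfolding norm_mult norm_power norm_of_nat by (intro mult_left_mono bergman_h_bound) auto
qed (use z1 in auto)

text \<open>Summing \<open>Y_term_h_has_sum\<close> over \<open>l\<close>. In the creation part the sum over \<open>l\<close> and the sum over the modes
  factorise at each of the \<open>n + 1\<close> variables that the new factor can occupy.\<close>

lemma Y_sum_is_h:
  assumes S: "Y_sum_is a b S" and S': "\<And>i. Y_sum_is a (h (int i) b) (S' i)" and Kb: "\<And>i. i \<ge> Kb \<Longrightarrow> h (int i) b = 0"
  shows "Y_sum_is (h (- int (Suc j)) a) b (tens_creation (W j) S + (\<Sum>i<Kb. tens_scale (annihilation_coeff j i) (S' i)))"
  unfolding Y_sum_is_def
proof (intro allI)
  fix m x
  let ?w = "\<lambda>l. \<Psi> (Y_term (h (- int (Suc j)) a) l b) m x - (\<Sum>i<Kb. annihilation_coeff j i * \<Psi> (Y_term a (l - int (Suc (i + j))) (h (int i) b)) m x)"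
  note hs = Y_term_h_has_sum[OF Kb, where a = a and j = j and m = m and x = x]
  have up: "(?w has_sum tens_creation (W j) S m x) UNIV"
  proof (cases "m = 0 \<or> x \<notin> polydisc m")
    case True
    then have z: "tens_creation A F m x = 0" for A F by (auto simp: tens_creation_def split: nat.split)
    have "?w l = 0" for l
      by (rule has_sum_unique[OF hs has_sum_0]) (simp_all add: z)
    then show ?thesis by (simp add: z)
  next
    case False
    then obtain n where m: "m = Suc n" and x: "x \<in> polydisc (Suc n)" by (cases m) auto
    let ?xb = "\<lambda>b. restrict (x \<circ> Transposition.transpose n b) {..<n}"
    let ?g = "\<lambda>b i. of_nat (i + j choose i) * \<zeta> ^ i * bergman_h (i + j) (x b)"
    let ?f = "\<lambda>b' l. \<Psi> (Y_term a l b) n (?xb b')"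
    let ?wb = "\<lambda>b' l. infsum (\<lambda>i. ?g b' i * ?f b' (l + int i)) UNIV"
    have wbs: "((\<lambda>i. ?g b' i * ?f b' (l + int i)) has_sum ?wb b' l) UNIV" if "b' \<le> n" for b' l
    proof -
      obtain Y0 where Y0: "\<And>k. k \<ge> Y0 \<Longrightarrow> Y a k b = 0"
        using vertex_algebra.truncation[OF VA[OF Y], of a b] by blast
      have "finite {i. ?g b' i * ?f b' (l + int i) \<noteq> 0}"
      proof (rule finite_subset)
        show "{i. ?g b' i * ?f b' (l + int i) \<noteq> 0} \<subseteq> {..<nat (Y0 - l)}"
        proof (rule subsetI, rule ccontr)
          fix i assume i: "i \<in> {i. ?g b' i * ?f b' (l + int i) \<noteq> 0}" "i \<notin> {..<nat (Y0 - l)}"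
          then have "Y_term a (l + int i) b = 0" using Y0[of "l + int i"] by (simp add: Y_term_def)
          then show False using i by (simp add: Psi_zero_apply)
        qed
      qed simp
      then have "(\<lambda>i. ?g b' i * ?f b' (l + int i)) summable_on {i. ?g b' i * ?f b' (l + int i) \<noteq> 0}" by simp
      then have "(\<lambda>i. ?g b' i * ?f b' (l + int i)) summable_on UNIV"
        by (rule summable_on_cong_neutral[THEN iffD1, rotated -1]) auto
      then show ?thesis by simp
    qed
    have wb: "(?wb b' has_sum W j (x b') * S n (?xb b')) UNIV" if b': "b' \<le> n" for b'
    proof (rule shifted_product_has_sum)
      show "(?f b' has_sum S n (?xb b')) UNIV" using S by (simp add: Y_sum_is_def)
      show "(\<lambda>l. norm (?f b' l)) summable_on UNIV" by (rule Y_term_summable)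
      show "(?g b' has_sum W j (x b')) UNIV" by (rule W[OF polydisc_coordinate[OF x]]) (use b' in simp)
      show "(\<lambda>i. norm (?g b' i)) summable_on UNIV" by (rule W_summable)
    qed (rule wbs[OF b'])
    have "((\<lambda>l. (\<Sum>b'\<le>n. ?wb b' l) / of_real (sqrt (real (Suc n)))) has_sum
        (\<Sum>b'\<le>n. W j (x b') * S n (?xb b')) / of_real (sqrt (real (Suc n)))) UNIV"
      by (intro has_sum_divide_const has_sum_over_sum) (use wb in auto)
    moreover have "?w l = (\<Sum>b'\<le>n. ?wb b' l) / of_real (sqrt (real (Suc n)))" for l
    proof (rule has_sum_unique[OF hs])
      have "((\<lambda>i. (\<Sum>b'\<le>n. ?g b' i * ?f b' (l + int i)) / of_real (sqrt (real (Suc n)))) has_sum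
         (\<Sum>b'\<le>n. ?wb b' l) / of_real (sqrt (real (Suc n)))) UNIV"
        by (intro has_sum_divide_const has_sum_over_sum) (use wbs in auto)
      then show "((\<lambda>i. of_nat (i + j choose i) * \<zeta> ^ i * tens_creation (bergman_h (i + j)) (\<Psi> (Y_term a (l + int i) b)) m x) has_sum
         (\<Sum>b'\<le>n. ?wb b' l) / of_real (sqrt (real (Suc n)))) UNIV"
        using x by (simp add: tens_creation_def m sum_distrib_left mult.assoc del: of_nat_Suc)
    qed
    ultimately show ?thesis using x by (simp add: tens_creation_def m del: of_nat_Suc)
  qed
  have acoeff: "((\<lambda>l. \<Sum>i<Kb. annihilation_coeff j i * \<Psi> (Y_term a (l - int (Suc (i + j))) (h (int i) b)) m x) has_sum
      (\<Sum>i<Kb. annihilation_coeff j i * S' i m x)) UNIV"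
  proof (intro has_sum_over_sum has_sum_cmult_right)
    fix i
    have "bij (\<lambda>l::int. l - int (Suc (i + j)))" by (rule bij_betwI[where g = "\<lambda>l. l + int (Suc (i + j))"]) auto
    then show "((\<lambda>l. \<Psi> (Y_term a (l - int (Suc (i + j))) (h (int i) b)) m x) has_sum S' i m x) UNIV"
      using has_sum_reindex_bij_betw[of "\<lambda>l. l - int (Suc (i + j))" UNIV UNIV "\<lambda>l. \<Psi> (Y_term a l (h (int i) b)) m x"] S'[of i]
      by (simp add: Y_sum_is_def)
  qed
  show "((\<lambda>l. \<Psi> (Y_term (h (- int (Suc j)) a) l b) m x) has_sum
      (tens_creation (W j) S + (\<Sum>i<Kb. tens_scale (annihilation_coeff j i) (S' i))) m x) UNIV"
    using has_sum_add[OF up acoeff] by (simp add: tens_scale_def sum_fun_apply)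
qed

end

end

section \<open>The mode expansion on powers\<close>

lemma tens_scale_left: "tens_scale (c + d) x = tens_scale c x + tens_scale d x" "tens_scale 0 x = 0"
  by (auto simp: tens_scale_def fun_eq_iff algebra_simps)

lemma mode_sum:
  fixes f :: "nat \<Rightarrow> complex"
  assumes "\<And>d k. (d, k) \<in> set be \<Longrightarrow> Suc k < K"
  shows "(\<Sum>i<K. f i * (\<Sum>(d, k)\<leftarrow>be. if int (Suc k) = int i then d else 0)) = (\<Sum>(d, k)\<leftarrow>be. d * f (Suc k))"
  using assms
proof (induction be)
  case (Cons y be)
  obtain d k where y: "y = (d, k)" by (cases y)
  have "(\<Sum>i<K. f i * (\<Sum>(d, k)\<leftarrow>y # be. if int (Suc k) = int i then d else 0))
     = (\<Sum>i<K. if i = Suc k then f i * d else 0) + (\<Sum>i<K. f i * (\<Sum>(d, k)\<leftarrow>be. if int (Suc k) = int i then d else 0))"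
    unfolding sum.distrib[symmetric] by (intro sum.cong) (auto simp: y distrib_left)
  also have "(\<Sum>i<K. if i = Suc k then f i * d else 0) = f (Suc k) * d"
    using Cons.prems[of d k] by (simp add: y)
  finally have e: "(\<Sum>i<K. f i * (\<Sum>(d, k)\<leftarrow>y # be. if int (Suc k) = int i then d else 0))
     = f (Suc k) * d + (\<Sum>i<K. f i * (\<Sum>(d, k)\<leftarrow>be. if int (Suc k) = int i then d else 0))" .
  have ih: "(\<Sum>i<K. f i * (\<Sum>(d, k)\<leftarrow>be. if int (Suc k) = int i then d else 0)) = (\<Sum>(d, k)\<leftarrow>be. d * f (Suc k))"
    by (rule Cons.IH) (use Cons.prems in auto)
  show ?case unfolding e ih by (simp add: y)
qed simp

text \<open>Of \<open>p\<close> factors \<open>A\<close> and \<open>q\<close> factors \<open>B\<close>, \<open>k\<close> pairs are contracted. The terms with \<open>k > q\<close> vanish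
  with their binomial coefficient; summing up to \<open>p\<close> suits the recursion.\<close>

definition contraction_sum :: "complex \<Rightarrow> (complex \<Rightarrow> complex) \<Rightarrow> (complex \<Rightarrow> complex) \<Rightarrow> nat \<Rightarrow> nat \<Rightarrow> tens" where
  "contraction_sum C A B p q = (\<Sum>k\<le>p. tens_scale (C ^ k * fact k * of_nat (p choose k) * of_nat (q choose k))
     (sym_tensor (replicate (p - k) A @ replicate (q - k) B)))"

text \<open>A further factor \<open>A\<close> is either left alone or contracted with one of the \<open>q\<close> factors \<open>B\<close>; this is
  Pascal's rule for \<open>p\<close>.\<close>

lemma contraction_sum_Suc:
  "contraction_sum C A B (Suc p) q = tens_creation A (contraction_sum C A B p q) + tens_scale (of_nat q * C) (contraction_sum C A B p (q - 1))"
proof -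
  let ?P = "\<lambda>i j. sym_tensor (replicate i A @ replicate j B)"
  have crsum: "tens_creation A (\<Sum>k\<in>I. f k) = (\<Sum>k\<in>I. tens_creation A (f k))" for f and I :: "nat set"
    by (induction I rule: infinite_finite_induct) (simp_all only: sum.infinite sum.empty sum.insert tens_creation_lin simp_thms)
  let ?co = "\<lambda>x y k. C ^ k * fact k * complex_of_nat x * of_nat y"
  let ?A = "tens_scale (?co 1 1 0) (?P (Suc p) q)"
  let ?X = "\<lambda>b. \<Sum>k\<le>p. tens_scale (?co (b k) (q choose Suc k) (Suc k)) (?P (p - k) (q - Suc k))"
  have split: "contraction_sum C A B (Suc p) q = ?A + ?X (\<lambda>k. Suc p choose Suc k)"
    unfolding contraction_sum_def by (subst sum.atMost_Suc_shift) simp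
  have pascal: "?X (\<lambda>k. Suc p choose Suc k) = ?X (\<lambda>k. p choose Suc k) + ?X (\<lambda>k. p choose k)"
    unfolding sum.distrib[symmetric] tens_scale_left(1)[symmetric]
    by (intro sum.cong HOL.refl arg_cong2[where f = tens_scale]) (simp add: algebra_simps)
  have "?A + ?X (\<lambda>k. p choose Suc k) = (\<Sum>k\<le>Suc p. tens_scale (?co (p choose k) (q choose k) k) (?P (Suc p - k) (q - k)))"
    by (subst sum.atMost_Suc_shift) (simp only: binomial_n_0 of_nat_1 diff_zero diff_Suc_Suc)
  also have "\<dots> = (\<Sum>k\<le>p. tens_scale (?co (p choose k) (q choose k) k) (?P (Suc p - k) (q - k)))"
  proof -
    have "?co (p choose Suc p) (q choose Suc p) (Suc p) = 0" by simp
    then show ?thesis unfolding sum.atMost_Suc by (simp only: tens_scale_left add_0_right)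
  qed
  also have "\<dots> = tens_creation A (contraction_sum C A B p q)"
    unfolding contraction_sum_def crsum tens_creation_lin
    by (intro sum.cong HOL.refl arg_cong2[where f = tens_scale]) (simp add: Suc_diff_le sym_tensor_Cons)
  finally have new_factor: "?A + ?X (\<lambda>k. p choose Suc k) = tens_creation A (contraction_sum C A B p q)" .
  have contracted: "?X (\<lambda>k. p choose k) = tens_scale (of_nat q * C) (contraction_sum C A B p (q - 1))"
    unfolding contraction_sum_def tens_scale_sum tens_scale_add
  proof (intro sum.cong HOL.refl arg_cong2[where f = tens_scale] arg_cong[where f = sym_tensor])
    fix k
    have "Suc k * (q choose Suc k) = q * (q - 1 choose k)"
      by (cases q) (simp_all only: Suc_times_binomial diff_Suc_1 binomial_0_Suc mult_0_right mult_0)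
    then have e: "of_nat (Suc k) * of_nat (q choose Suc k) = (of_nat q * of_nat (q - 1 choose k) :: complex)"
      by (simp only: of_nat_mult[symmetric])
    have "?co (p choose k) (q choose Suc k) (Suc k)
        = C * C ^ k * fact k * of_nat (p choose k) * (of_nat (Suc k) * of_nat (q choose Suc k))"
      by (simp only: power_Suc fact_Suc mult_ac)
    also have "\<dots> = of_nat q * C * (?co (p choose k) (q - 1 choose k) k)"
      unfolding e by (simp only: mult_ac)
    finally show "?co (p choose k) (q choose Suc k) (Suc k) = of_nat q * C * (?co (p choose k) (q - 1 choose k) k)" .
    show "replicate (p - k) A @ replicate (q - Suc k) B = replicate (p - k) A @ replicate (q - 1 - k) B" by simp
  qed
  show ?thesis unfolding split pascal contracted[symmetric] new_factor[symmetric] by (simp only: add.assoc)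
qed

text \<open>The image of a one-particle vector when the basis vectors are sent to \<open>W j\<close>.\<close>

definition one_particle_image :: "(nat \<Rightarrow> complex \<Rightarrow> complex) \<Rightarrow> (complex \<times> nat) list \<Rightarrow> complex \<Rightarrow> complex" where
  "one_particle_image W al x = (\<Sum>(c, j)\<leftarrow>al. c * W j x)"

context
  fixes Y :: "fock \<Rightarrow> int \<Rightarrow> fock \<Rightarrow> fock" and \<Psi> :: "fock \<Rightarrow> tens" and \<zeta> :: complex
  assumes Y: "is_M0_vertex_algebra Y" and Psi: "is_Psi \<Psi>" and z0: "\<zeta> \<noteq> 0" and z1: "cmod \<zeta> < 1"
begin

lemmas YPz = Y Psi z0 z1

abbreviation (input) "sums_to \<equiv> Y_sum_is Y \<Psi> \<zeta>"
abbreviation (input) "acoeff \<equiv> annihilation_coeff \<zeta>"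

lemma Y_sum_is_vac: "sums_to vac b (\<Psi> b)"
  unfolding Y_sum_is_def[OF YPz]
proof (intro allI)
  fix m x
  have e: "\<Psi> (Y_term Y \<zeta> vac l b) m x = (if l = -1 then \<Psi> b m x else 0)" for l
    by (simp add: Y_term_def[OF YPz] Y_vac[OF Y] Psi_zero_apply[OF YPz])
  have "((\<lambda>l. \<Psi> (Y_term Y \<zeta> vac l b) m x) has_sum \<Psi> b m x) {-1}"
    by (rule has_sum_finiteI) (auto simp: e)
  then show "((\<lambda>l. \<Psi> (Y_term Y \<zeta> vac l b) m x) has_sum \<Psi> b m x) UNIV"
    by (rule has_sum_cong_neutral[THEN iffD1, rotated -1]) (auto simp: e)
qed

text \<open>The contraction as the field produces it: the factor \<open>Suc k\<close> is the commutator of \<open>h (int (Suc k))\<close> with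
  \<open>h (- int (Suc k))\<close>.\<close>

definition mode_pairing :: "(complex \<times> nat) list \<Rightarrow> (complex \<times> nat) list \<Rightarrow> complex" where
  "mode_pairing al be = (\<Sum>(c, j)\<leftarrow>al. \<Sum>(d, k)\<leftarrow>be. c * (d * (of_nat (Suc k) * acoeff j (Suc k))))"

lemma mode_pairing_sum:
  assumes "\<And>d k. (d, k) \<in> set be \<Longrightarrow> Suc k < K"
  shows "(\<Sum>i<K. (\<Sum>(c, j)\<leftarrow>al. c * acoeff j i) * (of_nat i * (\<Sum>(d, k)\<leftarrow>be. if int (Suc k) = int i then d else 0)))
     = mode_pairing al be"
proof (induction al)
  case Nil
  show ?case by (simp add: mode_pairing_def)
next
  case (Cons y al)
  obtain c j where y: "y = (c, j)" by (cases y)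
  let ?s = "\<lambda>i. \<Sum>(d, k)\<leftarrow>be. if int (Suc k) = int i then d else (0::complex)"
  have "(\<Sum>i<K. (\<Sum>(c, j)\<leftarrow>y # al. c * acoeff j i) * (of_nat i * ?s i))
      = (\<Sum>i<K. (c * (of_nat i * acoeff j i)) * ?s i) + (\<Sum>i<K. (\<Sum>(c, j)\<leftarrow>al. c * acoeff j i) * (of_nat i * ?s i))"
    unfolding sum.distrib[symmetric] y by (intro sum.cong) (simp_all add: algebra_simps)
  also have "(\<Sum>i<K. (c * (of_nat i * acoeff j i)) * ?s i) = (\<Sum>(d, k)\<leftarrow>be. d * (c * (of_nat (Suc k) * acoeff j (Suc k))))"
    by (rule mode_sum[OF assms])
  also have "\<dots> = (\<Sum>(d, k)\<leftarrow>be. c * (d * (of_nat (Suc k) * acoeff j (Suc k))))"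
    by (simp only: mult.left_commute)
  finally show ?case unfolding Cons by (simp add: mode_pairing_def y)
qed

context
  fixes W :: "nat \<Rightarrow> complex \<Rightarrow> complex"
  assumes W: "\<And>j x. x \<in> disc \<Longrightarrow> ((\<lambda>i. of_nat (i + j choose i) * \<zeta> ^ i * bergman_h (i + j) x) has_sum W j x) UNIV"
begin

lemma Y_sum_is_fock_creation:
  assumes S: "sums_to a b S" and S': "\<And>i. sums_to a (h (int i) b) (S' i)" and Kb: "\<And>i. i \<ge> Kb \<Longrightarrow> h (int i) b = 0"
  shows "sums_to (fock_creation al a) b (tens_creation (one_particle_image W al) S + (\<Sum>i<Kb. tens_scale (\<Sum>(c, j)\<leftarrow>al. c * acoeff j i) (S' i)))"
proof (induction al)
  case Nil
  have "one_particle_image W [] = (\<lambda>z. 0)" by (auto simp: one_particle_image_def)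
  then have "tens_creation (one_particle_image W []) S + (\<Sum>i<Kb. tens_scale (\<Sum>(c, j)\<leftarrow>[]. c * acoeff j i) (S' i)) = 0"
    by (simp only: tens_creation_lin list.map sum_list.Nil tens_scale_left sum.neutral_const add_0)
  then show ?case unfolding fock_creation_simps by (simp only: Y_sum_is_lin[OF YPz])
next
  case (Cons y al)
  obtain c j where y: "y = (c, j)" by (cases y)
  have p: "one_particle_image W ((c, j) # al) = (\<lambda>z. c * W j z + one_particle_image W al z)" by (auto simp: one_particle_image_def)
  have "tens_creation (one_particle_image W (y # al)) S + (\<Sum>i<Kb. tens_scale (\<Sum>(c, j)\<leftarrow>y # al. c * acoeff j i) (S' i))
      = tens_scale c (tens_creation (W j) S + (\<Sum>i<Kb. tens_scale (acoeff j i) (S' i)))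
        + (tens_creation (one_particle_image W al) S + (\<Sum>i<Kb. tens_scale (\<Sum>(c, j)\<leftarrow>al. c * acoeff j i) (S' i)))"
    unfolding y p tens_creation_lin tens_scale_add tens_scale_sum
    by (simp add: tens_scale_left sum.distrib algebra_simps)
  moreover have "sums_to (fock_creation (y # al) a) b (tens_scale c (tens_creation (W j) S + (\<Sum>i<Kb. tens_scale (acoeff j i) (S' i)))
        + (tens_creation (one_particle_image W al) S + (\<Sum>i<Kb. tens_scale (\<Sum>(c, j)\<leftarrow>al. c * acoeff j i) (S' i))))"
    unfolding y fock_creation_simps
    by (rule Y_sum_is_lin(1)[OF YPz Y_sum_is_lin(2)[OF YPz Y_sum_is_h[OF YPz W S S' Kb]] Cons])
  ultimately show ?case by (simp only:)
qed

text \<open>Multiplying the first argument by a creation operator has the effect of \<open>contraction_sum_Suc\<close>: its creation part is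
  the multiplication by the image vector, and its annihilation part removes one of the \<open>q\<close> factors.\<close>

lemma Y_sum_is_powers:
  "sums_to ((fock_creation al ^^ p) vac) ((fock_creation be ^^ q) vac) (contraction_sum (mode_pairing al be) (one_particle_image W al) (one_particle be) p q)"
proof (induction p arbitrary: q)
  case 0
  have "contraction_sum (mode_pairing al be) (one_particle_image W al) (one_particle be) 0 q = \<Psi> ((fock_creation be ^^ q) vac)"
    by (simp add: contraction_sum_def Psi_power[OF Psi])
  then show ?case using Y_sum_is_vac by simp
next
  case (Suc p)
  let ?b = "(fock_creation be ^^ q) vac" and ?C = "mode_pairing al be"
  let ?T = "contraction_sum ?C (one_particle_image W al) (one_particle be)"
  let ?s = "\<lambda>i. \<Sum>(d, k)\<leftarrow>be. if int (Suc k) = int i then d else (0::complex)"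
  \<comment> \<open>beyond \<open>K\<close> no mode occurs in \<open>be\<close>, so the annihilation operators vanish on \<open>?b\<close>\<close>
  define K where "K = Suc (Suc (sum_list (map snd be)))"
  have K: "Suc k < K" if "(d, k) \<in> set be" for d k
  proof -
    have "k \<in> set (map snd be)" using that by force
    then have "k \<le> sum_list (map snd be)" by (rule member_le_sum_list) simp
    then show ?thesis by (simp add: K_def)
  qed
  have hb: "h (int i) ?b = fock_scale (of_nat q * (of_nat i * ?s i)) ((fock_creation be ^^ (q - 1)) vac)" for i
    using h_fock_creation_power[where be = be and q = q and n = "int i"] by simp
  have "?s i = 0" if "i \<ge> K" for i
  proof -
    have "map (\<lambda>(d, k). if int (Suc k) = int i then d else (0::complex)) be = map (\<lambda>_. 0) be"
      using K that by (intro map_cong) fastforce+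
    then show ?thesis by (simp only: sum_list_0)
  qed
  then have hz: "h (int i) ?b = 0" if "i \<ge> K" for i using that by (simp add: hb)
  have e: "(\<Sum>i<K. tens_scale (\<Sum>(c, j)\<leftarrow>al. c * acoeff j i) (tens_scale (of_nat q * (of_nat i * ?s i)) (?T p (q - 1))))
      = tens_scale (of_nat q * ?C) (?T p (q - 1))"
  proof -
    have "(\<Sum>i<K. tens_scale (\<Sum>(c, j)\<leftarrow>al. c * acoeff j i) (tens_scale (of_nat q * (of_nat i * ?s i)) (?T p (q - 1))))
      = tens_scale (\<Sum>i<K. of_nat q * ((\<Sum>(c, j)\<leftarrow>al. c * acoeff j i) * (of_nat i * ?s i))) (?T p (q - 1))"
      by (intro ext) (simp add: tens_scale_def sum_fun_apply sum_distrib_left sum_distrib_right mult_ac)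
    moreover have "(\<Sum>i<K. (\<Sum>(c, j)\<leftarrow>al. c * acoeff j i) * (of_nat i * ?s i)) = ?C"
      by (rule mode_pairing_sum) (rule K)
    ultimately show ?thesis by (simp only: sum_distrib_left[symmetric])
  qed
  have "sums_to (fock_creation al ((fock_creation al ^^ p) vac)) ?b (tens_creation (one_particle_image W al) (?T p q) +
      (\<Sum>i<K. tens_scale (\<Sum>(c, j)\<leftarrow>al. c * acoeff j i) (tens_scale (of_nat q * (of_nat i * ?s i)) (?T p (q - 1)))))"
    by (rule Y_sum_is_fock_creation[OF Suc _ hz]) (simp_all only: hb Y_sum_is_lin(5)[OF YPz Suc])
  then show ?case unfolding e contraction_sum_Suc funpow.simps o_apply .
qed

end

end

lemma scaled_fock_creation_power:
  assumes "r \<noteq> 0"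
  shows "weight_scaling r ((fock_creation al ^^ p) vac) = (fock_creation (map (\<lambda>(c, j). (c * r ^ Suc j, j)) al) ^^ p) vac"
proof -
  have 1: "weight_scaling r (fock_creation al v) = fock_creation (map (\<lambda>(c, j). (c * r ^ Suc j, j)) al) (weight_scaling r v)" for v
  proof (induction al)
    case Nil
    show ?case by (simp add: fock_creation_simps linearD(3)[OF weight_scaling_linear[OF assms]])
  next
    case (Cons y al)
    obtain c j where y: "y = (c, j)" by (cases y)
    have "r powi (- (- int (Suc j))) = r ^ Suc j" by (simp only: minus_minus power_int_of_nat)
    then show ?case
      unfolding y list.map prod.case fock_creation_simps weight_scaling_simps[OF assms] Cons by (simp only: fock.scale_scale)
  qed
  show ?thesis by (induction p) (simp_all add: 1 weight_scaling_simps[OF assms])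
qed

text \<open>The contraction of the vertex algebra, with the weights \<open>r ^ L(0)\<close> and \<open>s ^ L(0)\<close>, is the one defined by
  \<open>G_kernel\<close>.\<close>

lemma G_coeff_annihilation:
  assumes "\<zeta> \<noteq> 0"
  shows "of_real r ^ Suc j * (of_real s ^ Suc k * (of_nat (Suc k) * (of_nat (Suc k + j choose Suc k) * (- 1) ^ j * \<zeta> powi (- int (Suc (Suc k + j))))))
    = G_coeff \<zeta> r s j k"
proof -
  have "Suc k * (Suc k + j choose Suc k) = (j + k + 1) * (j + k choose j)"
  proof -
    have "Suc k * (Suc (k + j) choose Suc k) = Suc (k + j) * (k + j choose k)" by (rule Suc_times_binomial)
    moreover have "(k + j choose k) = (j + k choose j)" by (metis add.commute binomial_symmetric diff_add_inverse le_add1)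
    ultimately show ?thesis by (simp add: add.commute)
  qed
  then have b: "of_nat (Suc k) * of_nat (Suc k + j choose Suc k) = (of_nat (j + k + 1) * of_nat (j + k choose j) :: complex)"
    by (simp only: of_nat_mult[symmetric])
  have z: "\<zeta> powi (- int (Suc (Suc k + j))) = 1 / \<zeta> ^ (j + k + 2)"
  proof -
    have "Suc (Suc k + j) = j + k + 2" by simp
    then show ?thesis by (simp only: power_int_minus power_int_of_nat divide_inverse mult_1)
  qed
  have m: "(- complex_of_real r) ^ j = (- 1) ^ j * of_real r ^ j" by (rule power_minus)
  have "of_real r ^ Suc j * (of_real s ^ Suc k * (of_nat (Suc k) * (of_nat (Suc k + j choose Suc k) * (- 1) ^ j * \<zeta> powi (- int (Suc (Suc k + j))))))
     = of_real r ^ Suc j * of_real s ^ Suc k * (of_nat (Suc k) * of_nat (Suc k + j choose Suc k)) * (- 1) ^ j * (1 / \<zeta> ^ (j + k + 2))"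
    unfolding z by (simp only: mult_ac)
  also have "\<dots> = G_coeff \<zeta> r s j k"
    unfolding b G_coeff_def m by (simp add: mult_ac del: of_nat_add of_nat_Suc)
  finally show ?thesis .
qed

lemma sum_list_map_prod: "(\<Sum>(c, j)\<leftarrow>map (\<lambda>(c, j). (f c j, j)) al. g c j) = (\<Sum>(c, j)\<leftarrow>al. g (f c j) j)"
  for g :: "complex \<Rightarrow> nat \<Rightarrow> complex"
  by (induction al) auto

section \<open>Limits in completions\<close>

lemma A2_norm_triangle:
  assumes "f \<in> A2 m" "g \<in> A2 m"
  shows "A2_norm m (\<lambda>x. f x + g x) \<le> A2_norm m f + A2_norm m g"
proof -
  let ?M = "polydisc_measure m"
  note s = assms[THEN A2_sqi]
  have g': "sqi ?M (\<lambda>x. - g x)" using sqi_scale[OF s(2), of "-1"] by simp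
  have "(nrm ?M (\<lambda>x. f x - (- g x)))\<^sup>2 = (nrm ?M f)\<^sup>2 - 2 * Re (ip ?M f (\<lambda>x. - g x)) + (nrm ?M (\<lambda>x. - g x))\<^sup>2"
    by (rule nrm_diff_square[OF s(1) g'])
  moreover have "nrm ?M (\<lambda>x. - g x) = nrm ?M g" by (simp add: nrm_def)
  moreover have "- Re (ip ?M f (\<lambda>x. - g x)) \<le> nrm ?M f * nrm ?M g"
    using ip_bound[OF s(1) g'] abs_Re_le_cmod[of "ip ?M f (\<lambda>x. - g x)"] by (simp add: \<open>nrm ?M (\<lambda>x. - g x) = nrm ?M g\<close>)
  ultimately have "(nrm ?M (\<lambda>x. f x + g x))\<^sup>2 \<le> (nrm ?M f + nrm ?M g)\<^sup>2"
    by (simp add: power2_sum)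
  then show ?thesis
    unfolding A2_norm_nrm by (rule power2_le_imp_le) simp
qed

lemma A2_norm_zero_imp:
  assumes "f \<in> A2 m" "A2_norm m f = 0"
  shows "f x = 0"
proof (cases "x \<in> polydisc m")
  case True
  then obtain C where "\<forall>f\<in>A2 m. cmod (f x) \<le> C * A2_norm m f" using A2_evaluation_bound by blast
  then show ?thesis using assms by force
qed (simp add: A2_zero_outside[OF assms(1)])

lemma Sym_dist_L2: "Sym_dist N x y = L2_set (\<lambda>m. A2_norm m (x m - y m)) {..N}"
  by (simp add: Sym_dist_def L2_set_def)

lemma A2_norm_minus: "A2_norm m (f - g) = A2_norm m (g - f)"
  by (simp add: A2_norm_def fun_diff_def norm_minus_commute)

lemma A2_fun_diff: "f \<in> A2 m \<Longrightarrow> g \<in> A2 m \<Longrightarrow> f - g \<in> A2 m"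
  using A2_diff by (simp add: fun_diff_def)

lemma Sym_metric: "Metric_space (Sym_A2_upto N) (Sym_dist N)"
proof
  have A2: "x m \<in> A2 m" if "x \<in> Sym_A2_upto N" for x m
    using that by (simp add: Sym_A2_upto_def Sym_A2_def)
  show "0 \<le> Sym_dist N x y" for x y by (simp add: Sym_dist_L2)
  show "Sym_dist N x y = Sym_dist N y x" for x y
    unfolding Sym_dist_def by (subst A2_norm_minus) simp
  show "Sym_dist N x y = 0 \<longleftrightarrow> x = y" if "x \<in> Sym_A2_upto N" "y \<in> Sym_A2_upto N" for x y
  proof
    assume "Sym_dist N x y = 0"
    then have z: "A2_norm m (x m - y m) = 0" if "m \<le> N" for m
      using that by (simp add: Sym_dist_L2 L2_set_eq_0_iff)
    show "x = y"
    proof (intro ext)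
      fix m z
      show "x m z = y m z"
      proof (cases "m \<le> N")
        case True
        have "(x m - y m) z = 0"
          by (rule A2_norm_zero_imp[OF A2_fun_diff[OF A2[OF that(1)] A2[OF that(2)]] z[OF True]])
        then show ?thesis by simp
      next
        case False
        then show ?thesis using that by (simp add: Sym_A2_upto_def)
      qed
    qed
  qed (simp add: Sym_dist_def A2_norm_def)
  show "Sym_dist N x z \<le> Sym_dist N x y + Sym_dist N y z"
    if "x \<in> Sym_A2_upto N" "y \<in> Sym_A2_upto N" "z \<in> Sym_A2_upto N" for x y z
  proof -
    have "A2_norm m (x m - z m) \<le> A2_norm m (x m - y m) + A2_norm m (y m - z m)" for m
    proof -
      have "x m - z m = (\<lambda>w. (x m - y m) w + (y m - z m) w)" by auto
      then show ?thesis
        using A2_norm_triangle[OF A2_fun_diff[OF A2[OF that(1)] A2[OF that(2)]] A2_fun_diff[OF A2[OF that(2)] A2[OF that(3)]]]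
        by metis
    qed
    then have "Sym_dist N x z \<le> L2_set (\<lambda>m. A2_norm m (x m - y m) + A2_norm m (y m - z m)) {..N}"
      unfolding Sym_dist_L2 by (intro L2_set_mono) (simp_all add: A2_norm_def)
    also have "\<dots> \<le> Sym_dist N x y + Sym_dist N y z"
      unfolding Sym_dist_L2 by (rule L2_set_triangle_ineq)
    finally show ?thesis .
  qed
qed

text \<open>In each degree the norm is at most the supremum, because the polydisc has mass 1.\<close>

lemma Sym_dist_bound:
  assumes A: "\<And>m. x m - y m \<in> A2 m" and c: "\<And>m z. cmod (x m z - y m z) \<le> c"
  shows "Sym_dist N x y \<le> real (N + 1) * c"
proof -
  have c0: "0 \<le> c" using order_trans[OF norm_ge_zero c] .
  have n: "A2_norm m (x m - y m) \<le> c" for m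
    unfolding A2_norm_nrm
    by (rule polyd.nrm_le_bound[OF sqi_measurable[OF A2_sqi[OF A]]]) (use c c0 in auto)
  have "Sym_dist N x y \<le> (\<Sum>m\<le>N. A2_norm m (x m - y m))"
    unfolding Sym_dist_L2 by (rule L2_set_le_sum) (simp add: A2_norm_def)
  also have "\<dots> \<le> (\<Sum>m\<le>N. c)" by (intro sum_mono n)
  finally show ?thesis by simp
qed

text \<open>Completeness is about sequences; the sums over symmetric intervals form one, and such intervals
  exhaust every finite set.\<close>

lemma (in Metric_space) complete_partial_sums:
  fixes f :: "int set \<Rightarrow> 'a"
  assumes "mcomplete" and f: "\<And>I. finite I \<Longrightarrow> f I \<in> M"
    and cauchy: "\<And>\<epsilon>. \<epsilon> > 0 \<Longrightarrow> \<exists>J. finite J \<and> (\<forall>I. finite I \<longrightarrow> J \<subseteq> I \<longrightarrow> d (f I) (f J) < \<epsilon>)"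
  shows "\<exists>y. limitin mtopology f y (finite_subsets_at_top UNIV)"
proof -
  define \<sigma> where "\<sigma> = (\<lambda>n::nat. f {- int n..int n})"
  have cover: "\<exists>n0. \<forall>n\<ge>n0. J \<subseteq> {- int n..int n}" if "finite J" for J
  proof (intro exI allI impI)
    fix n assume "(\<Sum>j\<in>J. nat \<bar>j\<bar>) \<le> n"
    then have "nat \<bar>j\<bar> \<le> n" if "j \<in> J" for j
      using member_le_sum[of j J "\<lambda>j. nat \<bar>j\<bar>"] that \<open>finite J\<close> by force
    then show "J \<subseteq> {- int n..int n}" by force
  qed
  have close: "\<exists>J. finite J \<and> (\<forall>I I'. finite I \<longrightarrow> finite I' \<longrightarrow> J \<subseteq> I \<longrightarrow> J \<subseteq> I' \<longrightarrow> d (f I) (f I') < \<epsilon>)" if e: "\<epsilon> > 0" for \<epsilon>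
  proof -
    obtain J where J: "finite J" "\<And>I. finite I \<Longrightarrow> J \<subseteq> I \<Longrightarrow> d (f I) (f J) < \<epsilon> / 2"
      using cauchy[OF half_gt_zero[OF e]] by blast
    have "d (f I) (f I') < \<epsilon>" if "finite I" "finite I'" "J \<subseteq> I" "J \<subseteq> I'" for I I'
    proof -
      have "d (f I) (f I') \<le> d (f I) (f J) + d (f J) (f I')"
        by (rule triangle) (use f J that in auto)
      then show ?thesis using J(2)[of I] J(2)[of I'] that commute[of "f J" "f I'"] by simp
    qed
    then show ?thesis using J(1) by blast
  qed
  have "MCauchy \<sigma>"
    unfolding MCauchy_def
  proof (intro conjI allI impI)
    show "range \<sigma> \<subseteq> M" using f by (auto simp: \<sigma>_def)
    fix \<epsilon> :: real assume e: "\<epsilon> > 0"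
    obtain J where J: "finite J" "\<And>I I'. finite I \<Longrightarrow> finite I' \<Longrightarrow> J \<subseteq> I \<Longrightarrow> J \<subseteq> I' \<Longrightarrow> d (f I) (f I') < \<epsilon>"
      using close[OF e] by blast
    obtain n0 where n0: "\<And>n. n \<ge> n0 \<Longrightarrow> J \<subseteq> {- int n..int n}" using cover[OF J(1)] by blast
    then show "\<exists>N. \<forall>n n'. N \<le> n \<longrightarrow> N \<le> n' \<longrightarrow> d (\<sigma> n) (\<sigma> n') < \<epsilon>"
      unfolding \<sigma>_def using J(2)[OF finite_atLeastAtMost finite_atLeastAtMost n0 n0] by blast
  qed
  then obtain y where y: "limitin mtopology \<sigma> y sequentially"
    using assms(1) unfolding mcomplete_def by blast
  have yM: "y \<in> M" using y by (rule limitin_mspace)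
  have "limitin mtopology f y (finite_subsets_at_top UNIV)"
    unfolding limitin_metric
  proof (intro conjI allI impI yM)
    fix \<epsilon> :: real assume e: "\<epsilon> > 0"
    obtain J where J: "finite J" "\<And>I I'. finite I \<Longrightarrow> finite I' \<Longrightarrow> J \<subseteq> I \<Longrightarrow> J \<subseteq> I' \<Longrightarrow> d (f I) (f I') < \<epsilon> / 2"
      using close[OF half_gt_zero[OF e]] by blast
    obtain n0 where n0: "\<And>n. n \<ge> n0 \<Longrightarrow> J \<subseteq> {- int n..int n}" using cover[OF J(1)] by blast
    have "\<forall>\<^sub>F n in sequentially. d (\<sigma> n) y < \<epsilon> / 2"
      using y e unfolding limitin_metric by (auto elim: eventually_mono dest!: spec[of _ "\<epsilon> / 2"])
    then obtain n1 where n1: "\<And>n. n \<ge> n1 \<Longrightarrow> d (\<sigma> n) y < \<epsilon> / 2" by (auto simp: eventually_sequentially)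
    let ?n = "max n0 n1"
    have "f I \<in> M \<and> d (f I) y < \<epsilon>" if I: "finite I" "J \<subseteq> I" for I
    proof
      show "f I \<in> M" using f I by simp
      have "d (f I) y \<le> d (f I) (\<sigma> ?n) + d (\<sigma> ?n) y"
        by (rule triangle) (use f I yM in \<open>auto simp: \<sigma>_def\<close>)
      moreover have "d (f I) (\<sigma> ?n) < \<epsilon> / 2" unfolding \<sigma>_def by (rule J(2)) (use I n0 in auto)
      ultimately show "d (f I) y < \<epsilon>" using n1[of ?n] by simp
    qed
    then show "\<forall>\<^sub>F I in finite_subsets_at_top UNIV. f I \<in> M \<and> d (f I) y < \<epsilon>"
      unfolding eventually_finite_subsets_at_top using J(1) by (intro exI[of _ J]) auto
  qed
  then show ?thesis ..
qed

lemma affine_separation: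
  assumes cl: "closure (ball (\<zeta>::complex) r) \<inter> closure (ball 0 s) = {}" and rs: "0 < r" "0 < s"
  shows "r + s < cmod \<zeta>"
proof (rule ccontr)
  assume n: "\<not> r + s < cmod \<zeta>"
  have cb: "cball \<zeta> r \<inter> cball 0 s = {}" using cl rs by simp
  show False
  proof (cases "cmod \<zeta> \<le> s")
    case True
    then have "\<zeta> \<in> cball \<zeta> r \<inter> cball 0 s" using rs by simp
    then show False using cb by blast
  next
    case False
    \<comment> \<open>the point of the small disc that is closest to \<open>\<zeta>\<close>\<close>
    define w where "w = of_real (s / cmod \<zeta>) * \<zeta>"
    have z: "0 < cmod \<zeta>" using False rs by linarith
    have "cmod w = s" using z rs by (simp add: w_def norm_mult norm_divide)
    moreover have "\<zeta> - w = of_real (1 - s / cmod \<zeta>) * \<zeta>" by (simp add: w_def algebra_simps)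
    then have "cmod (\<zeta> - w) = \<bar>1 - s / cmod \<zeta>\<bar> * cmod \<zeta>" by (simp only: norm_mult norm_of_real)
    then have "cmod (\<zeta> - w) = cmod \<zeta> - s" using z False by (simp add: left_diff_distrib)
    ultimately have "w \<in> cball \<zeta> r \<inter> cball 0 s" using n by (simp add: dist_norm)
    then show False using cb by blast
  qed
qed

section \<open>Comparison of the two operations\<close>

context
  fixes Y :: "fock \<Rightarrow> int \<Rightarrow> fock \<Rightarrow> fock" and \<Psi> :: "fock \<Rightarrow> tens" and \<zeta> :: complex and r s :: real
  assumes Y: "is_M0_vertex_algebra Y" and Psi: "is_Psi \<Psi>" and z0: "\<zeta> \<noteq> 0" and z1: "cmod \<zeta> < 1"
    and rs: "0 < r" "0 < s" "r + s < cmod \<zeta>" and s1: "s < 1"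
    and sub: "ball \<zeta> r \<subseteq> disc" "ball 0 s \<subseteq> disc"
begin

text \<open>Both sides are the same sum over the number of contracted pairs: the closed form of the exponential on
  powers on one side, the recursion coming from the Borcherds identity on the other.\<close>

lemma rho_powers_Y_sum_is:
  "Y_sum_is Y \<Psi> \<zeta> (weight_scaling (of_real r) ((fock_creation al ^^ p) vac)) (weight_scaling (of_real s) ((fock_creation be ^^ q) vac))
     (rho2_N (affine_map \<zeta> r) (affine_map 0 s) (\<Psi> ((fock_creation al ^^ p) vac)) (\<Psi> ((fock_creation be ^^ q) vac)))"
proof -
  let ?al = "map (\<lambda>(c, j). (c * of_real r ^ Suc j, j)) al" and ?be = "map (\<lambda>(c, j). (c * of_real s ^ Suc j, j)) be"
  \<comment> \<open>the power of \<open>r\<close> belongs to \<open>r ^ L(0)\<close> and is returned to the coefficients in \<open>?al\<close>\<close>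
  define W where "W = (\<lambda>j x. rho_series \<zeta> r (bergman_h j) x / of_real r ^ (j + 1))"
  have W: "((\<lambda>i. of_nat (i + j choose i) * \<zeta> ^ i * bergman_h (i + j) x) has_sum W j x) UNIV" if "x \<in> disc" for j x
    unfolding W_def by (rule rho_bergman_h_has_sum[OF rs(1) sub(1) that])
  have A: "one_particle_image W ?al = rho_cl1 (affine_map \<zeta> r) (one_particle al)"
  proof
    fix x
    have "one_particle_image W ?al x = (\<Sum>(c, j)\<leftarrow>al. c * of_real r ^ Suc j * W j x)"
      unfolding one_particle_image_def by (rule sum_list_map_prod)
    also have "\<dots> = (\<Sum>(c, j)\<leftarrow>al. c * rho_series \<zeta> r (bergman_h j) x)"
      by (intro arg_cong[where f = sum_list] map_cong) (use rs in \<open>auto simp: W_def\<close>)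
    also have "\<dots> = rho_cl1 (affine_map \<zeta> r) (one_particle al) x"
      by (simp add: rho_cl1_affine[OF rs(1) sub(1) one_particle_bergman] rho_series_one_particle[OF rs(1) sub(1)])
    finally show "one_particle_image W ?al x = rho_cl1 (affine_map \<zeta> r) (one_particle al) x" .
  qed
  have B: "one_particle ?be = rho_cl1 (affine_map 0 s) (one_particle be)"
  proof
    fix x
    have "one_particle ?be x = (\<Sum>(c, j)\<leftarrow>be. c * of_real s ^ Suc j * bergman_h j x)"
      unfolding one_particle_def by (rule sum_list_map_prod)
    also have "\<dots> = (\<Sum>(c, j)\<leftarrow>be. c * rho_series 0 s (bergman_h j) x)"
      by (simp add: rho_series_zero[OF rs(2) s1] mult.assoc)
    also have "\<dots> = rho_cl1 (affine_map 0 s) (one_particle be) x"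
      by (simp add: rho_cl1_affine[OF rs(2) sub(2) one_particle_bergman] rho_series_one_particle[OF rs(2) sub(2)])
    finally show "one_particle ?be x = rho_cl1 (affine_map 0 s) (one_particle be) x" .
  qed
  have C: "mode_pairing \<zeta> ?al ?be = kernel_pairing (G_kernel (affine_map \<zeta> r) (affine_map 0 s)) (one_particle al) (one_particle be)"
  proof -
    let ?e = "\<lambda>j k. of_nat (Suc k) * (of_nat (Suc k + j choose Suc k) * (- 1) ^ j * \<zeta> powi (- int (Suc (Suc k + j))))"
    have "mode_pairing \<zeta> ?al ?be = (\<Sum>(c, j)\<leftarrow>?al. \<Sum>(d, k)\<leftarrow>?be. c * (d * ?e j k))"
      by (simp only: mode_pairing_def[OF Y Psi z0 z1] annihilation_coeff_def[OF Y Psi z0 z1])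
    also have "\<dots> = (\<Sum>(c, j)\<leftarrow>al. \<Sum>(d, k)\<leftarrow>?be. (c * of_real r ^ Suc j) * (d * ?e j k))"
      by (rule sum_list_map_prod)
    also have "\<dots> = (\<Sum>(c, j)\<leftarrow>al. \<Sum>(d, k)\<leftarrow>be. (c * of_real r ^ Suc j) * ((d * of_real s ^ Suc k) * ?e j k))"
      by (subst sum_list_map_prod) (rule HOL.refl)
    also have "\<dots> = (\<Sum>(c, j)\<leftarrow>al. \<Sum>(d, k)\<leftarrow>be. c * d * G_coeff \<zeta> r s j k)"
      unfolding G_coeff_annihilation[OF z0, symmetric] by (simp only: mult_ac)
    finally show ?thesis by (simp only: kernel_pairing_one_particle[OF rs])
  qed
  have rho: "rho2_N (affine_map \<zeta> r) (affine_map 0 s) (\<Psi> ((fock_creation al ^^ p) vac)) (\<Psi> ((fock_creation be ^^ q) vac))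
      = contraction_sum (mode_pairing \<zeta> ?al ?be) (one_particle_image W ?al) (one_particle ?be) p q"
  proof -
    let ?C = "mode_pairing \<zeta> ?al ?be"
    have "rho2_N (affine_map \<zeta> r) (affine_map 0 s) (\<Psi> ((fock_creation al ^^ p) vac)) (\<Psi> ((fock_creation be ^^ q) vac))
      = (\<Sum>k\<le>min p q. tens_scale (?C ^ k * fact p * fact q / (fact k * fact (p - k) * fact (q - k)))
       (sym_tensor (replicate (p - k) (one_particle_image W ?al) @ replicate (q - k) (one_particle ?be))))"
      unfolding Psi_power[OF Psi] rho_powers[OF rs sub one_particle_bergman one_particle_bergman] A B C ..
    also have "\<dots> = (\<Sum>k\<le>min p q. tens_scale (?C ^ k * fact k * of_nat (p choose k) * of_nat (q choose k))
       (sym_tensor (replicate (p - k) (one_particle_image W ?al) @ replicate (q - k) (one_particle ?be))))"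
    proof (intro sum.cong HOL.refl arg_cong2[where f = tens_scale])
      fix k assume "k \<in> {..min p q}"
      then have "k \<le> p" "k \<le> q" by auto
      then show "?C ^ k * fact p * fact q / (fact k * fact (p - k) * fact (q - k))
         = ?C ^ k * fact k * of_nat (p choose k) * of_nat (q choose k)"
        by (simp add: binomial_fact)
    qed
    also have "\<dots> = contraction_sum ?C (one_particle_image W ?al) (one_particle ?be) p q"
      unfolding contraction_sum_def
      by (rule sum.mono_neutral_left) (auto simp: tens_scale_left binomial_eq_0)
    finally show ?thesis .
  qed
  have r0: "complex_of_real r \<noteq> 0" "complex_of_real s \<noteq> 0" using rs by auto
  show ?thesis
    unfolding rho scaled_fock_creation_power[OF r0(1)] scaled_fock_creation_power[OF r0(2)]
    by (rule Y_sum_is_powers[OF Y Psi z0 z1]) (rule W)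
qed

text \<open>Polarisation, first in the second argument and then in the first.\<close>

lemma rho_Y_sum_is:
  "Y_sum_is Y \<Psi> \<zeta> (weight_scaling (of_real r) v1) (weight_scaling (of_real s) v2)
     (rho2_N (affine_map \<zeta> r) (affine_map 0 s) (\<Psi> v1) (\<Psi> v2))"
proof -
  let ?rho = "rho2_N (affine_map \<zeta> r) (affine_map 0 s)"
  let ?H = "\<lambda>v1 v2. Y_sum_is Y \<Psi> \<zeta> (weight_scaling (of_real r) v1) (weight_scaling (of_real s) v2) (?rho (\<Psi> v1) (\<Psi> v2))"
  have r0: "complex_of_real r \<noteq> 0" "complex_of_real s \<noteq> 0" using rs by auto
  note lin = Psi_lin[OF Psi] and wr = linearD[OF weight_scaling_linear[OF r0(1)]]
    and ws = linearD[OF weight_scaling_linear[OF r0(2)]] and T = Psi_alg_tens[OF Psi]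
    and VL = Y_sum_is_lin[OF Y Psi z0 z1]
  have rz: "?rho 0 (\<Psi> v) = 0" "?rho (\<Psi> v) 0 = 0" for v
  proof -
    have e: "tens_scale 0 x = 0" for x by (rule tens_scale_left(2))
    show "?rho 0 (\<Psi> v) = 0" using rho_scale(1)[OF rs sub T[of v] T[of v], where c = 0] unfolding e .
    show "?rho (\<Psi> v) 0 = 0" using rho_scale(2)[OF rs sub T[of v] T[of v], where c = 0] unfolding e .
  qed
  obtain p q where p: "v1 \<in> M_upto p" and q: "v2 \<in> M_upto q" using fock_union by meson
  have 1: "?H ((fock_creation al ^^ n) vac) v2" for al n
  proof -
    have "v2 \<in> {v2. ?H ((fock_creation al ^^ n) vac) v2}"
    proof (rule polarisation[OF _ _ q])
      show "fock.subspace {v2. ?H ((fock_creation al ^^ n) vac) v2}"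
      proof (rule fock.subspaceI; unfold mem_Collect_eq)
        show "?H ((fock_creation al ^^ n) vac) 0" unfolding lin ws rz by (rule VL)
        show "?H ((fock_creation al ^^ n) vac) (x + y)" if "?H ((fock_creation al ^^ n) vac) x" "?H ((fock_creation al ^^ n) vac) y" for x y
          unfolding lin ws rho_add_right[OF rs sub T T T] by (rule VL(4)[OF that])
        show "?H ((fock_creation al ^^ n) vac) (fock_scale c x)" if "?H ((fock_creation al ^^ n) vac) x" for c x
          unfolding lin ws rho_scale(2)[OF rs sub T T] by (rule VL(5)[OF that])
      qed
    qed (use rho_powers_Y_sum_is in auto)
    then show ?thesis by simp
  qed
  have "v1 \<in> {v1. ?H v1 v2}"
  proof (rule polarisation[OF _ _ p])
    show "fock.subspace {v1. ?H v1 v2}"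
    proof (rule fock.subspaceI; unfold mem_Collect_eq)
      show "?H 0 v2" unfolding lin wr rz by (rule VL)
      show "?H (x + y) v2" if "?H x v2" "?H y v2" for x y
        unfolding lin wr rho_add_left[OF rs sub T T T] by (rule VL(1)[OF that])
      show "?H (fock_scale c x) v2" if "?H x v2" for c x
        unfolding lin wr rho_scale(1)[OF rs sub T T] by (rule VL(2)[OF that])
    qed
  qed (use 1 in auto)
  then show ?thesis by simp
qed

end

lemma weight_scaling_M_upto:
  assumes r: "r \<noteq> 0" and v: "v \<in> M_upto p"
  shows "weight_scaling r v \<in> M_upto p"
proof -
  note lin = linearD[OF weight_scaling_linear[OF r]]
  show ?thesis
    using v unfolding M_upto_eq[of p]
  proof (induction rule: fock.span_induct_alt)
    case base
    show ?case unfolding lin by (rule fock.span_zero)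
  next
    case (step c x y)
    then obtain ks where ks: "x = h_monomial ks" by auto
    have e: "weight_scaling r x = fock_scale (r ^ sum_list ks) x"
      unfolding ks by (rule weight_scaling_monomial[OF r])
    show ?case
      unfolding lin e by (rule fock.span_add[OF fock.span_scale[OF fock.span_scale[OF fock.span_base[OF step(1)]]] step(2)])
  qed
qed

theorem theorem3p7:
  fixes \<zeta> :: complex and r s :: real
    and Y :: "fock \<Rightarrow> int \<Rightarrow> fock \<Rightarrow> fock"
    and L0 \<theta> :: "fock \<Rightarrow> fock"
    and B :: "fock \<Rightarrow> fock \<Rightarrow> complex"
    and \<Psi> :: "fock \<Rightarrow> tens"
    and v1 v2 :: fock and p q :: nat
    and X :: "'x set" and d :: "'x \<Rightarrow> 'x \<Rightarrow> real" and \<iota> :: "fock \<Rightarrow> 'x"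
    and \<Psi>' :: "'x \<Rightarrow> tens"
  assumes "\<zeta> \<in> disc" "\<zeta> \<noteq> 0" "0 < r" "r < 1" "0 < s" "s < 1"
    and "closure (ball \<zeta> r) \<inter> closure (ball 0 s) = {}"
    and "ball \<zeta> r \<subseteq> disc" "ball 0 s \<subseteq> disc"
    and "is_M0_vertex_algebra Y" "is_L0 L0" "is_theta \<theta>" "is_invariant_form Y L0 B"
    and "is_Psi \<Psi>"
    and "v1 \<in> M_upto p" "v2 \<in> M_upto q"
    and "is_completion (M_upto (p + q)) (M_dist \<theta> B) X d \<iota>"
    and "is_Psi_extension \<Psi> (p + q) X d \<iota> \<Psi>'"
  shows "\<exists>y. Y_sums_to Y X d \<iota> (L0_power L0 r v1) (L0_power L0 s v2) \<zeta> y \<and>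
             rho2_N (affine_map \<zeta> r) (affine_map 0 s) (\<Psi> v1) (\<Psi> v2) = \<Psi>' y"
proof -
  note z = assms(1,2) and rs0 = assms(3-6) and sub = assms(8,9) and Y = assms(10) and L0 = assms(11)
    and Psi = assms(14) and v = assms(15,16) and compl = assms(17) and extension = assms(18)
  have z1: "cmod \<zeta> < 1" using z(1) by simp
  have rs: "0 < r" "0 < s" "r + s < cmod \<zeta>" using affine_separation[OF assms(7)] rs0 by auto
  have r0: "complex_of_real r \<noteq> 0" "complex_of_real s \<noteq> 0" using rs by auto
  define N where "N = p + q"
  define a where "a = weight_scaling (of_real r) v1"
  define b where "b = weight_scaling (of_real s) v2"
  define u where "u = (\<lambda>l. Y_term Y \<zeta> a l b)"
  define R where "R = rho2_N (affine_map \<zeta> r) (affine_map 0 s) (\<Psi> v1) (\<Psi> v2)"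
  define S where "S = (\<lambda>I. \<Sum>l\<in>I. u l)"
  have ab: "L0_power L0 r v1 = a" "L0_power L0 s v2 = b"
    by (simp_all add: a_def b_def L0_power_eq[OF L0] rs)
  note YPz = Y Psi z(2) z1
  have uM: "u l \<in> M_upto N" for l
    unfolding u_def N_def a_def b_def
    by (rule Y_term_M_upto[OF YPz weight_scaling_M_upto[OF r0(2) v(2)] weight_scaling_M_upto[OF r0(1) v(1)]])
  have SM: "S I \<in> M_upto N" for I unfolding S_def by (rule M_upto_subspace(5)[OF uM])
  obtain g where g: "g summable_on UNIV" "\<And>l m x. cmod (\<Psi> (u l) m x) \<le> g l"
    using Y_bound[OF YPz, of a b] unfolding Y_terms_dominated_def[OF YPz] u_def by blast
  have g0: "0 \<le> g l" for l using order_trans[OF norm_ge_zero g(2)] .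
  have PS: "\<Psi> (S I) m x = (\<Sum>l\<in>I. \<Psi> (u l) m x)" for I m x
    unfolding S_def by (rule Psi_sum_apply[OF YPz])

  from compl have mX: "Metric_space X d" and cX: "Metric_space.mcomplete X d" and iX: "\<And>a. a \<in> M_upto N \<Longrightarrow> \<iota> a \<in> X"
    and iso: "\<And>a b. a \<in> M_upto N \<Longrightarrow> b \<in> M_upto N \<Longrightarrow> d (\<iota> a) (\<iota> b) = M_dist \<theta> B a b"
    unfolding is_completion_def N_def by auto
  interpret mX: Metric_space X d by (rule mX)
  interpret mS: Metric_space "Sym_A2_upto N" "Sym_dist N" by (rule Sym_metric)

  \<comment> \<open>distances of partial sums are computed on the Bergman side, where the uniform bounds apply\<close>
  have dist: "d (\<iota> (S I)) (\<iota> (S J)) \<le> real (N + 1) * sum g (I - J)" if "finite I" "J \<subseteq> I" for I J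
  proof -
    have "d (\<iota> (S I)) (\<iota> (S J)) = Sym_dist N (\<Psi> (S I)) (\<Psi> (S J))"
      unfolding iso[OF SM SM] by (rule M_dist_Sym_dist[OF Y L0 assms(12,13) Psi SM SM])
    also have "\<dots> \<le> real (N + 1) * sum g (I - J)"
    proof (rule Sym_dist_bound)
      show "\<Psi> (S I) m - \<Psi> (S J) m \<in> A2 m" for m by (intro A2_fun_diff Psi_A2[OF Psi])
      show "cmod (\<Psi> (S I) m x - \<Psi> (S J) m x) \<le> sum g (I - J)" for m x
      proof -
        have "\<Psi> (S I) m x - \<Psi> (S J) m x = (\<Sum>l\<in>I - J. \<Psi> (u l) m x)"
          unfolding PS by (simp add: sum_diff that)
        then show ?thesis using g(2) by (simp add: sum_norm_le)
      qed
    qed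
    finally show ?thesis .
  qed
  have "\<exists>y. limitin mX.mtopology (\<lambda>I. \<iota> (S I)) y (finite_subsets_at_top UNIV)"
  proof (rule mX.complete_partial_sums[OF cX])
    show "\<iota> (S I) \<in> X" for I by (rule iX[OF SM])
    fix \<epsilon> :: real assume e: "\<epsilon> > 0"
    have "(sum g \<longlongrightarrow> infsum g UNIV) (finite_subsets_at_top UNIV)"
      using has_sum_infsum[OF g(1)] by (simp add: has_sum_def)
    then have "\<forall>\<^sub>F J in finite_subsets_at_top UNIV. infsum g UNIV - \<epsilon> / real (N + 1) < sum g J"
      using e by (intro order_tendstoD) auto
    then obtain J where J: "finite J" "infsum g UNIV - \<epsilon> / real (N + 1) < sum g J"
      by (auto simp: eventually_finite_subsets_at_top)
    have "d (\<iota> (S I)) (\<iota> (S J)) < \<epsilon>" if I: "finite I" "J \<subseteq> I" for I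
    proof -
      have "sum g I \<le> infsum g UNIV" by (rule finite_sum_le_infsum[OF g(1) I(1)]) (auto simp: g0)
      then have "sum g (I - J) < \<epsilon> / real (N + 1)" using J(2) I by (simp add: sum_diff)
      then have "real (N + 1) * sum g (I - J) < \<epsilon>" by (simp add: field_simps)
      then show ?thesis using dist[OF I] by simp
    qed
    then show "\<exists>J. finite J \<and> (\<forall>I. finite I \<longrightarrow> J \<subseteq> I \<longrightarrow> d (\<iota> (S I)) (\<iota> (S J)) < \<epsilon>)"
      using J(1) by blast
  qed
  then obtain y where y: "limitin mX.mtopology (\<lambda>I. \<iota> (S I)) y (finite_subsets_at_top UNIV)" ..
  have "continuous_map mX.mtopology mS.mtopology \<Psi>'" and Psi': "\<And>a. a \<in> M_upto N \<Longrightarrow> \<Psi>' (\<iota> a) = \<Psi> a"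
    using extension unfolding is_Psi_extension_def N_def by auto
  \<comment> \<open>\<open>\<Psi>'\<close> carries the limit of the partial sums to the limit of their images\<close>
  from continuous_map_limit[OF this(1) y]
  have "limitin mS.mtopology (\<lambda>I. \<Psi> (S I)) (\<Psi>' y) (finite_subsets_at_top UNIV)"
    by (simp add: o_def Psi'[OF SM])
  then have yS: "\<Psi>' y \<in> Sym_A2_upto N"
    and lim: "((\<lambda>I. Sym_dist N (\<Psi> (S I)) (\<Psi>' y)) \<longlongrightarrow> 0) (finite_subsets_at_top UNIV)"
    unfolding mS.limitin_metric_dist_null by auto

  have point: "((\<lambda>I. \<Psi> (S I) m x) \<longlongrightarrow> \<Psi>' y m x) (finite_subsets_at_top UNIV)" for m x
  proof -
    have yA: "\<Psi>' y m \<in> A2 m" using yS by (simp add: Sym_A2_upto_def Sym_A2_def)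
    consider "x \<notin> polydisc m" | "N < m" | "x \<in> polydisc m" "m \<le> N" by linarith
    then show ?thesis
    proof cases
      case 1
      then show ?thesis using A2_zero_outside[OF yA] A2_zero_outside[OF Psi_A2[OF Psi]] by simp
    next
      case 2
      then have "\<Psi>' y m = 0" using yS by (simp add: Sym_A2_upto_def)
      then show ?thesis using Psi_degree[OF Psi SM 2] by simp
    next
      case 3
      obtain C where C: "0 \<le> C" "\<And>f. f \<in> A2 m \<Longrightarrow> cmod (f x) \<le> C * A2_norm m f"
        using A2_evaluation_bound[OF 3(1)] by auto
      have bound: "cmod (\<Psi> (S I) m x - \<Psi>' y m x) \<le> C * Sym_dist N (\<Psi> (S I)) (\<Psi>' y)" for I
      proof -
        have "A2_norm m (\<Psi> (S I) m - \<Psi>' y m) \<le> Sym_dist N (\<Psi> (S I)) (\<Psi>' y)"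
          unfolding Sym_dist_L2
          by (rule member_le_L2_set[where f = "\<lambda>m. A2_norm m (\<Psi> (S I) m - \<Psi>' y m)"]) (use 3(2) in auto)
        then have "C * A2_norm m (\<Psi> (S I) m - \<Psi>' y m) \<le> C * Sym_dist N (\<Psi> (S I)) (\<Psi>' y)"
          by (rule mult_left_mono[OF _ C(1)])
        moreover have "cmod ((\<Psi> (S I) m - \<Psi>' y m) x) \<le> C * A2_norm m (\<Psi> (S I) m - \<Psi>' y m)"
          by (rule C(2)[OF A2_fun_diff[OF Psi_A2[OF Psi] yA]])
        ultimately show ?thesis by simp
      qed
      have null: "((\<lambda>I. C * Sym_dist N (\<Psi> (S I)) (\<Psi>' y)) \<longlongrightarrow> 0) (finite_subsets_at_top UNIV)"
        using tendsto_mult_right_zero[OF lim] .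
      have "((\<lambda>I. \<Psi> (S I) m x - \<Psi>' y m x) \<longlongrightarrow> 0) (finite_subsets_at_top UNIV)"
        by (rule Lim_null_comparison[OF always_eventually null]) (rule allI, rule bound)
      then show ?thesis by (simp only: LIM_zero_iff)
    qed
  qed
  \<comment> \<open>convergence in norm and pointwise summation have the same limit\<close>
  have "R = \<Psi>' y"
  proof (intro ext)
    fix m x
    have "((\<lambda>l. \<Psi> (u l) m x) has_sum R m x) UNIV"
      using rho_Y_sum_is[OF YPz rs rs0(4) sub, of v1 v2]
      unfolding Y_sum_is_def[OF YPz] R_def u_def a_def b_def by blast
    then have "((\<lambda>I. \<Psi> (S I) m x) \<longlongrightarrow> R m x) (finite_subsets_at_top UNIV)"
      by (simp add: has_sum_def PS)
    with point show "R m x = \<Psi>' y m x"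
      by (rule tendsto_unique[OF finite_subsets_at_top_neq_bot, rotated])
  qed
  moreover have "Y_sums_to Y X d \<iota> (L0_power L0 r v1) (L0_power L0 s v2) \<zeta> y"
    unfolding Y_sums_to_def ab using y by (simp add: S_def u_def Y_term_def[OF YPz])
  ultimately show ?thesis unfolding R_def by blast
qed

end
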